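(* For each $0<\rho<1$ there exist finite positive constants $\delta_0(\rho), C(\rho), N_0(\rho)$ such that for all $0<\delta\le\delta_0(\rho)$ and $N\ge N_0(\rho)$, $$\mathbb{P}^\rho\big\{\text{there exists } z \text{ outside } [\![0,v_N]\!]\text{ such that } |\mathbf{Z}^{0\to z}|\le\delta N^{2/3}\big\}\;\le\; C(\rho)\,|\log\delta|^{2/3}\,\delta .$$
   Context: Notation: $e_1=(1,0)$, $e_2=(0,1)$; points of $\mathbb{Z}^2$ are ordered coordinatewise, $|x|_1=|x_1|+|x_2|$; $[\![a,b]\!]=\{x\in\mathbb{Z}^2:a\le x\le b\}$; $\mathrm{Exp}(\alpha)$ is the exponential distribution of rate $\alpha$. For $\rho\in(0,1)$ and a real scaling parameter $N>0$, $v_N=(\lfloor N(1-\rho)^2\rfloor,\lfloor N\rho^2\rfloor)$. Stationary last-passage percolation with base point $0$ and parameter $\rho$: under $\mathbb{P}^\rho$ the following weights are mutually independent: bulk weights $\omega_z\sim\mathrm{Exp}(1)$ for $z\in\mathbb{Z}_{>0}^2$, and boundary weights $I_{ke_1}\sim\mathrm{Exp}(1-\rho)$, $J_{le_2}\sim\mathrm{Exp}(\rho)$ for $k,l\in\mathbb{Z}_{>0}$. For $x\le y$ in $\mathbb{Z}_{>0}^2$, $G_{x,y}$ is the maximum of $\sum_{k=0}^{|y-x|_1}\omega_{z_k}$ over paths from $x$ to $y$ with steps in $\{e_1,e_2\}$. For $y=(m,n)\in\mathbb{Z}_{>0}^2$, $$G^\rho_{0,y}=\max_{1\le k\le m}\Big\{\sum_{i=1}^kI_{ie_1}+G_{ke_1+e_2,y}\Big\}\vee\max_{1\le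 l\le n}\Big\{\sum_{j=1}^lJ_{je_2}+G_{le_2+e_1,y}\Big\}.$$ The maximizer is almost surely unique. The exit time $\mathbf{Z}^{0\to y}\in\mathbb{Z}\setminus\{0\}$ is $k>0$ if the maximum is attained at the term $\sum_{i=1}^kI_{ie_1}+G_{ke_1+e_2,y}$, and $-l<0$ if it is attained at the term $\sum_{j=1}^lJ_{je_2}+G_{le_2+e_1,y}$. Points $z$ "outside $[\![0,v_N]\!]$" range over $\mathbb{Z}_{>0}^2\setminus[\![0,v_N]\!]$, where the exit time is defined. *)

theory Defs
  imports "HOL-Probability.Probability"
begin

text \<open>
  Points of the planar lattice are pairs of integers. Order, addition, subtraction and intervals on
  pairs are the componentwise ones of the library, so \<open>{x..y}\<close> is a lattice rectangle.
\<close>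

definition e1 :: "int \<times> int" where "e1 = (1, 0)"
definition e2 :: "int \<times> int" where "e2 = (0, 1)"

definition pos_quadrant :: "(int \<times> int) set" where
  "pos_quadrant = {z. 0 < fst z \<and> 0 < snd z}"

definition v_corner :: "real \<Rightarrow> real \<Rightarrow> int \<times> int" where
  "v_corner \<rho> N = (\<lfloor>N * (1 - \<rho>)\<^sup>2\<rfloor>, \<lfloor>N * \<rho>\<^sup>2\<rfloor>)"

text \<open>
  A weight configuration \<open>\<omega>\<close> carries all weights at once: \<open>\<omega> z\<close> is the bulk weight
  for \<open>z\<close> in the open quadrant, \<open>\<omega> (k, 0)\<close> is the boundary weight \<open>I\<close> at \<open>k e\<^sub>1\<close> and
  \<open>\<omega> (0, l)\<close> is the boundary weight \<open>J\<close> at \<open>l e\<^sub>2\<close>. There is no weight at the origin.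
\<close>

definition weight_sites :: "(int \<times> int) set" where
  "weight_sites = {z. 0 \<le> fst z \<and> 0 \<le> snd z \<and> z \<noteq> 0}"

definition weight_rate :: "real \<Rightarrow> int \<times> int \<Rightarrow> real" where
  "weight_rate \<rho> z = (if snd z = 0 then 1 - \<rho> else if fst z = 0 then \<rho> else 1)"

definition stationary_measure :: "real \<Rightarrow> (int \<times> int \<Rightarrow> real) measure" where
  "stationary_measure \<rho> =
     (\<Pi>\<^sub>M z\<in>weight_sites. density lborel (exponential_density (weight_rate \<rho> z)))"

definition up_right_paths :: "int \<times> int \<Rightarrow> int \<times> int \<Rightarrow> (int \<times> int) list set" where
  "up_right_paths x y =
     {p. p \<noteq> [] \<and> hd p = x \<and> last p = y \<and> successively (\<lambda>a b. b - a \<in> {e1, e2}) p}"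

definition lpp :: "(int \<times> int \<Rightarrow> real) \<Rightarrow> int \<times> int \<Rightarrow> int \<times> int \<Rightarrow> real" where
  "lpp \<omega> x y = Max ((\<lambda>p. \<Sum>z\<leftarrow>p. \<omega> z) ` up_right_paths x y)"

text \<open>
  The terms of the maximum defining the stationary last-passage time to \<open>y\<close>, indexed by signed
  exit points: \<open>k > 0\<close> is an exit from the horizontal axis at \<open>k e\<^sub>1\<close>, and \<open>-l < 0\<close> is an
  exit from the vertical axis at \<open>l e\<^sub>2\<close>.
\<close>

definition exit_points :: "int \<times> int \<Rightarrow> int set" where
  "exit_points y = {1..fst y} \<union> uminus ` {1..snd y}"

definition exit_value :: "(int \<times> int \<Rightarrow> real) \<Rightarrow> int \<times> int \<Rightarrow> int \<Rightarrow> real" where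
  "exit_value \<omega> y k =
     (if 0 < k then (\<Sum>i=1..k. \<omega> (i, 0)) + lpp \<omega> (k, 1) y
      else (\<Sum>j=1..-k. \<omega> (0, j)) + lpp \<omega> (1, -k) y)"

definition stationary_lpp :: "(int \<times> int \<Rightarrow> real) \<Rightarrow> int \<times> int \<Rightarrow> real" where
  "stationary_lpp \<omega> y =
     max (Max ((\<lambda>k. exit_value \<omega> y k) ` {1..fst y}))
         (Max ((\<lambda>l. exit_value \<omega> y (-l)) ` {1..snd y}))"

text \<open>
  The exit point is almost surely unique; on the null event of ties a maximizer is selected
  by \<open>SOME\<close>.
\<close>

definition exit_time :: "(int \<times> int \<Rightarrow> real) \<Rightarrow> int \<times> int \<Rightarrow> int" where
  "exit_time \<omega> y = (SOME k. k \<in> exit_points y \<and> exit_value \<omega> y k = stationary_lpp \<omega> y)"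

lemma prob_space_stationary_measure:
  assumes "0 < \<rho>" "\<rho> < 1"
  shows "prob_space (stationary_measure \<rho>)"
  unfolding stationary_measure_def
  by (intro prob_space_PiM prob_space_exponential_density)
     (use assms in \<open>auto simp: weight_rate_def\<close>)

lemma measurable_weight [measurable]:
  "z \<in> weight_sites \<Longrightarrow> (\<lambda>\<omega>. \<omega> z) \<in> borel_measurable (stationary_measure \<rho>)"
  unfolding stationary_measure_def by measurable

lemma distributed_weight:
  assumes "0 < \<rho>" "\<rho> < 1" "z \<in> weight_sites"
  shows "distributed (stationary_measure \<rho>) lborel (\<lambda>\<omega>. \<omega> z)
           (exponential_density (weight_rate \<rho> z))"
proof -
  have P: "prob_space (density lborel (exponential_density (weight_rate \<rho> z)))" for z
    by (rule prob_space_exponential_density) (use assms in \<open>auto simp: weight_rate_def\<close>)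
  have "distr (stationary_measure \<rho>) lborel (\<lambda>\<omega>. \<omega> z) =
        distr (stationary_measure \<rho>) (density lborel (exponential_density (weight_rate \<rho> z))) (\<lambda>\<omega>. \<omega> z)"
    by (rule distr_cong) auto
  also have "\<dots> = density lborel (exponential_density (weight_rate \<rho> z))"
    unfolding stationary_measure_def
    by (rule distr_PiM_component) (use P assms in auto)
  finally show ?thesis
    using assms by (auto simp: distributed_def)
qed

lemma indep_vars_weight:
  assumes "0 < \<rho>" "\<rho> < 1"
  shows "prob_space.indep_vars (stationary_measure \<rho>) (\<lambda>_. borel) (\<lambda>z \<omega>. \<omega> z) weight_sites"
proof -
  let ?M = "stationary_measure \<rho>"
  let ?D = "\<lambda>z. density lborel (exponential_density (weight_rate \<rho> z))"
  interpret prob_space ?M by (rule prob_space_stationary_measure[OF assms])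
  have [measurable_cong]: "sets ?M = sets (\<Pi>\<^sub>M z\<in>weight_sites. borel)"
    unfolding stationary_measure_def by (intro sets_PiM_cong) auto
  have space: "space ?M = weight_sites \<rightarrow>\<^sub>E UNIV"
    by (simp add: stationary_measure_def space_PiM)
  have D: "distr ?M borel (\<lambda>\<omega>. \<omega> z) = ?D z" if "z \<in> weight_sites" for z
    using distributed_distr_eq_density[OF distributed_weight[OF assms that]]
    by (simp cong: distr_cong)
  have "distr ?M (\<Pi>\<^sub>M z\<in>weight_sites. borel) (\<lambda>\<omega>. \<lambda>z\<in>weight_sites. \<omega> z) =
        distr ?M ?M (\<lambda>\<omega>. \<omega>)"
    by (rule distr_cong) (auto simp: space \<open>sets ?M = _\<close> PiE_restrict)
  also have "\<dots> = (\<Pi>\<^sub>M z\<in>weight_sites. distr ?M borel (\<lambda>\<omega>. \<omega> z))"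
    using PiM_cong[of weight_sites weight_sites "\<lambda>z. distr ?M borel (\<lambda>\<omega>. \<omega> z)" ?D] D
    by (simp add: stationary_measure_def)
  finally show ?thesis
    by (subst indep_vars_iff_distr_eq_PiM')
       (auto simp: weight_sites_def zero_prod_def intro!: measurable_weight exI[of _ 1])
qed

lemma up_right_paths_bounds:
  assumes "p \<noteq> []" "successively (\<lambda>a b. b - a \<in> {e1, e2}) p"
  shows "set p \<subseteq> {hd p..last p} \<and>
         int (length p) = fst (last p) - fst (hd p) + (snd (last p) - snd (hd p)) + 1"
  using assms
proof (induction p rule: list_nonempty_induct)
  case (single x)
  then show ?case by simp
next
  case (cons x xs)
  then have "hd xs - x \<in> {e1, e2}" "successively (\<lambda>a b. b - a \<in> {e1, e2}) xs"
    by (auto simp: successively_Cons)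
  with cons have IH: "set xs \<subseteq> {hd xs..last xs}"
    "int (length xs) = fst (last xs) - fst (hd xs) + (snd (last xs) - snd (hd xs)) + 1"
    and step: "hd xs = x + e1 \<or> hd xs = x + e2"
    by (auto simp: algebra_simps)
  have "hd xs \<in> set xs" using cons by simp
  with IH(1) have "hd xs \<le> last xs" by fastforce
  moreover have "x \<le> hd xs" using step by (auto simp: e1_def e2_def less_eq_prod_def)
  ultimately show ?case
    using \<open>xs \<noteq> []\<close> IH step by (auto simp: e1_def e2_def less_eq_prod_def)
qed

lemma finite_up_right_paths: "finite (up_right_paths x y)"
proof -
  have "finite ({fst x..fst y} \<times> {snd x..snd y})" by simp
  also have "{fst x..fst y} \<times> {snd x..snd y} = {x..y}"
    by (auto simp: less_eq_prod_def)
  finally have "finite {p. set p \<subseteq> {x..y} \<and> length p \<le> nat (fst y - fst x + (snd y - snd x) + 1)}"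
    by (rule finite_lists_length_le)
  then show ?thesis
    by (rule rev_finite_subset) (use up_right_paths_bounds in \<open>fastforce simp: up_right_paths_def\<close>)
qed

lemma up_right_paths_nonempty:
  assumes "x \<le> y"
  shows "up_right_paths x y \<noteq> {}"
  using assms
proof (induction "nat (fst y - fst x + (snd y - snd x))" arbitrary: x)
  case 0
  then have "x = y" by (auto simp: less_eq_prod_def prod_eq_iff)
  then have "[x] \<in> up_right_paths x y" by (simp add: up_right_paths_def)
  then show ?case by blast
next
  case (Suc n)
  obtain s where s: "s \<in> {e1, e2}" "x + s \<le> y"
  proof (cases "fst x < fst y")
    case True
    then show ?thesis using Suc.prems that[of e1] by (auto simp: e1_def less_eq_prod_def)
  next
    case False
    then have "snd x < snd y" using Suc by (auto simp: less_eq_prod_def)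
    then show ?thesis using Suc.prems that[of e2] by (auto simp: e2_def less_eq_prod_def)
  qed
  moreover have "n = nat (fst y - fst (x + s) + (snd y - snd (x + s)))"
    using Suc.hyps(2) s by (auto simp: e1_def e2_def)
  ultimately obtain p where "p \<in> up_right_paths (x + s) y"
    using Suc.hyps(1) by blast
  then have "x # p \<in> up_right_paths x y"
    using s by (auto simp: up_right_paths_def successively_Cons)
  then show ?case by blast
qed

lemma exit_time_attains:
  assumes "y \<in> pos_quadrant"
  shows "exit_time \<omega> y \<in> exit_points y"
    and "exit_value \<omega> y (exit_time \<omega> y) = stationary_lpp \<omega> y"
proof -
  let ?A = "(\<lambda>k. exit_value \<omega> y k) ` {1..fst y}" and ?B = "(\<lambda>l. exit_value \<omega> y (-l)) ` {1..snd y}"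
  have "Max ?A \<in> ?A" "Max ?B \<in> ?B"
    using assms by (auto intro!: Max_in simp: pos_quadrant_def)
  then have "\<exists>k. k \<in> exit_points y \<and> exit_value \<omega> y k = stationary_lpp \<omega> y"
    unfolding stationary_lpp_def exit_points_def max_def
    by (smt (verit) UnI1 UnI2 imageE imageI)
  from someI_ex[OF this]
  show "exit_time \<omega> y \<in> exit_points y" "exit_value \<omega> y (exit_time \<omega> y) = stationary_lpp \<omega> y"
    by (simp_all add: exit_time_def)
qed

lemma measurable_lpp:
  assumes "x \<in> pos_quadrant"
  shows "(\<lambda>\<omega>. lpp \<omega> x y) \<in> borel_measurable (stationary_measure \<rho>)"
proof -
  have "(\<lambda>\<omega>. \<Sum>z\<leftarrow>p. \<omega> z) \<in> borel_measurable (stationary_measure \<rho>)"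
    if "set p \<subseteq> weight_sites" for p
    using that by (induction p) auto
  moreover have "set p \<subseteq> weight_sites" if "p \<in> up_right_paths x y" for p
  proof -
    have "set p \<subseteq> {x..y}"
      using up_right_paths_bounds that by (auto simp: up_right_paths_def)
    then show ?thesis
      using assms by (fastforce simp: pos_quadrant_def weight_sites_def less_eq_prod_def)
  qed
  ultimately show ?thesis
    unfolding lpp_def by (intro borel_measurable_Max finite_up_right_paths) auto
qed

lemma measurable_exit_value:
  assumes "y \<in> pos_quadrant" "k \<in> exit_points y"
  shows "(\<lambda>\<omega>. exit_value \<omega> y k) \<in> borel_measurable (stationary_measure \<rho>)"
proof (cases "0 < k")
  case True
  then show ?thesis unfolding exit_value_def
    by (auto intro!: borel_measurable_add borel_measurable_sum measurable_weight measurable_lpp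
             simp: weight_sites_def pos_quadrant_def zero_prod_def)
next
  case False
  then show ?thesis using assms unfolding exit_value_def
    by (auto intro!: borel_measurable_add borel_measurable_sum measurable_weight measurable_lpp
             simp: weight_sites_def pos_quadrant_def zero_prod_def exit_points_def)
qed

lemma measurable_stationary_lpp:
  assumes "y \<in> pos_quadrant"
  shows "(\<lambda>\<omega>. stationary_lpp \<omega> y) \<in> borel_measurable (stationary_measure \<rho>)"
  unfolding stationary_lpp_def
  by (intro borel_measurable_max borel_measurable_Max measurable_exit_value assms)
     (auto simp: exit_points_def)

lemma measurable_exit_time:
  assumes y: "y \<in> pos_quadrant"
  shows "(\<lambda>\<omega>. exit_time \<omega> y) \<in> measurable (stationary_measure \<rho>) (count_space UNIV)"
proof -
  let ?M = "stationary_measure \<rho>"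
  let ?S = "\<lambda>\<omega>. {k \<in> exit_points y. exit_value \<omega> y k = stationary_lpp \<omega> y}"
  have fin: "finite (exit_points y)" by (simp add: exit_points_def)
  have "?S \<in> measurable ?M (count_space (Pow (exit_points y)))"
  proof (subst measurable_count_space_eq_countable, goal_cases)
    case 1
    show ?case using fin by (simp add: countable_finite)
  next
    case 2
    have "?S -` {A} \<inter> space ?M \<in> sets ?M" if "A \<subseteq> exit_points y" for A
    proof -
      have "?S -` {A} \<inter> space ?M =
        {\<omega> \<in> space ?M. \<forall>k\<in>exit_points y. (exit_value \<omega> y k = stationary_lpp \<omega> y) = (k \<in> A)}"
        using that by auto
      moreover have "\<dots> \<in> sets ?M"
      proof (intro sets.sets_Collect_finite_All' fin)
        fix k assume k: "k \<in> exit_points y"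
        note [measurable] = measurable_exit_value[OF y k] measurable_stationary_lpp[OF y]
        have "{\<omega> \<in> space ?M. exit_value \<omega> y k = stationary_lpp \<omega> y} \<in> sets ?M"
          by (intro borel_measurable_eq) measurable
        then show "{\<omega> \<in> space ?M. (exit_value \<omega> y k = stationary_lpp \<omega> y) = (k \<in> A)} \<in> sets ?M"
          by (cases "k \<in> A") (auto intro: sets.sets_Collect_neg)
      next
        show "exit_points y \<noteq> {}" using y by (auto simp: exit_points_def pos_quadrant_def)
      qed
      ultimately show ?thesis by simp
    qed
    then show ?case by auto
  qed
  then have "(\<lambda>\<omega>. SOME k. k \<in> ?S \<omega>) \<in> measurable ?M (count_space UNIV)"
    by (rule measurable_compose) simp
  then show ?thesis by (simp add: exit_time_def)
qed

text \<open>
  Since \<open>measure\<close> is 0 on non-measurable sets, bounds on the following event are meaningful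
  only because it is measurable.
\<close>

lemma exit_time_event_measurable:
  "{\<omega> \<in> space (stationary_measure \<rho>).
      \<exists>z\<in>pos_quadrant - {0..v_corner \<rho> N}. real_of_int \<bar>exit_time \<omega> z\<bar> \<le> c}
     \<in> sets (stationary_measure \<rho>)"
proof (rule sets.sets_Collect_countable_Ex')
  show "countable (pos_quadrant - {0..v_corner \<rho> N})" by (rule countableI_type)
  fix z assume "z \<in> pos_quadrant - {0..v_corner \<rho> N}"
  then have [measurable]:
    "(\<lambda>\<omega>. exit_time \<omega> z) \<in> measurable (stationary_measure \<rho>) (count_space UNIV)"
    by (intro measurable_exit_time) simp
  show "{\<omega> \<in> space (stationary_measure \<rho>). real_of_int \<bar>exit_time \<omega> z\<bar> \<le> c}
     \<in> sets (stationary_measure \<rho>)"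
    by measurable
qed

end

theory Submission
  imports Defs
begin

text \<open>
  Transposing the plane exchanges the two axes and turns \<open>\<rho>\<close> into \<open>1 - \<rho>\<close>, so it is enough to
  bound the probability that some point outside the rectangle has an optimal exit \<open>e\<close> through the
  horizontal axis with \<open>1 \<le> e \<le> k\<close>, where \<open>k\<close> is \<open>\<delta> N\<^sup>2\<^sup>/\<^sup>3\<close> rounded down. Write
  \<open>r\<^sup>3 = - ln \<delta>\<close>. Each single \<open>e\<close> costs at most a constant times
  \<open>r\<^sup>2 N\<^sup>-\<^sup>2\<^sup>/\<^sup>3\<close>, up to events of total probability \<open>O(exp (- r\<^sup>3)) = O(\<delta>)\<close>. Summing over the \<open>k\<close>
  possible exits gives \<open>\<delta> r\<^sup>2 = \<delta> \<bar>ln \<delta>\<bar>\<^sup>2\<^sup>/\<^sup>3\<close>.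

  Following the geodesic of \<open>z\<close> backwards keeps the exit \<open>e\<close> optimal, so the exit is also optimal
  for some point \<open>p\<close> on the north-east boundary of the rectangle (\<open>opt_exit_boundary\<close>). An
  exponential tail bound for exit points (\<open>exit_bound\<close>) forces \<open>p\<close> to lie within distance of order
  \<open>r N\<^sup>2\<^sup>/\<^sup>3\<close> of the corner, because from farther away the characteristic direction hits the
  axes much farther than \<open>k\<close> from the origin.

  Optimality of \<open>e\<close> for \<open>p\<close> says that two walks stay low: to the right of \<open>e\<close>, the
  boundary weights minus the increments of the passage time to \<open>p\<close> have nonpositive partial sums, and
  the same holds to the left of \<open>e\<close> and on up the vertical axis, with all signs reversed. The
  increments depend on the unknown \<open>p\<close>. Crossing of paths sandwiches them, simultaneously for
  all \<open>p\<close> near the corner, between increments of two stationary models that start from the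
  corner and run backwards, with parameters \<open>\<lambda> = \<rho> + \<kappa>\<close> and \<open>\<mu> = \<rho> - \<kappa>\<close> for \<open>\<kappa>\<close>
  of order \<open>r N\<^sup>-\<^sup>1\<^sup>/\<^sup>3\<close> (\<open>window_walks\<close>); again the tail bound for exit points makes
  the sandwich fail with probability \<open>O(\<delta>)\<close> only.

  The increments of one stationary model along its far boundary are independent exponentials. The two
  models are built on the same bulk and coupled like the two classes of a queue, and then even the
  \<open>\<lambda>\<close>-increments to the right of \<open>e\<close> and the \<open>\<mu>\<close>-increments to the left of \<open>e\<close> are jointly
  independent (\<open>coupled_output_law\<close>). So for fixed \<open>e\<close> the event forces two independent walks with
  drift of order \<open>\<kappa>\<close> and at least \<open>N\<^sup>2\<^sup>/\<^sup>3\<close> steps to stay below a level of order one. A walk of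
  \<open>T\<close> steps does so with probability of order \<open>\<kappa> + 1 / sqrt T\<close>, here of order \<open>\<kappa>\<close>, and the two walks
  together give \<open>\<kappa>\<^sup>2\<close> (\<open>two_walks_bound\<close>).
\<close>

section \<open>Last-passage values over up-right paths\<close>

lemma le_prod_iff: "x \<le> y \<longleftrightarrow> fst x \<le> fst y \<and> snd x \<le> snd y"
  for x y :: "int \<times> int"
  by (simp add: less_eq_prod_def)

lemma lpp_ge_path:
  assumes "p \<in> up_right_paths x y"
  shows "(\<Sum>z\<leftarrow>p. w z) \<le> lpp w x y"
  unfolding lpp_def using assms by (intro Max_ge finite_imageI finite_up_right_paths) auto

lemma lpp_attained:
  assumes "x \<le> y"
  obtains p where "p \<in> up_right_paths x y" "lpp w x y = (\<Sum>z\<leftarrow>p. w z)"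
proof -
  have "lpp w x y \<in> (\<lambda>p. \<Sum>z\<leftarrow>p. w z) ` up_right_paths x y"
    unfolding lpp_def
    by (intro Max_in finite_imageI finite_up_right_paths)
       (use up_right_paths_nonempty[OF assms] in auto)
  then show ?thesis using that by auto
qed

lemma up_right_paths_le:
  assumes "p \<in> up_right_paths x y"
  shows "x \<le> y" "set p \<subseteq> {x..y}"
    "int (length p) = fst y - fst x + (snd y - snd x) + 1"
proof -
  have p: "p \<noteq> []" "hd p = x" "last p = y" "successively (\<lambda>a b. b - a \<in> {e1, e2}) p"
    using assms by (auto simp: up_right_paths_def)
  from up_right_paths_bounds[OF p(1,4)] p
  show "set p \<subseteq> {x..y}" "int (length p) = fst y - fst x + (snd y - snd x) + 1" by auto
  then show "x \<le> y" using p hd_in_set[of p] by fastforce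
qed

lemma path_Cons:
  assumes "p \<in> up_right_paths (x + s) y" "s \<in> {e1, e2}"
  shows "x # p \<in> up_right_paths x y"
  using assms by (auto simp: up_right_paths_def successively_Cons)

lemma path_snoc:
  assumes "p \<in> up_right_paths x (y - s)" "s \<in> {e1, e2}"
  shows "p @ [y] \<in> up_right_paths x y"
  using assms by (auto simp: up_right_paths_def successively_append_iff)

lemma path_uncons:
  assumes "p \<in> up_right_paths x y" "x \<noteq> y"
  obtains s q where "s \<in> {e1, e2}" "p = x # q" "q \<in> up_right_paths (x + s) y"
proof (cases p)
  case Nil
  then show ?thesis using assms by (auto simp: up_right_paths_def)
next
  case (Cons a q)
  then have "q \<noteq> []" using assms by (auto simp: up_right_paths_def)
  moreover have "hd q - x \<in> {e1, e2}"
    using assms Cons \<open>q \<noteq> []\<close> by (auto simp: up_right_paths_def successively_Cons)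
  ultimately show ?thesis
    using assms(1) Cons by (intro that[of "hd q - x" q])
      (simp_all add: up_right_paths_def successively_Cons)
qed

lemma path_unsnoc:
  assumes "p \<in> up_right_paths x y" "x \<noteq> y"
  obtains s q where "s \<in> {e1, e2}" "p = q @ [y]" "q \<in> up_right_paths x (y - s)"
proof (cases p rule: rev_cases)
  case Nil
  then show ?thesis using assms by (auto simp: up_right_paths_def)
next
  case (snoc q a)
  then have "q \<noteq> []" using assms by (auto simp: up_right_paths_def)
  moreover have "y - last q \<in> {e1, e2}"
    using assms snoc \<open>q \<noteq> []\<close> by (auto simp: up_right_paths_def successively_append_iff)
  ultimately show ?thesis
    using assms(1) snoc by (intro that[of "y - last q" q])
      (simp_all add: up_right_paths_def successively_append_iff)
qed

lemma lpp_refl [simp]: "lpp w x x = w x"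
proof -
  have "p = [x]" if "p \<in> up_right_paths x x" for p
  proof -
    have "length p = 1" using up_right_paths_le(3)[OF that] by simp
    then obtain a where "p = [a]" by (cases p) auto
    then show ?thesis using that by (simp add: up_right_paths_def)
  qed
  moreover obtain p where "p \<in> up_right_paths x x" "lpp w x x = (\<Sum>z\<leftarrow>p. w z)"
    using lpp_attained[of x x w] by blast
  ultimately show ?thesis by fastforce
qed

lemma lpp_first_step_ge:
  assumes "s \<in> {e1, e2}" "x + s \<le> y"
  shows "w x + lpp w (x + s) y \<le> lpp w x y"
proof -
  obtain p where p: "p \<in> up_right_paths (x + s) y" "lpp w (x + s) y = (\<Sum>z\<leftarrow>p. w z)"
    using lpp_attained[OF assms(2)] by blast
  show ?thesis using lpp_ge_path[OF path_Cons[OF p(1) assms(1)], of w] p(2) by simp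
qed

lemma lpp_last_step_ge:
  assumes "s \<in> {e1, e2}" "x \<le> y - s"
  shows "lpp w x (y - s) + w y \<le> lpp w x y"
proof -
  obtain p where p: "p \<in> up_right_paths x (y - s)" "lpp w x (y - s) = (\<Sum>z\<leftarrow>p. w z)"
    using lpp_attained[OF assms(2)] by blast
  show ?thesis using lpp_ge_path[OF path_snoc[OF p(1) assms(1)], of w] p(2) by simp
qed

lemma lpp_first_step:
  assumes "x \<le> y" "x \<noteq> y"
  obtains s where "s \<in> {e1, e2}" "x + s \<le> y" "lpp w x y = w x + lpp w (x + s) y"
proof -
  obtain p where p: "p \<in> up_right_paths x y" "lpp w x y = (\<Sum>z\<leftarrow>p. w z)"
    using lpp_attained[OF assms(1)] by blast
  obtain s q where q: "s \<in> {e1, e2}" "p = x # q" "q \<in> up_right_paths (x + s) y"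
    using path_uncons[OF p(1) assms(2)] by blast
  have le: "x + s \<le> y" by (rule up_right_paths_le[OF q(3)])
  show ?thesis
    using that[OF q(1) le] lpp_ge_path[OF q(3), of w] lpp_first_step_ge[OF q(1) le, of w] p(2) q(2)
    by simp
qed

lemma lpp_last_step:
  assumes "x \<le> y" "x \<noteq> y"
  obtains s where "s \<in> {e1, e2}" "x \<le> y - s" "lpp w x y = lpp w x (y - s) + w y"
proof -
  obtain p where p: "p \<in> up_right_paths x y" "lpp w x y = (\<Sum>z\<leftarrow>p. w z)"
    using lpp_attained[OF assms(1)] by blast
  obtain s q where q: "s \<in> {e1, e2}" "p = q @ [y]" "q \<in> up_right_paths x (y - s)"
    using path_unsnoc[OF p(1) assms(2)] by blast
  have le: "x \<le> y - s" by (rule up_right_paths_le[OF q(3)])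
  show ?thesis
    using that[OF q(1) le] lpp_ge_path[OF q(3), of w] lpp_last_step_ge[OF q(1) le, of w] p(2) q(2)
    by simp
qed

lemma lpp_cong:
  assumes "\<And>z. z \<in> {x..y} \<Longrightarrow> w z = w' z"
  shows "lpp w x y = lpp w' x y"
proof -
  have "(\<Sum>z\<leftarrow>p. w z) = (\<Sum>z\<leftarrow>p. w' z)" if "p \<in> up_right_paths x y" for p
    using up_right_paths_le(2)[OF that] assms by (intro arg_cong[where f=sum_list] map_cong) auto
  then show ?thesis unfolding lpp_def by (metis (mono_tags, lifting) image_cong)
qed

text \<open>
  Reversing paths: the passage time to a fixed endpoint is a passage time from a fixed starting
  point in the rotated configuration.
\<close>

lemma lpp_reflect: "lpp (\<lambda>z. w (c - z)) x y = lpp w (c - y) (c - x)" if "x \<le> y"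
proof -
  have *: "lpp (\<lambda>z. w (c - z)) x y \<le> lpp w (c - y) (c - x)" if le: "x \<le> y" for w x y
  proof -
    obtain p where p: "p \<in> up_right_paths x y"
      "lpp (\<lambda>z. w (c - z)) x y = (\<Sum>z\<leftarrow>p. w (c - z))"
      using lpp_attained[OF le] by blast
    have "(\<lambda>a b. (c - a) - (c - b) \<in> {e1, e2}) = (\<lambda>a b. b - a \<in> {e1, e2})"
      by (simp add: fun_eq_iff)
    then have "rev (map (\<lambda>z. c - z) p) \<in> up_right_paths (c - y) (c - x)"
      using p(1) unfolding up_right_paths_def mem_Collect_eq
      by (simp add: hd_rev last_rev last_map hd_map successively_map successively_rev)
    from lpp_ge_path[OF this, of w]
    have "(\<Sum>z\<leftarrow>rev p. w (c - z)) \<le> lpp w (c - y) (c - x)" by (simp add: rev_map o_def)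
    moreover have "(\<Sum>z\<leftarrow>rev p. w (c - z)) = (\<Sum>z\<leftarrow>p. w (c - z))"
      unfolding rev_map[symmetric] by (rule sum_list_rev)
    ultimately show ?thesis using p(2) by simp
  qed
  have "lpp w (c - y) (c - x) = lpp (\<lambda>z. (\<lambda>z. w (c - z)) (c - z)) (c - y) (c - x)"
    by simp
  also have "\<dots> \<le> lpp (\<lambda>z. w (c - z)) (c - (c - x)) (c - (c - y))"
    by (rule *) (use that in \<open>auto simp: le_prod_iff\<close>)
  finally show ?thesis using *[OF that, of w] by simp
qed

lemma lpp_swap: "lpp (\<lambda>z. w (prod.swap z)) x y = lpp w (prod.swap x) (prod.swap y)" if "x \<le> y"
proof -
  have *: "lpp (\<lambda>z. w (prod.swap z)) x y \<le> lpp w (prod.swap x) (prod.swap y)" if le: "x \<le> y" for w x y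
  proof -
    obtain p where p: "p \<in> up_right_paths x y"
      "lpp (\<lambda>z. w (prod.swap z)) x y = (\<Sum>z\<leftarrow>p. w (prod.swap z))"
      using lpp_attained[OF le] by blast
    have "prod.swap b - prod.swap a \<in> {e1, e2} \<longleftrightarrow> b - a \<in> {e1, e2}" for a b
      by (cases a; cases b) (auto simp: e1_def e2_def)
    then have "map prod.swap p \<in> up_right_paths (prod.swap x) (prod.swap y)"
      using p(1) unfolding up_right_paths_def
      by (auto simp: last_map hd_map successively_map)
    from lpp_ge_path[OF this, of w] show ?thesis
      using p(2) by (simp add: o_def)
  qed
  have "lpp w (prod.swap x) (prod.swap y) = lpp (\<lambda>z. (\<lambda>z. w (prod.swap z)) (prod.swap z)) (prod.swap x) (prod.swap y)"
    by simp
  also have "\<dots> \<le> lpp (\<lambda>z. w (prod.swap z)) (prod.swap (prod.swap x)) (prod.swap (prod.swap y))"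
    by (rule *) (use that in \<open>auto simp: le_prod_iff\<close>)
  finally show ?thesis using *[OF that, of w] by simp
qed

section \<open>Crossing paths\<close>

text \<open>
  The two increments at one cell have to be bounded together. The first step of a geodesic from
  \<open>q\<close> decides which of them is immediate, and the other reduces to a neighbouring cell.
\<close>

lemma crossing_steps:
  fixes p p' q :: "int \<times> int"
  assumes "fst p \<le> fst p'" "snd p' \<le> snd p"
  shows "(q + e1 \<le> p \<and> q + e1 \<le> p' \<longrightarrow>
            lpp w q p' - lpp w (q + e1) p' \<le> lpp w q p - lpp w (q + e1) p) \<and>
         (q + e2 \<le> p \<and> q + e2 \<le> p' \<longrightarrow>
            lpp w q p - lpp w (q + e2) p \<le> lpp w q p' - lpp w (q + e2) p')"
proof (induction "nat (fst p - fst q + (snd p' - snd q))" arbitrary: q rule: less_induct)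
  case less
  have s12: "e1 \<in> {e1, e2}" "e2 \<in> {e1, e2}" by auto
  note ge = lpp_first_step_ge[OF s12(1), of q _ w] lpp_first_step_ge[OF s12(2), of q _ w]
  show ?case
  proof (intro conjI impI)
    assume le: "q + e1 \<le> p \<and> q + e1 \<le> p'"
    obtain s where s: "s \<in> {e1, e2}" "q + s \<le> p'" "lpp w q p' = w q + lpp w (q + s) p'"
      by (rule lpp_first_step[of q p' w]) (use le in \<open>auto simp: le_prod_iff e1_def\<close>)
    show "lpp w q p' - lpp w (q + e1) p' \<le> lpp w q p - lpp w (q + e1) p"
    proof (cases "s = e1")
      case True
      then show ?thesis using s ge(1)[of p] le by simp
    next
      case False
      then have s2: "s = e2" using s by auto
      have l2: "q + e2 + e1 \<le> p" "q + e2 + e1 \<le> p'" "q + e2 \<le> p"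
        using le s s2 assms by (auto simp: le_prod_iff e1_def e2_def)
      have n: "nat (fst p - fst (q + e2) + (snd p' - snd (q + e2))) < nat (fst p - fst q + (snd p' - snd q))"
              "nat (fst p - fst (q + e1) + (snd p' - snd (q + e1))) < nat (fst p - fst q + (snd p' - snd q))"
        using le s s2 by (auto simp: le_prod_iff e1_def e2_def)
      have c: "q + e1 + e2 = q + e2 + e1" by (simp add: algebra_simps)
      have "lpp w (q + e2) p' - lpp w (q + e2 + e1) p' \<le> lpp w (q + e2) p - lpp w (q + e2 + e1) p"
        "lpp w (q + e1) p - lpp w (q + e2 + e1) p \<le> lpp w (q + e1) p' - lpp w (q + e2 + e1) p'"
        using less[OF n(1)] less[OF n(2)] l2 c by auto
      then show ?thesis using s s2 ge(2)[OF l2(3)] by simp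
    qed
  next
    assume le: "q + e2 \<le> p \<and> q + e2 \<le> p'"
    obtain s where s: "s \<in> {e1, e2}" "q + s \<le> p" "lpp w q p = w q + lpp w (q + s) p"
      by (rule lpp_first_step[of q p w]) (use le in \<open>auto simp: le_prod_iff e2_def\<close>)
    show "lpp w q p - lpp w (q + e2) p \<le> lpp w q p' - lpp w (q + e2) p'"
    proof (cases "s = e2")
      case True
      then show ?thesis using s ge(2)[of p'] le by simp
    next
      case False
      then have s2: "s = e1" using s by auto
      have l2: "q + e2 + e1 \<le> p" "q + e2 + e1 \<le> p'" "q + e1 \<le> p'"
        using le s s2 assms by (auto simp: le_prod_iff e1_def e2_def)
      have n: "nat (fst p - fst (q + e2) + (snd p' - snd (q + e2))) < nat (fst p - fst q + (snd p' - snd q))"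
              "nat (fst p - fst (q + e1) + (snd p' - snd (q + e1))) < nat (fst p - fst q + (snd p' - snd q))"
        using le s s2 l2 by (auto simp: le_prod_iff e1_def e2_def)
      have c: "q + e1 + e2 = q + e2 + e1" by (simp add: algebra_simps)
      have "lpp w (q + e2) p' - lpp w (q + e2 + e1) p' \<le> lpp w (q + e2) p - lpp w (q + e2 + e1) p"
        "lpp w (q + e1) p - lpp w (q + e2 + e1) p \<le> lpp w (q + e1) p' - lpp w (q + e2 + e1) p'"
        using less[OF n(1)] less[OF n(2)] l2 c by auto
      then show ?thesis using s s2 ge(1)[OF l2(3)] by simp
    qed
  qed
qed

lemma crossing_horizontal:
  assumes "fst b \<le> fst b'" "snd b' \<le> snd b" "a + (int k, 0) \<le> b" "a \<le> b'"
  shows "lpp w a b' + lpp w (a + (int k, 0)) b \<le> lpp w a b + lpp w (a + (int k, 0)) b'"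
  using assms(3)
proof (induction k)
  case 0
  show ?case by (simp flip: zero_prod_def)
next
  case (Suc k)
  have eq: "a + (int (Suc k), 0) = (a + (int k, 0)) + e1" by (auto simp: e1_def prod_eq_iff)
  have "a + (int k, 0) \<le> b" "a + (int k, 0) + e1 \<le> b" "a + (int k, 0) + e1 \<le> b'"
    using Suc.prems assms by (auto simp: le_prod_iff e1_def)
  with Suc.IH crossing_steps[OF assms(1,2), of "a + (int k, 0)" w] show ?case
    unfolding eq by auto
qed

lemma crossing_vertical:
  assumes "fst b \<le> fst b'" "snd b' \<le> snd b" "a + (0, int k) \<le> b'" "a \<le> b"
  shows "lpp w (a + (0, int k)) b' + lpp w a b \<le> lpp w (a + (0, int k)) b + lpp w a b'"
  using assms(3)
proof (induction k)
  case 0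
  show ?case by (simp flip: zero_prod_def)
next
  case (Suc k)
  have eq: "a + (0, int (Suc k)) = (a + (0, int k)) + e2" by (auto simp: e2_def prod_eq_iff)
  have "a + (0, int k) \<le> b'" "a + (0, int k) + e2 \<le> b" "a + (0, int k) + e2 \<le> b'"
    using Suc.prems assms by (auto simp: le_prod_iff e2_def)
  with Suc.IH crossing_steps[OF assms(1,2), of "a + (0, int k)" w] show ?case
    unfolding eq by auto
qed

text \<open>
  A path from \<open>a\<close> to \<open>b'\<close> and a path from \<open>a'\<close> to \<open>b\<close> must meet, and exchanging their ends at
  the meeting point gives paths from \<open>a\<close> to \<open>b\<close> and from \<open>a'\<close> to \<open>b'\<close>. The proof
  telescopes the one-step inequalities instead.
\<close>

lemma crossing:
  assumes a: "fst a \<le> fst a'" "snd a' \<le> snd a" and b: "fst b \<le> fst b'" "snd b' \<le> snd b"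
    and le: "a' \<le> b" "a \<le> b'"
  shows "lpp w a b' + lpp w a' b \<le> lpp w a b + lpp w a' b'"
proof -
  define c where "c = (fst a', snd a)"
  have c1: "c = a + (int (nat (fst a' - fst a)), 0)" "c = a' + (0, int (nat (snd a - snd a')))"
    using a by (auto simp: c_def prod_eq_iff)
  have "c \<le> b" "c \<le> b'" using a b le by (auto simp: c_def le_prod_iff)
  with crossing_horizontal[OF b, of a "nat (fst a' - fst a)" w]
    crossing_vertical[OF b, of a' "nat (snd a - snd a')" w] le
  show ?thesis unfolding c1[symmetric] by linarith
qed

section \<open>The exponential cell map\<close>

definition expo :: "real \<Rightarrow> real measure" where
  "expo r = density lborel (exponential_density r)"

lemma sets_expo [simp, measurable_cong]: "sets (expo r) = sets borel"
  and space_expo [simp]: "space (expo r) = UNIV"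
  by (simp_all add: expo_def)

lemma borel_measurable_expo [simp]: "borel_measurable (expo r) = borel_measurable borel"
  by (rule measurable_cong_sets) simp_all

lemma prob_space_expo: "0 < r \<Longrightarrow> prob_space (expo r)"
  unfolding expo_def by (rule prob_space_exponential_density)

lemma nn_integral_expo:
  assumes "f \<in> borel_measurable borel"
  shows "(\<integral>\<^sup>+x. f x \<partial>expo r) = (\<integral>\<^sup>+x. ennreal (exponential_density r x) * f x \<partial>lborel)"
  unfolding expo_def using assms by (subst nn_integral_density) auto

lemma nn_integral_shift:
  fixes f :: "real \<Rightarrow> ennreal"
  assumes "f \<in> borel_measurable borel"
  shows "(\<integral>\<^sup>+x. f x \<partial>lborel) = (\<integral>\<^sup>+x. f (x + t) \<partial>lborel)"
  using nn_integral_real_affine[OF assms, of 1 t] by (simp add: add.commute)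

text \<open>
  The change of variables from a pair to its difference and its minimum preserves Lebesgue
  measure.
\<close>

lemma nn_integral_difference_min:
  fixes F :: "real \<times> real \<times> real \<Rightarrow> ennreal"
  assumes [measurable]: "F \<in> borel_measurable (borel \<Otimes>\<^sub>M borel \<Otimes>\<^sub>M borel)"
  shows "(\<integral>\<^sup>+x. \<integral>\<^sup>+y. \<integral>\<^sup>+z. F (x, y, z) \<partial>lborel \<partial>lborel \<partial>lborel) =
         (\<integral>\<^sup>+d. \<integral>\<^sup>+r. \<integral>\<^sup>+z. F (r + max 0 d, r + max 0 (- d), z) \<partial>lborel \<partial>lborel \<partial>lborel)"
proof -
  have "(\<integral>\<^sup>+x. \<integral>\<^sup>+y. \<integral>\<^sup>+z. F (x, y, z) \<partial>lborel \<partial>lborel \<partial>lborel) =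
        (\<integral>\<^sup>+y. \<integral>\<^sup>+x. \<integral>\<^sup>+z. F (x, y, z) \<partial>lborel \<partial>lborel \<partial>lborel)"
    by (rule lborel_pair.Fubini') measurable
  also have "\<dots> = (\<integral>\<^sup>+y. \<integral>\<^sup>+d. \<integral>\<^sup>+z. F (d + y, y, z) \<partial>lborel \<partial>lborel \<partial>lborel)"
    by (intro nn_integral_cong nn_integral_shift) measurable
  also have "\<dots> = (\<integral>\<^sup>+d. \<integral>\<^sup>+y. \<integral>\<^sup>+z. F (d + y, y, z) \<partial>lborel \<partial>lborel \<partial>lborel)"
    by (rule lborel_pair.Fubini') measurable
  also have "\<dots> = (\<integral>\<^sup>+d. \<integral>\<^sup>+r. \<integral>\<^sup>+z. F (d + (r + max 0 (- d)), r + max 0 (- d), z) \<partial>lborel \<partial>lborel \<partial>lborel)"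
    by (intro nn_integral_cong nn_integral_shift) measurable
  also have "\<dots> = (\<integral>\<^sup>+d. \<integral>\<^sup>+r. \<integral>\<^sup>+z. F (r + max 0 d, r + max 0 (- d), z) \<partial>lborel \<partial>lborel \<partial>lborel)"
  proof (intro nn_integral_cong)
    fix d r z :: real
    have "d + (r + max 0 (- d)) = r + max 0 d" by (simp add: max_def)
    then show "F (d + (r + max 0 (- d)), r + max 0 (- d), z) = F (r + max 0 d, r + max 0 (- d), z)"
      by (simp only:)
  qed
  finally show ?thesis .
qed

lemma nn_integral_expo3:
  fixes f :: "real \<times> real \<times> real \<Rightarrow> ennreal"
  assumes [measurable]: "f \<in> borel_measurable (borel \<Otimes>\<^sub>M borel \<Otimes>\<^sub>M borel)"
  shows "(\<integral>\<^sup>+x. \<integral>\<^sup>+y. \<integral>\<^sup>+z. f (x, y, z) \<partial>expo c \<partial>expo b \<partial>expo a) =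
    (\<integral>\<^sup>+x. \<integral>\<^sup>+y. \<integral>\<^sup>+z. ennreal (exponential_density a x) * ennreal (exponential_density b y) *
       ennreal (exponential_density c z) * f (x, y, z) \<partial>lborel \<partial>lborel \<partial>lborel)"
proof -
  have "(\<integral>\<^sup>+x. \<integral>\<^sup>+y. \<integral>\<^sup>+z. f (x, y, z) \<partial>expo c \<partial>expo b \<partial>expo a) =
    (\<integral>\<^sup>+x. ennreal (exponential_density a x) * (\<integral>\<^sup>+y. ennreal (exponential_density b y) *
       (\<integral>\<^sup>+z. ennreal (exponential_density c z) * f (x, y, z) \<partial>lborel) \<partial>lborel) \<partial>lborel)"
    by (simp add: nn_integral_expo)
  also have "\<dots> = (\<integral>\<^sup>+x. \<integral>\<^sup>+y. \<integral>\<^sup>+z. ennreal (exponential_density a x) * ennreal (exponential_density b y) *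
       ennreal (exponential_density c z) * f (x, y, z) \<partial>lborel \<partial>lborel \<partial>lborel)"
    by (simp add: nn_integral_cmult[symmetric] mult.assoc)
  finally show ?thesis .
qed

text \<open>
  The Burke property of a single cell. A cell receives a horizontal increment \<open>x\<close>, a vertical
  increment \<open>y\<close> and a weight \<open>z\<close>, and emits the two increments on its opposite sides together with
  \<open>min x y\<close>. The law is preserved because for independent exponentials the minimum is independent
  of the difference, so that it can be exchanged with \<open>z\<close>, which has the same law.
\<close>

lemma cell_nn_integral:
  fixes f :: "real \<times> real \<times> real \<Rightarrow> ennreal"
  assumes f [measurable]: "f \<in> borel_measurable (borel \<Otimes>\<^sub>M borel \<Otimes>\<^sub>M borel)"
    and pos: "0 < a" "0 < b"
  shows "(\<integral>\<^sup>+x. \<integral>\<^sup>+y. \<integral>\<^sup>+z. f (z + max 0 (x - y), z + max 0 (y - x), min x y) \<partial>expo (a + b) \<partial>expo b \<partial>expo a) =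
         (\<integral>\<^sup>+x. \<integral>\<^sup>+y. \<integral>\<^sup>+z. f (x, y, z) \<partial>expo (a + b) \<partial>expo b \<partial>expo a)"
proof -
  let ?e = "\<lambda>x y z. ennreal (exponential_density a x) * ennreal (exponential_density b y) *
       ennreal (exponential_density (a + b) z)"
  have e: "?e (r + max 0 d) (r + max 0 (- d)) z = ?e (z + max 0 d) (z + max 0 (- d)) r" for r d z
    using pos by (auto simp: exponential_density_def max_def algebra_simps
        simp flip: ennreal_mult exp_add)
  have "(\<integral>\<^sup>+x. \<integral>\<^sup>+y. \<integral>\<^sup>+z. f (z + max 0 (x - y), z + max 0 (y - x), min x y) \<partial>expo (a + b) \<partial>expo b \<partial>expo a)
    = (\<integral>\<^sup>+x. \<integral>\<^sup>+y. \<integral>\<^sup>+z. ?e x y z * f (z + max 0 (x - y), z + max 0 (y - x), min x y) \<partial>lborel \<partial>lborel \<partial>lborel)"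
    using nn_integral_expo3[of "\<lambda>(x,y,z). f (z + max 0 (x - y), z + max 0 (y - x), min x y)" a b "a + b"]
    by simp
  also have "\<dots> = (\<integral>\<^sup>+d. \<integral>\<^sup>+r. \<integral>\<^sup>+z. ?e (r + max 0 d) (r + max 0 (- d)) z *
      f (z + max 0 ((r + max 0 d) - (r + max 0 (- d))), z + max 0 ((r + max 0 (- d)) - (r + max 0 d)),
         min (r + max 0 d) (r + max 0 (- d))) \<partial>lborel \<partial>lborel \<partial>lborel)"
    using nn_integral_difference_min[of "\<lambda>(x,y,z). ?e x y z * f (z + max 0 (x - y), z + max 0 (y - x), min x y)"]
    by simp
  also have "\<dots> = (\<integral>\<^sup>+d. \<integral>\<^sup>+r. \<integral>\<^sup>+z. ?e (z + max 0 d) (z + max 0 (- d)) r *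
      f (z + max 0 d, z + max 0 (- d), r) \<partial>lborel \<partial>lborel \<partial>lborel)"
  proof (intro nn_integral_cong)
    fix d r z :: real
    have "max 0 ((r + max 0 d) - (r + max 0 (- d))) = max 0 d"
      "max 0 ((r + max 0 (- d)) - (r + max 0 d)) = max 0 (- d)"
      "min (r + max 0 d) (r + max 0 (- d)) = r" by (auto simp: max_def min_def)
    then show "?e (r + max 0 d) (r + max 0 (- d)) z *
      f (z + max 0 ((r + max 0 d) - (r + max 0 (- d))), z + max 0 ((r + max 0 (- d)) - (r + max 0 d)),
         min (r + max 0 d) (r + max 0 (- d))) = ?e (z + max 0 d) (z + max 0 (- d)) r *
      f (z + max 0 d, z + max 0 (- d), r)" by (simp only: e)
  qed
  also have "\<dots> = (\<integral>\<^sup>+d. \<integral>\<^sup>+z. \<integral>\<^sup>+r. ?e (z + max 0 d) (z + max 0 (- d)) r *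
      f (z + max 0 d, z + max 0 (- d), r) \<partial>lborel \<partial>lborel \<partial>lborel)"
    by (intro nn_integral_cong lborel_pair.Fubini') measurable
  also have "\<dots> = (\<integral>\<^sup>+x. \<integral>\<^sup>+y. \<integral>\<^sup>+z. ?e x y z * f (x, y, z) \<partial>lborel \<partial>lborel \<partial>lborel)"
    using nn_integral_difference_min[of "\<lambda>(x,y,z). ?e x y z * f (x, y, z)"] by simp
  also have "\<dots> = (\<integral>\<^sup>+x. \<integral>\<^sup>+y. \<integral>\<^sup>+z. f (x, y, z) \<partial>expo (a + b) \<partial>expo b \<partial>expo a)"
    by (rule nn_integral_expo3[symmetric]) measurable
  finally show ?thesis .
qed

section \<open>Families of independent exponential variables\<close>

text \<open>
  The law is only prescribed on a finite index set \<open>K\<close>, as a whole product measure. Processes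
  built from the weights step by step are then again such families, on index sets that
  change from step to step.
\<close>

definition exp_family :: "'a measure \<Rightarrow> 'i set \<Rightarrow> ('i \<Rightarrow> real) \<Rightarrow> ('i \<Rightarrow> 'a \<Rightarrow> real) \<Rightarrow> bool" where
  "exp_family M K r X \<longleftrightarrow> prob_space M \<and> finite K \<and> (\<forall>k\<in>K. 0 < r k) \<and>
     (\<forall>k\<in>K. X k \<in> borel_measurable M) \<and>
     distr M (PiM K (\<lambda>_. borel)) (\<lambda>\<omega>. \<lambda>k\<in>K. X k \<omega>) = PiM K (\<lambda>k. expo (r k))"

lemma exp_familyD:
  assumes "exp_family M K r X"
  shows "prob_space M" "finite K" "k \<in> K \<Longrightarrow> 0 < r k" "k \<in> K \<Longrightarrow> X k \<in> borel_measurable M"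
    "distr M (PiM K (\<lambda>_. borel)) (\<lambda>\<omega>. \<lambda>k\<in>K. X k \<omega>) = PiM K (\<lambda>k. expo (r k))"
  using assms by (auto simp: exp_family_def)

lemma sets_PiM_expo [simp, measurable_cong]: "sets (PiM K (\<lambda>k. expo (r k))) = sets (PiM K (\<lambda>_. borel))"
  by (intro sets_PiM_cong) auto

lemma borel_measurable_PiM_expo [simp]:
  "borel_measurable (PiM K (\<lambda>k. expo (r k))) = borel_measurable (PiM K (\<lambda>_. borel))"
  by (rule measurable_cong_sets) simp_all

lemma exp_family_cong:
  assumes "exp_family M K r X" "\<And>k. k \<in> K \<Longrightarrow> r k = r' k"
    "\<And>k \<omega>. k \<in> K \<Longrightarrow> X k \<omega> = Y k \<omega>"
  shows "exp_family M K r' Y"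
proof -
  have "X k = Y k" if "k \<in> K" for k using assms(3)[OF that] by auto
  moreover have "PiM K (\<lambda>k. expo (r k)) = PiM K (\<lambda>k. expo (r' k))"
    by (intro PiM_cong) (auto simp: assms(2))
  moreover have "(\<lambda>\<omega>. \<lambda>k\<in>K. X k \<omega>) = (\<lambda>\<omega>. \<lambda>k\<in>K. Y k \<omega>)"
    by (auto simp: assms(3) cong: restrict_cong)
  ultimately show ?thesis using assms(1,2) by (auto simp: exp_family_def)
qed

lemma exp_family_nn_integral:
  assumes "exp_family M K r X" and f: "f \<in> borel_measurable (PiM K (\<lambda>_. borel))"
  shows "(\<integral>\<^sup>+\<omega>. f (\<lambda>k\<in>K. X k \<omega>) \<partial>M) = (\<integral>\<^sup>+x. f x \<partial>PiM K (\<lambda>k. expo (r k)))"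
proof -
  note D = exp_familyD[OF assms(1)]
  have [measurable]: "(\<lambda>\<omega>. \<lambda>k\<in>K. X k \<omega>) \<in> measurable M (PiM K (\<lambda>_. borel))"
    by (intro measurable_restrict D)
  show ?thesis unfolding D(5)[symmetric] using f by (subst nn_integral_distr) auto
qed

lemma exp_family_reindex:
  assumes "exp_family M K r X" "inj_on g L" "g ` L \<subseteq> K"
  shows "exp_family M L (\<lambda>l. r (g l)) (\<lambda>l. X (g l))"
proof -
  note D = exp_familyD[OF assms(1)]
  have fin: "finite L" using finite_imageD[OF finite_subset[OF assms(3) D(2)] assms(2)] .
  have [measurable]: "(\<lambda>\<omega>. \<lambda>k\<in>K. X k \<omega>) \<in> measurable M (PiM K (\<lambda>_. borel))"
    by (intro measurable_restrict D)
  have g: "g l \<in> K" if "l \<in> L" for l using that assms(3) by auto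
  define r' where "r' = (\<lambda>k. if k \<in> K then r k else 1)"
  have r': "PiM K (\<lambda>k. expo (r k)) = PiM K (\<lambda>k. expo (r' k))"
    "PiM L (\<lambda>l. expo (r (g l))) = PiM L (\<lambda>l. expo (r' (g l)))"
    by (intro PiM_cong; auto simp: r'_def g)+
  have P: "prob_space (expo (r' k))" for k
    by (rule prob_space_expo) (use D(3) in \<open>auto simp: r'_def\<close>)
  have m: "(\<lambda>x. \<lambda>l\<in>L. x (g l)) \<in> measurable (PiM K (\<lambda>_. borel)) (PiM L (\<lambda>_. borel))"
    using g by (intro measurable_restrict measurable_component_singleton) auto
  have "distr M (PiM L (\<lambda>_. borel)) (\<lambda>\<omega>. \<lambda>l\<in>L. X (g l) \<omega>) =
    distr (distr M (PiM K (\<lambda>_. borel)) (\<lambda>\<omega>. \<lambda>k\<in>K. X k \<omega>)) (PiM L (\<lambda>_. borel)) (\<lambda>x. \<lambda>l\<in>L. x (g l))"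
    by (subst distr_distr[OF m]) (auto intro!: distr_cong simp: o_def fun_eq_iff g)
  also have "\<dots> = distr (PiM K (\<lambda>k. expo (r' k))) (PiM L (\<lambda>l. expo (r' (g l)))) (\<lambda>x. \<lambda>l\<in>L. x (g l))"
    unfolding D(5) r' by (intro distr_cong) auto
  also have "\<dots> = PiM L (\<lambda>l. expo (r' (g l)))"
    using assms(2) g by (intro distr_PiM_reindex P) auto
  finally show ?thesis using D fin g by (auto simp: exp_family_def r'(2))
qed

lemma exp_family_subset: "exp_family M K r X \<Longrightarrow> L \<subseteq> K \<Longrightarrow> exp_family M L r X"
  using exp_family_reindex[of M K r X id L] by auto

lemma exp_family_eqI:
  assumes M: "prob_space M" "finite K" "\<And>k. k \<in> K \<Longrightarrow> 0 < r k"
    "\<And>k. k \<in> K \<Longrightarrow> X k \<in> borel_measurable M"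
    and eq: "\<And>A. (\<And>k. k \<in> K \<Longrightarrow> A k \<in> sets borel) \<Longrightarrow>
      (\<integral>\<^sup>+\<omega>. (\<Prod>k\<in>K. indicator (A k) (X k \<omega>)) \<partial>M) = (\<Prod>k\<in>K. emeasure (expo (r k)) (A k))"
  shows "exp_family M K r X"
proof -
  define r' where "r' = (\<lambda>k. if k \<in> K then r k else 1)"
  have P: "prob_space (expo (r' k))" for k
    by (rule prob_space_expo) (use M in \<open>auto simp: r'_def\<close>)
  interpret product_prob_space "\<lambda>k. expo (r' k)" K
    by (intro product_prob_spaceI P)
  have [measurable]: "(\<lambda>\<omega>. \<lambda>k\<in>K. X k \<omega>) \<in> measurable M (PiM K (\<lambda>_. borel))"
    by (intro measurable_restrict M)
  have "distr M (PiM K (\<lambda>_. borel)) (\<lambda>\<omega>. \<lambda>k\<in>K. X k \<omega>) = PiM K (\<lambda>k. expo (r' k))"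
  proof (rule PiM_eqI)
    fix A assume A: "\<And>k. k \<in> K \<Longrightarrow> A k \<in> sets (expo (r' k))"
    have [measurable]: "Pi\<^sub>E K A \<in> sets (PiM K (\<lambda>_. borel))"
      using A M(2) by (intro sets_PiM_I_finite) auto
    have "emeasure (distr M (PiM K (\<lambda>_. borel)) (\<lambda>\<omega>. \<lambda>k\<in>K. X k \<omega>)) (Pi\<^sub>E K A) =
      (\<integral>\<^sup>+x. indicator (Pi\<^sub>E K A) x \<partial>distr M (PiM K (\<lambda>_. borel)) (\<lambda>\<omega>. \<lambda>k\<in>K. X k \<omega>))"
      by simp
    also have "\<dots> = (\<integral>\<^sup>+\<omega>. indicator (Pi\<^sub>E K A) (\<lambda>k\<in>K. X k \<omega>) \<partial>M)"
      by (subst nn_integral_distr) auto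
    also have "\<dots> = (\<integral>\<^sup>+\<omega>. (\<Prod>k\<in>K. indicator (A k) (X k \<omega>)) \<partial>M)"
    proof (intro nn_integral_cong)
      fix \<omega>
      show "indicator (Pi\<^sub>E K A) (\<lambda>k\<in>K. X k \<omega>) = (\<Prod>k\<in>K. indicator (A k) (X k \<omega>) :: ennreal)"
      proof (cases "\<forall>k\<in>K. X k \<omega> \<in> A k")
        case True
        then show ?thesis by (simp add: PiE_iff)
      next
        case False
        then show ?thesis using M(2) by (auto simp: PiE_iff indicator_def intro!: prod_zero[symmetric])
      qed
    qed
    also have "\<dots> = (\<Prod>k\<in>K. emeasure (expo (r' k)) (A k))"
      using A by (subst eq) (auto simp: r'_def)
    finally show "emeasure (distr M (PiM K (\<lambda>_. borel)) (\<lambda>\<omega>. \<lambda>k\<in>K. X k \<omega>)) (Pi\<^sub>E K A) =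
      (\<Prod>k\<in>K. emeasure (expo (r' k)) (A k))" .
  qed (use M in auto)
  moreover have "PiM K (\<lambda>k. expo (r k)) = PiM K (\<lambda>k. expo (r' k))"
    by (intro PiM_cong) (auto simp: r'_def)
  ultimately show ?thesis using M by (simp add: exp_family_def)
qed

text \<open>
  A cell acts in place on three members of a family. Joint laws of increments are found by applying
  one cell after the other.
\<close>

lemma exp_family_cell:
  assumes X: "exp_family M K r X" and abc: "a \<in> K" "b \<in> K" "c \<in> K" "a \<noteq> b" "a \<noteq> c" "b \<noteq> c"
    and rc: "r c = r a + r b"
  shows "exp_family M K r (X(a := \<lambda>\<omega>. X c \<omega> + max 0 (X a \<omega> - X b \<omega>),
     b := \<lambda>\<omega>. X c \<omega> + max 0 (X b \<omega> - X a \<omega>), c := \<lambda>\<omega>. min (X a \<omega>) (X b \<omega>)))"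
    (is "exp_family M K r ?Y")
proof (rule exp_family_eqI)
  note D = exp_familyD[OF X]
  have m [measurable]: "X a \<in> borel_measurable M" "X b \<in> borel_measurable M" "X c \<in> borel_measurable M"
    using D(4) abc by auto
  show "prob_space M" "finite K" "\<And>k. k \<in> K \<Longrightarrow> 0 < r k" using D by auto
  show "?Y k \<in> borel_measurable M" if "k \<in> K" for k
    using D(4)[OF that] by auto
  fix A assume A: "\<And>k. k \<in> K \<Longrightarrow> A k \<in> sets (borel :: real measure)"
  have [measurable]: "A a \<in> sets borel" "A b \<in> sets borel" "A c \<in> sets borel" using A abc by auto
  define L where "L = K - {a, b, c}"
  have L: "finite L" "a \<notin> L" "b \<notin> L" "c \<notin> L" "K = insert a (insert b (insert c L))"
    using D(2) abc by (auto simp: L_def)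
  have AL: "A k \<in> sets borel" if "k \<in> L" for k using A that by (auto simp: L_def)
  define g :: "('b \<Rightarrow> real) \<Rightarrow> ennreal" where "g = (\<lambda>x. \<Prod>k\<in>L. indicator (A k) (x k))"
  have g [measurable]: "g \<in> borel_measurable (PiM J (\<lambda>_. borel))" if "L \<subseteq> J" for J
    unfolding g_def using that AL
    by (intro borel_measurable_prod_ennreal measurable_compose[OF measurable_component_singleton] borel_measurable_indicator) auto
  have g_upd: "g (x(a := u)) = g x" "g (x(b := u)) = g x" "g (x(c := u)) = g x" for x u
    unfolding g_def using L by (auto intro!: prod.cong)
  define h :: "real \<times> real \<times> real \<Rightarrow> ennreal" where
    "h = (\<lambda>(x, y, z). indicator (A a) x * indicator (A b) y * indicator (A c) z)"
  have h [measurable]: "h \<in> borel_measurable (borel \<Otimes>\<^sub>M borel \<Otimes>\<^sub>M borel)" unfolding h_def by measurable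
  define r' where "r' = (\<lambda>k. if k \<in> K then r k else 1)"
  have pse: "prob_space (expo (r' k))" for k
    by (rule prob_space_expo) (use D in \<open>auto simp: r'_def\<close>)
  interpret product_prob_space "\<lambda>k. expo (r' k)" K
    by (intro product_prob_spaceI pse)
  have PiMr': "PiM K (\<lambda>k. expo (r k)) = PiM K (\<lambda>k. expo (r' k))"
    by (intro PiM_cong) (auto simp: r'_def)
  \<comment> \<open>Fubini: integrate the three cell coordinates first.\<close>
  have fub: "(\<integral>\<^sup>+x. f (x a, x b, x c) * g x \<partial>PiM K (\<lambda>k. expo (r' k))) =
     (\<integral>\<^sup>+x. g x \<partial>PiM L (\<lambda>k. expo (r' k))) * (\<integral>\<^sup>+x. \<integral>\<^sup>+y. \<integral>\<^sup>+z. f (x, y, z) \<partial>expo (r' c) \<partial>expo (r' b) \<partial>expo (r' a))"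
    if [measurable]: "f \<in> borel_measurable (borel \<Otimes>\<^sub>M borel \<Otimes>\<^sub>M borel)" for f :: "real \<times> real \<times> real \<Rightarrow> ennreal"
  proof -
    have [measurable]: "(\<lambda>x. x a) \<in> borel_measurable (PiM (insert a (insert b (insert c L))) (\<lambda>_. borel))"
      "(\<lambda>x. x b) \<in> borel_measurable (PiM (insert a (insert b (insert c L))) (\<lambda>_. borel))"
      "(\<lambda>x. x c) \<in> borel_measurable (PiM (insert a (insert b (insert c L))) (\<lambda>_. borel))"
      "(\<lambda>x. x b) \<in> borel_measurable (PiM (insert b (insert c L)) (\<lambda>_. borel))"
      "(\<lambda>x. x c) \<in> borel_measurable (PiM (insert b (insert c L)) (\<lambda>_. borel))"
      "(\<lambda>x. x c) \<in> borel_measurable (PiM (insert c L) (\<lambda>_. borel))"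
      by (intro measurable_component_singleton; simp)+
    have [measurable]: "g \<in> borel_measurable (PiM (insert a (insert b (insert c L))) (\<lambda>_. borel))"
      "g \<in> borel_measurable (PiM (insert b (insert c L)) (\<lambda>_. borel))"
      "g \<in> borel_measurable (PiM (insert c L) (\<lambda>_. borel))" "g \<in> borel_measurable (PiM L (\<lambda>_. borel))"
      by (intro g; auto)+
    have "(\<integral>\<^sup>+x. f (x a, x b, x c) * g x \<partial>PiM K (\<lambda>k. expo (r' k))) =
       (\<integral>\<^sup>+u. \<integral>\<^sup>+x. f (u, x b, x c) * g x \<partial>PiM (insert b (insert c L)) (\<lambda>k. expo (r' k)) \<partial>expo (r' a))"
      unfolding L(5) using L abc by (subst product_nn_integral_insert_rev) (auto simp: g_upd)
    also have "\<dots> = (\<integral>\<^sup>+u. \<integral>\<^sup>+v. \<integral>\<^sup>+x. f (u, v, x c) * g x \<partial>PiM (insert c L) (\<lambda>k. expo (r' k)) \<partial>expo (r' b) \<partial>expo (r' a))"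
      using L abc by (intro nn_integral_cong, subst product_nn_integral_insert_rev) (auto simp: g_upd)
    also have "\<dots> = (\<integral>\<^sup>+u. \<integral>\<^sup>+v. \<integral>\<^sup>+z. \<integral>\<^sup>+x. f (u, v, z) * g x \<partial>PiM L (\<lambda>k. expo (r' k)) \<partial>expo (r' c) \<partial>expo (r' b) \<partial>expo (r' a))"
      using L abc by (intro nn_integral_cong, subst product_nn_integral_insert_rev) (auto simp: g_upd)
    also have "\<dots> = (\<integral>\<^sup>+u. \<integral>\<^sup>+v. \<integral>\<^sup>+z. (\<integral>\<^sup>+x. g x \<partial>PiM L (\<lambda>k. expo (r' k))) * f (u, v, z) \<partial>expo (r' c) \<partial>expo (r' b) \<partial>expo (r' a))"
    proof -
      have gE: "g \<in> borel_measurable (PiM L (\<lambda>k. expo (r' k)))" by simp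
      show ?thesis unfolding nn_integral_cmult[OF gE] by (simp only: mult.commute)
    qed
    also have "\<dots> = (\<integral>\<^sup>+x. g x \<partial>PiM L (\<lambda>k. expo (r' k))) * (\<integral>\<^sup>+x. \<integral>\<^sup>+y. \<integral>\<^sup>+z. f (x, y, z) \<partial>expo (r' c) \<partial>expo (r' b) \<partial>expo (r' a))"
    proof -
      interpret eb: prob_space "expo (r' b)" by (rule pse)
      interpret ec: prob_space "expo (r' c)" by (rule pse)
      show ?thesis by (simp add: nn_integral_cmult)
    qed
    finally show ?thesis .
  qed
  define h' where "h' = (\<lambda>(x, y, z). h (z + max 0 (x - y), z + max 0 (y - x), min x y))"
  have h' [measurable]: "h' \<in> borel_measurable (borel \<Otimes>\<^sub>M borel \<Otimes>\<^sub>M borel)" unfolding h'_def by measurable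
  have mK: "(\<lambda>x. f (x a, x b, x c) * g x) \<in> borel_measurable (PiM K (\<lambda>_. borel))"
    if [measurable]: "f \<in> borel_measurable (borel \<Otimes>\<^sub>M borel \<Otimes>\<^sub>M borel)" for f :: "real \<times> real \<times> real \<Rightarrow> ennreal"
  proof -
    have [measurable]: "(\<lambda>x. x a) \<in> borel_measurable (PiM K (\<lambda>_. borel))"
      "(\<lambda>x. x b) \<in> borel_measurable (PiM K (\<lambda>_. borel))"
      "(\<lambda>x. x c) \<in> borel_measurable (PiM K (\<lambda>_. borel))"
      using abc by (intro measurable_component_singleton; simp)+
    have [measurable]: "g \<in> borel_measurable (PiM K (\<lambda>_. borel))" by (rule g) (auto simp: L_def)
    show ?thesis by measurable
  qed
  have prodK: "(\<Prod>k\<in>K. F k) = F a * F b * F c * (\<Prod>k\<in>L. F k)" for F :: "'b \<Rightarrow> ennreal"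
    unfolding L(5) using L abc by (simp add: mult.assoc)
  have "(\<integral>\<^sup>+\<omega>. (\<Prod>k\<in>K. indicator (A k) (?Y k \<omega>)) \<partial>M) =
     (\<integral>\<^sup>+\<omega>. (\<lambda>x. h' (x a, x b, x c) * g x) (\<lambda>k\<in>K. X k \<omega>) \<partial>M)"
  proof (intro nn_integral_cong)
    fix \<omega>
    have "(\<Prod>k\<in>L. indicator (A k) (?Y k \<omega>)) = (\<Prod>k\<in>L. indicator (A k) (X k \<omega>) :: ennreal)"
      using L by (intro prod.cong) auto
    moreover have "g (\<lambda>k\<in>K. X k \<omega>) = (\<Prod>k\<in>L. indicator (A k) (X k \<omega>))"
      unfolding g_def by (intro prod.cong) (auto simp: L_def)
    ultimately show "(\<Prod>k\<in>K. indicator (A k) (?Y k \<omega>)) = (\<lambda>x. h' (x a, x b, x c) * g x) (\<lambda>k\<in>K. X k \<omega>)"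
      unfolding prodK using abc by (simp add: h'_def h_def)
  qed
  also have "\<dots> = (\<integral>\<^sup>+x. h' (x a, x b, x c) * g x \<partial>PiM K (\<lambda>k. expo (r' k)))"
    unfolding PiMr'[symmetric] by (rule exp_family_nn_integral[OF X mK[OF h']])
  also have "\<dots> = (\<integral>\<^sup>+x. h (x a, x b, x c) * g x \<partial>PiM K (\<lambda>k. expo (r' k)))"
    unfolding fub[OF h'] fub[OF h] using cell_nn_integral[OF h, of "r' a" "r' b"] abc D(3) rc
    by (simp add: h'_def r'_def)
  also have "\<dots> = (\<integral>\<^sup>+x. (\<Prod>k\<in>K. indicator (A k) (x k)) \<partial>PiM K (\<lambda>k. expo (r' k)))"
    unfolding prodK by (simp add: h_def g_def)
  also have "\<dots> = (\<Prod>k\<in>K. emeasure (expo (r' k)) (A k))"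
    using A D(2) by (subst product_nn_integral_prod) auto
  also have "\<dots> = (\<Prod>k\<in>K. emeasure (expo (r k)) (A k))"
    by (intro prod.cong) (auto simp: r'_def)
  finally show "(\<integral>\<^sup>+\<omega>. (\<Prod>k\<in>K. indicator (A k) (?Y k \<omega>)) \<partial>M) = (\<Prod>k\<in>K. emeasure (expo (r k)) (A k))" .
qed

lemma PiM_expo_cong:
  "(\<And>k. k \<in> K \<Longrightarrow> r k = r' k) \<Longrightarrow> PiM K (\<lambda>k. expo (r k)) = PiM K (\<lambda>k. expo (r' k))"
  by (intro PiM_cong) auto

lemma product_prob_space_expo:
  assumes "\<And>k. 0 < r k"
  shows "product_prob_space (\<lambda>k. expo (r k))"
  by (intro product_prob_spaceI prob_space_expo assms)

lemma measurable_indicator_scale [measurable]: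
  fixes A :: "real set"
  assumes "A \<in> sets borel"
  shows "(\<lambda>x. indicator A (c * x) :: ennreal) \<in> borel_measurable borel"
proof (rule measurable_compose[where f="\<lambda>x. c * x" and g="indicator A"])
  show "(\<lambda>x. c * x) \<in> borel_measurable borel" by simp
  show "indicator A \<in> borel_measurable borel" using assms by simp
qed

lemma emeasure_expo_scale:
  assumes "0 < r" "0 < c" and [measurable]: "A \<in> sets borel"
  shows "(\<integral>\<^sup>+x. indicator A (c * x) \<partial>expo r) = emeasure (expo (r / c)) A"
proof -
  have "emeasure (expo (r / c)) A = (\<integral>\<^sup>+x. indicator A x \<partial>expo (r / c))" by simp
  also have "\<dots> = (\<integral>\<^sup>+x. ennreal (exponential_density (r / c) x) * indicator A x \<partial>lborel)"
    by (rule nn_integral_expo) simp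
  also have "\<dots> = ennreal c * (\<integral>\<^sup>+x. ennreal (exponential_density (r / c) (c * x)) * indicator A (c * x) \<partial>lborel)"
    using assms(2) nn_integral_real_affine[of "\<lambda>x. ennreal (exponential_density (r / c) x) * indicator A x" c 0]
    by simp
  also have "\<dots> = (\<integral>\<^sup>+x. ennreal c * (ennreal (exponential_density (r / c) (c * x)) * indicator A (c * x)) \<partial>lborel)"
  proof (rule nn_integral_cmult[symmetric])
    show "(\<lambda>x. ennreal (exponential_density (r / c) (c * x)) * indicator A (c * x)) \<in> borel_measurable lborel"
      unfolding measurable_lborel2
      by (intro borel_measurable_times_ennreal measurable_indicator_scale assms(3)) simp
  qed
  also have "\<dots> = (\<integral>\<^sup>+x. ennreal (exponential_density r x) * indicator A (c * x) \<partial>lborel)"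
  proof (intro nn_integral_cong)
    fix x
    have "c * exponential_density (r / c) (c * x) = exponential_density r x"
      using assms by (auto simp: exponential_density_def field_simps mult_less_0_iff)
    then have "ennreal c * ennreal (exponential_density (r / c) (c * x)) = ennreal (exponential_density r x)"
      using assms by (subst ennreal_mult[symmetric]) (auto simp: exponential_density_nonneg)
    then show "ennreal c * (ennreal (exponential_density (r / c) (c * x)) * indicator A (c * x)) =
      ennreal (exponential_density r x) * indicator A (c * x)"
      by (simp add: mult.assoc[symmetric])
  qed
  also have "\<dots> = (\<integral>\<^sup>+x. indicator A (c * x) \<partial>expo r)"
    by (rule nn_integral_expo[symmetric, OF measurable_indicator_scale[OF assms(3)]])
  finally show ?thesis ..
qed

lemma exp_family_scale:
  assumes X: "exp_family M K r X" and c: "\<And>k. k \<in> K \<Longrightarrow> 0 < c k"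
  shows "exp_family M K (\<lambda>k. r k / c k) (\<lambda>k \<omega>. c k * X k \<omega>)"
proof (rule exp_family_eqI)
  note D = exp_familyD[OF X]
  show "prob_space M" "finite K" using D by auto
  show "0 < r k / c k" if "k \<in> K" for k using D(3) c that by simp
  show "(\<lambda>\<omega>. c k * X k \<omega>) \<in> borel_measurable M" if "k \<in> K" for k
    using D(4)[OF that] by measurable
  fix A assume A: "\<And>k. k \<in> K \<Longrightarrow> A k \<in> sets (borel :: real measure)"
  have ind: "(\<lambda>x. indicator (A k) (c k * x) :: ennreal) \<in> borel_measurable borel" if "k \<in> K" for k
    by (intro measurable_indicator_scale A that)
  define r' where "r' = (\<lambda>k. if k \<in> K then r k else 1)"
  interpret product_prob_space "\<lambda>k. expo (r' k)" K
    by (rule product_prob_space_expo) (use D in \<open>auto simp: r'_def\<close>)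
  have PiMr': "PiM K (\<lambda>k. expo (r k)) = PiM K (\<lambda>k. expo (r' k))"
    by (intro PiM_expo_cong) (auto simp: r'_def)
  have meas: "(\<lambda>x. \<Prod>k\<in>K. indicator (A k) (c k * x k) :: ennreal) \<in> borel_measurable (PiM K (\<lambda>_. borel))"
  proof (rule borel_measurable_prod_ennreal)
    fix k assume k: "k \<in> K"
    show "(\<lambda>x. indicator (A k) (c k * x k) :: ennreal) \<in> borel_measurable (PiM K (\<lambda>_. borel))"
      by (rule measurable_compose[OF measurable_component_singleton[OF k] ind[OF k]])
  qed
  have "(\<integral>\<^sup>+\<omega>. (\<Prod>k\<in>K. indicator (A k) (c k * X k \<omega>)) \<partial>M) =
    (\<integral>\<^sup>+\<omega>. (\<lambda>x. \<Prod>k\<in>K. indicator (A k) (c k * x k)) (\<lambda>k\<in>K. X k \<omega>) \<partial>M)"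
    by (intro nn_integral_cong) (auto intro!: prod.cong)
  also have "\<dots> = (\<integral>\<^sup>+x. (\<Prod>k\<in>K. indicator (A k) (c k * x k)) \<partial>PiM K (\<lambda>k. expo (r' k)))"
    unfolding PiMr'[symmetric] by (rule exp_family_nn_integral[OF X meas])
  also have "\<dots> = (\<Prod>k\<in>K. \<integral>\<^sup>+x. indicator (A k) (c k * x) \<partial>expo (r' k))"
    using ind D(2) by (subst product_nn_integral_prod) auto
  also have "\<dots> = (\<Prod>k\<in>K. emeasure (expo (r k / c k)) (A k))"
    by (intro prod.cong refl) (use A c D(3) in \<open>auto simp: r'_def emeasure_expo_scale\<close>)
  finally show "(\<integral>\<^sup>+\<omega>. (\<Prod>k\<in>K. indicator (A k) (c k * X k \<omega>)) \<partial>M) =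
    (\<Prod>k\<in>K. emeasure (expo (r k / c k)) (A k))" .
qed

lemma exp_family_stationary:
  assumes "0 < \<rho>" "\<rho> < 1" "finite K" "K \<subseteq> weight_sites"
  shows "exp_family (stationary_measure \<rho>) K (weight_rate \<rho>) (\<lambda>z \<omega>. \<omega> z)"
  unfolding exp_family_def
proof (intro conjI ballI)
  have P: "prob_space (expo (weight_rate \<rho> z))" for z
    by (rule prob_space_expo) (use assms in \<open>auto simp: weight_rate_def\<close>)
  have "distr (stationary_measure \<rho>) (PiM K (\<lambda>_. borel)) (\<lambda>\<omega>. \<lambda>k\<in>K. \<omega> k) =
    distr (PiM weight_sites (\<lambda>z. expo (weight_rate \<rho> z))) (PiM K (\<lambda>k. expo (weight_rate \<rho> (id k)))) (\<lambda>\<omega>. \<lambda>k\<in>K. \<omega> (id k))"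
    unfolding stationary_measure_def expo_def[symmetric] by (intro distr_cong) auto
  also have "\<dots> = PiM K (\<lambda>k. expo (weight_rate \<rho> (id k)))"
    by (rule distr_PiM_reindex[OF P]) (use assms in auto)
  finally show "distr (stationary_measure \<rho>) (PiM K (\<lambda>_. borel)) (\<lambda>\<omega>. \<lambda>k\<in>K. \<omega> k) = PiM K (\<lambda>k. expo (weight_rate \<rho> k))"
    by simp
qed (use assms in \<open>auto simp: weight_rate_def intro!: prob_space_stationary_measure measurable_weight\<close>)

text \<open>
  Changing the rates tilts the law exponentially. This yields moment generating functions of
  passage times.
\<close>

lemma PiM_expo_density:
  assumes "finite K" "\<And>k. 0 < r k" "\<And>k. 0 < r' k"
  shows "PiM K (\<lambda>k. expo (r' k)) =
    density (PiM K (\<lambda>k. expo (r k))) (\<lambda>x. \<Prod>k\<in>K. ennreal (r' k / r k * exp (- (r' k - r k) * x k)))"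
proof -
  interpret R: product_prob_space "\<lambda>k. expo (r k)" K by (rule product_prob_space_expo[OF assms(2)])
  interpret R': product_prob_space "\<lambda>k. expo (r' k)" K by (rule product_prob_space_expo[OF assms(3)])
  have one: "(\<integral>\<^sup>+x. ennreal (r' k / r k * exp (- (r' k - r k) * x)) * indicator B x \<partial>expo (r k)) = emeasure (expo (r' k)) B"
    if [measurable]: "B \<in> sets borel" for k B
  proof -
    have "(\<integral>\<^sup>+x. ennreal (r' k / r k * exp (- (r' k - r k) * x)) * indicator B x \<partial>expo (r k)) =
      (\<integral>\<^sup>+x. ennreal (exponential_density (r k) x) * (ennreal (r' k / r k * exp (- (r' k - r k) * x)) * indicator B x) \<partial>lborel)"
      by (rule nn_integral_expo) measurable
    also have "\<dots> = (\<integral>\<^sup>+x. ennreal (exponential_density (r' k) x) * indicator B x \<partial>lborel)"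
    proof (intro nn_integral_cong)
      fix x
      have "exponential_density (r k) x * (r' k / r k * exp (- (r' k - r k) * x)) = exponential_density (r' k) x"
        using assms(2)[of k] by (auto simp: exponential_density_def algebra_simps simp flip: exp_add)
      then have "ennreal (exponential_density (r k) x) * ennreal (r' k / r k * exp (- (r' k - r k) * x)) = ennreal (exponential_density (r' k) x)"
        using assms(2,3)[of k] by (subst ennreal_mult[symmetric]) (auto simp: exponential_density_nonneg)
      then show "ennreal (exponential_density (r k) x) * (ennreal (r' k / r k * exp (- (r' k - r k) * x)) * indicator B x) =
        ennreal (exponential_density (r' k) x) * indicator B x"
        by (simp add: mult.assoc[symmetric])
    qed
    also have "\<dots> = (\<integral>\<^sup>+x. indicator B x \<partial>expo (r' k))"
      by (rule nn_integral_expo[symmetric]) measurable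
    finally show ?thesis by simp
  qed
  have dens [measurable]: "(\<lambda>x. \<Prod>k\<in>K. ennreal (r' k / r k * exp (- (r' k - r k) * x k))) \<in> borel_measurable (PiM K (\<lambda>_. borel))"
  proof (rule borel_measurable_prod_ennreal)
    fix k assume k: "k \<in> K"
    have [measurable]: "(\<lambda>x. x k) \<in> borel_measurable (PiM K (\<lambda>_. borel :: real measure))"
      using k by (rule measurable_component_singleton)
    show "(\<lambda>x. ennreal (r' k / r k * exp (- (r' k - r k) * x k))) \<in> borel_measurable (PiM K (\<lambda>_. borel))"
      by measurable
  qed
  show ?thesis
  proof (rule R'.PiM_eqI[symmetric])
    fix A assume A: "\<And>k. k \<in> K \<Longrightarrow> A k \<in> sets (expo (r' k))"
    have [measurable]: "Pi\<^sub>E K A \<in> sets (PiM K (\<lambda>_. borel))"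
      using A assms(1) by (intro sets_PiM_I_finite) auto
    have ind: "(\<lambda>x. ennreal (r' k / r k * exp (- (r' k - r k) * x)) * indicator (A k) x) \<in> borel_measurable borel"
      if "k \<in> K" for k
    proof -
      have [measurable]: "A k \<in> sets borel" using A[OF that] by simp
      show ?thesis by measurable
    qed
    have "emeasure (density (PiM K (\<lambda>k. expo (r k))) (\<lambda>x. \<Prod>k\<in>K. ennreal (r' k / r k * exp (- (r' k - r k) * x k)))) (Pi\<^sub>E K A) =
      (\<integral>\<^sup>+x. (\<Prod>k\<in>K. ennreal (r' k / r k * exp (- (r' k - r k) * x k))) * indicator (Pi\<^sub>E K A) x \<partial>PiM K (\<lambda>k. expo (r k)))"
      using dens by (subst emeasure_density) auto
    also have "\<dots> = (\<integral>\<^sup>+x. (\<Prod>k\<in>K. ennreal (r' k / r k * exp (- (r' k - r k) * x k)) * indicator (A k) (x k)) \<partial>PiM K (\<lambda>k. expo (r k)))"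
    proof (intro nn_integral_cong)
      fix x assume "x \<in> space (PiM K (\<lambda>k. expo (r k)))"
      then have "indicator (Pi\<^sub>E K A) x = (\<Prod>k\<in>K. indicator (A k) (x k) :: ennreal)"
        using assms(1) by (cases "\<forall>k\<in>K. x k \<in> A k")
          (auto simp: PiE_iff space_PiM indicator_def intro!: prod_zero[symmetric])
      then show "(\<Prod>k\<in>K. ennreal (r' k / r k * exp (- (r' k - r k) * x k))) * indicator (Pi\<^sub>E K A) x =
        (\<Prod>k\<in>K. ennreal (r' k / r k * exp (- (r' k - r k) * x k)) * indicator (A k) (x k))"
        by (simp add: prod.distrib)
    qed
    also have "\<dots> = (\<Prod>k\<in>K. \<integral>\<^sup>+x. ennreal (r' k / r k * exp (- (r' k - r k) * x)) * indicator (A k) x \<partial>expo (r k))"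
      using ind assms(1) by (subst R.product_nn_integral_prod) auto
    also have "\<dots> = (\<Prod>k\<in>K. emeasure (expo (r' k)) (A k))"
      by (intro prod.cong refl one) (use A in auto)
    finally show "emeasure (density (PiM K (\<lambda>k. expo (r k))) (\<lambda>x. \<Prod>k\<in>K. ennreal (r' k / r k * exp (- (r' k - r k) * x k)))) (Pi\<^sub>E K A) = (\<Prod>k\<in>K. emeasure (expo (r' k)) (A k))" .
  qed (use assms(1) in auto)
qed

section \<open>Columns of cells\<close>

text \<open>
  A column of cells stacked vertically. The column receives the horizontal increment \<open>h\<close>
  at its bottom, the vertical increments \<open>V\<close> along its left side and the weights \<open>Om\<close>;
  \<open>column_h\<close> is the horizontal increment after \<open>j\<close> cells, \<open>column_v\<close> the vertical
  increments on the right side, and \<open>column_dual\<close> the minima, which act as weights for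
  the reversed dynamics. In queueing terms these are sojourn times, departures and
  dual services.
\<close>

primrec column_h :: "real \<Rightarrow> (nat \<Rightarrow> real) \<Rightarrow> (nat \<Rightarrow> real) \<Rightarrow> nat \<Rightarrow> real" where
  "column_h h V Om 0 = h"
| "column_h h V Om (Suc j) = Om (Suc j) + max 0 (column_h h V Om j - V (Suc j))"

definition column_v :: "real \<Rightarrow> (nat \<Rightarrow> real) \<Rightarrow> (nat \<Rightarrow> real) \<Rightarrow> nat \<Rightarrow> real" where
  "column_v h V Om j = Om j + max 0 (V j - column_h h V Om (j - 1))"

definition column_dual :: "real \<Rightarrow> (nat \<Rightarrow> real) \<Rightarrow> (nat \<Rightarrow> real) \<Rightarrow> nat \<Rightarrow> real" where
  "column_dual h V Om j = min (column_h h V Om (j - 1)) (V j)"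

text \<open>
  Two classes of increments pass a site in either order with the same result: first couple
  the inputs and then apply the cell with weight \<open>om\<close>, or first apply that cell to the inputs of
  one class and let the second class run through the dual weights before coupling.
\<close>

lemma cell_braid:
  fixes v u hl a s om :: real
  defines "w \<equiv> v + max 0 (u - hl)" and "hm \<equiv> min u hl"
    and "s' \<equiv> om + max 0 (s - hl)" and "a' \<equiv> min hl s + max 0 (a - v)"
  shows "om + max 0 ((s + max 0 (a - w)) - hm) = s' + max 0 (a' - u)"
    and "s + max 0 (w - a) =
      (min hl s + max 0 (v - a)) + max 0 ((s' + max 0 (u - a')) - (om + max 0 (hl - s)))"
    and "om + max 0 (hm - (s + max 0 (a - w))) =
      min (s' + max 0 (u - a')) (om + max 0 (hl - s))"
  unfolding w_def hm_def s'_def a'_def max_def min_def by (smt (verit))+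

lemma column_h_braid:
  fixes s om a :: "nat \<Rightarrow> real"
  assumes w: "w = v + max 0 (u - hl)" and hm: "hm = min u hl"
  defines "s' \<equiv> column_v hl s om" and "R \<equiv> column_dual hl s om"
  defines "a' \<equiv> column_v v a R"
  shows "column_h w a s j = column_h v a R j + max 0 (column_h u a' s' j - column_h hl s om j)"
    and "column_h hm (column_v w a s) om j = min (column_h u a' s' j) (column_h hl s om j)"
proof (induction j)
  case 0
  { case 1 show ?case using w by simp }
  { case 2 show ?case using hm by simp }
next
  case (Suc j)
  note IH = Suc
  have s': "s' (Suc j) = om (Suc j) + max 0 (s (Suc j) - column_h hl s om j)"
    and R: "R (Suc j) = min (column_h hl s om j) (s (Suc j))"
    by (simp_all add: s'_def R_def column_v_def column_dual_def)
  have a': "a' (Suc j) = min (column_h hl s om j) (s (Suc j)) + max 0 (a (Suc j) - column_h v a R j)"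
    by (simp add: a'_def column_v_def R)
  have d: "column_v w a s (Suc j) = s (Suc j) + max 0 (a (Suc j) - column_h w a s j)" by (simp add: column_v_def)
  note B = cell_braid[where v="column_h v a R j" and u="column_h u a' s' j" and hl="column_h hl s om j" and a="a (Suc j)"
      and s="s (Suc j)" and om="om (Suc j)"]
  { case 1 show ?case using B(2) IH by (simp add: s' R a') }
  { case 2 show ?case using B(3) IH by (simp add: s' R a' d) }
qed

text \<open>
  The interchange for a whole column, obtained by stacking the one-cell identities.
\<close>

lemma column_v_braid:
  assumes "w = v + max 0 (u - hl)" "hm = min u hl"
  shows "column_v hm (column_v w a s) om = column_v u (column_v v a (column_dual hl s om)) (column_v hl s om)"
proof
  fix j
  have d: "column_v w a s j = s j + max 0 (a j - column_h w a s (j - 1))" by (simp add: column_v_def)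
  show "column_v hm (column_v w a s) om j = column_v u (column_v v a (column_dual hl s om)) (column_v hl s om) j"
    unfolding column_v_def[of hm] column_v_def[of u] d column_h_braid[OF assms]
    using cell_braid(1)[where v="column_h v a (column_dual hl s om) (j - 1)" and hl="column_h hl s om (j - 1)" and a="a j"
      and s="s j" and om="om j" and u="column_h u (column_v v a (column_dual hl s om)) (column_v hl s om) (j - 1)"]
    by (simp add: column_v_def column_dual_def column_h_braid(1)[OF assms, where om=om])
qed

section \<open>Grids of cells\<close>

text \<open>
  Columns placed next to each other, each feeding its right side into the next: \<open>grid_v\<close> and \<open>grid_h\<close>
  are the vertical and horizontal increments of the passage time with boundary weights \<open>H\<close> and \<open>V\<close>.
\<close>

primrec grid_v :: "(nat \<Rightarrow> real) \<Rightarrow> (nat \<Rightarrow> real) \<Rightarrow> (nat \<Rightarrow> nat \<Rightarrow> real) \<Rightarrow> nat \<Rightarrow> nat \<Rightarrow> real" where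
  "grid_v H V Om 0 = V"
| "grid_v H V Om (Suc i) = column_v (H (Suc i)) (grid_v H V Om i) (Om (Suc i))"

definition grid_h :: "(nat \<Rightarrow> real) \<Rightarrow> (nat \<Rightarrow> real) \<Rightarrow> (nat \<Rightarrow> nat \<Rightarrow> real) \<Rightarrow> nat \<Rightarrow> nat \<Rightarrow> real" where
  "grid_h H V Om i j = column_h (H i) (grid_v H V Om (i - 1)) (Om i) j"

definition grid_dual :: "(nat \<Rightarrow> real) \<Rightarrow> (nat \<Rightarrow> real) \<Rightarrow> (nat \<Rightarrow> nat \<Rightarrow> real) \<Rightarrow> nat \<Rightarrow> nat \<Rightarrow> real" where
  "grid_dual H V Om i j = column_dual (H i) (grid_v H V Om (i - 1)) (Om i) j"

text \<open>
  If the boundary \<open>(U, column_v (w 0) a s)\<close> is coupled to the boundary \<open>(H, s)\<close> through a chain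
  \<open>w\<close> of cells, then the vertical increments of both models stay coupled in every column,
  with the dual weights of the second model as weights of the auxiliary increments.
\<close>

lemma grid_v_braid:
  assumes "\<And>i. i < m \<Longrightarrow> w i = V (Suc i) + max 0 (w (Suc i) - H (Suc i))"
    "\<And>i. i < m \<Longrightarrow> U (Suc i) = min (w (Suc i)) (H (Suc i))" "i \<le> m"
  shows "grid_v U (column_v (w 0) a s) Om i = column_v (w i) (grid_v V a (grid_dual H s Om) i) (grid_v H s Om i)"
  using assms(3)
proof (induction i)
  case (Suc i)
  have "grid_dual H s Om (Suc i) = column_dual (H (Suc i)) (grid_v H s Om i) (Om (Suc i))"
    by (simp add: grid_dual_def fun_eq_iff)
  moreover have "i < m" using Suc.prems by simp
  ultimately show ?case
    using Suc column_v_braid[OF assms(1)[OF \<open>i < m\<close>] assms(2)[OF \<open>i < m\<close>]] by simp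
qed simp

lemma column_h_cong:
  assumes "\<And>i. 1 \<le> i \<Longrightarrow> i \<le> j \<Longrightarrow> V i = V' i" "\<And>i. 1 \<le> i \<Longrightarrow> i \<le> j \<Longrightarrow> Om i = Om' i"
  shows "column_h h V Om j = column_h h V' Om' j"
  using assms by (induction j) auto

lemma column_v_cong:
  assumes "\<And>i. 1 \<le> i \<Longrightarrow> i \<le> j \<Longrightarrow> V i = V' i" "\<And>i. 1 \<le> i \<Longrightarrow> i \<le> j \<Longrightarrow> Om i = Om' i" "1 \<le> j"
  shows "column_v h V Om j = column_v h V' Om' j" "column_dual h V Om j = column_dual h V' Om' j"
proof -
  have "column_h h V Om (j - 1) = column_h h V' Om' (j - 1)" by (intro column_h_cong) (use assms in auto)
  then show "column_v h V Om j = column_v h V' Om' j" "column_dual h V Om j = column_dual h V' Om' j"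
    using assms by (auto simp: column_v_def column_dual_def)
qed

lemma grid_v_cong:
  assumes "\<And>i. 1 \<le> i \<Longrightarrow> i \<le> m \<Longrightarrow> H i = H' i" "\<And>j. 1 \<le> j \<Longrightarrow> j \<le> n \<Longrightarrow> V j = V' j"
    "\<And>i j. 1 \<le> i \<Longrightarrow> i \<le> m \<Longrightarrow> 1 \<le> j \<Longrightarrow> j \<le> n \<Longrightarrow> Om i j = Om' i j"
    "1 \<le> j" "j \<le> n"
  shows "grid_v H V Om m j = grid_v H' V' Om' m j"
  using assms
proof (induction m arbitrary: j)
  case (Suc m)
  have "grid_v H V Om m i = grid_v H' V' Om' m i" if "1 \<le> i" "i \<le> n" for i
    by (rule Suc.IH) (use Suc.prems that in auto)
  then show ?case using Suc.prems by (auto intro!: column_v_cong)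
qed simp

lemma grid_h_cong:
  assumes "\<And>i. 1 \<le> i \<Longrightarrow> i \<le> m \<Longrightarrow> H i = H' i" "\<And>j. 1 \<le> j \<Longrightarrow> j \<le> n \<Longrightarrow> V j = V' j"
    "\<And>i j. 1 \<le> i \<Longrightarrow> i \<le> m \<Longrightarrow> 1 \<le> j \<Longrightarrow> j \<le> n \<Longrightarrow> Om i j = Om' i j"
    "1 \<le> i" "i \<le> m" "j \<le> n"
  shows "grid_h H V Om i j = grid_h H' V' Om' i j"
proof -
  have "grid_v H V Om (i - 1) l = grid_v H' V' Om' (i - 1) l" if "1 \<le> l" "l \<le> n" for l
    by (rule grid_v_cong[where n=n]) (use assms that in auto)
  moreover have "H i = H' i" using assms by auto
  moreover have "Om i l = Om' i l" if "1 \<le> l" "l \<le> j" for l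
    using assms(3)[of i l] assms(4-6) that by auto
  ultimately show ?thesis unfolding grid_h_def using assms(6) by (auto intro!: column_h_cong)
qed

section \<open>Cells preserve the law\<close>

text \<open>
  One cell after the other is applied in place: the horizontal increment travels up the slot
  \<open>h\<close>, and cell \<open>j\<close> overwrites the slots of its left increment and of its weight.
\<close>

lemma exp_family_column:
  fixes h :: 'i and v c :: "nat \<Rightarrow> 'i"
  assumes X: "exp_family M K r X"
    and K: "h \<in> K" "\<And>j. 1 \<le> j \<Longrightarrow> j \<le> n \<Longrightarrow> v j \<in> K" "\<And>j. 1 \<le> j \<Longrightarrow> j \<le> n \<Longrightarrow> c j \<in> K"
    and inj: "inj v" "inj c" "h \<notin> range v" "h \<notin> range c" "range v \<inter> range c = {}"
    and r: "\<And>j. 1 \<le> j \<Longrightarrow> j \<le> n \<Longrightarrow> r (c j) = r h + r (v j)"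
    and Y: "\<And>\<omega>. Y h \<omega> = column_h (X h \<omega>) (\<lambda>j. X (v j) \<omega>) (\<lambda>j. X (c j) \<omega>) n"
      "\<And>j \<omega>. 1 \<le> j \<Longrightarrow> j \<le> n \<Longrightarrow> Y (v j) \<omega> = column_v (X h \<omega>) (\<lambda>j. X (v j) \<omega>) (\<lambda>j. X (c j) \<omega>) j"
      "\<And>j \<omega>. 1 \<le> j \<Longrightarrow> j \<le> n \<Longrightarrow> Y (c j) \<omega> = column_dual (X h \<omega>) (\<lambda>j. X (v j) \<omega>) (\<lambda>j. X (c j) \<omega>) j"
      "\<And>k \<omega>. k \<in> K \<Longrightarrow> k \<noteq> h \<Longrightarrow> k \<notin> v ` {1..n} \<Longrightarrow> k \<notin> c ` {1..n} \<Longrightarrow> Y k \<omega> = X k \<omega>"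
  shows "exp_family M K r Y"
  using K r Y
proof (induction n arbitrary: Y)
  case 0
  show ?case by (rule exp_family_cong[OF X]) (use 0 in \<open>auto, metis\<close>)
next
  case (Suc n)
  define Z where "Z = (\<lambda>k \<omega>. if k = h then column_h (X h \<omega>) (\<lambda>j. X (v j) \<omega>) (\<lambda>j. X (c j) \<omega>) n
    else if k = v (Suc n) \<or> k = c (Suc n) then X k \<omega> else Y k \<omega>)"
  have ne: "v j \<noteq> h" "c j \<noteq> h" "v j \<noteq> c i" "c i \<noteq> v j" "v i = v j \<longleftrightarrow> i = j" "c i = c j \<longleftrightarrow> i = j" for i j
    using inj(3) inj(4) inj(5) inj_eq[OF inj(1)] inj_eq[OF inj(2)] by (blast, blast, blast, blast, simp, simp)
  have Z: "exp_family M K r Z"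
  proof (rule Suc.IH)
    fix k \<omega> assume "k \<in> K" "k \<noteq> h" "k \<notin> v ` {1..n}" "k \<notin> c ` {1..n}"
    then show "Z k \<omega> = X k \<omega>" using Suc.prems(8)[of k \<omega>]
      by (auto simp: Z_def atLeastAtMostSuc_conv)
  qed (use Suc.prems ne in \<open>auto simp: Z_def\<close>)
  let ?n = "Suc n"
  show ?case
  proof (rule exp_family_cong[OF exp_family_cell[OF Z, of h "v ?n" "c ?n"] refl])
    fix k \<omega> assume k: "k \<in> K"
    have Zs: "Z h \<omega> = column_h (X h \<omega>) (\<lambda>j. X (v j) \<omega>) (\<lambda>j. X (c j) \<omega>) n" "Z (v ?n) \<omega> = X (v ?n) \<omega>"
      "Z (c ?n) \<omega> = X (c ?n) \<omega>" using ne by (auto simp: Z_def)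
    consider "k = h" | "k = v ?n" | "k = c ?n" | "k \<noteq> h" "k \<noteq> v ?n" "k \<noteq> c ?n" by blast
    then show "(Z(h := \<lambda>\<omega>. Z (c ?n) \<omega> + max 0 (Z h \<omega> - Z (v ?n) \<omega>),
         v ?n := \<lambda>\<omega>. Z (c ?n) \<omega> + max 0 (Z (v ?n) \<omega> - Z h \<omega>), c ?n := \<lambda>\<omega>. min (Z h \<omega>) (Z (v ?n) \<omega>))) k \<omega> = Y k \<omega>"
    proof cases
      case 1
      then show ?thesis using ne Suc.prems(5) Zs by (simp add: ne(1-4)[THEN not_sym])
    next
      case 2
      then show ?thesis using ne Suc.prems(6)[of ?n \<omega>] Zs by (simp add: column_v_def)
    next
      case 3
      then show ?thesis using ne Suc.prems(7)[of ?n \<omega>] Zs by (simp add: column_dual_def)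
    next
      case 4
      then show ?thesis by (simp add: Z_def)
    qed
  qed (use Suc.prems ne in \<open>auto simp: ne(1-4)[THEN not_sym]\<close>)
qed

lemma exp_family_grid:
  fixes hs vs :: "nat \<Rightarrow> 'i" and cs :: "nat \<Rightarrow> nat \<Rightarrow> 'i"
  assumes X: "exp_family M K r X"
    and K: "\<And>i. 1 \<le> i \<Longrightarrow> i \<le> m \<Longrightarrow> hs i \<in> K" "\<And>j. 1 \<le> j \<Longrightarrow> j \<le> n \<Longrightarrow> vs j \<in> K"
      "\<And>i j. 1 \<le> i \<Longrightarrow> i \<le> m \<Longrightarrow> 1 \<le> j \<Longrightarrow> j \<le> n \<Longrightarrow> cs i j \<in> K"
    and inj: "inj hs" "inj vs" "\<And>i j i' j'. cs i j = cs i' j' \<longleftrightarrow> i = i' \<and> j = j'"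
      "\<And>i j. hs i \<noteq> vs j" "\<And>i i' j. hs i \<noteq> cs i' j" "\<And>i j j'. vs j \<noteq> cs i j'"
    and r: "\<And>i j. 1 \<le> i \<Longrightarrow> i \<le> m \<Longrightarrow> 1 \<le> j \<Longrightarrow> j \<le> n \<Longrightarrow> r (cs i j) = r (hs i) + r (vs j)"
    and Y: "\<And>i \<omega>. 1 \<le> i \<Longrightarrow> i \<le> m \<Longrightarrow> Y (hs i) \<omega> = grid_h (\<lambda>i. X (hs i) \<omega>) (\<lambda>j. X (vs j) \<omega>) (\<lambda>i j. X (cs i j) \<omega>) i n"
      "\<And>j \<omega>. 1 \<le> j \<Longrightarrow> j \<le> n \<Longrightarrow> Y (vs j) \<omega> = grid_v (\<lambda>i. X (hs i) \<omega>) (\<lambda>j. X (vs j) \<omega>) (\<lambda>i j. X (cs i j) \<omega>) m j"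
      "\<And>i j \<omega>. 1 \<le> i \<Longrightarrow> i \<le> m \<Longrightarrow> 1 \<le> j \<Longrightarrow> j \<le> n \<Longrightarrow>
        Y (cs i j) \<omega> = grid_dual (\<lambda>i. X (hs i) \<omega>) (\<lambda>j. X (vs j) \<omega>) (\<lambda>i j. X (cs i j) \<omega>) i j"
      "\<And>k \<omega>. k \<in> K \<Longrightarrow> k \<notin> hs ` {1..m} \<Longrightarrow> k \<notin> vs ` {1..n} \<Longrightarrow> k \<notin> case_prod cs ` ({1..m} \<times> {1..n}) \<Longrightarrow> Y k \<omega> = X k \<omega>"
  shows "exp_family M K r Y"
  using K r Y
proof (induction m arbitrary: Y)
  case 0
  show ?case
  proof (rule exp_family_cong[OF X])
    fix k \<omega> assume "k \<in> K"
    then show "X k \<omega> = Y k \<omega>" using 0(6)[of _ \<omega>] 0(8)[of k \<omega>] by (cases "k \<in> vs ` {1..n}") auto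
  qed simp
next
  case (Suc m)
  let ?H = "\<lambda>\<omega> i. X (hs i) \<omega>" and ?V = "\<lambda>\<omega> j. X (vs j) \<omega>" and ?O = "\<lambda>\<omega> i j. X (cs i j) \<omega>"
  let ?m = "Suc m"
  define Z where "Z = (\<lambda>k \<omega>. if k \<in> range vs then (if k \<in> vs ` {1..n} then grid_v (?H \<omega>) (?V \<omega>) (?O \<omega>) m (inv vs k) else X k \<omega>)
    else if k = hs ?m \<or> k \<in> cs ?m ` {1..n} then X k \<omega> else Y k \<omega>)"
  have ne: "vs j \<noteq> hs i" "cs i' j \<noteq> hs i" "cs i j' \<noteq> vs j" "hs i = hs i' \<longleftrightarrow> i = i'" "vs j = vs j' \<longleftrightarrow> j = j'" for i j i' j'
    using inj(4)[of i j] inj(5)[of i i' j] inj(6)[of j i j'] inj(1,2) by (auto simp: inj_eq simp del: inj)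
  have inv: "inv vs (vs j) = j" for j using inj(2) by simp
  have Z: "exp_family M K r Z"
  proof (rule Suc.IH)
    fix k \<omega> assume k: "k \<in> K" "k \<notin> hs ` {1..m}" "k \<notin> vs ` {1..n}" "k \<notin> case_prod cs ` ({1..m} \<times> {1..n})"
    show "Z k \<omega> = X k \<omega>"
    proof (cases "k \<in> range vs \<or> k = hs ?m \<or> k \<in> cs ?m ` {1..n}")
      case True
      then show ?thesis using k by (auto simp: Z_def)
    next
      case False
      have "k \<notin> hs ` {1..?m}" "k \<notin> case_prod cs ` ({1..?m} \<times> {1..n})"
        using False k by (auto simp: atLeastAtMostSuc_conv)
      then show ?thesis using Suc.prems(8)[of k \<omega>] False k by (simp add: Z_def)
    qed
  qed (use Suc.prems ne inj in \<open>auto simp: Z_def inv\<close>)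
  have Zs: "Z (hs ?m) \<omega> = X (hs ?m) \<omega>" "\<And>j. 1 \<le> j \<Longrightarrow> j \<le> n \<Longrightarrow> Z (vs j) \<omega> = grid_v (?H \<omega>) (?V \<omega>) (?O \<omega>) m j"
    "\<And>j. 1 \<le> j \<Longrightarrow> j \<le> n \<Longrightarrow> Z (cs ?m j) \<omega> = X (cs ?m j) \<omega>" for \<omega>
    using ne inj by (auto simp: Z_def inv)
  show ?case
  proof (rule exp_family_column[OF Z, of "hs ?m" n vs "cs ?m"])
    fix \<omega>
    have "Y (hs ?m) \<omega> = column_h (X (hs ?m) \<omega>) (grid_v (?H \<omega>) (?V \<omega>) (?O \<omega>) m) (\<lambda>j. X (cs ?m j) \<omega>) n"
      using Suc.prems(5)[of ?m \<omega>] by (simp add: grid_h_def)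
    also have "\<dots> = column_h (Z (hs ?m) \<omega>) (\<lambda>j. Z (vs j) \<omega>) (\<lambda>j. Z (cs ?m j) \<omega>) n"
      unfolding Zs(1) by (rule column_h_cong) (auto simp: Zs)
    finally show "Y (hs ?m) \<omega> = \<dots>" .
    fix j assume j: "1 \<le> j" "j \<le> n"
    have "Y (vs j) \<omega> = column_v (X (hs ?m) \<omega>) (grid_v (?H \<omega>) (?V \<omega>) (?O \<omega>) m) (\<lambda>j. X (cs ?m j) \<omega>) j"
      using Suc.prems(6)[OF j, of \<omega>] by simp
    also have "\<dots> = column_v (Z (hs ?m) \<omega>) (\<lambda>j. Z (vs j) \<omega>) (\<lambda>j. Z (cs ?m j) \<omega>) j"
      unfolding Zs(1) by (rule column_v_cong) (use j in \<open>auto simp: Zs\<close>)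
    finally show "Y (vs j) \<omega> = \<dots>" .
    have "Y (cs ?m j) \<omega> = column_dual (X (hs ?m) \<omega>) (grid_v (?H \<omega>) (?V \<omega>) (?O \<omega>) m) (\<lambda>j. X (cs ?m j) \<omega>) j"
      using Suc.prems(7)[of ?m j \<omega>] j by (simp add: grid_dual_def)
    also have "\<dots> = column_dual (Z (hs ?m) \<omega>) (\<lambda>j. Z (vs j) \<omega>) (\<lambda>j. Z (cs ?m j) \<omega>) j"
      unfolding Zs(1) by (rule column_v_cong) (use j in \<open>auto simp: Zs\<close>)
    finally show "Y (cs ?m j) \<omega> = \<dots>" .
  next
    fix k \<omega> assume k: "k \<in> K" "k \<noteq> hs ?m" "k \<notin> vs ` {1..n}" "k \<notin> cs ?m ` {1..n}"
    show "Y k \<omega> = Z k \<omega>"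
    proof (cases "k \<in> range vs")
      case True
      then have "k \<notin> hs ` {1..?m}" "k \<notin> case_prod cs ` ({1..?m} \<times> {1..n})"
        using ne(1,3) by (auto; metis)+
      then show ?thesis using Suc.prems(8)[of k \<omega>] k True by (simp add: Z_def)
    next
      case False
      then show ?thesis using k by (simp add: Z_def)
    qed
  next
    show "inj (cs ?m)" using inj(3) by (auto intro!: injI)
    show "hs ?m \<notin> range vs" "hs ?m \<notin> range (cs ?m)" using inj(4,5) by blast+
    show "range vs \<inter> range (cs ?m) = {}" using inj(6) by auto
    show "inj vs" by (fact inj(2))
    show "hs ?m \<in> K" by (rule Suc.prems(1)) auto
    show "vs j \<in> K" "cs ?m j \<in> K" if "1 \<le> j" "j \<le> n" for j
      using that by (auto intro!: Suc.prems(2,3))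
    show "r (cs ?m j) = r (hs ?m) + r (vs j)" if "1 \<le> j" "j \<le> n" for j
      using that by (intro Suc.prems(4)) auto
  qed
qed

section \<open>Random walks with differences of exponentials as steps\<close>

text \<open>
  The probability that the walk with steps \<open>u - v\<close>, where \<open>u\<close> has rate \<open>a\<close> and \<open>v\<close> has rate
  \<open>b\<close> for successive pairs \<open>(a, b)\<close>, never exceeds the level \<open>y\<close>. The recursion lowers the
  remaining level by each step.
\<close>

fun stay_prob :: "(real \<times> real) list \<Rightarrow> real \<Rightarrow> ennreal" where
  "stay_prob [] y = 1"
| "stay_prob ((a, b) # l) y =
     (\<integral>\<^sup>+v. \<integral>\<^sup>+u. indicator {..y} (u - v) * stay_prob l (y - u + v) \<partial>expo a \<partial>expo b)"

fun pos_rates :: "(real \<times> real) list \<Rightarrow> bool" where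
  "pos_rates l \<longleftrightarrow> (\<forall>(a, b)\<in>set l. 0 < a \<and> 0 < b)"
declare pos_rates.simps [simp del]

lemma pos_rates_Cons [simp]: "pos_rates ((a, b) # l) \<longleftrightarrow> 0 < a \<and> 0 < b \<and> pos_rates l"
  by (auto simp: pos_rates.simps)

lemma pos_rates_append [simp]: "pos_rates (l @ l') \<longleftrightarrow> pos_rates l \<and> pos_rates l'"
  by (auto simp: pos_rates.simps)

lemma measurable_stay_prob: "pos_rates l \<Longrightarrow> stay_prob l \<in> borel_measurable borel"
proof (induction l)
  case Nil
  have "stay_prob [] = (\<lambda>_. 1)" by auto
  then show ?case by simp
next
  case (Cons p l)
  obtain a b where p: "p = (a, b)" by fastforce
  interpret A: prob_space "expo a" using Cons p by (intro prob_space_expo) auto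
  interpret B: prob_space "expo b" using Cons p by (intro prob_space_expo) auto
  have [measurable]: "stay_prob l \<in> borel_measurable borel" using Cons p by auto
  have "(\<lambda>y. \<integral>\<^sup>+v. \<integral>\<^sup>+u. indicator {..y} (u - v) * stay_prob l (y - u + v) \<partial>expo a \<partial>expo b) =
    (\<lambda>y. \<integral>\<^sup>+v. \<integral>\<^sup>+u. (if u - v \<le> y then stay_prob l (y - u + v) else 0) \<partial>expo a \<partial>expo b)"
    by (intro ext nn_integral_cong) (auto simp: indicator_def)
  also have "\<dots> \<in> borel_measurable borel" by measurable
  finally show ?case by (simp add: p)
qed

lemma measurable_stay_integrand:
  assumes "pos_rates l"
  shows "(\<lambda>u. indicator {..y} (u - v) * stay_prob l (y - u + v)) \<in> borel_measurable borel"
proof -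
  have [measurable]: "stay_prob l \<in> borel_measurable borel" by (rule measurable_stay_prob[OF assms])
  have "(\<lambda>u. indicator {..y} (u - v) * stay_prob l (y - u + v)) = (\<lambda>u. if u - v \<le> y then stay_prob l (y - u + v) else 0)"
    by (auto simp: indicator_def)
  then show ?thesis by simp
qed

lemma stay_prob_le_1: "pos_rates l \<Longrightarrow> stay_prob l y \<le> 1"
proof (induction l arbitrary: y)
  case (Cons p l)
  obtain a b where p: "p = (a, b)" by fastforce
  interpret A: prob_space "expo a" using Cons p by (intro prob_space_expo) auto
  interpret B: prob_space "expo b" using Cons p by (intro prob_space_expo) auto
  have "stay_prob (p # l) y \<le> (\<integral>\<^sup>+v. \<integral>\<^sup>+u. 1 \<partial>expo a \<partial>expo b)"
    unfolding p stay_prob.simps using Cons p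
    by (intro nn_integral_mono) (auto simp: indicator_def)
  also have "\<dots> = 1" by (simp add: A.emeasure_space_1[simplified] B.emeasure_space_1[simplified])
  finally show ?case .
qed simp

lemma stay_prob_append_le: "pos_rates (l @ l') \<Longrightarrow> stay_prob (l @ l') y \<le> stay_prob l y"
proof (induction l arbitrary: y)
  case Nil
  then show ?case using stay_prob_le_1 by simp
next
  case (Cons p l)
  obtain a b where p: "p = (a, b)" by fastforce
  show ?case unfolding p append_Cons stay_prob.simps using Cons p
    by (intro nn_integral_mono mult_left_mono) auto
qed

text \<open>
  The function \<open>y \<mapsto> (1 - c * exp (- \<eta> * y)) / (1 - q)\<close> is a supersolution of the equation satisfied by
  the discounted occupation \<open>\<Sum>n. q\<^sup>n * P (stay below y for n steps)\<close>. Overshoots of an exponential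
  step are again exponential, which is why an explicit exponential function works; \<open>root\<close> says
  that \<open>\<eta>\<close> lies beyond the root of the characteristic equation and \<open>c\<close> absorbs the overshoot.
\<close>

lemma walk_step_bound:
  fixes a b c \<eta> q y :: real
  assumes ab: "0 < a" "0 < b" and q: "0 < q" "q < 1" and \<eta>: "0 < \<eta>" "\<eta> < a"
    and c: "0 \<le> c" "c * a \<le> a - \<eta>" and root: "(a - b) * \<eta> + a * b * (1 - q) \<le> \<eta>\<^sup>2" and y: "0 \<le> y"
  shows "1 + ennreal q * (\<integral>\<^sup>+v. \<integral>\<^sup>+u. indicator {..y} (u - v) *
      ennreal ((1 - c * exp (- \<eta> * (y - u + v))) / (1 - q)) \<partial>expo a \<partial>expo b)
    \<le> ennreal ((1 - c * exp (- \<eta> * y)) / (1 - q))"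
proof -
  define \<kappa> where "\<kappa> = c * a / (a - \<eta>)"
  have \<kappa>: "0 \<le> \<kappa>" "\<kappa> \<le> 1" using c \<eta> ab by (auto simp: \<kappa>_def)
  have "c \<le> 1" using c ab \<eta> by (smt (verit) mult_le_cancel_right1)
  have ce: "c * exp (- \<eta> * z) \<le> 1" "\<kappa> * exp (- \<eta> * z) \<le> 1" if "0 \<le> z" for z
    using \<open>c \<le> 1\<close> c \<kappa> \<eta> that by (auto intro!: mult_le_one)
  have inner: "(\<integral>\<^sup>+u. indicator {..y} (u - v) * ennreal ((1 - c * exp (- \<eta> * (y - u + v))) / (1 - q)) \<partial>expo a)
    \<le> ennreal ((1 - \<kappa> * exp (- \<eta> * (y + v))) / (1 - q))" if v: "0 \<le> v" for v
  proof -
    define z where "z = y + v"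
    have z: "0 \<le> z" using y v by (simp add: z_def)
    have "(\<lambda>u. indicator {..y} (u - v) * ennreal ((1 - c * exp (- \<eta> * (y - u + v))) / (1 - q))) \<in> borel_measurable borel"
      by measurable
    then have "(\<integral>\<^sup>+u. indicator {..y} (u - v) * ennreal ((1 - c * exp (- \<eta> * (y - u + v))) / (1 - q)) \<partial>expo a)
      = (\<integral>\<^sup>+u. ennreal (exponential_density a u) * (indicator {..y} (u - v) * ennreal ((1 - c * exp (- \<eta> * (y - u + v))) / (1 - q))) \<partial>lborel)"
      by (rule nn_integral_expo)
    also have "\<dots> = (\<integral>\<^sup>+u. ennreal (a * exp (- a * u) * (1 - c * exp (- \<eta> * (z - u))) / (1 - q)) * indicator {0..z} u \<partial>lborel)"
    proof (intro nn_integral_cong)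
      fix u
      show "ennreal (exponential_density a u) * (indicator {..y} (u - v) * ennreal ((1 - c * exp (- \<eta> * (y - u + v))) / (1 - q))) =
        ennreal (a * exp (- a * u) * (1 - c * exp (- \<eta> * (z - u))) / (1 - q)) * indicator {0..z} u"
      proof (cases "0 \<le> u \<and> u \<le> z")
        case True
        have e: "y - u + v = z - u" and "u - v \<le> y" using True by (auto simp: z_def)
        then show ?thesis using True ab q ce(1)[of "z - u"] unfolding e
          by (simp add: exponential_density_def ennreal_mult[symmetric] mult.commute)
      next
        case False
        then show ?thesis by (auto simp: exponential_density_def z_def indicator_def)
      qed
    qed
    also have "\<dots> = ennreal ((\<kappa> * exp (- \<eta> * z) * exp (- (a - \<eta>) * z) - exp (- a * z)) / (1 - q) - (\<kappa> * exp (- \<eta> * z) * exp (- (a - \<eta>) * 0) - exp (- a * 0)) / (1 - q))"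
    proof (rule nn_integral_FTC_Icc[where F="\<lambda>u. (\<kappa> * exp (- \<eta> * z) * exp (- (a - \<eta>) * u) - exp (- a * u)) / (1 - q)"])
      fix u assume u: "u \<in> {0..z}"
      show "0 \<le> a * exp (- a * u) * (1 - c * exp (- \<eta> * (z - u))) / (1 - q)"
        using ab q ce(1)[of "z - u"] u by simp
      have E: "exp (- \<eta> * z) * exp (- (a - \<eta>) * u) = exp (- a * u) * exp (- \<eta> * (z - u))"
        by (simp add: exp_add[symmetric] algebra_simps)
      have K: "\<kappa> * (a - \<eta>) = c * a" using \<eta> by (simp add: \<kappa>_def)
      have "\<kappa> * exp (- \<eta> * z) * (exp (- (a - \<eta>) * u) * (- (a - \<eta>))) =
         - (\<kappa> * (a - \<eta>)) * (exp (- \<eta> * z) * exp (- (a - \<eta>) * u))" by (simp only: mult_ac mult_minus_left mult_minus_right)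
      also have "\<dots> = - (c * a) * (exp (- a * u) * exp (- \<eta> * (z - u)))" unfolding E K ..
      finally have "a * exp (- a * u) * (1 - c * exp (- \<eta> * (z - u))) =
         (\<kappa> * exp (- \<eta> * z) * (exp (- (a - \<eta>) * u) * (- (a - \<eta>))) - exp (- a * u) * (- a))"
        by (simp add: algebra_simps)
      then show "((\<lambda>u. (\<kappa> * exp (- \<eta> * z) * exp (- (a - \<eta>) * u) - exp (- a * u)) / (1 - q)) has_real_derivative
           a * exp (- a * u) * (1 - c * exp (- \<eta> * (z - u))) / (1 - q)) (at u)"
        using q by (auto intro!: derivative_eq_intros)
    qed (use z in auto)
    also have "\<dots> \<le> ennreal ((1 - \<kappa> * exp (- \<eta> * z)) / (1 - q))"
    proof (intro ennreal_leI)
      have "exp (- \<eta> * z) * exp (- (a - \<eta>) * z) = exp (- a * z)"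
        by (simp add: exp_add[symmetric] algebra_simps)
      then have "\<kappa> * exp (- \<eta> * z) * exp (- (a - \<eta>) * z) - exp (- a * z) = - (1 - \<kappa>) * exp (- a * z)"
        by (simp add: algebra_simps)
      also have "\<dots> \<le> 0" using \<kappa> by (intro mult_nonpos_nonneg) auto
      finally show "(\<kappa> * exp (- \<eta> * z) * exp (- (a - \<eta>) * z) - exp (- a * z)) / (1 - q) - (\<kappa> * exp (- \<eta> * z) * exp (- (a - \<eta>) * 0) - exp (- a * 0)) / (1 - q)
        \<le> (1 - \<kappa> * exp (- \<eta> * z)) / (1 - q)"
        using q by (simp add: divide_simps)
    qed
    finally show ?thesis by (simp add: z_def)
  qed
  have "(\<integral>\<^sup>+v. \<integral>\<^sup>+u. indicator {..y} (u - v) * ennreal ((1 - c * exp (- \<eta> * (y - u + v))) / (1 - q)) \<partial>expo a \<partial>expo b)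
    = (\<integral>\<^sup>+v. ennreal (exponential_density b v) * (\<integral>\<^sup>+u. indicator {..y} (u - v) * ennreal ((1 - c * exp (- \<eta> * (y - u + v))) / (1 - q)) \<partial>expo a) \<partial>lborel)"
  proof (rule nn_integral_expo)
    interpret A: prob_space "expo a" using ab by (intro prob_space_expo)
    have "(\<lambda>v. \<integral>\<^sup>+u. indicator {..y} (u - v) * ennreal ((1 - c * exp (- \<eta> * (y - u + v))) / (1 - q)) \<partial>expo a) =
      (\<lambda>v. \<integral>\<^sup>+u. (if u - v \<le> y then ennreal ((1 - c * exp (- \<eta> * (y - u + v))) / (1 - q)) else 0) \<partial>expo a)"
      by (intro ext nn_integral_cong) (auto simp: indicator_def)
    also have "\<dots> \<in> borel_measurable borel" by measurable
    finally show "(\<lambda>v. \<integral>\<^sup>+u. indicator {..y} (u - v) * ennreal ((1 - c * exp (- \<eta> * (y - u + v))) / (1 - q)) \<partial>expo a) \<in> borel_measurable borel" .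
  qed
  also have "\<dots> \<le> (\<integral>\<^sup>+v. ennreal (b * exp (- b * v) * (1 - \<kappa> * exp (- \<eta> * (y + v))) / (1 - q)) * indicator {0..} v \<partial>lborel)"
  proof (intro nn_integral_mono)
    fix v
    show "ennreal (exponential_density b v) * (\<integral>\<^sup>+u. indicator {..y} (u - v) * ennreal ((1 - c * exp (- \<eta> * (y - u + v))) / (1 - q)) \<partial>expo a)
      \<le> ennreal (b * exp (- b * v) * (1 - \<kappa> * exp (- \<eta> * (y + v))) / (1 - q)) * indicator {0..} v"
    proof (cases "0 \<le> v")
      case True
      have "ennreal (exponential_density b v) * (\<integral>\<^sup>+u. indicator {..y} (u - v) * ennreal ((1 - c * exp (- \<eta> * (y - u + v))) / (1 - q)) \<partial>expo a)
        \<le> ennreal (exponential_density b v) * ennreal ((1 - \<kappa> * exp (- \<eta> * (y + v))) / (1 - q))"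
        by (intro mult_left_mono inner True) simp
      also have "\<dots> = ennreal (b * exp (- b * v) * (1 - \<kappa> * exp (- \<eta> * (y + v))) / (1 - q))"
        using True ab q ce(2)[of "y + v"] y
        by (simp add: exponential_density_def ennreal_mult[symmetric] mult.commute)
      finally show ?thesis using True by simp
    qed (simp add: exponential_density_def)
  qed
  also have "\<dots> = ennreal (0 - (\<kappa> * exp (- \<eta> * y) * (b / (b + \<eta>)) * exp (- (b + \<eta>) * 0) - exp (- b * 0)) / (1 - q))"
  proof (rule nn_integral_FTC_atLeast[where F="\<lambda>v. (\<kappa> * exp (- \<eta> * y) * (b / (b + \<eta>)) * exp (- (b + \<eta>) * v) - exp (- b * v)) / (1 - q)"])
    fix v :: real assume v: "0 \<le> v"
    show "0 \<le> b * exp (- b * v) * (1 - \<kappa> * exp (- \<eta> * (y + v))) / (1 - q)"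
      using ab q ce(2)[of "y + v"] v y by simp
    have "exp (- b * v) * exp (- \<eta> * (y + v)) = exp (- \<eta> * y) * exp (- (b + \<eta>) * v)"
      by (simp add: exp_add[symmetric] algebra_simps)
    then have "b * exp (- b * v) * (1 - \<kappa> * exp (- \<eta> * (y + v))) =
      \<kappa> * exp (- \<eta> * y) * (b / (b + \<eta>)) * (exp (- (b + \<eta>) * v) * (- (b + \<eta>))) - exp (- b * v) * (- b)"
      using ab \<eta> by (simp add: field_simps)
    then show "((\<lambda>v. (\<kappa> * exp (- \<eta> * y) * (b / (b + \<eta>)) * exp (- (b + \<eta>) * v) - exp (- b * v)) / (1 - q)) has_real_derivative
        b * exp (- b * v) * (1 - \<kappa> * exp (- \<eta> * (y + v))) / (1 - q)) (at v)"
      using q ab \<eta> by (auto intro!: derivative_eq_intros)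
  next
    have lim: "((\<lambda>v. exp (- d * v)) \<longlongrightarrow> 0) at_top" if "0 < d" for d :: real
      using that by (intro filterlim_compose[OF exp_at_bot] filterlim_tendsto_neg_mult_at_bot[OF tendsto_const _ filterlim_ident]) auto
    have "((\<lambda>v. (\<kappa> * exp (- \<eta> * y) * (b / (b + \<eta>)) * exp (- (b + \<eta>) * v) - exp (- b * v)) / (1 - q)) \<longlongrightarrow>
      (\<kappa> * exp (- \<eta> * y) * (b / (b + \<eta>)) * 0 - 0) / (1 - q)) at_top"
      using ab \<eta> q by (intro tendsto_intros lim) auto
    then show "((\<lambda>v. (\<kappa> * exp (- \<eta> * y) * (b / (b + \<eta>)) * exp (- (b + \<eta>) * v) - exp (- b * v)) / (1 - q)) \<longlongrightarrow> 0) at_top"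
      by simp
  qed measurable
  finally have I: "(\<integral>\<^sup>+v. \<integral>\<^sup>+u. indicator {..y} (u - v) * ennreal ((1 - c * exp (- \<eta> * (y - u + v))) / (1 - q)) \<partial>expo a \<partial>expo b)
    \<le> ennreal ((1 - \<kappa> * exp (- \<eta> * y) * (b / (b + \<eta>))) / (1 - q))"
    by (simp add: minus_divide_left)
  have "1 + ennreal q * (\<integral>\<^sup>+v. \<integral>\<^sup>+u. indicator {..y} (u - v) * ennreal ((1 - c * exp (- \<eta> * (y - u + v))) / (1 - q)) \<partial>expo a \<partial>expo b)
    \<le> 1 + ennreal q * ennreal ((1 - \<kappa> * exp (- \<eta> * y) * (b / (b + \<eta>))) / (1 - q))"
    by (intro add_left_mono mult_left_mono I) simp
  also have "\<dots> = ennreal (1 + q * ((1 - \<kappa> * exp (- \<eta> * y) * (b / (b + \<eta>))) / (1 - q)))"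
  proof -
    have "\<kappa> * exp (- \<eta> * y) * (b / (b + \<eta>)) \<le> 1"
      using ce(2)[OF y] ab \<eta> \<kappa> y by (intro mult_le_one) auto
    then show ?thesis using q by (simp add: ennreal_mult[symmetric] flip: ennreal_1 ennreal_plus)
  qed
  also have "\<dots> \<le> ennreal ((1 - c * exp (- \<eta> * y)) / (1 - q))"
  proof (intro ennreal_leI)
    have "(a - \<eta>) * (b + \<eta>) \<le> q * a * b"
      using root by (simp add: algebra_simps power2_eq_square)
    then have "c * ((a - \<eta>) * (b + \<eta>)) \<le> c * (q * a * b)" by (rule mult_left_mono) (rule c)
    then have "c \<le> c * (q * a * b) / ((a - \<eta>) * (b + \<eta>))"
      using ab \<eta> by (subst pos_le_divide_eq) auto
    also have "\<dots> = q * (\<kappa> * (b / (b + \<eta>)))" by (simp add: \<kappa>_def)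
    finally have "c \<le> q * (\<kappa> * (b / (b + \<eta>)))" .
    then have "c * exp (- \<eta> * y) \<le> q * (\<kappa> * (b / (b + \<eta>))) * exp (- \<eta> * y)"
      by (rule mult_right_mono) simp
    then have "(1 - q) + q * (1 - \<kappa> * exp (- \<eta> * y) * (b / (b + \<eta>))) \<le> 1 - c * exp (- \<eta> * y)"
      by (simp add: algebra_simps)
    from divide_right_mono[OF this, of "1 - q"] q
    show "1 + q * ((1 - \<kappa> * exp (- \<eta> * y) * (b / (b + \<eta>))) / (1 - q)) \<le> (1 - c * exp (- \<eta> * y)) / (1 - q)"
      by (simp add: add_divide_distrib)
  qed
  finally show ?thesis .
qed

lemma stay_prob_sum_bound:
  fixes c \<eta> q y :: real
  assumes "pos_rates l" and q: "0 < q" "q < 1" and \<eta>: "0 < \<eta>" and c: "0 \<le> c"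
    and rates: "\<And>a b. (a, b) \<in> set l \<Longrightarrow> \<eta> < a \<and> c * a \<le> a - \<eta> \<and> (a - b) * \<eta> + a * b * (1 - q) \<le> \<eta>\<^sup>2"
    and y: "0 \<le> y" and c1: "c \<le> 1 - (1 - q)"
  shows "(\<Sum>n\<le>length l. ennreal q ^ n * stay_prob (take n l) y) \<le> ennreal ((1 - c * exp (- \<eta> * y)) / (1 - q))"
  using assms(1) rates y
proof (induction l arbitrary: y)
  case Nil
  have "c * exp (- \<eta> * y) \<le> c * 1" using c \<eta> Nil by (intro mult_left_mono) auto
  then have "1 \<le> (1 - c * exp (- \<eta> * y)) / (1 - q)" using q c1 by (simp add: field_simps)
  then show ?case using ennreal_leI[of 1] by simp
next
  case (Cons p l)
  obtain a b where p: "p = (a, b)" by fastforce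
  note rt = Cons.prems(2)[of a b, unfolded p, simplified]
  have pr: "pos_rates l" "pos_rates (take n l)" "0 < a" "0 < b" for n
    using Cons p by (auto simp: pos_rates.simps dest: in_set_takeD)
  note ms = measurable_stay_integrand[OF pr(2)]
  interpret A: prob_space "expo a" using pr by (intro prob_space_expo) auto
  interpret B: prob_space "expo b" using pr by (intro prob_space_expo) auto
  have ms2: "(\<lambda>v. \<integral>\<^sup>+u. indicator {..y} (u - v) * stay_prob (take n l) (y - u + v) \<partial>expo a) \<in> borel_measurable borel" for n
  proof -
    have [measurable]: "stay_prob (take n l) \<in> borel_measurable borel" by (rule measurable_stay_prob[OF pr(2)])
    have "(\<lambda>v. \<integral>\<^sup>+u. indicator {..y} (u - v) * stay_prob (take n l) (y - u + v) \<partial>expo a) =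
      (\<lambda>v. \<integral>\<^sup>+u. (if u - v \<le> y then stay_prob (take n l) (y - u + v) else 0) \<partial>expo a)"
      by (intro ext nn_integral_cong) (auto simp: indicator_def)
    also have "\<dots> \<in> borel_measurable borel" by measurable
    finally show ?thesis .
  qed
  have "(\<Sum>n\<le>length (p # l). ennreal q ^ n * stay_prob (take n (p # l)) y) =
     1 + (\<Sum>n\<le>length l. ennreal q ^ Suc n * stay_prob (p # take n l) y)"
    unfolding length_Cons sum.atMost_Suc_shift by simp
  also have "(\<Sum>n\<le>length l. ennreal q ^ Suc n * stay_prob (p # take n l) y) =
    ennreal q * (\<Sum>n\<le>length l. ennreal q ^ n * stay_prob (p # take n l) y)"
    by (simp add: sum_distrib_left mult.assoc)
  also have "(\<Sum>n\<le>length l. ennreal q ^ n * stay_prob (p # take n l) y) =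
    (\<integral>\<^sup>+v. \<integral>\<^sup>+u. indicator {..y} (u - v) * (\<Sum>n\<le>length l. ennreal q ^ n * stay_prob (take n l) (y - u + v)) \<partial>expo a \<partial>expo b)"
  proof -
    have "(\<integral>\<^sup>+u. indicator {..y} (u - v) * (\<Sum>n\<le>length l. ennreal q ^ n * stay_prob (take n l) (y - u + v)) \<partial>expo a) =
      (\<Sum>n\<le>length l. ennreal q ^ n * (\<integral>\<^sup>+u. indicator {..y} (u - v) * stay_prob (take n l) (y - u + v) \<partial>expo a))" for v
    proof -
      have "(\<integral>\<^sup>+u. indicator {..y} (u - v) * (\<Sum>n\<le>length l. ennreal q ^ n * stay_prob (take n l) (y - u + v)) \<partial>expo a) =
        (\<integral>\<^sup>+u. (\<Sum>n\<le>length l. ennreal q ^ n * (indicator {..y} (u - v) * stay_prob (take n l) (y - u + v))) \<partial>expo a)"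
        by (simp add: sum_distrib_left mult_ac)
      also have "\<dots> = (\<Sum>n\<le>length l. \<integral>\<^sup>+u. ennreal q ^ n * (indicator {..y} (u - v) * stay_prob (take n l) (y - u + v)) \<partial>expo a)"
        by (rule nn_integral_sum) (use ms in simp)
      also have "\<dots> = (\<Sum>n\<le>length l. ennreal q ^ n * (\<integral>\<^sup>+u. indicator {..y} (u - v) * stay_prob (take n l) (y - u + v) \<partial>expo a))"
        by (intro sum.cong refl nn_integral_cmult) (use ms in simp)
      finally show ?thesis .
    qed
    then have "(\<integral>\<^sup>+v. \<integral>\<^sup>+u. indicator {..y} (u - v) * (\<Sum>n\<le>length l. ennreal q ^ n * stay_prob (take n l) (y - u + v)) \<partial>expo a \<partial>expo b)
      = (\<Sum>n\<le>length l. \<integral>\<^sup>+v. ennreal q ^ n * (\<integral>\<^sup>+u. indicator {..y} (u - v) * stay_prob (take n l) (y - u + v) \<partial>expo a) \<partial>expo b)"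
      using ms2 by (simp add: nn_integral_sum)
    also have "\<dots> = (\<Sum>n\<le>length l. ennreal q ^ n * stay_prob (p # take n l) y)"
      using ms2 by (simp add: nn_integral_cmult p)
    finally show ?thesis ..
  qed
  also have "1 + ennreal q * (\<integral>\<^sup>+v. \<integral>\<^sup>+u. indicator {..y} (u - v) * (\<Sum>n\<le>length l. ennreal q ^ n * stay_prob (take n l) (y - u + v)) \<partial>expo a \<partial>expo b)
    \<le> 1 + ennreal q * (\<integral>\<^sup>+v. \<integral>\<^sup>+u. indicator {..y} (u - v) * ennreal ((1 - c * exp (- \<eta> * (y - u + v))) / (1 - q)) \<partial>expo a \<partial>expo b)"
  proof (rule add_left_mono, rule mult_left_mono, rule nn_integral_mono, rule nn_integral_mono)
    fix v u
    show "indicator {..y} (u - v) * (\<Sum>n\<le>length l. ennreal q ^ n * stay_prob (take n l) (y - u + v))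
      \<le> indicator {..y} (u - v) * ennreal ((1 - c * exp (- \<eta> * (y - u + v))) / (1 - q))"
    proof (cases "u - v \<le> y")
      case True
      have "(\<Sum>n\<le>length l. ennreal q ^ n * stay_prob (take n l) (y - u + v)) \<le> ennreal ((1 - c * exp (- \<eta> * (y - u + v))) / (1 - q))"
        by (rule Cons.IH[OF pr(1)]) (use Cons.prems(2) True in auto)
      then show ?thesis using True by simp
    qed simp
  qed simp
  also have "\<dots> \<le> ennreal ((1 - c * exp (- \<eta> * y)) / (1 - q))"
    by (rule walk_step_bound) (use pr rt q \<eta> c Cons.prems in auto)
  finally show ?case .
qed

text \<open>
  Staying low for \<open>n\<close> steps is less likely for larger \<open>n\<close>. So the whole walk's probability is at
  most the discounted average over all its prefixes, and with discount \<open>1 - 1 / (2 T)\<close> for \<open>T\<close> steps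
  the discount factors stay above one half. The bound of the discounted sum near \<open>y = 0\<close> is then of
  order \<open>\<eta>\<close>, which is the larger of the drift and \<open>1 / sqrt T\<close>.
\<close>

lemma stay_prob_bound:
  fixes \<eta> a\<^sub>0 y :: real
  assumes l: "pos_rates l" "l \<noteq> []" and \<eta>: "0 < \<eta>" "\<eta> < a\<^sub>0"
    and rates: "\<And>a b. (a, b) \<in> set l \<Longrightarrow> a\<^sub>0 \<le> a \<and> (a - b) * \<eta> + a * b / (2 * length l) \<le> \<eta>\<^sup>2"
    and len: "a\<^sub>0 \<le> 2 * length l * \<eta>"
    and y: "0 \<le> y"
  shows "stay_prob l y \<le> ennreal (4 * \<eta> * (1 / a\<^sub>0 + y))"
proof -
  define T where "T = length l"
  have T: "1 \<le> T" using l(2) by (auto simp: T_def Suc_le_eq)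
  define q where "q = 1 - 1 / (2 * real T)"
  define c where "c = 1 - \<eta> / a\<^sub>0"
  have q: "0 < q" "q < 1" "1 - q = 1 / (2 * real T)" using T by (auto simp: q_def field_simps)
  have c: "0 \<le> c" "c \<le> 1" using \<eta> by (auto simp: c_def)
  have B1: "(\<Sum>n\<le>length l. ennreal q ^ n * stay_prob (take n l) y) \<le> ennreal ((1 - c * exp (- \<eta> * y)) / (1 - q))"
  proof (rule stay_prob_sum_bound[OF l(1) q(1,2) \<eta>(1) c(1) _ y])
    fix a b assume ab: "(a, b) \<in> set l"
    have "a\<^sub>0 \<le> a" using rates[OF ab] by simp
    then have "\<eta> * a\<^sub>0 \<le> \<eta> * a" using \<eta> by simp
    then have "\<eta> \<le> \<eta> / a\<^sub>0 * a" using \<eta> by (simp add: field_simps)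
    then show "\<eta> < a \<and> c * a \<le> a - \<eta> \<and> (a - b) * \<eta> + a * b * (1 - q) \<le> \<eta>\<^sup>2"
      using rates[OF ab] \<eta> by (simp add: c_def q(3) T_def algebra_simps)
  next
    show "c \<le> 1 - (1 - q)" using len T \<eta> unfolding q(3) c_def T_def[symmetric] by (simp add: field_simps)
  qed
  have B2: "(\<Sum>n\<le>length l. ennreal (1/2) * stay_prob l y) \<le> (\<Sum>n\<le>length l. ennreal q ^ n * stay_prob (take n l) y)"
  proof (intro sum_mono mult_mono)
    fix n assume n: "n \<in> {..length l}"
    have "1 + real n * (- (1 / (2 * real T))) \<le> (1 + (- (1 / (2 * real T)))) ^ n"
      by (rule Bernoulli_inequality) (use T in auto)
    moreover have "real n \<le> real T" using n by (simp add: T_def)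
    then have "real n / (2 * real T) \<le> 1 / 2" using T by (simp add: divide_le_eq)
    ultimately have "1 / 2 \<le> q ^ n" by (simp add: q_def)
    then show "ennreal (1 / 2) \<le> ennreal q ^ n"
      unfolding ennreal_power[OF less_imp_le[OF q(1)]] by (rule ennreal_leI)
    have "stay_prob (take n l @ drop n l) y \<le> stay_prob (take n l) y"
      by (rule stay_prob_append_le) (use l in simp)
    then show "stay_prob l y \<le> stay_prob (take n l) y" by simp
  qed auto
  note S = order_trans[OF B2 B1]
  have "1 - c * exp (- \<eta> * y) \<le> \<eta> * (1 / a\<^sub>0 + y)"
  proof -
    have "1 - \<eta> * y \<le> exp (- \<eta> * y)" using exp_ge_add_one_self[of "- \<eta> * y"] by simp
    then have "c * (1 - \<eta> * y) \<le> c * exp (- \<eta> * y)" by (intro mult_left_mono c)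
    moreover have "c * (\<eta> * y) \<le> 1 * (\<eta> * y)" using c \<eta> y by (intro mult_right_mono) auto
    ultimately show ?thesis by (simp add: c_def algebra_simps)
  qed
  then have "2 * real T * (1 - c * exp (- \<eta> * y)) \<le> 2 * real T * (\<eta> * (1 / a\<^sub>0 + y))"
    by (rule mult_left_mono) simp
  moreover have "(1 - c * exp (- \<eta> * y)) / (1 - q) = 2 * real T * (1 - c * exp (- \<eta> * y))"
    unfolding q(3) by simp
  ultimately have "(1 - c * exp (- \<eta> * y)) / (1 - q) \<le> 2 * real T * (\<eta> * (1 / a\<^sub>0 + y))"
    by simp
  with S have S2: "(\<Sum>n\<le>length l. ennreal (1/2) * stay_prob l y) \<le> ennreal (2 * real T * (\<eta> * (1 / a\<^sub>0 + y)))"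
    by (meson ennreal_leI order_trans)
  obtain p where p: "stay_prob l y = ennreal p" "0 \<le> p"
    using stay_prob_le_1[OF l(1), of y] by (metis ennreal_cases ennreal_one_neq_top top.extremum_unique)
  have "(\<Sum>n\<le>length l. ennreal (1/2) * stay_prob l y) = ennreal ((real T + 1) / 2 * p)"
  proof -
    have "ennreal (1 / 2) * ennreal p = ennreal (1 / 2 * p)" using p(2) by (subst ennreal_mult) auto
    then have "(\<Sum>n\<le>length l. ennreal (1/2) * stay_prob l y) = (\<Sum>n\<le>length l. ennreal (1 / 2 * p))" by (simp only: p(1))
    also have "\<dots> = ennreal (\<Sum>n\<le>length l. 1 / 2 * p)" using p(2) by (intro sum_ennreal) auto
    also have "(\<Sum>n\<le>length l. 1 / 2 * p) = (real T + 1) / 2 * p" by (simp add: T_def)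
    finally show ?thesis .
  qed
  with S2 have "ennreal ((real T + 1) / 2 * p) \<le> ennreal (2 * real T * (\<eta> * (1 / a\<^sub>0 + y)))" by simp
  then have "(real T + 1) / 2 * p \<le> 2 * real T * (\<eta> * (1 / a\<^sub>0 + y))"
    by (rule ennreal_le_iff[THEN iffD1, rotated]) (use \<eta> y in auto)
  moreover have "real T * p \<le> (real T + 1) * p" using p by (intro mult_right_mono) auto
  ultimately have "real T * p \<le> real T * (4 * \<eta> * (1 / a\<^sub>0 + y))" by (simp add: algebra_simps)
  then have "p \<le> 4 * \<eta> * (1 / a\<^sub>0 + y)" using T by (simp only: mult_le_cancel_left_pos)
  then show ?thesis unfolding p(1) by (rule ennreal_leI)
qed

text \<open>
  The same walk along a configuration \<open>x\<close>: a step is the difference of the entries in two slots.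
\<close>

fun stays_below :: "('i \<times> 'i) list \<Rightarrow> ('i \<Rightarrow> real) \<Rightarrow> real \<Rightarrow> bool" where
  "stays_below [] x y \<longleftrightarrow> True"
| "stays_below ((\<alpha>, \<beta>) # l) x y \<longleftrightarrow> x \<alpha> - x \<beta> \<le> y \<and> stays_below l x (y - x \<alpha> + x \<beta>)"

definition slots :: "('i \<times> 'i) list \<Rightarrow> 'i list" where
  "slots l = map fst l @ map snd l"

lemma stays_below_cong: "(\<And>k. k \<in> set (slots l) \<Longrightarrow> x k = x' k) \<Longrightarrow> stays_below l x y = stays_below l x' y"
  by (induction l x y rule: stays_below.induct) (auto simp: slots_def)

lemma stays_below_iff:
  "stays_below l x y \<longleftrightarrow> (\<forall>n\<le>length l. (\<Sum>(\<alpha>, \<beta>)\<leftarrow>take n l. x \<alpha> - x \<beta>) \<le> y \<or> n = 0)"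
proof (induction l arbitrary: y)
  case (Cons p l)
  obtain \<alpha> \<beta> where p: "p = (\<alpha>, \<beta>)" by fastforce
  show ?case unfolding p stays_below.simps Cons.IH
  proof (intro iffI allI impI conjI)
    fix n assume *: "x \<alpha> - x \<beta> \<le> y \<and> (\<forall>n\<le>length l. (\<Sum>(\<alpha>, \<beta>)\<leftarrow>take n l. x \<alpha> - x \<beta>) \<le> y - x \<alpha> + x \<beta> \<or> n = 0)"
      and n: "n \<le> length ((\<alpha>, \<beta>) # l)"
    show "(\<Sum>(\<alpha>, \<beta>)\<leftarrow>take n ((\<alpha>, \<beta>) # l). x \<alpha> - x \<beta>) \<le> y \<or> n = 0"
    proof (cases n)
      case (Suc m)
      then show ?thesis using *[THEN conjunct2, rule_format, of m] *[THEN conjunct1] n by (cases m) auto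
    qed simp
  next
    assume *: "\<forall>n\<le>length ((\<alpha>, \<beta>) # l). (\<Sum>(\<alpha>, \<beta>)\<leftarrow>take n ((\<alpha>, \<beta>) # l). x \<alpha> - x \<beta>) \<le> y \<or> n = 0"
    show "x \<alpha> - x \<beta> \<le> y" using *[rule_format, of 1] by simp
    fix n assume "n \<le> length l"
    then show "(\<Sum>(\<alpha>, \<beta>)\<leftarrow>take n l. x \<alpha> - x \<beta>) \<le> y - x \<alpha> + x \<beta> \<or> n = 0"
      using *[rule_format, of "Suc n"] by simp
  qed
qed simp

lemma measurable_stays_below:
  assumes "\<And>k. k \<in> set (slots l) \<Longrightarrow> (\<lambda>x. h x k) \<in> borel_measurable N" "f \<in> borel_measurable N"
  shows "(\<lambda>x. indicator {x. stays_below l (h x) (f x)} x :: ennreal) \<in> borel_measurable N"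
  using assms
proof (induction l arbitrary: f)
  case (Cons p l)
  obtain \<alpha> \<beta> where p: "p = (\<alpha>, \<beta>)" by fastforce
  have [measurable]: "(\<lambda>x. h x \<alpha>) \<in> borel_measurable N" "(\<lambda>x. h x \<beta>) \<in> borel_measurable N"
    "f \<in> borel_measurable N"
    using Cons.prems by (auto simp: p slots_def)
  have [measurable]: "(\<lambda>x. indicator {x. stays_below l (h x) (f x - h x \<alpha> + h x \<beta>)} x :: ennreal) \<in> borel_measurable N"
    by (rule Cons.IH) (use Cons.prems in \<open>auto simp: slots_def\<close>)
  have "(\<lambda>x. indicator {x. stays_below (p # l) (h x) (f x)} x :: ennreal) =
    (\<lambda>x. if h x \<alpha> - h x \<beta> \<le> f x then indicator {x. stays_below l (h x) (f x - h x \<alpha> + h x \<beta>)} x else 0)"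
    by (auto simp: p indicator_def)
  then show ?case by simp
qed simp

text \<open>
  If the slots of the walk are distinct, its steps are independent of each other and of anything
  that ignores these slots.
\<close>

lemma nn_integral_stays_below:
  fixes r :: "'i \<Rightarrow> real"
  assumes r: "\<And>k. 0 < r k" and l: "distinct (slots l)" "set (slots l) \<inter> L = {}" "finite L"
    and g: "g \<in> borel_measurable (PiM (set (slots l) \<union> L) (\<lambda>_. borel))" "g \<in> borel_measurable (PiM L (\<lambda>_. borel))"
    and ins: "\<And>x k u. k \<in> set (slots l) \<Longrightarrow> g (x(k := u)) = g x"
  shows "(\<integral>\<^sup>+x. indicator {x. stays_below l x y} x * g x \<partial>PiM (set (slots l) \<union> L) (\<lambda>k. expo (r k))) =
    stay_prob (map (\<lambda>(\<alpha>, \<beta>). (r \<alpha>, r \<beta>)) l) y * (\<integral>\<^sup>+x. g x \<partial>PiM L (\<lambda>k. expo (r k)))"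
  using l g ins
proof (induction l arbitrary: y)
  case Nil
  then show ?case by (simp add: slots_def)
next
  case (Cons p l)
  obtain \<alpha> \<beta> where p: "p = (\<alpha>, \<beta>)" by fastforce
  interpret product_prob_space "\<lambda>k. expo (r k)" "set (slots (p # l)) \<union> L"
    by (rule product_prob_space_expo[OF r])
  have pse: "prob_space (expo (r k))" for k by (rule prob_space_expo[OF r])
  let ?S = "set (slots l) \<union> L" and ?rr = "map (\<lambda>(\<alpha>, \<beta>). (r \<alpha>, r \<beta>)) l"
  have S: "set (slots (p # l)) \<union> L = insert \<beta> (insert \<alpha> ?S)" "finite ?S" "\<beta> \<notin> insert \<alpha> ?S" "\<alpha> \<notin> ?S"
    using Cons.prems by (auto simp: slots_def p)
  have gm: "g \<in> borel_measurable (PiM (insert \<beta> (insert \<alpha> ?S)) (\<lambda>_. borel))"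
    using Cons.prems(4) unfolding S(1) .
  have upd [simp]: "g (x(\<alpha> := u)) = g x" "g (x(\<beta> := u)) = g x" for x u
    by (rule Cons.prems(6); simp add: slots_def p)+
  \<comment> \<open>\<open>g\<close> ignores the two coordinates that are integrated out.\<close>
  have grid_dual: "g \<in> borel_measurable (PiM (insert \<alpha> ?S) (\<lambda>_. borel))" "g \<in> borel_measurable (PiM ?S (\<lambda>_. borel))"
  proof -
    have "(\<lambda>x. g (x(\<beta> := 0))) \<in> borel_measurable (PiM (insert \<alpha> ?S) (\<lambda>_. borel))"
      by (rule measurable_compose[OF _ gm]) (intro measurable_fun_upd[where J="insert \<alpha> ?S"]; auto)
    then show g1: "g \<in> borel_measurable (PiM (insert \<alpha> ?S) (\<lambda>_. borel))" by simp
    have "(\<lambda>x. g (x(\<alpha> := 0))) \<in> borel_measurable (PiM ?S (\<lambda>_. borel))"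
      by (rule measurable_compose[OF _ g1]) (intro measurable_fun_upd[where J="?S"]; auto)
    then show "g \<in> borel_measurable (PiM ?S (\<lambda>_. borel))" by simp
  qed
  have IH: "(\<integral>\<^sup>+x. indicator {x. stays_below l x y} x * g x \<partial>PiM ?S (\<lambda>k. expo (r k))) =
    stay_prob ?rr y * (\<integral>\<^sup>+x. g x \<partial>PiM L (\<lambda>k. expo (r k)))" for y
    by (rule Cons.IH) (use Cons.prems grid_dual in \<open>auto simp: slots_def\<close>)
  have m1: "(\<lambda>x. indicator {x. stays_below (p # l) x y} x * g x) \<in> borel_measurable (PiM (insert \<beta> (insert \<alpha> ?S)) (\<lambda>_. borel))"
  proof (intro borel_measurable_times_ennreal gm measurable_stays_below)
    fix k assume "k \<in> set (slots (p # l))"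
    then have "k \<in> insert \<beta> (insert \<alpha> ?S)" using S(1) by blast
    then show "(\<lambda>x. x k) \<in> borel_measurable (PiM (insert \<beta> (insert \<alpha> ?S)) (\<lambda>_. borel))"
      by (rule measurable_component_singleton)
  qed simp
  have "(\<integral>\<^sup>+x. indicator {x. stays_below (p # l) x y} x * g x \<partial>PiM (set (slots (p # l)) \<union> L) (\<lambda>k. expo (r k))) =
    (\<integral>\<^sup>+v. \<integral>\<^sup>+x. indicator {x. stays_below (p # l) x y} (x(\<beta> := v)) * g x \<partial>PiM (insert \<alpha> ?S) (\<lambda>k. expo (r k)) \<partial>expo (r \<beta>))"
    unfolding S(1) using S m1 by (subst product_nn_integral_insert_rev) auto
  also have "\<dots> = (\<integral>\<^sup>+v. \<integral>\<^sup>+u. \<integral>\<^sup>+x. indicator {x. stays_below (p # l) x y} (x(\<alpha> := u, \<beta> := v)) * g x \<partial>PiM ?S (\<lambda>k. expo (r k)) \<partial>expo (r \<alpha>) \<partial>expo (r \<beta>))"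
  proof (intro nn_integral_cong)
    fix v
    have "(\<lambda>x. indicator {x. stays_below (p # l) (x(\<beta> := v)) y} x :: ennreal) \<in> borel_measurable (PiM (insert \<alpha> ?S) (\<lambda>_. borel))"
    proof (rule measurable_stays_below)
      fix k assume "k \<in> set (slots (p # l))"
      then have k: "k \<in> insert \<beta> (insert \<alpha> ?S)" using S(1) by blast
      show "(\<lambda>x. (x(\<beta> := v)) k) \<in> borel_measurable (PiM (insert \<alpha> ?S) (\<lambda>_. borel))"
      proof (cases "k = \<beta>")
        case False
        then have "k \<in> insert \<alpha> ?S" using k by simp
        then have "(\<lambda>x. x k) \<in> borel_measurable (PiM (insert \<alpha> ?S) (\<lambda>_. borel :: real measure))"
          by (rule measurable_component_singleton)
        then show ?thesis using False by simp
      qed simp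
    qed simp
    then have m2: "(\<lambda>x. indicator {x. stays_below (p # l) x y} (x(\<beta> := v)) * g x) \<in> borel_measurable (PiM (insert \<alpha> ?S) (\<lambda>_. borel))"
      using grid_dual(1) by (intro borel_measurable_times_ennreal) (auto simp: indicator_def)
    show "(\<integral>\<^sup>+x. indicator {x. stays_below (p # l) x y} (x(\<beta> := v)) * g x \<partial>PiM (insert \<alpha> ?S) (\<lambda>k. expo (r k))) =
      (\<integral>\<^sup>+u. \<integral>\<^sup>+x. indicator {x. stays_below (p # l) x y} (x(\<alpha> := u, \<beta> := v)) * g x \<partial>PiM ?S (\<lambda>k. expo (r k)) \<partial>expo (r \<alpha>))"
      using S m2 by (subst product_nn_integral_insert_rev) auto
  qed
  also have "\<dots> = (\<integral>\<^sup>+v. \<integral>\<^sup>+u. indicator {..y} (u - v) * stay_prob ?rr (y - u + v) * (\<integral>\<^sup>+x. g x \<partial>PiM L (\<lambda>k. expo (r k))) \<partial>expo (r \<alpha>) \<partial>expo (r \<beta>))"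
  proof (intro nn_integral_cong)
    fix v u
    have "(\<integral>\<^sup>+x. indicator {x. stays_below (p # l) x y} (x(\<alpha> := u, \<beta> := v)) * g x \<partial>PiM ?S (\<lambda>k. expo (r k))) =
      (\<integral>\<^sup>+x. indicator {..y} (u - v) * (indicator {x. stays_below l x (y - u + v)} x * g x) \<partial>PiM ?S (\<lambda>k. expo (r k)))"
    proof (intro nn_integral_cong)
      fix x
      have "stays_below l (x(\<alpha> := u, \<beta> := v)) z = stays_below l x z" for z
        by (rule stays_below_cong) (use S in auto)
      moreover have "\<alpha> \<noteq> \<beta>" using S by auto
      ultimately show "indicator {x. stays_below (p # l) x y} (x(\<alpha> := u, \<beta> := v)) * g x = indicator {..y} (u - v) * (indicator {x. stays_below l x (y - u + v)} x * g x)"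
        by (auto simp: indicator_def p)
    qed
    also have "\<dots> = indicator {..y} (u - v) * (stay_prob ?rr (y - u + v) * (\<integral>\<^sup>+x. g x \<partial>PiM L (\<lambda>k. expo (r k))))"
      unfolding IH[symmetric]
    proof (rule nn_integral_cmult)
      have "(\<lambda>x. indicator {x. stays_below l x (y - u + v)} x * g x) \<in> borel_measurable (PiM ?S (\<lambda>_. borel))"
        by (intro borel_measurable_times_ennreal grid_dual measurable_stays_below) auto
      then show "(\<lambda>x. indicator {x. stays_below l x (y - u + v)} x * g x) \<in> borel_measurable (PiM ?S (\<lambda>k. expo (r k)))" by simp
    qed
    finally show "(\<integral>\<^sup>+x. indicator {x. stays_below (p # l) x y} (x(\<alpha> := u, \<beta> := v)) * g x \<partial>PiM ?S (\<lambda>k. expo (r k))) =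
      indicator {..y} (u - v) * stay_prob ?rr (y - u + v) * (\<integral>\<^sup>+x. g x \<partial>PiM L (\<lambda>k. expo (r k)))" by (simp add: mult.assoc)
  qed
  also have "\<dots> = (\<integral>\<^sup>+v. (\<integral>\<^sup>+u. indicator {..y} (u - v) * stay_prob ?rr (y - u + v) \<partial>expo (r \<alpha>)) * (\<integral>\<^sup>+x. g x \<partial>PiM L (\<lambda>k. expo (r k))) \<partial>expo (r \<beta>))"
  proof (intro nn_integral_cong nn_integral_multc)
    fix v
    have "pos_rates ?rr" using r by (auto simp: pos_rates.simps)
    then show "(\<lambda>u. indicator {..y} (u - v) * stay_prob ?rr (y - u + v)) \<in> borel_measurable (expo (r \<alpha>))"
      using measurable_stay_integrand by simp
  qed
  also have "\<dots> = stay_prob (map (\<lambda>(\<alpha>, \<beta>). (r \<alpha>, r \<beta>)) (p # l)) y * (\<integral>\<^sup>+x. g x \<partial>PiM L (\<lambda>k. expo (r k)))"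
  proof -
    interpret A: prob_space "expo (r \<alpha>)" by (rule pse)
    have pr: "pos_rates ?rr" using r by (auto simp: pos_rates.simps)
    have [measurable]: "stay_prob ?rr \<in> borel_measurable borel" by (rule measurable_stay_prob[OF pr])
    have "(\<lambda>v. \<integral>\<^sup>+u. indicator {..y} (u - v) * stay_prob ?rr (y - u + v) \<partial>expo (r \<alpha>)) =
      (\<lambda>v. \<integral>\<^sup>+u. (if u - v \<le> y then stay_prob ?rr (y - u + v) else 0) \<partial>expo (r \<alpha>))"
      by (intro ext nn_integral_cong) (auto simp: indicator_def)
    also have "\<dots> \<in> borel_measurable borel" by measurable
    finally show ?thesis by (subst nn_integral_multc) (simp_all add: p)
  qed
  finally show ?case .
qed

lemma nn_integral_expo_id:
  assumes "0 < r"
  shows "(\<integral>\<^sup>+y. ennreal y \<partial>expo r) = ennreal (1 / r)"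
proof -
  have "(\<integral>\<^sup>+y. ennreal y \<partial>expo r) = (\<integral>\<^sup>+y. ennreal (exponential_density r y) * ennreal y \<partial>lborel)"
    by (rule nn_integral_expo) simp
  also have "\<dots> = (\<integral>\<^sup>+y. ennreal (exponential_density r y * y ^ 1) \<partial>lborel)"
    by (intro nn_integral_cong) (use assms in \<open>auto simp: exponential_density_def ennreal_mult\<close>)
  also have "\<dots> = ennreal (1 / r)"
    using nn_integral_erlang_ith_moment[OF assms, of 0 1] by simp
  finally show ?thesis .
qed

lemma sets_stays_below:
  assumes "\<And>k. k \<in> set (slots l) \<Longrightarrow> X k \<in> borel_measurable M" "f \<in> borel_measurable M"
  shows "{\<omega> \<in> space M. stays_below l (\<lambda>k. X k \<omega>) (f \<omega>)} \<in> sets M"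
proof -
  have "(\<lambda>\<omega>. indicator {\<omega>. stays_below l (\<lambda>k. X k \<omega>) (f \<omega>)} \<omega> :: ennreal) \<in> borel_measurable M"
    by (rule measurable_stays_below) (use assms in auto)
  then have "(\<lambda>\<omega>. indicator {\<omega>. stays_below l (\<lambda>k. X k \<omega>) (f \<omega>)} \<omega> :: ennreal) -` {1} \<inter> space M \<in> sets M"
    by (rule measurable_sets) simp
  also have "(\<lambda>\<omega>. indicator {\<omega>. stays_below l (\<lambda>k. X k \<omega>) (f \<omega>)} \<omega> :: ennreal) -` {1} \<inter> space M =
    {\<omega> \<in> space M. stays_below l (\<lambda>k. X k \<omega>) (f \<omega>)}"
    by (auto simp: indicator_def)
  finally show ?thesis .
qed

text \<open>
  The second walk starts from the random level \<open>X \<gamma>\<close>. Conditionally on it the walks are independent,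
  each bound is linear in its level, and the mean of \<open>X \<gamma>\<close> is \<open>1 / r \<gamma>\<close>.
\<close>

lemma two_walks_bound:
  fixes r :: "'i \<Rightarrow> real" and \<eta> a\<^sub>0 :: real
  assumes X: "exp_family M K r X"
    and d: "distinct (slots l\<^sub>1 @ \<gamma> # slots l\<^sub>2)" "set (slots l\<^sub>1 @ \<gamma> # slots l\<^sub>2) \<subseteq> K"
    and ne: "l\<^sub>1 \<noteq> []" "l\<^sub>2 \<noteq> []" and \<eta>: "0 < \<eta>" "\<eta> < a\<^sub>0"
    and rates: "\<And>\<alpha> \<beta>. (\<alpha>, \<beta>) \<in> set l\<^sub>1 \<Longrightarrow> a\<^sub>0 \<le> r \<alpha> \<and> (r \<alpha> - r \<beta>) * \<eta> + r \<alpha> * r \<beta> / (2 * length l\<^sub>1) \<le> \<eta>\<^sup>2"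
      "\<And>\<alpha> \<beta>. (\<alpha>, \<beta>) \<in> set l\<^sub>2 \<Longrightarrow> a\<^sub>0 \<le> r \<alpha> \<and> (r \<alpha> - r \<beta>) * \<eta> + r \<alpha> * r \<beta> / (2 * length l\<^sub>2) \<le> \<eta>\<^sup>2"
    and len: "a\<^sub>0 \<le> 2 * length l\<^sub>1 * \<eta>" "a\<^sub>0 \<le> 2 * length l\<^sub>2 * \<eta>"
  shows "emeasure M {\<omega> \<in> space M. stays_below l\<^sub>1 (\<lambda>k. X k \<omega>) 0 \<and> stays_below l\<^sub>2 (\<lambda>k. X k \<omega>) (X \<gamma> \<omega>)}
    \<le> ennreal (16 * \<eta>\<^sup>2 / a\<^sub>0 * (1 / a\<^sub>0 + 1 / r \<gamma>))"
proof -
  define L where "L = insert \<gamma> (set (slots l\<^sub>2))"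
  define J where "J = set (slots l\<^sub>1) \<union> L"
  have J: "J \<subseteq> K" "finite J" "finite L" using d by (auto simp: J_def L_def)
  define r' where "r' = (\<lambda>k. if k \<in> K then r k else 1)"
  have XJ: "exp_family M J r' X"
    by (rule exp_family_cong[OF exp_family_subset[OF X J(1)]]) (use J in \<open>auto simp: r'_def\<close>)
  note D = exp_familyD[OF X]
  have r': "0 < r' k" for k using D(3) by (auto simp: r'_def)
  have r'k: "r' k = r k" if "k \<in> J" for k using that J by (auto simp: r'_def)
  interpret product_prob_space "\<lambda>k. expo (r' k)" J by (rule product_prob_space_expo[OF r'])
  let ?S = "{\<omega> \<in> space M. stays_below l\<^sub>1 (\<lambda>k. X k \<omega>) 0 \<and> stays_below l\<^sub>2 (\<lambda>k. X k \<omega>) (X \<gamma> \<omega>)}"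
  have JK: "k \<in> K" if "k \<in> J" for k using that J by auto
  have S: "?S = {\<omega> \<in> space M. stays_below l\<^sub>1 (\<lambda>k. X k \<omega>) 0} \<inter> {\<omega> \<in> space M. stays_below l\<^sub>2 (\<lambda>k. X k \<omega>) (X \<gamma> \<omega>)}" by auto
  have [measurable]: "?S \<in> sets M"
    unfolding S by (intro sets.Int sets_stays_below D(4) JK) (auto simp: J_def L_def)
  define g :: "('i \<Rightarrow> real) \<Rightarrow> ennreal" where "g = (\<lambda>x. indicator {x. stays_below l\<^sub>2 x (x \<gamma>)} x)"
  have gm: "g \<in> borel_measurable (PiM H (\<lambda>_. borel))" if "L \<subseteq> H" for H
    unfolding g_def by (rule measurable_stays_below) (use that in \<open>auto simp: L_def intro!: measurable_component_singleton\<close>)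
  have pr: "pos_rates (map (\<lambda>(\<alpha>, \<beta>). (r' \<alpha>, r' \<beta>)) l)" for l using r' by (auto simp: pos_rates.simps)
  have m0: "(\<lambda>x. indicator {x. stays_below l\<^sub>1 x 0} x * g x) \<in> borel_measurable (PiM J (\<lambda>_. borel))"
    by (intro borel_measurable_times_ennreal gm measurable_stays_below) (auto simp: J_def intro!: measurable_component_singleton)
  have "emeasure M ?S = (\<integral>\<^sup>+\<omega>. indicator ?S \<omega> \<partial>M)" by simp
  also have "\<dots> = (\<integral>\<^sup>+\<omega>. (\<lambda>x. indicator {x. stays_below l\<^sub>1 x 0} x * g x) (\<lambda>k\<in>J. X k \<omega>) \<partial>M)"
  proof (intro nn_integral_cong)
    fix \<omega> assume "\<omega> \<in> space M"
    moreover have "stays_below l\<^sub>1 (\<lambda>k\<in>J. X k \<omega>) 0 = stays_below l\<^sub>1 (\<lambda>k. X k \<omega>) 0"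
      by (rule stays_below_cong) (auto simp: J_def)
    moreover have "stays_below l\<^sub>2 (\<lambda>k\<in>J. X k \<omega>) y = stays_below l\<^sub>2 (\<lambda>k. X k \<omega>) y" for y
      by (rule stays_below_cong) (auto simp: J_def L_def)
    moreover have "\<gamma> \<in> J" by (simp add: J_def L_def)
    ultimately show "indicator ?S \<omega> = (\<lambda>x. indicator {x. stays_below l\<^sub>1 x 0} x * g x) (\<lambda>k\<in>J. X k \<omega>)"
      by (auto simp: indicator_def g_def)
  qed
  also have "\<dots> = (\<integral>\<^sup>+x. indicator {x. stays_below l\<^sub>1 x 0} x * g x \<partial>PiM J (\<lambda>k. expo (r' k)))"
    by (rule exp_family_nn_integral[OF XJ m0])
  also have "\<dots> = stay_prob (map (\<lambda>(\<alpha>, \<beta>). (r' \<alpha>, r' \<beta>)) l\<^sub>1) 0 * (\<integral>\<^sup>+x. g x \<partial>PiM L (\<lambda>k. expo (r' k)))"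
    unfolding J_def
  proof (rule nn_integral_stays_below[OF r'])
    fix x k u assume k: "k \<in> set (slots l\<^sub>1)"
    have "stays_below l\<^sub>2 (x(k := u)) y = stays_below l\<^sub>2 x y" for y
      by (rule stays_below_cong) (use k d in auto)
    moreover have "k \<noteq> \<gamma>" using k d by auto
    ultimately show "g (x(k := u)) = g x" by (simp add: g_def indicator_def)
  qed (use d in \<open>auto simp: L_def intro!: gm\<close>)
  also have "(\<integral>\<^sup>+x. g x \<partial>PiM L (\<lambda>k. expo (r' k))) =
    (\<integral>\<^sup>+y. stay_prob (map (\<lambda>(\<alpha>, \<beta>). (r' \<alpha>, r' \<beta>)) l\<^sub>2) y \<partial>expo (r' \<gamma>))"
  proof -
    have "(\<integral>\<^sup>+x. g x \<partial>PiM L (\<lambda>k. expo (r' k))) =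
      (\<integral>\<^sup>+y. \<integral>\<^sup>+x. g (x(\<gamma> := y)) \<partial>PiM (set (slots l\<^sub>2)) (\<lambda>k. expo (r' k)) \<partial>expo (r' \<gamma>))"
      unfolding L_def using d gm[of L] by (subst product_nn_integral_insert_rev) (auto simp: L_def)
    also have "\<dots> = (\<integral>\<^sup>+y. \<integral>\<^sup>+x. indicator {x. stays_below l\<^sub>2 x y} x * 1 \<partial>PiM (set (slots l\<^sub>2) \<union> {}) (\<lambda>k. expo (r' k)) \<partial>expo (r' \<gamma>))"
    proof (intro nn_integral_cong)
      fix x y
      have "stays_below l\<^sub>2 (x(\<gamma> := y)) y = stays_below l\<^sub>2 x y" by (rule stays_below_cong) (use d in auto)
      then have "g (x(\<gamma> := y)) = indicator {x. stays_below l\<^sub>2 x y} x * 1" by (simp add: g_def indicator_def)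
      then show "(\<integral>\<^sup>+x. g (x(\<gamma> := y)) \<partial>PiM (set (slots l\<^sub>2)) (\<lambda>k. expo (r' k))) =
        (\<integral>\<^sup>+x. indicator {x. stays_below l\<^sub>2 x y} x * 1 \<partial>PiM (set (slots l\<^sub>2) \<union> {}) (\<lambda>k. expo (r' k)))"
      proof -
        have "g (x(\<gamma> := y)) = indicator {x. stays_below l\<^sub>2 x y} x * 1" for x
        proof -
          have "stays_below l\<^sub>2 (x(\<gamma> := y)) y = stays_below l\<^sub>2 x y" by (rule stays_below_cong) (use d in auto)
          then show ?thesis by (simp add: g_def indicator_def)
        qed
        then show ?thesis by simp
      qed
    qed
    also have "\<dots> = (\<integral>\<^sup>+y. stay_prob (map (\<lambda>(\<alpha>, \<beta>). (r' \<alpha>, r' \<beta>)) l\<^sub>2) y \<partial>expo (r' \<gamma>))"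
    proof (rule nn_integral_cong)
      fix y
      have "prob_space (PiM {} (\<lambda>k. expo (r' k)))" by (intro prob_space_PiM prob_space_expo r')
      then have one: "(\<integral>\<^sup>+x. 1 \<partial>PiM {} (\<lambda>k. expo (r' k))) = 1"
        by (simp add: prob_space.emeasure_space_1)
      show "(\<integral>\<^sup>+x. indicator {x. stays_below l\<^sub>2 x y} x * 1 \<partial>PiM (set (slots l\<^sub>2) \<union> {}) (\<lambda>k. expo (r' k))) =
        stay_prob (map (\<lambda>(\<alpha>, \<beta>). (r' \<alpha>, r' \<beta>)) l\<^sub>2) y"
      proof -
        have "(\<integral>\<^sup>+x. indicator {x. stays_below l\<^sub>2 x y} x * 1 \<partial>PiM (set (slots l\<^sub>2) \<union> {}) (\<lambda>k. expo (r' k))) =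
          stay_prob (map (\<lambda>(\<alpha>, \<beta>). (r' \<alpha>, r' \<beta>)) l\<^sub>2) y * (\<integral>\<^sup>+x. 1 \<partial>PiM {} (\<lambda>k. expo (r' k)))"
        proof (rule nn_integral_stays_below[OF r'])
          show "distinct (slots l\<^sub>2)" using d(1) by simp
        qed simp_all
        then show ?thesis unfolding one mult_1_right .
      qed
    qed
    finally show ?thesis .
  qed
  also have "stay_prob (map (\<lambda>(\<alpha>, \<beta>). (r' \<alpha>, r' \<beta>)) l\<^sub>1) 0 \<le> ennreal (4 * \<eta> * (1 / a\<^sub>0 + 0))"
  proof (rule stay_prob_bound[OF pr _ \<eta>])
    fix a b assume "(a, b) \<in> set (map (\<lambda>(\<alpha>, \<beta>). (r' \<alpha>, r' \<beta>)) l\<^sub>1)"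
    then obtain \<alpha> \<beta> where ab: "(\<alpha>, \<beta>) \<in> set l\<^sub>1" "a = r' \<alpha>" "b = r' \<beta>" by auto
    then have "\<alpha> \<in> J" "\<beta> \<in> J" by (auto simp: J_def slots_def intro: rev_image_eqI)
    then show "a\<^sub>0 \<le> a \<and> (a - b) * \<eta> + a * b / real (2 * length (map (\<lambda>(\<alpha>, \<beta>). (r' \<alpha>, r' \<beta>)) l\<^sub>1)) \<le> \<eta>\<^sup>2"
      using rates(1)[OF ab(1)] by (simp add: ab(2,3) r'k)
  qed (use ne len in auto)
  also have "(\<integral>\<^sup>+y. stay_prob (map (\<lambda>(\<alpha>, \<beta>). (r' \<alpha>, r' \<beta>)) l\<^sub>2) y \<partial>expo (r' \<gamma>)) \<le>
    ennreal (4 * \<eta> * (1 / a\<^sub>0 + 1 / r \<gamma>))"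
  proof -
    have "(\<integral>\<^sup>+y. stay_prob (map (\<lambda>(\<alpha>, \<beta>). (r' \<alpha>, r' \<beta>)) l\<^sub>2) y \<partial>expo (r' \<gamma>)) \<le>
      (\<integral>\<^sup>+y. ennreal (4 * \<eta> / a\<^sub>0) + ennreal (4 * \<eta>) * ennreal y \<partial>expo (r' \<gamma>))"
    proof (rule nn_integral_mono_AE)
      have "AE y in expo (r' \<gamma>). 0 \<le> y"
        unfolding expo_def by (subst AE_density) (auto simp: exponential_density_def)
      then show "AE y in expo (r' \<gamma>). stay_prob (map (\<lambda>(\<alpha>, \<beta>). (r' \<alpha>, r' \<beta>)) l\<^sub>2) y \<le> ennreal (4 * \<eta> / a\<^sub>0) + ennreal (4 * \<eta>) * ennreal y"
      proof eventually_elim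
        case (elim y)
        have "stay_prob (map (\<lambda>(\<alpha>, \<beta>). (r' \<alpha>, r' \<beta>)) l\<^sub>2) y \<le> ennreal (4 * \<eta> * (1 / a\<^sub>0 + y))"
        proof (rule stay_prob_bound[OF pr _ \<eta>])
          fix a b assume "(a, b) \<in> set (map (\<lambda>(\<alpha>, \<beta>). (r' \<alpha>, r' \<beta>)) l\<^sub>2)"
          then obtain \<alpha> \<beta> where ab: "(\<alpha>, \<beta>) \<in> set l\<^sub>2" "a = r' \<alpha>" "b = r' \<beta>" by auto
          then have "\<alpha> \<in> J" "\<beta> \<in> J" by (auto simp: J_def L_def slots_def intro: rev_image_eqI)
          then show "a\<^sub>0 \<le> a \<and> (a - b) * \<eta> + a * b / real (2 * length (map (\<lambda>(\<alpha>, \<beta>). (r' \<alpha>, r' \<beta>)) l\<^sub>2)) \<le> \<eta>\<^sup>2"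
            using rates(2)[OF ab(1)] by (simp add: ab(2,3) r'k)
        qed (use ne len elim in auto)
        also have "4 * \<eta> * (1 / a\<^sub>0 + y) = 4 * \<eta> / a\<^sub>0 + 4 * \<eta> * y" by (simp add: algebra_simps)
        also have "ennreal \<dots> = ennreal (4 * \<eta> / a\<^sub>0) + ennreal (4 * \<eta>) * ennreal y"
          using \<eta> elim by (simp add: ennreal_mult)
        finally show ?case .
      qed
    qed
    also have "\<dots> = ennreal (4 * \<eta> / a\<^sub>0) + ennreal (4 * \<eta>) * ennreal (1 / r' \<gamma>)"
    proof -
      have "(\<integral>\<^sup>+y. ennreal (4 * \<eta>) * ennreal y \<partial>expo (r' \<gamma>)) = ennreal (4 * \<eta>) * ennreal (1 / r' \<gamma>)"
        by (subst nn_integral_cmult) (simp_all add: nn_integral_expo_id[OF r'])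
      then show ?thesis by (subst nn_integral_add) (simp_all add: prob_space.emeasure_space_1[OF prob_space_expo[OF r'], simplified])
    qed
    also have "\<dots> = ennreal (4 * \<eta> * (1 / a\<^sub>0 + 1 / r' \<gamma>))"
    proof -
      have "ennreal (4 * \<eta>) * ennreal (1 / r' \<gamma>) = ennreal (4 * \<eta> * (1 / r' \<gamma>))"
        using \<eta> r'[of \<gamma>] by (intro ennreal_mult[symmetric]) auto
      moreover have "ennreal (4 * \<eta> / a\<^sub>0) + ennreal (4 * \<eta> * (1 / r' \<gamma>)) = ennreal (4 * \<eta> / a\<^sub>0 + 4 * \<eta> * (1 / r' \<gamma>))"
        using \<eta> r'[of \<gamma>] by (intro ennreal_plus[symmetric]) auto
      ultimately show ?thesis by (simp add: distrib_left)
    qed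
    finally show ?thesis using r'k[of \<gamma>] by (simp add: J_def L_def)
  qed
  finally have "emeasure M ?S \<le> ennreal (4 * \<eta> * (1 / a\<^sub>0 + 0)) * ennreal (4 * \<eta> * (1 / a\<^sub>0 + 1 / r \<gamma>))"
    by (simp add: mult_mono)
  also have "\<dots> = ennreal ((4 * \<eta> * (1 / a\<^sub>0 + 0)) * (4 * \<eta> * (1 / a\<^sub>0 + 1 / r \<gamma>)))"
    using \<eta> D(3)[of \<gamma>] d by (intro ennreal_mult[symmetric]) (auto intro!: mult_nonneg_nonneg add_nonneg_nonneg)
  also have "(4 * \<eta> * (1 / a\<^sub>0 + 0)) * (4 * \<eta> * (1 / a\<^sub>0 + 1 / r \<gamma>)) = 16 * \<eta>\<^sup>2 / a\<^sub>0 * (1 / a\<^sub>0 + 1 / r \<gamma>)"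
    by (simp add: power2_eq_square)
  finally show ?thesis .
qed

section \<open>Passage times with boundary weights\<close>

lemma lpp_corner:
  assumes "x \<le> y - e1" "x \<le> y - e2"
  shows "lpp w x y = w y + max (lpp w x (y - e1)) (lpp w x (y - e2))"
proof -
  obtain s where s: "s \<in> {e1, e2}" "x \<le> y - s" "lpp w x y = lpp w x (y - s) + w y"
    by (rule lpp_last_step[of x y w]) (use assms in \<open>auto simp: le_prod_iff e1_def e2_def\<close>)
  show ?thesis
    using s lpp_last_step_ge[of e1 x y w] lpp_last_step_ge[of e2 x y w] assms by auto
qed

lemma lpp_row:
  assumes "snd x = snd y" "fst x < fst y"
  shows "lpp w x y = lpp w x (y - e1) + w y"
proof -
  obtain s where s: "s \<in> {e1, e2}" "x \<le> y - s" "lpp w x y = lpp w x (y - s) + w y"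
    by (rule lpp_last_step[of x y w]) (use assms in \<open>auto simp: le_prod_iff\<close>)
  then show ?thesis using assms by (auto simp: le_prod_iff e2_def)
qed

lemma lpp_column:
  assumes "fst x = fst y" "snd x < snd y"
  shows "lpp w x y = lpp w x (y - e2) + w y"
proof -
  obtain s where s: "s \<in> {e1, e2}" "x \<le> y - s" "lpp w x y = lpp w x (y - s) + w y"
    by (rule lpp_last_step[of x y w]) (use assms in \<open>auto simp: le_prod_iff\<close>)
  then show ?thesis using assms by (auto simp: le_prod_iff e1_def)
qed

text \<open>
  The weights of a stationary model on the quadrant. The origin gets weight 0, so that the
  passage time from the origin is the maximum over all exits.
\<close>

definition grid_weights :: "(nat \<Rightarrow> real) \<Rightarrow> (nat \<Rightarrow> real) \<Rightarrow> (nat \<Rightarrow> nat \<Rightarrow> real) \<Rightarrow> int \<times> int \<Rightarrow> real" where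
  "grid_weights H V Om z = (if fst z \<ge> 1 \<and> snd z \<ge> 1 then Om (nat (fst z)) (nat (snd z))
     else if fst z \<ge> 1 \<and> snd z = 0 then H (nat (fst z))
     else if fst z = 0 \<and> snd z \<ge> 1 then V (nat (snd z)) else 0)"

lemma grid_weights_cong:
  assumes "z \<le> (int m, int n)" "\<And>i. 1 \<le> i \<Longrightarrow> i \<le> m \<Longrightarrow> H i = H' i" "\<And>j. 1 \<le> j \<Longrightarrow> j \<le> n \<Longrightarrow> V j = V' j"
    "\<And>i j. 1 \<le> i \<Longrightarrow> i \<le> m \<Longrightarrow> 1 \<le> j \<Longrightarrow> j \<le> n \<Longrightarrow> Om i j = Om' i j"
  shows "grid_weights H V Om z = grid_weights H' V' Om' z"
proof -
  have "nat (fst z) \<le> m" "nat (snd z) \<le> n" using assms(1) by (auto simp: le_prod_iff)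
  then show ?thesis unfolding grid_weights_def using assms(2)[of "nat (fst z)"] assms(3)[of "nat (snd z)"]
      assms(4)[of "nat (fst z)" "nat (snd z)"] by (auto simp: Suc_le_eq)
qed

definition corner_passage :: "(nat \<Rightarrow> real) \<Rightarrow> (nat \<Rightarrow> real) \<Rightarrow> (nat \<Rightarrow> nat \<Rightarrow> real) \<Rightarrow> nat \<Rightarrow> nat \<Rightarrow> real" where
  "corner_passage H V Om i j = lpp (grid_weights H V Om) 0 (int i, int j)"

lemma corner_passage_rec:
  "corner_passage H V Om 0 0 = 0"
  "corner_passage H V Om (Suc i) 0 = corner_passage H V Om i 0 + H (Suc i)"
  "corner_passage H V Om 0 (Suc j) = corner_passage H V Om 0 j + V (Suc j)"
  "corner_passage H V Om (Suc i) (Suc j) = Om (Suc i) (Suc j) + max (corner_passage H V Om i (Suc j)) (corner_passage H V Om (Suc i) j)"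
proof -
  have d: "(int (Suc i), y) - e1 = (int i, y)" "(y, int (Suc j)) - e2 = (y, int j)" for i j y
    by (simp_all add: e1_def e2_def)
  show "corner_passage H V Om 0 0 = 0" by (simp add: corner_passage_def grid_weights_def flip: zero_prod_def)
  show "corner_passage H V Om (Suc i) 0 = corner_passage H V Om i 0 + H (Suc i)"
    using lpp_row[of 0 "(int (Suc i), 0)" "grid_weights H V Om"] unfolding d
    by (simp add: corner_passage_def grid_weights_def nat_add_distrib)
  show "corner_passage H V Om 0 (Suc j) = corner_passage H V Om 0 j + V (Suc j)"
    using lpp_column[of 0 "(0, int (Suc j))" "grid_weights H V Om"] unfolding d
    by (simp add: corner_passage_def grid_weights_def nat_add_distrib)
  show "corner_passage H V Om (Suc i) (Suc j) = Om (Suc i) (Suc j) + max (corner_passage H V Om i (Suc j)) (corner_passage H V Om (Suc i) j)"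
    using lpp_corner[of 0 "(int (Suc i), int (Suc j))" "grid_weights H V Om"] unfolding d
    by (simp add: corner_passage_def grid_weights_def le_prod_iff nat_add_distrib)
qed

lemma corner_passage_increments:
  shows grid_v_eq: "1 \<le> j \<Longrightarrow> grid_v H V Om i j = corner_passage H V Om i j - corner_passage H V Om i (j - 1)"
    and grid_h_eq: "1 \<le> i \<Longrightarrow> grid_h H V Om i j = corner_passage H V Om i j - corner_passage H V Om (i - 1) j"
proof -
  have *: "(\<forall>j. grid_v H V Om i (Suc j) = corner_passage H V Om i (Suc j) - corner_passage H V Om i j) \<and>
     (\<forall>j. column_h (H (Suc i)) (grid_v H V Om i) (Om (Suc i)) j = corner_passage H V Om (Suc i) j - corner_passage H V Om i j)" for i
  proof (induction i)
    case 0
    have "column_h (H (Suc 0)) V (Om (Suc 0)) j = corner_passage H V Om (Suc 0) j - corner_passage H V Om 0 j" for j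
      by (induction j) (auto simp: corner_passage_rec max_def)
    then show ?case by (auto simp: corner_passage_rec)
  next
    case (Suc i)
    have v: "grid_v H V Om (Suc i) (Suc j) = corner_passage H V Om (Suc i) (Suc j) - corner_passage H V Om (Suc i) j" for j
      using Suc by (simp add: column_v_def corner_passage_rec max_def)
    have "column_h (H (Suc (Suc i))) (grid_v H V Om (Suc i)) (Om (Suc (Suc i))) j = corner_passage H V Om (Suc (Suc i)) j - corner_passage H V Om (Suc i) j" for j
    proof (induction j)
      case 0
      show ?case by (simp add: corner_passage_rec(2)[of H V Om "Suc i"])
    next
      case (Suc j)
      have "corner_passage H V Om (Suc (Suc i)) (Suc j) = Om (Suc (Suc i)) (Suc j) + max (corner_passage H V Om (Suc i) (Suc j)) (corner_passage H V Om (Suc (Suc i)) j)"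
        by (rule corner_passage_rec)
      then show ?case unfolding column_h.simps Suc v by (simp add: max_def)
    qed
    then show ?case using v by auto
  qed
  show "1 \<le> j \<Longrightarrow> grid_v H V Om i j = corner_passage H V Om i j - corner_passage H V Om i (j - 1)"
    using * by (cases j) auto
  show "1 \<le> i \<Longrightarrow> grid_h H V Om i j = corner_passage H V Om i j - corner_passage H V Om (i - 1) j"
    using * by (cases i) (auto simp: grid_h_def)
qed

text \<open>
  Going first along the bottom and then up the right side writes the passage time as a sum in
  which, for a stationary boundary, the second part consists of independent exponentials.
\<close>

lemma corner_passage_boundary_sum:
  "corner_passage H V Om m n = (\<Sum>i=1..m. H i) + (\<Sum>j=1..n. grid_v H V Om m j)"
proof -
  have "corner_passage H V Om m 0 = (\<Sum>i=1..m. H i)"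
    by (induction m) (auto simp: corner_passage_rec)
  moreover have "corner_passage H V Om m n - corner_passage H V Om m 0 = (\<Sum>j=1..n. grid_v H V Om m j)"
    by (induction n) (auto simp: grid_v_eq)
  ultimately show ?thesis by simp
qed

section \<open>Exit values\<close>

lemma exit_points_swap: "k \<in> exit_points (prod.swap y) \<longleftrightarrow> - k \<in> exit_points y"
  by (auto simp: exit_points_def image_iff)

lemma exit_value_swap:
  assumes "y \<in> pos_quadrant" "k \<in> exit_points y"
  shows "exit_value (\<lambda>z. w (prod.swap z)) (prod.swap y) (- k) = exit_value w y k"
proof (cases "0 < k")
  case True
  have "lpp (\<lambda>z. w (prod.swap z)) (1, k) (prod.swap y) = lpp w (k, 1) y"
    using lpp_swap[of "(1, k)" "prod.swap y" w] assms True
    by (auto simp: le_prod_iff exit_points_def pos_quadrant_def)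
  then show ?thesis using True by (simp add: exit_value_def)
next
  case False
  have "lpp (\<lambda>z. w (prod.swap z)) (- k, 1) (prod.swap y) = lpp w (1, - k) y"
    using lpp_swap[of "(- k, 1)" "prod.swap y" w] assms False
    by (auto simp: le_prod_iff exit_points_def pos_quadrant_def)
  then show ?thesis using False assms by (auto simp: exit_value_def exit_points_def)
qed

lemma horizontal_exit_le:
  assumes "i \<le> k" "k \<le> fst y" "1 \<le> snd y"
  shows "(\<Sum>t=i..k. w (t, 0)) + lpp w (k, 1) y \<le> lpp w (i, 0) y"
  using assms(1)
proof (induction "nat (k - i)" arbitrary: i)
  case 0
  then have "i = k" by simp
  then show ?case using lpp_first_step_ge[of e2 "(k, 0)" y w] assms
    by (auto simp: e2_def le_prod_iff)
next
  case (Suc d)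
  then have ik: "i < k" by simp
  then have "{i..k} = insert i {i+1..k}" by auto
  then have "(\<Sum>t=i..k. w (t, 0)) = w (i, 0) + (\<Sum>t=i+1..k. w (t, 0))" by simp
  moreover have "(\<Sum>t=i+1..k. w (t, 0)) + lpp w (k, 1) y \<le> lpp w (i + 1, 0) y"
    using Suc ik by auto
  ultimately show ?case using lpp_first_step_ge[of e1 "(i, 0)" y w] assms ik
    by (auto simp: e1_def le_prod_iff)
qed

lemma horizontal_exit_attained:
  assumes "i \<le> fst y" "1 \<le> snd y"
  shows "\<exists>k\<in>{i..fst y}. lpp w (i, 0) y = (\<Sum>t=i..k. w (t, 0)) + lpp w (k, 1) y"
  using assms(1)
proof (induction "nat (fst y - i)" arbitrary: i rule: less_induct)
  case less
  obtain s where s: "s \<in> {e1, e2}" "(i, 0) + s \<le> y" "lpp w (i, 0) y = w (i, 0) + lpp w ((i, 0) + s) y"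
    by (rule lpp_first_step[of "(i, 0)" y w]) (use less assms in \<open>auto simp: le_prod_iff\<close>)
  show ?case
  proof (cases "s = e2")
    case True
    then show ?thesis using s less by (intro bexI[of _ i]) (auto simp: e2_def)
  next
    case False
    then have e: "(i, 0) + s = (i + 1, 0)" using s by (auto simp: e1_def)
    then have "i + 1 \<le> fst y" using s by (auto simp: le_prod_iff)
    then obtain k where k: "k \<in> {i+1..fst y}" "lpp w (i + 1, 0) y = (\<Sum>t=i+1..k. w (t, 0)) + lpp w (k, 1) y"
      using less(1)[of "i + 1"] less(2) by auto
    then have "{i..k} = insert i {i+1..k}" by auto
    then have "(\<Sum>t=i..k. w (t, 0)) = w (i, 0) + (\<Sum>t=i+1..k. w (t, 0))" by simp
    then show ?thesis using k s e by (intro bexI[of _ k]) auto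
  qed
qed

lemma exit_value_le_lpp:
  assumes y: "y \<in> pos_quadrant" and w: "w 0 = 0" and k: "k \<in> exit_points y"
  shows "exit_value w y k \<le> lpp w 0 y"
proof -
  have *: "exit_value w y k \<le> lpp w 0 y" if "y \<in> pos_quadrant" "w 0 = 0" "0 < k" "k \<in> exit_points y" for w y k
  proof -
    have "{0..k} = insert 0 {1..k}" using that by auto
    then have "(\<Sum>t=0..k. w (t, 0)) = (\<Sum>t=1..k. w (t, 0))" using that by (simp add: zero_prod_def)
    then show ?thesis using horizontal_exit_le[of 0 k y w] that
      by (auto simp: exit_value_def exit_points_def pos_quadrant_def zero_prod_def)
  qed
  show ?thesis
  proof (cases "0 < k")
    case False
    have "exit_value (\<lambda>z. w (prod.swap z)) (prod.swap y) (- k) \<le> lpp (\<lambda>z. w (prod.swap z)) 0 (prod.swap y)"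
      using assms False by (intro *) (auto simp: exit_points_swap pos_quadrant_def zero_prod_def exit_points_def)
    also have "\<dots> = lpp w 0 y"
      using lpp_swap[of 0 "prod.swap y" w] y by (auto simp: le_prod_iff pos_quadrant_def zero_prod_def)
    finally show ?thesis using exit_value_swap[OF y k] by simp
  qed (use * assms in blast)
qed

lemma lpp_exit_attained:
  assumes y: "y \<in> pos_quadrant" and w: "w 0 = 0"
  obtains k where "k \<in> exit_points y" "lpp w 0 y = exit_value w y k"
proof -
  have *: "\<exists>k\<in>{1..fst y}. lpp w (1, 0) y = exit_value w y k" if "y \<in> pos_quadrant" for w y
    using horizontal_exit_attained[of 1 y w] that by (auto simp: exit_value_def pos_quadrant_def)
  obtain s where s: "s \<in> {e1, e2}" "0 + s \<le> y" "lpp w 0 y = w 0 + lpp w (0 + s) y"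
    by (rule lpp_first_step[of 0 y w]) (use y in \<open>auto simp: le_prod_iff pos_quadrant_def\<close>)
  show ?thesis
  proof (cases "s = e1")
    case True
    then have "lpp w 0 y = lpp w (1, 0) y" using s w by (simp add: e1_def)
    then show ?thesis using *[OF y, of w] that by (auto simp: exit_points_def) (metis atLeastAtMost_iff)
  next
    case False
    then have e: "lpp w 0 y = lpp w (0, 1) y" using s w by (simp add: e2_def)
    have "prod.swap y \<in> pos_quadrant" using y by (simp add: pos_quadrant_def)
    from *[OF this, of "\<lambda>z. w (prod.swap z)"] obtain k where k: "k \<in> {1..snd y}"
      "lpp (\<lambda>z. w (prod.swap z)) (1, 0) (prod.swap y) = exit_value (\<lambda>z. w (prod.swap z)) (prod.swap y) k" by auto
    have ky: "- k \<in> exit_points y" using k by (auto simp: exit_points_def)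
    have "lpp (\<lambda>z. w (prod.swap z)) (1, 0) (prod.swap y) = lpp w (0, 1) y"
      using lpp_swap[of "(1, 0)" "prod.swap y" w] y by (auto simp: le_prod_iff pos_quadrant_def)
    then have "lpp w 0 y = exit_value w y (- k)" using e k exit_value_swap[OF y ky, of w] by simp
    then show ?thesis using that ky by blast
  qed
qed

lemma measurable_lpp_general:
  assumes "\<And>z. z \<in> {x..y} \<Longrightarrow> (\<lambda>\<omega>. w \<omega> z) \<in> borel_measurable N"
  shows "(\<lambda>\<omega>. lpp (w \<omega>) x y) \<in> borel_measurable N"
proof -
  have "(\<lambda>\<omega>. \<Sum>z\<leftarrow>p. w \<omega> z) \<in> borel_measurable N" if "set p \<subseteq> {x..y}" for p
    using that
  proof (induction p)
    case (Cons a p)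
    then show ?case using assms[of a] by (auto intro!: borel_measurable_add)
  qed simp
  then show ?thesis unfolding lpp_def
    using up_right_paths_le(2) by (intro borel_measurable_Max finite_up_right_paths) blast
qed

lemma measurable_exit_value_general:
  assumes w: "\<And>z. z \<in> {0..y} \<Longrightarrow> z \<noteq> 0 \<Longrightarrow> (\<lambda>\<omega>. w \<omega> z) \<in> borel_measurable N"
    and y: "y \<in> pos_quadrant" "k \<in> exit_points y"
  shows "(\<lambda>\<omega>. exit_value (w \<omega>) y k) \<in> borel_measurable N"
proof (cases "0 < k")
  case True
  then have "(\<lambda>\<omega>. exit_value (w \<omega>) y k) = (\<lambda>\<omega>. (\<Sum>i=1..k. w \<omega> (i, 0)) + lpp (w \<omega>) (k, 1) y)"
    by (simp add: exit_value_def)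
  also have "\<dots> \<in> borel_measurable N"
    using True y by (intro borel_measurable_add borel_measurable_sum measurable_lpp_general w)
      (auto simp: exit_points_def le_prod_iff pos_quadrant_def zero_prod_def)
  finally show ?thesis .
next
  case False
  then have "(\<lambda>\<omega>. exit_value (w \<omega>) y k) = (\<lambda>\<omega>. (\<Sum>j=1..-k. w \<omega> (0, j)) + lpp (w \<omega>) (1, -k) y)"
    by (simp add: exit_value_def)
  also have "\<dots> \<in> borel_measurable N"
    using False y by (intro borel_measurable_add borel_measurable_sum measurable_lpp_general w)
      (auto simp: exit_points_def le_prod_iff pos_quadrant_def zero_prod_def)
  finally show ?thesis .
qed

section \<open>An exit point bound\<close>

text \<open>
  Names for the independent exponential variables. \<open>HI\<close>, \<open>SJ\<close> are the horizontal and vertical boundary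
  weights of a stationary model and \<open>OM\<close> its bulk weights. For a second model on the same bulk, \<open>VI\<close>,
  \<open>WW\<close>, \<open>AJ\<close> supply the additional randomness. \<open>BI\<close>, \<open>BJ\<close> are the weights on the two axes
  of the original quadrant.
\<close>

datatype slot = HI nat | VI nat | WW | SJ nat | AJ nat | OM nat nat | BI nat | BJ nat

definition grid_slots :: "nat \<Rightarrow> nat \<Rightarrow> slot set" where
  "grid_slots m n = HI ` {1..m} \<union> SJ ` {1..n} \<union> case_prod OM ` ({1..m} \<times> {1..n})"

definition grid_rate :: "real \<Rightarrow> real \<Rightarrow> slot \<Rightarrow> real" where
  "grid_rate a b k = (case k of HI _ \<Rightarrow> a | SJ _ \<Rightarrow> b | _ \<Rightarrow> 1)"

lemma grid_rate_simps [simp]: "grid_rate a b (HI i) = a" "grid_rate a b (SJ j) = b" "grid_rate a b (OM i' j') = 1"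
  by (simp_all add: grid_rate_def)

abbreviation slot_weights :: "(slot \<Rightarrow> real) \<Rightarrow> int \<times> int \<Rightarrow> real" where
  "slot_weights x \<equiv> grid_weights (\<lambda>i. x (HI i)) (\<lambda>j. x (SJ j)) (\<lambda>i j. x (OM i j))"

lemma finite_grid_slots: "finite (grid_slots m n)"
  by (simp add: grid_slots_def)

lemma mem_grid_slots [simp]:
  "HI i \<in> grid_slots m n \<longleftrightarrow> 1 \<le> i \<and> i \<le> m"
  "SJ j \<in> grid_slots m n \<longleftrightarrow> 1 \<le> j \<and> j \<le> n"
  "OM i j \<in> grid_slots m n \<longleftrightarrow> 1 \<le> i \<and> i \<le> m \<and> 1 \<le> j \<and> j \<le> n"
  by (auto simp: grid_slots_def)

lemma prod_grid_slots:
  fixes f :: "slot \<Rightarrow> 'a :: comm_monoid_mult"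
  shows "(\<Prod>k\<in>grid_slots m n. f k) = (\<Prod>i=1..m. f (HI i)) * (\<Prod>j=1..n. f (SJ j)) * (\<Prod>(i, j)\<in>{1..m} \<times> {1..n}. f (OM i j))"
proof -
  have "(\<Prod>k\<in>grid_slots m n. f k) = (\<Prod>k\<in>HI ` {1..m} \<union> SJ ` {1..n}. f k) * (\<Prod>k\<in>case_prod OM ` ({1..m} \<times> {1..n}). f k)"
    unfolding grid_slots_def by (rule prod.union_disjoint) auto
  also have "(\<Prod>k\<in>HI ` {1..m} \<union> SJ ` {1..n}. f k) = (\<Prod>k\<in>HI ` {1..m}. f k) * (\<Prod>k\<in>SJ ` {1..n}. f k)"
    by (rule prod.union_disjoint) auto
  also have "(\<Prod>k\<in>HI ` {1..m}. f k) = (\<Prod>i=1..m. f (HI i))" by (subst prod.reindex) (auto simp: inj_on_def)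
  also have "(\<Prod>k\<in>SJ ` {1..n}. f k) = (\<Prod>j=1..n. f (SJ j))" by (subst prod.reindex) (auto simp: inj_on_def)
  also have "(\<Prod>k\<in>case_prod OM ` ({1..m} \<times> {1..n}). f k) = (\<Prod>(i, j)\<in>{1..m} \<times> {1..n}. f (OM i j))"
    by (subst prod.reindex) (auto simp: inj_on_def intro!: prod.cong)
  finally show ?thesis .
qed

lemma measurable_grid_weights:
  assumes "\<And>i. 1 \<le> i \<Longrightarrow> i \<le> m \<Longrightarrow> (\<lambda>\<omega>. H \<omega> i) \<in> borel_measurable N"
    "\<And>j. 1 \<le> j \<Longrightarrow> j \<le> n \<Longrightarrow> (\<lambda>\<omega>. V \<omega> j) \<in> borel_measurable N"
    "\<And>i j. 1 \<le> i \<Longrightarrow> i \<le> m \<Longrightarrow> 1 \<le> j \<Longrightarrow> j \<le> n \<Longrightarrow> (\<lambda>\<omega>. Om \<omega> i j) \<in> borel_measurable N"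
    "z \<le> (int m, int n)"
  shows "(\<lambda>\<omega>. grid_weights (H \<omega>) (V \<omega>) (Om \<omega>) z) \<in> borel_measurable N"
proof -
  consider "1 \<le> fst z \<and> 1 \<le> snd z" | "\<not> (1 \<le> fst z \<and> 1 \<le> snd z)" "1 \<le> fst z \<and> snd z = 0"
    | "\<not> (1 \<le> fst z \<and> 1 \<le> snd z)" "\<not> (1 \<le> fst z \<and> snd z = 0)" "fst z = 0 \<and> 1 \<le> snd z"
    | "\<not> (1 \<le> fst z \<and> 1 \<le> snd z)" "\<not> (1 \<le> fst z \<and> snd z = 0)" "\<not> (fst z = 0 \<and> 1 \<le> snd z)"
    by blast
  then show ?thesis
  proof cases
    case 1
    then have "(\<lambda>\<omega>. Om \<omega> (nat (fst z)) (nat (snd z))) \<in> borel_measurable N"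
      using assms(4) by (intro assms(3)) (auto simp: le_prod_iff)
    then show ?thesis unfolding grid_weights_def if_P[OF 1] .
  next
    case 2
    then have "(\<lambda>\<omega>. H \<omega> (nat (fst z))) \<in> borel_measurable N"
      using assms(4) by (intro assms(1)) (auto simp: le_prod_iff)
    then show ?thesis unfolding grid_weights_def if_not_P[OF 2(1)] if_P[OF 2(2)] .
  next
    case 3
    then have "(\<lambda>\<omega>. V \<omega> (nat (snd z))) \<in> borel_measurable N"
      using assms(4) by (intro assms(2)) (auto simp: le_prod_iff)
    then show ?thesis unfolding grid_weights_def if_not_P[OF 3(1)] if_not_P[OF 3(2)] if_P[OF 3(3)] .
  next
    case 4
    show ?thesis unfolding grid_weights_def if_not_P[OF 4(1)] if_not_P[OF 4(2)] if_not_P[OF 4(3)] by simp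
  qed
qed

lemma expo_mgf:
  assumes "0 < b" "\<sigma> < b"
  shows "(\<integral>\<^sup>+x. ennreal (exp (\<sigma> * x)) \<partial>expo b) = ennreal (b / (b - \<sigma>))"
proof -
  interpret prob_space "expo (b - \<sigma>)" using assms by (intro prob_space_expo) simp
  have "(\<integral>\<^sup>+x. ennreal (exp (\<sigma> * x)) \<partial>expo b) = (\<integral>\<^sup>+x. ennreal (exponential_density b x) * ennreal (exp (\<sigma> * x)) \<partial>lborel)"
    by (rule nn_integral_expo) measurable
  also have "\<dots> = (\<integral>\<^sup>+x. ennreal (b / (b - \<sigma>)) * ennreal (exponential_density (b - \<sigma>) x) \<partial>lborel)"
  proof (intro nn_integral_cong)
    fix x
    have "exponential_density b x * exp (\<sigma> * x) = b / (b - \<sigma>) * exponential_density (b - \<sigma>) x"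
    proof -
      have "exp (- x * b) * exp (\<sigma> * x) = exp (- x * (b - \<sigma>))"
        by (simp add: exp_add[symmetric] algebra_simps)
      then have "b * exp (- x * b) * exp (\<sigma> * x) = b / (b - \<sigma>) * ((b - \<sigma>) * exp (- x * (b - \<sigma>)))"
        using assms by simp
      then show ?thesis by (simp add: exponential_density_def)
    qed
    then show "ennreal (exponential_density b x) * ennreal (exp (\<sigma> * x)) = ennreal (b / (b - \<sigma>)) * ennreal (exponential_density (b - \<sigma>) x)"
      using assms by (simp add: ennreal_mult[symmetric] exponential_density_nonneg)
  qed
  also have "\<dots> = ennreal (b / (b - \<sigma>)) * (\<integral>\<^sup>+x. ennreal (exponential_density (b - \<sigma>) x) * 1 \<partial>lborel)"
    by (subst nn_integral_cmult) auto
  also have "(\<integral>\<^sup>+x. ennreal (exponential_density (b - \<sigma>) x) * 1 \<partial>lborel) = (\<integral>\<^sup>+x. 1 \<partial>expo (b - \<sigma>))"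
    by (rule nn_integral_expo[symmetric]) simp
  finally show ?thesis by (simp add: emeasure_space_1[simplified])
qed

lemma exp_family_coordinates:
  assumes "finite K" "\<And>k. 0 < r k"
  shows "exp_family (PiM K (\<lambda>k. expo (r k))) K r (\<lambda>k x. x k)"
  unfolding exp_family_def
proof (intro conjI ballI)
  show "prob_space (PiM K (\<lambda>k. expo (r k)))" by (intro prob_space_PiM prob_space_expo assms)
  have "distr (PiM K (\<lambda>k. expo (r k))) (PiM K (\<lambda>_. borel)) (\<lambda>\<omega>. \<lambda>k\<in>K. \<omega> k) = distr (PiM K (\<lambda>k. expo (r k))) (PiM K (\<lambda>k. expo (r k))) (\<lambda>\<omega>. \<omega>)"
    by (rule distr_cong) (auto simp: space_PiM)
  then show "distr (PiM K (\<lambda>k. expo (r k))) (PiM K (\<lambda>_. borel)) (\<lambda>\<omega>. \<lambda>k\<in>K. \<omega> k) = PiM K (\<lambda>k. expo (r k))"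
    by simp
qed (use assms in \<open>auto intro!: measurable_component_singleton\<close>)

lemma exp_family_prod_nn_integral:
  assumes X: "exp_family M K r X" and J: "J \<subseteq> K" and f: "\<And>k. k \<in> J \<Longrightarrow> f k \<in> borel_measurable borel"
  shows "(\<integral>\<^sup>+\<omega>. (\<Prod>k\<in>J. f k (X k \<omega>)) \<partial>M) = (\<Prod>k\<in>J. \<integral>\<^sup>+x. f k x \<partial>expo (r k))"
proof -
  note D = exp_familyD[OF exp_family_subset[OF X J]]
  define r' where "r' = (\<lambda>k. if k \<in> J then r k else 1)"
  interpret product_prob_space "\<lambda>k. expo (r' k)" J
    by (rule product_prob_space_expo) (use D(3) in \<open>auto simp: r'_def\<close>)
  have m: "(\<lambda>x. \<Prod>k\<in>J. f k (x k)) \<in> borel_measurable (PiM J (\<lambda>_. borel))"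
  proof (rule borel_measurable_prod_ennreal)
    fix k assume k: "k \<in> J"
    show "(\<lambda>x. f k (x k)) \<in> borel_measurable (PiM J (\<lambda>_. borel))"
      by (rule measurable_compose[OF measurable_component_singleton[OF k] f[OF k]])
  qed
  have "(\<integral>\<^sup>+\<omega>. (\<Prod>k\<in>J. f k (X k \<omega>)) \<partial>M) = (\<integral>\<^sup>+\<omega>. (\<lambda>x. \<Prod>k\<in>J. f k (x k)) (\<lambda>k\<in>J. X k \<omega>) \<partial>M)"
    by (intro nn_integral_cong) (auto intro!: prod.cong)
  also have "\<dots> = (\<integral>\<^sup>+x. (\<Prod>k\<in>J. f k (x k)) \<partial>PiM J (\<lambda>k. expo (r k)))"
    by (rule exp_family_nn_integral[OF exp_family_subset[OF X J] m])
  also have "PiM J (\<lambda>k. expo (r k)) = PiM J (\<lambda>k. expo (r' k))"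
    by (rule PiM_expo_cong) (simp add: r'_def)
  also have "(\<integral>\<^sup>+x. (\<Prod>k\<in>J. f k (x k)) \<partial>PiM J (\<lambda>k. expo (r' k))) = (\<Prod>k\<in>J. \<integral>\<^sup>+x. f k x \<partial>expo (r' k))"
    using f D(2) by (subst product_nn_integral_prod) auto
  also have "\<dots> = (\<Prod>k\<in>J. \<integral>\<^sup>+x. f k x \<partial>expo (r k))"
    by (intro prod.cong) (auto simp: r'_def)
  finally show ?thesis .
qed

text \<open>
  Tilting the law by the sum of the horizontal boundary weights changes their rate from
  \<open>\<alpha>\<close> to \<open>\<alpha> + \<sigma>\<close> and makes the model stationary with parameters \<open>\<alpha>\<close>, \<open>\<beta>\<close>. The density cancels the
  part \<open>\<Sum>i. H i\<close> of the passage time, and what remains is the sum of the outgoing vertical increments,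
  independent exponentials of rate \<open>\<beta>\<close> by the Burke property.
\<close>

lemma passage_time_mgf:
  assumes X: "exp_family M (grid_slots m n) (grid_rate (\<alpha> + \<sigma>) \<beta>) X"
    and ab: "0 < \<alpha>" "0 < \<beta>" "\<alpha> + \<beta> = 1" "0 < \<alpha> + \<sigma>" "\<sigma> < \<beta>"
  shows "(\<integral>\<^sup>+\<omega>. ennreal (exp (\<sigma> * lpp (slot_weights (\<lambda>k. X k \<omega>)) 0 (int m, int n))) \<partial>M) =
    ennreal (((\<alpha> + \<sigma>) / \<alpha>) ^ m * (\<beta> / (\<beta> - \<sigma>)) ^ n)"
proof -
  let ?K = "grid_slots m n" and ?r = "grid_rate \<alpha> \<beta>" and ?r' = "grid_rate (\<alpha> + \<sigma>) \<beta>"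
  let ?P = "PiM ?K (\<lambda>k. expo (?r k))"
  define g where "g = (\<lambda>x. lpp (slot_weights x) 0 (int m, int n))"
  have pos: "0 < ?r k" "0 < ?r' k" for k using ab by (auto simp: grid_rate_def split: slot.splits)
  have gm [measurable]: "g \<in> borel_measurable (PiM ?K (\<lambda>_. borel))"
    unfolding g_def
    by (rule measurable_lpp_general, rule measurable_grid_weights[where m=m and n=n])
      ((rule measurable_component_singleton, simp)+, simp add: le_prod_iff)
  have g_restrict: "g (\<lambda>k\<in>?K. x k) = g x" for x
    unfolding g_def by (rule lpp_cong, rule grid_weights_cong[where m=m and n=n]) simp_all
  have "(\<integral>\<^sup>+\<omega>. ennreal (exp (\<sigma> * lpp (slot_weights (\<lambda>k. X k \<omega>)) 0 (int m, int n))) \<partial>M) =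
    (\<integral>\<^sup>+\<omega>. (\<lambda>x. ennreal (exp (\<sigma> * g x))) (\<lambda>k\<in>?K. X k \<omega>) \<partial>M)"
    unfolding g_restrict by (simp add: g_def)
  also have "\<dots> = (\<integral>\<^sup>+x. ennreal (exp (\<sigma> * g x)) \<partial>PiM ?K (\<lambda>k. expo (?r' k)))"
    by (rule exp_family_nn_integral[OF X]) measurable
  also have "\<dots> = (\<integral>\<^sup>+x. (\<Prod>k\<in>?K. ennreal (?r' k / ?r k * exp (- (?r' k - ?r k) * x k))) * ennreal (exp (\<sigma> * g x)) \<partial>?P)"
  proof -
    have dens: "(\<lambda>x. \<Prod>k\<in>?K. ennreal (?r' k / ?r k * exp (- (?r' k - ?r k) * x k))) \<in> borel_measurable (PiM ?K (\<lambda>_. borel))"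
    proof (rule borel_measurable_prod_ennreal)
      fix k assume k: "k \<in> ?K"
      have [measurable]: "(\<lambda>x. x k) \<in> borel_measurable (PiM ?K (\<lambda>_. borel :: real measure))"
        using k by (rule measurable_component_singleton)
      show "(\<lambda>x. ennreal (?r' k / ?r k * exp (- (?r' k - ?r k) * x k))) \<in> borel_measurable (PiM ?K (\<lambda>_. borel))"
        by measurable
    qed
    have PD: "PiM ?K (\<lambda>k. expo (?r' k)) = density ?P (\<lambda>x. \<Prod>k\<in>?K. ennreal (?r' k / ?r k * exp (- (?r' k - ?r k) * x k)))"
      by (rule PiM_expo_density[OF finite_grid_slots pos])
    have gm': "(\<lambda>x. ennreal (exp (\<sigma> * g x))) \<in> borel_measurable (PiM ?K (\<lambda>_. borel))" by measurable
    show ?thesis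
      unfolding PD by (rule nn_integral_density) (subst borel_measurable_PiM_expo, fact dens gm')+
  qed
  also have "\<dots> = (\<integral>\<^sup>+x. ennreal (((\<alpha> + \<sigma>) / \<alpha>) ^ m) * (\<Prod>k\<in>SJ ` {1..n}. ennreal (exp (\<sigma> * grid_v (\<lambda>i. x (HI i)) (\<lambda>j. x (SJ j)) (\<lambda>i j. x (OM i j)) m (case k of SJ j \<Rightarrow> j)))) \<partial>?P)"
  proof (intro nn_integral_cong)
    fix x
    let ?g = "grid_v (\<lambda>i. x (HI i)) (\<lambda>j. x (SJ j)) (\<lambda>i j. x (OM i j)) m"
    have G: "g x = (\<Sum>i=1..m. x (HI i)) + (\<Sum>j=1..n. ?g j)"
      using corner_passage_boundary_sum[of "\<lambda>i. x (HI i)" "\<lambda>j. x (SJ j)" "\<lambda>i j. x (OM i j)" m n]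
      by (simp add: g_def corner_passage_def)
    have "(\<Prod>k\<in>?K. ?r' k / ?r k * exp (- (?r' k - ?r k) * x k)) = (\<Prod>i=1..m. (\<alpha> + \<sigma>) / \<alpha> * exp (- \<sigma> * x (HI i)))"
      unfolding prod_grid_slots using ab by simp
    also have "\<dots> = ((\<alpha> + \<sigma>) / \<alpha>) ^ m * exp (- \<sigma> * (\<Sum>i=1..m. x (HI i)))"
      unfolding prod.distrib exp_sum[OF finite_atLeastAtMost, symmetric] sum_distrib_left[symmetric]
      by simp
    finally have P: "(\<Prod>k\<in>?K. ?r' k / ?r k * exp (- (?r' k - ?r k) * x k)) = ((\<alpha> + \<sigma>) / \<alpha>) ^ m * exp (- \<sigma> * (\<Sum>i=1..m. x (HI i)))" .
    have "(\<Prod>k\<in>?K. ennreal (?r' k / ?r k * exp (- (?r' k - ?r k) * x k))) = ennreal (\<Prod>k\<in>?K. ?r' k / ?r k * exp (- (?r' k - ?r k) * x k))"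
      using pos by (intro prod_ennreal) (simp add: less_imp_le)
    then have "(\<Prod>k\<in>?K. ennreal (?r' k / ?r k * exp (- (?r' k - ?r k) * x k))) * ennreal (exp (\<sigma> * g x)) =
      ennreal (((\<alpha> + \<sigma>) / \<alpha>) ^ m * exp (- \<sigma> * (\<Sum>i=1..m. x (HI i))) * exp (\<sigma> * g x))"
      unfolding P using ab by (simp add: ennreal_mult[symmetric])
    also have "((\<alpha> + \<sigma>) / \<alpha>) ^ m * exp (- \<sigma> * (\<Sum>i=1..m. x (HI i))) * exp (\<sigma> * g x) = ((\<alpha> + \<sigma>) / \<alpha>) ^ m * (\<Prod>j=1..n. exp (\<sigma> * ?g j))"
    proof -
      have "exp (- \<sigma> * (\<Sum>i=1..m. x (HI i))) * exp (\<sigma> * g x) = exp (\<sigma> * (\<Sum>j=1..n. ?g j))"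
        unfolding G by (simp add: exp_add[symmetric] distrib_left)
      also have "\<dots> = (\<Prod>j=1..n. exp (\<sigma> * ?g j))"
        unfolding sum_distrib_left by (rule exp_sum) simp
      finally show ?thesis by (simp only: mult.assoc)
    qed
    also have "ennreal \<dots> = ennreal (((\<alpha> + \<sigma>) / \<alpha>) ^ m) * (\<Prod>j=1..n. ennreal (exp (\<sigma> * ?g j)))"
      using ab by (simp add: ennreal_mult prod_nonneg prod_ennreal)
    also have "(\<Prod>j=1..n. ennreal (exp (\<sigma> * ?g j))) = (\<Prod>k\<in>SJ ` {1..n}. ennreal (exp (\<sigma> * ?g (case k of SJ j \<Rightarrow> j))))"
      by (subst prod.reindex) (auto simp: inj_on_def)
    finally show "(\<Prod>k\<in>?K. ennreal (?r' k / ?r k * exp (- (?r' k - ?r k) * x k))) * ennreal (exp (\<sigma> * g x)) =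
      ennreal (((\<alpha> + \<sigma>) / \<alpha>) ^ m) * (\<Prod>k\<in>SJ ` {1..n}. ennreal (exp (\<sigma> * ?g (case k of SJ j \<Rightarrow> j))))" .
  qed
  also have "\<dots> = ennreal (((\<alpha> + \<sigma>) / \<alpha>) ^ m) * ennreal ((\<beta> / (\<beta> - \<sigma>)) ^ n)"
  proof -
    define Y :: "slot \<Rightarrow> (slot \<Rightarrow> real) \<Rightarrow> real" where "Y = (\<lambda>k x. case k of
        HI i \<Rightarrow> grid_h (\<lambda>i. x (HI i)) (\<lambda>j. x (SJ j)) (\<lambda>i j. x (OM i j)) i n
      | SJ j \<Rightarrow> grid_v (\<lambda>i. x (HI i)) (\<lambda>j. x (SJ j)) (\<lambda>i j. x (OM i j)) m j
      | OM i j \<Rightarrow> grid_dual (\<lambda>i. x (HI i)) (\<lambda>j. x (SJ j)) (\<lambda>i j. x (OM i j)) i j | _ \<Rightarrow> x k)"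
    have Y: "exp_family ?P ?K ?r Y"
      by (rule exp_family_grid[OF exp_family_coordinates[OF finite_grid_slots pos(1)], where m=m and n=n and hs=HI and vs=SJ and cs=OM])
        (use ab in \<open>auto simp: Y_def inj_def grid_slots_def\<close>)
    have YS: "Y k x = grid_v (\<lambda>i. x (HI i)) (\<lambda>j. x (SJ j)) (\<lambda>i j. x (OM i j)) m (case k of SJ j \<Rightarrow> j)" if "k \<in> SJ ` {1..n}" for k x
      using that by (auto simp: Y_def)
    have "(\<integral>\<^sup>+x. (\<Prod>k\<in>SJ ` {1..n}. ennreal (exp (\<sigma> * Y k x))) \<partial>?P) = (\<Prod>k\<in>SJ ` {1..n}. \<integral>\<^sup>+y. ennreal (exp (\<sigma> * y)) \<partial>expo (?r k))"
      by (rule exp_family_prod_nn_integral[OF Y]) auto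
    also have "\<dots> = (\<Prod>j=1..n. ennreal (\<beta> / (\<beta> - \<sigma>)))"
      by (subst prod.reindex) (use ab in \<open>auto simp: inj_on_def expo_mgf\<close>)
    also have "\<dots> = ennreal ((\<beta> / (\<beta> - \<sigma>)) ^ n)" using ab by (simp add: ennreal_power)
    finally have I: "(\<integral>\<^sup>+x. (\<Prod>k\<in>SJ ` {1..n}. ennreal (exp (\<sigma> * Y k x))) \<partial>?P) = ennreal ((\<beta> / (\<beta> - \<sigma>)) ^ n)" .
    have "(\<lambda>x. \<Prod>k\<in>SJ ` {1..n}. ennreal (exp (\<sigma> * Y k x))) \<in> borel_measurable ?P"
    proof (rule borel_measurable_prod_ennreal)
      fix k assume "k \<in> SJ ` {1..n}"
      then have [measurable]: "Y k \<in> borel_measurable ?P" using exp_familyD(4)[OF Y, of k] by auto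
      show "(\<lambda>x. ennreal (exp (\<sigma> * Y k x))) \<in> borel_measurable ?P" by measurable
    qed
    then have "(\<integral>\<^sup>+x. ennreal (((\<alpha> + \<sigma>) / \<alpha>) ^ m) * (\<Prod>k\<in>SJ ` {1..n}. ennreal (exp (\<sigma> * Y k x))) \<partial>?P) =
      ennreal (((\<alpha> + \<sigma>) / \<alpha>) ^ m) * ennreal ((\<beta> / (\<beta> - \<sigma>)) ^ n)"
      unfolding I[symmetric] by (rule nn_integral_cmult)
    then show ?thesis by (simp add: YS cong: prod.cong)
  qed
  also have "\<dots> = ennreal (((\<alpha> + \<sigma>) / \<alpha>) ^ m * (\<beta> / (\<beta> - \<sigma>)) ^ n)"
    using ab by (intro ennreal_mult[symmetric]) auto
  finally show ?thesis .
qed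

lemma exp_family_AE_nonneg:
  assumes X: "exp_family M K r X"
  shows "AE \<omega> in M. \<forall>k\<in>K. 0 \<le> X k \<omega>"
proof -
  note D = exp_familyD[OF X]
  have "AE \<omega> in M. 0 \<le> X k \<omega>" if k: "k \<in> K" for k
  proof -
    have [measurable]: "X k \<in> borel_measurable M" by (rule D(4)[OF k])
    have "(\<integral>\<^sup>+\<omega>. (\<Prod>k\<in>{k}. indicator {..<0} (X k \<omega>)) \<partial>M) = (\<Prod>k\<in>{k}. \<integral>\<^sup>+x. indicator {..<0} x \<partial>expo (r k))"
      by (rule exp_family_prod_nn_integral[OF X]) (use k in auto)
    then have "(\<integral>\<^sup>+\<omega>. indicator {..<0} (X k \<omega>) \<partial>M) = (\<integral>\<^sup>+x. indicator {..<0} x \<partial>expo (r k))" by simp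
    also have "\<dots> = (\<integral>\<^sup>+x. ennreal (exponential_density (r k) x) * indicator {..<0} x \<partial>lborel)"
      by (rule nn_integral_expo) simp
    also have "\<dots> = (\<integral>\<^sup>+(x::real). 0 \<partial>lborel)"
      by (intro nn_integral_cong) (auto simp: exponential_density_def indicator_def)
    finally have "(\<integral>\<^sup>+\<omega>. indicator {..<0} (X k \<omega>) \<partial>M) = 0" by simp
    moreover have "(\<lambda>\<omega>. indicator {..<0} (X k \<omega>) :: ennreal) \<in> borel_measurable M" by measurable
    ultimately have "AE \<omega> in M. indicator {..<0} (X k \<omega>) = (0 :: ennreal)"
      by (simp add: nn_integral_0_iff_AE)
    then show ?thesis by eventually_elim (auto simp: indicator_def split: if_splits)
  qed
  then show ?thesis using D(2) by (simp add: AE_finite_all)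
qed

lemma exponential_Markov:
  fixes f :: "'a \<Rightarrow> real"
  assumes [measurable]: "f \<in> borel_measurable M" and E: "(\<integral>\<^sup>+\<omega>. ennreal (exp (f \<omega>)) \<partial>M) \<le> ennreal E" and "0 \<le> E"
  shows "emeasure M {\<omega> \<in> space M. c \<le> f \<omega>} \<le> ennreal (exp (- c) * E)"
proof -
  have "emeasure M {\<omega> \<in> space M. c \<le> f \<omega>} = (\<integral>\<^sup>+\<omega>. indicator {\<omega> \<in> space M. c \<le> f \<omega>} \<omega> \<partial>M)" by simp
  also have "\<dots> \<le> (\<integral>\<^sup>+\<omega>. ennreal (exp (- c)) * ennreal (exp (f \<omega>)) \<partial>M)"
  proof (intro nn_integral_mono)
    fix \<omega>
    show "indicator {\<omega> \<in> space M. c \<le> f \<omega>} \<omega> \<le> ennreal (exp (- c)) * ennreal (exp (f \<omega>))"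
    proof (cases "c \<le> f \<omega>")
      case True
      then have "1 \<le> exp (- c) * exp (f \<omega>)" by (simp add: exp_add[symmetric])
      then have "ennreal 1 \<le> ennreal (exp (- c) * exp (f \<omega>))" by (rule ennreal_leI)
      then show ?thesis by (auto simp: ennreal_mult indicator_def)
    qed (auto simp: indicator_def)
  qed
  also have "\<dots> = ennreal (exp (- c)) * (\<integral>\<^sup>+\<omega>. ennreal (exp (f \<omega>)) \<partial>M)"
    by (rule nn_integral_cmult) measurable
  also have "\<dots> \<le> ennreal (exp (- c)) * ennreal E" by (intro mult_left_mono E) simp
  also have "\<dots> = ennreal (exp (- c) * E)" using \<open>0 \<le> E\<close> by (simp add: ennreal_mult)
  finally show ?thesis .
qed

text \<open>
  The constant 4 leaves room for the exponential Markov inequality with parameter \<open>a / 2\<close>.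
\<close>

lemma exponential_sum_tail:
  assumes X: "exp_family M K r X" and J: "J \<subseteq> K" "\<And>k. k \<in> J \<Longrightarrow> r k = a" and a: "0 < a"
  shows "emeasure M {\<omega> \<in> space M. 4 * card J / a \<le> (\<Sum>k\<in>J. X k \<omega>)} \<le> ennreal (exp (- real (card J)))"
proof -
  note D = exp_familyD[OF X]
  have fin: "finite J" using J D(2) finite_subset by blast
  have [measurable]: "(\<lambda>\<omega>. \<Sum>k\<in>J. X k \<omega>) \<in> borel_measurable M"
    using J D(4) by (intro borel_measurable_sum) auto
  have "(\<integral>\<^sup>+\<omega>. ennreal (exp (a / 2 * (\<Sum>k\<in>J. X k \<omega>))) \<partial>M) = (\<integral>\<^sup>+\<omega>. (\<Prod>k\<in>J. ennreal (exp (a / 2 * X k \<omega>))) \<partial>M)"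
    by (simp add: sum_distrib_left exp_sum fin prod_ennreal)
  also have "\<dots> = (\<Prod>k\<in>J. \<integral>\<^sup>+x. ennreal (exp (a / 2 * x)) \<partial>expo (r k))"
    by (rule exp_family_prod_nn_integral[OF X J(1)]) measurable
  also have "\<dots> = (\<Prod>k\<in>J. ennreal 2)"
  proof (intro prod.cong refl)
    fix k assume "k \<in> J"
    then show "(\<integral>\<^sup>+x. ennreal (exp (a / 2 * x)) \<partial>expo (r k)) = ennreal 2"
      using expo_mgf[of a "a / 2"] a by (simp only: J(2)) simp
  qed
  also have "\<dots> = ennreal (2 ^ card J)" unfolding prod_constant by (rule ennreal_power) simp
  finally have "emeasure M {\<omega> \<in> space M. 2 * real (card J) \<le> a / 2 * (\<Sum>k\<in>J. X k \<omega>)} \<le> ennreal (exp (- (2 * real (card J))) * 2 ^ card J)"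
    by (intro exponential_Markov) auto
  also have "\<dots> \<le> ennreal (exp (- (2 * real (card J))) * exp 1 ^ card J)"
  proof (intro ennreal_leI mult_left_mono power_mono)
    show "2 \<le> exp (1 :: real)" using exp_ge_add_one_self[of 1] by simp
  qed auto
  also have "exp (- (2 * real (card J))) * exp 1 ^ card J = exp (- real (card J))"
    by (simp add: exp_of_nat_mult[symmetric] exp_add[symmetric])
  also have "{\<omega> \<in> space M. 2 * real (card J) \<le> a / 2 * (\<Sum>k\<in>J. X k \<omega>)} = {\<omega> \<in> space M. 4 * card J / a \<le> (\<Sum>k\<in>J. X k \<omega>)}"
    using a by (auto simp: field_simps)
  finally show ?thesis by simp
qed

text \<open>
  Exits are compared through their values, so that ties cause no trouble: the event says that some exit
  to the left of \<open>s\<close>, vertical exits included, is at least as good as every exit beyond \<open>s\<close>.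
\<close>

definition small_exit :: "(int \<times> int \<Rightarrow> real) \<Rightarrow> int \<times> int \<Rightarrow> int \<Rightarrow> bool" where
  "small_exit w y s \<longleftrightarrow> (\<exists>k'\<in>exit_points y. k' \<le> s \<and>
     (\<forall>k\<in>exit_points y. s < k \<longrightarrow> exit_value w y k \<le> exit_value w y k'))"

lemma finite_exit_points [simp]: "finite (exit_points y)"
  by (simp add: exit_points_def)

lemma sets_small_exit:
  assumes "\<And>z. z \<in> {0..y} \<Longrightarrow> z \<noteq> 0 \<Longrightarrow> (\<lambda>\<omega>. w \<omega> z) \<in> borel_measurable M" "y \<in> pos_quadrant"
  shows "{\<omega> \<in> space M. small_exit (w \<omega>) y s} \<in> sets M"
proof -
  have m: "(\<lambda>\<omega>. exit_value (w \<omega>) y k) \<in> borel_measurable M" if "k \<in> exit_points y" for k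
    by (rule measurable_exit_value_general) (use assms that in auto)
  have "{\<omega> \<in> space M. small_exit (w \<omega>) y s} =
    (\<Union>k'\<in>{k'\<in>exit_points y. k' \<le> s}. space M \<inter> (\<Inter>k\<in>{k\<in>exit_points y. s < k}. {\<omega> \<in> space M. exit_value (w \<omega>) y k \<le> exit_value (w \<omega>) y k'}))"
    by (auto simp: small_exit_def)
  also have "\<dots> \<in> sets M"
  proof (intro sets.finite_UN)
    fix k' assume k': "k' \<in> {k'\<in>exit_points y. k' \<le> s}"
    show "space M \<inter> (\<Inter>k\<in>{k\<in>exit_points y. s < k}. {\<omega> \<in> space M. exit_value (w \<omega>) y k \<le> exit_value (w \<omega>) y k'}) \<in> sets M"
    proof (cases "{k\<in>exit_points y. s < k} = {}")
      case False
      then show ?thesis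
      proof (intro sets.Int sets.top sets.finite_INT)
        fix k assume "k \<in> {k\<in>exit_points y. s < k}"
        then show "{\<omega> \<in> space M. exit_value (w \<omega>) y k \<le> exit_value (w \<omega>) y k'} \<in> sets M"
          using k' by (intro borel_measurable_le m) auto
      qed auto
    qed (simp only: image_empty Inter_empty Int_UNIV_right sets.top INT_empty)
  qed simp
  finally show ?thesis .
qed

lemma exit_value_mono:
  assumes "y \<in> pos_quadrant" "k \<in> exit_points y"
    "\<And>i. 0 < i \<Longrightarrow> i \<le> fst y \<Longrightarrow> w (i, 0) = w' (i, 0)"
    "\<And>j. 0 < j \<Longrightarrow> j \<le> snd y \<Longrightarrow> w (0, j) \<le> w' (0, j)"
    "\<And>i j. 0 < i \<Longrightarrow> 0 < j \<Longrightarrow> w (i, j) = w' (i, j)"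
  shows "exit_value w y k \<le> exit_value w' y k" "0 < k \<Longrightarrow> exit_value w y k = exit_value w' y k"
proof -
  have l: "lpp w (i, j) y = lpp w' (i, j) y" if "0 < i" "0 < j" for i j
    by (rule lpp_cong) (use that assms(5) in \<open>auto simp: le_prod_iff\<close>)
  show "0 < k \<Longrightarrow> exit_value w y k = exit_value w' y k"
    using assms l by (auto simp: exit_value_def exit_points_def intro!: sum.cong)
  moreover have "exit_value w y k \<le> exit_value w' y k" if "\<not> 0 < k"
    using assms l that by (auto simp: exit_value_def exit_points_def intro!: sum_mono)
  ultimately show "exit_value w y k \<le> exit_value w' y k" by fastforce
qed

text \<open>
  Decrease the rate of the vertical weights from \<open>p\<close> to \<open>u\<close>, which favours small exits further. If the exit
  is at most \<open>s\<close>, then the passage time feels the horizontal weights only through their first \<open>s\<close>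
  sites, and changing their rate from \<open>1 - u - t\<close> to \<open>1 - u + t\<close> costs at most a small multiple of the sum
  of these. Yet the two passage times typically differ by an amount of order \<open>t\<close> times the length of the
  axis. Their moment generating functions at \<open>- t\<close> and \<open>t\<close> are explicit, and optimizing the
  threshold between them gives the square root.
\<close>

lemma exit_bound_raw:
  fixes p t L :: real
  assumes X: "exp_family M (grid_slots m n) (grid_rate (1 - p) p) X"
    and mn: "1 \<le> m" "1 \<le> n" and s: "s \<le> m" and p: "p < 1" and t: "0 < t" "2 * t < p" and L: "0 \<le> L"
  defines "u \<equiv> p - t"
  shows "emeasure M {\<omega> \<in> space M. small_exit (slot_weights (\<lambda>k. X k \<omega>)) (int m, int n) (int s) \<and>
       (\<Sum>i=1..s. X (HI i) \<omega>) < L}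
    \<le> ennreal (2 * sqrt (exp (t * (2 * t / (1 - u + t) * L)) *
        ((1 - (t / (1 - u))\<^sup>2) ^ m / (1 - (t / u)\<^sup>2) ^ n)))"
proof -
  note D = exp_familyD[OF X]
  let ?y = "(int m, int n)" and ?K = "grid_slots m n"
  have u: "0 < u" "t < u" "0 < 1 - u" "u < 1" "t < 1 - u" "u + t = p" using t p by (auto simp: u_def)
  have y: "?y \<in> pos_quadrant" using mn by (simp add: pos_quadrant_def)
  define w where "w = (\<lambda>\<omega>. slot_weights (\<lambda>k. X k \<omega>))"
  define c\<^sub>1 :: "slot \<Rightarrow> real" where "c\<^sub>1 = (\<lambda>k. case k of SJ j \<Rightarrow> p / u | _ \<Rightarrow> 1)"
  define c\<^sub>2 :: "slot \<Rightarrow> real" where "c\<^sub>2 = (\<lambda>k. case k of SJ j \<Rightarrow> p / u | HI i \<Rightarrow> (1 - p) / (1 - u + t) | _ \<Rightarrow> 1)"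
  define w\<^sub>1 where "w\<^sub>1 = (\<lambda>\<omega>. slot_weights (\<lambda>k. c\<^sub>1 k * X k \<omega>))"
  define w\<^sub>2 where "w\<^sub>2 = (\<lambda>\<omega>. slot_weights (\<lambda>k. c\<^sub>2 k * X k \<omega>))"
  define G\<^sub>1 where "G\<^sub>1 = (\<lambda>\<omega>. lpp (w\<^sub>1 \<omega>) 0 ?y)"
  define G\<^sub>2 where "G\<^sub>2 = (\<lambda>\<omega>. lpp (w\<^sub>2 \<omega>) 0 ?y)"
  define E\<^sub>1 where "E\<^sub>1 = ((1 - u - t) / (1 - u)) ^ m * (u / (u + t)) ^ n"
  define E\<^sub>2 where "E\<^sub>2 = ((1 - u + t) / (1 - u)) ^ m * (u / (u - t)) ^ n"
  have E: "0 < E\<^sub>1" "0 < E\<^sub>2" using u t by (auto simp: E\<^sub>1_def E\<^sub>2_def)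
  have X1: "exp_family M ?K (grid_rate ((1 - u) + (- t)) u) (\<lambda>k \<omega>. c\<^sub>1 k * X k \<omega>)"
    by (rule exp_family_cong[OF exp_family_scale[OF X, of c\<^sub>1]])
      (use u p t in \<open>auto simp: c\<^sub>1_def grid_rate_def u_def split: slot.splits\<close>)
  have X2: "exp_family M ?K (grid_rate ((1 - u) + t) u) (\<lambda>k \<omega>. c\<^sub>2 k * X k \<omega>)"
    by (rule exp_family_cong[OF exp_family_scale[OF X, of c\<^sub>2]])
      (use u p t in \<open>auto simp: c\<^sub>2_def grid_rate_def split: slot.splits\<close>)
  have I1: "(\<integral>\<^sup>+\<omega>. ennreal (exp (- t * G\<^sub>1 \<omega>)) \<partial>M) = ennreal E\<^sub>1"
    using passage_time_mgf[OF X1] u t by (simp add: G\<^sub>1_def w\<^sub>1_def E\<^sub>1_def)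
  have I2: "(\<integral>\<^sup>+\<omega>. ennreal (exp (t * G\<^sub>2 \<omega>)) \<partial>M) = ennreal E\<^sub>2"
    using passage_time_mgf[OF X2] u t by (simp add: G\<^sub>2_def w\<^sub>2_def E\<^sub>2_def)
  have mG: "G\<^sub>1 \<in> borel_measurable M" "G\<^sub>2 \<in> borel_measurable M"
    unfolding G\<^sub>1_def w\<^sub>1_def G\<^sub>2_def w\<^sub>2_def
    by (rule measurable_lpp_general, rule measurable_grid_weights; use exp_familyD(4)[OF X1] exp_familyD(4)[OF X2] in auto)+
  note [measurable] = mG
  define d where "d = 2 * t / (1 - u + t)"
  have d: "0 \<le> d" "1 - (1 - p) / (1 - u + t) = d" using u t by (auto simp: d_def u_def field_simps)
  \<comment> \<open>On the event, lowering the horizontal rate from \<open>1 - u + t\<close> to \<open>1 - u - t\<close> barely changes the passage time.\<close>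
  have incl: "G\<^sub>1 \<omega> \<le> G\<^sub>2 \<omega> + d * L"
    if nn: "\<forall>k\<in>?K. 0 \<le> X k \<omega>" and ev: "small_exit (w \<omega>) ?y (int s)" "(\<Sum>i=1..s. X (HI i) \<omega>) < L" for \<omega>
  proof -
    have mono: "exit_value (w \<omega>) ?y k \<le> exit_value (w\<^sub>1 \<omega>) ?y k"
      "0 < k \<Longrightarrow> exit_value (w \<omega>) ?y k = exit_value (w\<^sub>1 \<omega>) ?y k" if "k \<in> exit_points ?y" for k
    proof -
      have "1 * X (SJ j) \<omega> \<le> p / u * X (SJ j) \<omega>" if "1 \<le> j" "j \<le> n" for j
        using nn that u t by (intro mult_right_mono) (auto simp: u_def)
      then have w0: "w \<omega> (0, j) \<le> w\<^sub>1 \<omega> (0, j)" if "0 < j" "j \<le> int n" for j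
        using that by (simp add: w_def w\<^sub>1_def grid_weights_def c\<^sub>1_def nat_le_iff)
      show "exit_value (w \<omega>) ?y k \<le> exit_value (w\<^sub>1 \<omega>) ?y k"
        "0 < k \<Longrightarrow> exit_value (w \<omega>) ?y k = exit_value (w\<^sub>1 \<omega>) ?y k"
        by (rule exit_value_mono[OF y that]; use w0 in \<open>auto simp: w_def w\<^sub>1_def grid_weights_def c\<^sub>1_def\<close>)+
    qed
    obtain k' where k': "k' \<in> exit_points ?y" "k' \<le> int s"
      "\<And>k. k \<in> exit_points ?y \<Longrightarrow> int s < k \<Longrightarrow> exit_value (w \<omega>) ?y k \<le> exit_value (w \<omega>) ?y k'"
      using ev(1) by (auto simp: small_exit_def)
    have w10: "w\<^sub>1 \<omega> 0 = 0" "w\<^sub>2 \<omega> 0 = 0" by (simp_all add: w\<^sub>1_def w\<^sub>2_def grid_weights_def)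
    obtain k where k: "k \<in> exit_points ?y" "G\<^sub>1 \<omega> = exit_value (w\<^sub>1 \<omega>) ?y k"
      using lpp_exit_attained[OF y, of "w\<^sub>1 \<omega>"] w10(1) unfolding G\<^sub>1_def by blast
    obtain k'' where k'': "k'' \<in> exit_points ?y" "k'' \<le> int s" "G\<^sub>1 \<omega> \<le> exit_value (w\<^sub>1 \<omega>) ?y k''"
    proof (cases "k \<le> int s")
      case True
      then show ?thesis using that k by auto
    next
      case False
      then have "G\<^sub>1 \<omega> \<le> exit_value (w\<^sub>1 \<omega>) ?y k'"
        using k mono(2)[OF k(1)] k'(3)[OF k(1)] mono(1)[OF k'(1)] by simp
      then show ?thesis using that k' by auto
    qed
    have l: "lpp (w\<^sub>1 \<omega>) (i, j) ?y = lpp (w\<^sub>2 \<omega>) (i, j) ?y" if "0 < i" "0 < j" for i j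
      by (rule lpp_cong) (use that in \<open>auto simp: w\<^sub>1_def w\<^sub>2_def grid_weights_def c\<^sub>1_def c\<^sub>2_def le_prod_iff\<close>)
    have "exit_value (w\<^sub>1 \<omega>) ?y k'' \<le> exit_value (w\<^sub>2 \<omega>) ?y k'' + d * L"
    proof (cases "0 < k''")
      case True
      have "(\<Sum>i=1..k''. w\<^sub>1 \<omega> (i, 0)) - (\<Sum>i=1..k''. w\<^sub>2 \<omega> (i, 0)) = (\<Sum>i=1..k''. d * X (HI (nat i)) \<omega>)"
        unfolding sum_subtractf[symmetric] d(2)[symmetric]
        by (intro sum.cong) (auto simp: w\<^sub>1_def w\<^sub>2_def grid_weights_def c\<^sub>1_def c\<^sub>2_def left_diff_distrib)
      also have "\<dots> = d * (\<Sum>i=1..k''. X (HI (nat i)) \<omega>)" by (simp add: sum_distrib_left)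
      also have "(\<Sum>i=1..k''. X (HI (nat i)) \<omega>) = (\<Sum>i=1..nat k''. X (HI i) \<omega>)"
        by (rule sum.reindex_bij_witness[of _ int nat]) auto
      also have "\<dots> \<le> (\<Sum>i=1..s. X (HI i) \<omega>)"
        using k''(2) True nn s by (intro sum_mono2) auto
      also have "d * \<dots> \<le> d * L" using ev(2) d(1) by (intro mult_left_mono) auto
      finally show ?thesis using True l d(1) by (simp add: exit_value_def mult_left_mono)
    next
      case False
      have "w\<^sub>1 \<omega> (0, j) = w\<^sub>2 \<omega> (0, j)" for j by (simp add: w\<^sub>1_def w\<^sub>2_def grid_weights_def c\<^sub>1_def c\<^sub>2_def)
      then show ?thesis using False l k''(1) d(1) L by (auto simp: exit_value_def exit_points_def)
    qed
    also have "exit_value (w\<^sub>2 \<omega>) ?y k'' \<le> G\<^sub>2 \<omega>"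
      using exit_value_le_lpp[of ?y "w\<^sub>2 \<omega>" k''] y w10(2) k''(1) unfolding G\<^sub>2_def by blast
    finally show ?thesis using k''(3) by simp
  qed
  define b where "b = sqrt (exp (t * (d * L)) * E\<^sub>2 / E\<^sub>1)"
  have b: "0 < b" using E by (simp add: b_def)
  define g where "g = ln b / t"
  have g: "t * g = ln b" using t by (simp add: g_def)
  let ?A = "{\<omega> \<in> space M. small_exit (w \<omega>) ?y (int s) \<and> (\<Sum>i=1..s. X (HI i) \<omega>) < L}"
  let ?B\<^sub>1 = "{\<omega> \<in> space M. - ln b \<le> - t * G\<^sub>1 \<omega>}" and ?B\<^sub>2 = "{\<omega> \<in> space M. ln b - t * (d * L) \<le> t * G\<^sub>2 \<omega>}"
  have "emeasure M ?A \<le> emeasure M (?B\<^sub>1 \<union> ?B\<^sub>2)"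
  proof (rule emeasure_mono_AE)
    show "AE \<omega> in M. \<omega> \<in> ?A \<longrightarrow> \<omega> \<in> ?B\<^sub>1 \<union> ?B\<^sub>2"
      using exp_family_AE_nonneg[OF X]
    proof eventually_elim
      case (elim \<omega>)
      show ?case
      proof
        assume A: "\<omega> \<in> ?A"
        then have "t * G\<^sub>1 \<omega> \<le> t * (G\<^sub>2 \<omega> + d * L)" using incl[OF elim] t by (intro mult_left_mono) auto
        then have "t * G\<^sub>1 \<omega> \<le> ln b \<or> ln b \<le> t * G\<^sub>2 \<omega> + t * (d * L)" by (simp add: distrib_left) linarith
        then show "\<omega> \<in> ?B\<^sub>1 \<union> ?B\<^sub>2" using A by auto
      qed
    qed
  qed measurable
  also have "\<dots> \<le> emeasure M ?B\<^sub>1 + emeasure M ?B\<^sub>2" by (rule emeasure_subadditive) measurable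
  also have "\<dots> \<le> ennreal (exp (- (- ln b)) * E\<^sub>1) + ennreal (exp (- (ln b - t * (d * L))) * E\<^sub>2)"
    by (intro add_mono exponential_Markov eq_refl[OF I1] eq_refl[OF I2]) (use E in auto)
  also have "\<dots> = ennreal (b * E\<^sub>1 + exp (t * (d * L)) * E\<^sub>2 / b)"
    using E b by (simp add: exp_diff exp_minus inverse_eq_divide flip: ennreal_plus)
  also have "b * E\<^sub>1 + exp (t * (d * L)) * E\<^sub>2 / b = 2 * sqrt (exp (t * (d * L)) * (E\<^sub>1 * E\<^sub>2))"
  proof -
    define e where "e = exp (t * (d * L))"
    have e: "0 < e" by (simp add: e_def)
    have b2: "b\<^sup>2 = e * E\<^sub>2 / E\<^sub>1" using E e unfolding b_def e_def[symmetric] by simp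
    have "b * E\<^sub>1 = sqrt (e * (E\<^sub>1 * E\<^sub>2))"
      using E b by (intro real_sqrt_unique[symmetric]) (simp_all add: power_mult_distrib b2, simp add: power2_eq_square)
    moreover have "e * E\<^sub>2 / b = sqrt (e * (E\<^sub>1 * E\<^sub>2))"
      using E e b by (intro real_sqrt_unique[symmetric]) (simp_all add: power_divide b2, simp add: power2_eq_square)
    ultimately show ?thesis by (simp add: e_def)
  qed
  also have "E\<^sub>1 * E\<^sub>2 = (1 - (t / (1 - u))\<^sup>2) ^ m / (1 - (t / u)\<^sup>2) ^ n"
  proof -
    have "(1 - u - t) / (1 - u) * ((1 - u + t) / (1 - u)) = 1 - (t / (1 - u))\<^sup>2"
    proof -
      have "(1 - u - t) * (1 - u + t) = (1 - u)\<^sup>2 - t\<^sup>2" by (simp add: power2_eq_square algebra_simps)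
      then have "(1 - u - t) / (1 - u) * ((1 - u + t) / (1 - u)) = ((1 - u)\<^sup>2 - t\<^sup>2) / (1 - u)\<^sup>2"
        by (simp add: times_divide_times_eq power2_eq_square)
      also have "\<dots> = 1 - (t / (1 - u))\<^sup>2" using u by (simp add: diff_divide_distrib power_divide)
      finally show ?thesis .
    qed
    moreover have "u / (u + t) * (u / (u - t)) = 1 / (1 - (t / u)\<^sup>2)"
    proof -
      have "(u + t) * (u - t) = u\<^sup>2 - t\<^sup>2" by (simp add: power2_eq_square algebra_simps)
      then have "u / (u + t) * (u / (u - t)) = u\<^sup>2 / (u\<^sup>2 - t\<^sup>2)"
        by (simp add: times_divide_times_eq power2_eq_square)
      moreover have "1 - (t / u)\<^sup>2 = (u\<^sup>2 - t\<^sup>2) / u\<^sup>2" using u by (simp add: diff_divide_distrib power_divide)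
      ultimately show ?thesis by simp
    qed
    moreover have "E\<^sub>1 * E\<^sub>2 = ((1 - u - t) / (1 - u) * ((1 - u + t) / (1 - u))) ^ m * (u / (u + t) * (u / (u - t))) ^ n"
      unfolding E\<^sub>1_def E\<^sub>2_def by (simp only: power_mult_distrib mult_ac)
    ultimately show ?thesis by (simp add: power_one_over divide_inverse power_inverse)
  qed
  finally show ?thesis by (simp add: w_def d_def)
qed

text \<open>
  The first \<open>s\<close> horizontal weights sum to more than \<open>4 s / (1 - p)\<close> with probability at most
  \<open>exp (- s)\<close>. In the remaining exponent the difference \<open>n / u\<^sup>2 - m / (1 - u)\<^sup>2\<close> measures how far the
  endpoint lies from the characteristic direction of \<open>u\<close>.
\<close>

lemma exit_bound:
  fixes p t :: real
  assumes X: "exp_family M (grid_slots m n) (grid_rate (1 - p) p) X"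
    and mn: "1 \<le> m" "1 \<le> n" and s: "s \<le> m" and p: "p < 1" and t: "0 < t" "2 * t < p"
  defines "u \<equiv> p - t"
  assumes tu: "2 * t \<le> u"
  shows "emeasure M {\<omega> \<in> space M. small_exit (slot_weights (\<lambda>k. X k \<omega>)) (int m, int n) (int s)}
    \<le> ennreal (exp (- real s) + 2 * exp (4 * real s * t\<^sup>2 / (1 - p)\<^sup>2 - m * t\<^sup>2 / (2 * (1 - u)\<^sup>2) +
        n * t\<^sup>2 / (2 * u\<^sup>2) + n * t ^ 4 / u ^ 4))"
proof -
  note D = exp_familyD[OF X]
  have u: "0 < u" "t < u" "0 < 1 - u" "u < 1" "t < 1 - u" "u + t = p" "1 - p \<le> 1 - u + t" using t p by (auto simp: u_def)
  define L where "L = 4 * real s / (1 - p)"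
  have L: "0 \<le> L" using p by (simp add: L_def)
  let ?S = "\<lambda>\<omega>. small_exit (slot_weights (\<lambda>k. X k \<omega>)) (int m, int n) (int s)"
  let ?A = "{\<omega> \<in> space M. ?S \<omega> \<and> (\<Sum>i=1..s. X (HI i) \<omega>) < L}"
  have sumHI: "(\<Sum>i=1..s. X (HI i) \<omega>) = (\<Sum>k\<in>HI ` {1..s}. X k \<omega>)" for \<omega>
    by (subst sum.reindex) (auto simp: inj_on_def)
  have card: "card (HI ` {1..s}) = s" by (subst card_image) (auto simp: inj_on_def)
  let ?T = "{\<omega> \<in> space M. L \<le> (\<Sum>i=1..s. X (HI i) \<omega>)}"
  have mS: "(\<lambda>\<omega>. \<Sum>i=1..s. X (HI i) \<omega>) \<in> borel_measurable M"
    using s D(4) by (intro borel_measurable_sum) auto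
  have m1: "{\<omega> \<in> space M. ?S \<omega>} \<in> sets M"
    by (rule sets_small_exit, rule measurable_grid_weights[where m=m and n=n]) (use D(4) mn in \<open>auto simp: pos_quadrant_def\<close>)
  have m2: "{\<omega> \<in> space M. (\<Sum>i=1..s. X (HI i) \<omega>) < L} \<in> sets M" "?T \<in> sets M"
    using mS by measurable
  have "?A = {\<omega> \<in> space M. ?S \<omega>} \<inter> {\<omega> \<in> space M. (\<Sum>i=1..s. X (HI i) \<omega>) < L}" by auto
  then have m3: "?A \<in> sets M" using m1 m2 by simp
  have tail: "emeasure M ?T \<le> ennreal (exp (- real s))"
  proof -
    have "HI ` {1..s} \<subseteq> grid_slots m n" "\<And>k. k \<in> HI ` {1..s} \<Longrightarrow> grid_rate (1 - p) p k = 1 - p"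
      using s by auto
    from exponential_sum_tail[OF X this] show ?thesis
      using p unfolding card sumHI L_def by simp
  qed
  have "emeasure M {\<omega> \<in> space M. ?S \<omega>} \<le> emeasure M (?T \<union> ?A)"
    using m2 m3 by (intro emeasure_mono) auto
  also have "\<dots> \<le> emeasure M ?T + emeasure M ?A" using m2 m3 by (intro emeasure_subadditive) auto
  also have "\<dots> \<le> ennreal (exp (- real s)) + ennreal (2 * sqrt (exp (t * (2 * t / (1 - u + t) * L)) *
        ((1 - (t / (1 - u))\<^sup>2) ^ m / (1 - (t / u)\<^sup>2) ^ n)))"
    using exit_bound_raw[OF X mn s p t L] unfolding u_def by (intro add_mono tail) auto
  also have "\<dots> \<le> ennreal (exp (- real s)) + ennreal (2 * exp (4 * real s * t\<^sup>2 / (1 - p)\<^sup>2 - m * t\<^sup>2 / (2 * (1 - u)\<^sup>2) +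
        n * t\<^sup>2 / (2 * u\<^sup>2) + n * t ^ 4 / u ^ 4))"
  proof (intro add_left_mono ennreal_leI mult_left_mono)
    define z where "z = (t / u)\<^sup>2"
    define x where "x = (t / (1 - u))\<^sup>2"
    have z: "0 \<le> z" "z \<le> 1 / 2"
    proof -
      have "t / u \<le> 1 / 2" using tu u by (simp add: field_simps)
      then have "(t / u)\<^sup>2 \<le> (1 / 2)\<^sup>2" using t u by (intro power_mono) auto
      then have "z \<le> (1 / 2)\<^sup>2" by (simp only: z_def)
      then show "z \<le> 1 / 2" by (simp add: power2_eq_square)
    qed (simp add: z_def)
    have x: "0 \<le> x" "x < 1" using u t by (auto simp: x_def power_less_one_iff abs_square_less_1)
    have "1 - x \<le> exp (- x)" using exp_ge_add_one_self[of "- x"] by simp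
    then have "(1 - x) ^ m \<le> exp (- x) ^ m" using x by (intro power_mono) auto
    then have x1: "(1 - x) ^ m \<le> exp (- (m * x))" by (simp add: exp_of_nat_mult[symmetric])
    have "- z - 2 * z\<^sup>2 \<le> ln (1 - z)" by (rule ln_one_minus_pos_lower_bound) (use z in auto)
    then have "exp (- z - 2 * z\<^sup>2) \<le> 1 - z" using z by (metis exp_le_cancel_iff exp_ln diff_gt_0_iff_gt le_less_trans less_numeral_extra(1) one_less_numeral_iff semiring_norm(76) divide_less_eq_1_pos zero_less_numeral)
    then have "exp (- z - 2 * z\<^sup>2) ^ n \<le> (1 - z) ^ n" by (intro power_mono) auto
    then have z1: "exp (- (n * (z + 2 * z\<^sup>2))) \<le> (1 - z) ^ n"
      by (simp add: exp_of_nat_mult[symmetric] algebra_simps)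
    have "t * (2 * t / (1 - u + t) * L) \<le> t * (2 * t / (1 - p) * L)"
      using t p L u by (intro mult_left_mono mult_right_mono divide_left_mono) auto
    also have "\<dots> = 2 * (4 * real s * t\<^sup>2 / (1 - p)\<^sup>2)" by (simp add: L_def power2_eq_square)
    finally have "exp (t * (2 * t / (1 - u + t) * L)) * ((1 - x) ^ m / (1 - z) ^ n) \<le>
      exp (2 * (4 * real s * t\<^sup>2 / (1 - p)\<^sup>2)) * (exp (- (m * x)) / exp (- (n * (z + 2 * z\<^sup>2))))"
      using x z by (intro mult_mono frac_le x1 z1) (auto intro: divide_nonneg_nonneg)
    also have "\<dots> = exp (2 * (4 * real s * t\<^sup>2 / (1 - p)\<^sup>2 - m * x / 2 + n * z / 2 + n * z\<^sup>2))"
      by (simp add: exp_diff[symmetric] exp_add[symmetric] algebra_simps)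
    also have "m * x / 2 = m * t\<^sup>2 / (2 * (1 - u)\<^sup>2)" by (simp add: x_def power_divide)
    also have "n * z / 2 = n * t\<^sup>2 / (2 * u\<^sup>2)" by (simp add: z_def power_divide)
    also have "n * z\<^sup>2 = n * t ^ 4 / u ^ 4" by (simp add: z_def power_divide flip: power_mult)
    finally have "sqrt (exp (t * (2 * t / (1 - u + t) * L)) * ((1 - x) ^ m / (1 - z) ^ n)) \<le>
      sqrt (exp (2 * (4 * real s * t\<^sup>2 / (1 - p)\<^sup>2 - m * t\<^sup>2 / (2 * (1 - u)\<^sup>2) + n * t\<^sup>2 / (2 * u\<^sup>2) + n * t ^ 4 / u ^ 4)))"
      by (rule real_sqrt_le_mono)
    also have "\<dots> = exp (4 * real s * t\<^sup>2 / (1 - p)\<^sup>2 - m * t\<^sup>2 / (2 * (1 - u)\<^sup>2) + n * t\<^sup>2 / (2 * u\<^sup>2) + n * t ^ 4 / u ^ 4)"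
      by (rule real_sqrt_unique[OF exp_double[symmetric]]) simp
    finally show "sqrt (exp (t * (2 * t / (1 - u + t) * L)) * ((1 - (t / (1 - u))\<^sup>2) ^ m / (1 - (t / u)\<^sup>2) ^ n)) \<le>
      exp (4 * real s * t\<^sup>2 / (1 - p)\<^sup>2 - m * t\<^sup>2 / (2 * (1 - u)\<^sup>2) + n * t\<^sup>2 / (2 * u\<^sup>2) + n * t ^ 4 / u ^ 4)"
      by (simp add: x_def z_def)
  qed simp
  also have "\<dots> = ennreal (exp (- real s) + 2 * exp (4 * real s * t\<^sup>2 / (1 - p)\<^sup>2 - m * t\<^sup>2 / (2 * (1 - u)\<^sup>2) +
        n * t\<^sup>2 / (2 * u\<^sup>2) + n * t ^ 4 / u ^ 4))"
    by (rule ennreal_plus[symmetric]) auto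
  finally show ?thesis .
qed

section \<open>Optimal exits and monotonicity\<close>

definition exit_site :: "int \<Rightarrow> int \<times> int" where
  "exit_site k = (if 0 < k then (k, 1) else (1, - k))"

definition exit_weight :: "(int \<times> int \<Rightarrow> real) \<Rightarrow> int \<Rightarrow> real" where
  "exit_weight w k = (if 0 < k then \<Sum>i=1..k. w (i, 0) else \<Sum>j=1..-k. w (0, j))"

lemma exit_value_eq: "exit_value w y k = exit_weight w k + lpp w (exit_site k) y"
  by (simp add: exit_value_def exit_weight_def exit_site_def)

lemma exit_site_le:
  "k \<in> exit_points y \<Longrightarrow> y \<in> pos_quadrant \<Longrightarrow> exit_site k \<le> y"
  by (auto simp: exit_site_def exit_points_def pos_quadrant_def le_prod_iff)

lemma exit_value_crossing:
  assumes "j < k" "fst b \<le> fst b'" "snd b' \<le> snd b" "j \<in> exit_points b'" "k \<in> exit_points b"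
    "b \<in> pos_quadrant" "b' \<in> pos_quadrant"
  shows "exit_value w b' j + exit_value w b k \<le> exit_value w b j + exit_value w b' k"
proof -
  have "fst (exit_site j) \<le> fst (exit_site k)" "snd (exit_site k) \<le> snd (exit_site j)"
    using assms by (auto simp: exit_site_def exit_points_def)
  from crossing[OF this assms(2,3), of w] exit_site_le[OF assms(4,7)] exit_site_le[OF assms(5,6)]
  show ?thesis by (simp add: exit_value_eq)
qed

text \<open>
  Ties are allowed, so a point may have several optimal exits.
\<close>

definition opt_exit :: "(int \<times> int \<Rightarrow> real) \<Rightarrow> int \<times> int \<Rightarrow> int \<Rightarrow> bool" where
  "opt_exit w y e \<longleftrightarrow> e \<in> exit_points y \<and> (\<forall>j\<in>exit_points y. exit_value w y j \<le> exit_value w y e)"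

text \<open>
  The last step of the geodesic from the exit to \<open>z\<close> can be removed: the value of exit \<open>e\<close> drops by
  exactly \<open>w z\<close> and that of every other exit by at least that. Iterating, the path enters
  the rectangle through its north-east boundary.
\<close>

lemma opt_exit_boundary:
  assumes "opt_exit w z e" "z \<in> pos_quadrant" "\<not> (fst z \<le> m \<and> snd z \<le> n)" "1 \<le> e" "e \<le> m" "1 \<le> n"
  shows "\<exists>p. (fst p = m \<and> 1 \<le> snd p \<and> snd p \<le> n \<or> snd p = n \<and> e \<le> fst p \<and> fst p \<le> m) \<and> opt_exit w p e"
  using assms(1-3)
proof (induction "nat (fst z + snd z)" arbitrary: z rule: less_induct)
  case less
  have e: "exit_site e = (e, 1)" using assms(4) by (simp add: exit_site_def)
  have le: "(e, 1) \<le> z" using exit_site_le[of e z] less.prems e by (simp add: opt_exit_def)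
  have ne: "(e, 1) \<noteq> z" using less.prems(3) assms(5,6) by auto
  obtain s where s: "s \<in> {e1, e2}" "(e, 1) \<le> z - s" "lpp w (e, 1) z = lpp w (e, 1) (z - s) + w z"
    by (rule lpp_last_step[OF le ne])
  have pq: "z - s \<in> pos_quadrant" using s(2) assms(4) by (auto simp: le_prod_iff pos_quadrant_def)
  have opt: "opt_exit w (z - s) e"
    unfolding opt_exit_def
  proof (intro conjI ballI)
    show "e \<in> exit_points (z - s)" using s(2) assms(4) by (auto simp: exit_points_def le_prod_iff)
    fix j assume j: "j \<in> exit_points (z - s)"
    then have jz: "j \<in> exit_points z" using s(1) by (auto simp: exit_points_def e1_def e2_def)
    have "lpp w (exit_site j) (z - s) + w z \<le> lpp w (exit_site j) z"
      by (rule lpp_last_step_ge[OF s(1) exit_site_le[OF j pq]])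
    moreover have "exit_value w z j \<le> exit_value w z e" using less.prems(1) jz by (simp add: opt_exit_def)
    ultimately show "exit_value w (z - s) j \<le> exit_value w (z - s) e"
      using s(3) by (simp add: exit_value_eq e)
  qed
  show ?case
  proof (cases "fst (z - s) \<le> m \<and> snd (z - s) \<le> n")
    case True
    then have "fst (z - s) = m \<or> snd (z - s) = n"
      using less.prems(3) s(1) by (auto simp: e1_def e2_def)
    then show ?thesis using True opt s(2) pq
      by (intro exI[of _ "z - s"]) (auto simp: pos_quadrant_def le_prod_iff)
  next
    case False
    have "nat (fst (z - s) + snd (z - s)) < nat (fst z + snd z)"
      using s(1) less.prems(2) by (auto simp: e1_def e2_def pos_quadrant_def)
    from less.hyps[OF this opt pq False] show ?thesis .
  qed
qed

text \<open>
  Moving the endpoint to the north-west moves exits to the left, by crossing of paths.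
\<close>

lemma small_exit_mono:
  assumes "small_exit w b' s" "fst b \<le> fst b'" "snd b' \<le> snd b" "b \<in> pos_quadrant" "b' \<in> pos_quadrant"
    "0 \<le> s" "s \<le> fst b"
  shows "small_exit w b s"
proof -
  obtain k' where k': "k' \<in> exit_points b'" "k' \<le> s"
    "\<And>k. k \<in> exit_points b' \<Longrightarrow> s < k \<Longrightarrow> exit_value w b' k \<le> exit_value w b' k'"
    using assms(1) by (auto simp: small_exit_def)
  have k'b: "k' \<in> exit_points b" using k' assms by (auto simp: exit_points_def)
  moreover have "exit_value w b k \<le> exit_value w b k'" if "k \<in> exit_points b" "s < k" for k
  proof -
    have "k \<in> exit_points b'" using that assms by (auto simp: exit_points_def)
    from k'(3)[OF this that(2)] exit_value_crossing[of k' k b b' w] that k' assms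
    show ?thesis by linarith
  qed
  ultimately show ?thesis using k'(2) by (auto simp: small_exit_def)
qed

lemma large_exit_attained:
  assumes "\<not> small_exit w b s" "b \<in> pos_quadrant" "w 0 = 0"
  obtains k where "k \<in> exit_points b" "s < k" "lpp w 0 b = exit_value w b k"
proof -
  obtain k where k: "k \<in> exit_points b" "lpp w 0 b = exit_value w b k"
    using lpp_exit_attained[of b w] assms by blast
  have "s < k"
  proof (rule ccontr)
    assume "\<not> s < k"
    then have "small_exit w b s"
      using k exit_value_le_lpp[of b w] assms by (auto simp: small_exit_def intro!: bexI[of _ k])
    then show False using assms by simp
  qed
  then show ?thesis using that k by blast
qed

text \<open>
  The stationary geodesic to \<open>b\<close> leaves the axis to the right of \<open>P\<close>, so paths from \<open>P\<close> to the right
  neighbour of \<open>b\<close> cross it, and horizontal increments seen from \<open>P\<close> are dominated by the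
  stationary ones. One point \<open>b\<^sub>0\<close> to the north-west of all the \<open>b\<close> controls them at once.
\<close>

lemma stationary_horizontal_upper:
  assumes ns: "\<not> small_exit w b\<^sub>0 s" and w: "w 0 = 0"
    and b: "b\<^sub>0 \<in> pos_quadrant" "fst b\<^sub>0 \<le> fst b" "snd b \<le> snd b\<^sub>0" "1 \<le> snd b"
    and s: "1 \<le> s" "s \<le> fst b\<^sub>0" and P: "fst P \<le> s" "1 \<le> snd P" "P \<le> b"
  shows "lpp w P (b + e1) - lpp w P b \<le> lpp w 0 (b + e1) - lpp w 0 b"
proof -
  have bq: "b \<in> pos_quadrant" "b + e1 \<in> pos_quadrant" using b by (auto simp: pos_quadrant_def e1_def)
  have "\<not> small_exit w b s" using small_exit_mono[of w b s b\<^sub>0] ns b bq s by auto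
  then obtain k where k: "k \<in> exit_points b" "s < k" "lpp w 0 b = exit_value w b k"
    using large_exit_attained[of w b s] bq(1) w by blast
  have site: "exit_site k = (k, 1)" using k s by (simp add: exit_site_def)
  have "k \<in> exit_points (b + e1)" using k by (auto simp: exit_points_def e1_def)
  then have "exit_value w (b + e1) k \<le> lpp w 0 (b + e1)" using exit_value_le_lpp[of "b + e1" w k] bq(2) w by blast
  then have "lpp w (k, 1) (b + e1) - lpp w (k, 1) b \<le> lpp w 0 (b + e1) - lpp w 0 b"
    using k(3) by (simp add: exit_value_eq site)
  moreover have "lpp w P (b + e1) + lpp w (k, 1) b \<le> lpp w P b + lpp w (k, 1) (b + e1)"
    by (rule crossing) (use k s P exit_site_le[OF k(1) bq(1)] site in \<open>auto simp: e1_def le_prod_iff\<close>)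
  ultimately show ?thesis by linarith
qed

text \<open>
  Crossing acts on vertical increments in the opposite direction.
\<close>

lemma stationary_vertical_lower:
  assumes ns: "\<not> small_exit w b\<^sub>0 s" and w: "w 0 = 0"
    and b: "b\<^sub>0 \<in> pos_quadrant" "fst b\<^sub>0 \<le> fst b" "snd b + 1 \<le> snd b\<^sub>0" "1 \<le> snd b"
    and s: "1 \<le> s" "s \<le> fst b\<^sub>0" and P: "fst P \<le> s" "1 \<le> snd P" "P \<le> b"
  shows "lpp w 0 (b + e2) - lpp w 0 b \<le> lpp w P (b + e2) - lpp w P b"
proof -
  have bq: "b \<in> pos_quadrant" "b + e2 \<in> pos_quadrant" using b by (auto simp: pos_quadrant_def e2_def)
  have "\<not> small_exit w (b + e2) s"
    using small_exit_mono[of w "b + e2" s b\<^sub>0] ns b bq s by (auto simp: e2_def)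
  then obtain k where k: "k \<in> exit_points (b + e2)" "s < k" "lpp w 0 (b + e2) = exit_value w (b + e2) k"
    using large_exit_attained[of w "b + e2" s] bq(2) w by blast
  have site: "exit_site k = (k, 1)" using k s by (simp add: exit_site_def)
  have kb: "k \<in> exit_points b" using k s by (auto simp: exit_points_def e2_def)
  then have "exit_value w b k \<le> lpp w 0 b" using exit_value_le_lpp[of b w k] bq(1) w by blast
  then have "lpp w 0 (b + e2) - lpp w 0 b \<le> lpp w (k, 1) (b + e2) - lpp w (k, 1) b"
    using k(3) by (simp add: exit_value_eq site)
  moreover have "lpp w P b + lpp w (k, 1) (b + e2) \<le> lpp w P (b + e2) + lpp w (k, 1) b"
    by (rule crossing) (use k s P exit_site_le[OF kb bq(1)] site in \<open>auto simp: e2_def le_prod_iff\<close>)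
  ultimately show ?thesis by linarith
qed

lemma lpp_swap_zero:
  assumes "y \<in> pos_quadrant"
  shows "lpp (\<lambda>z. w (prod.swap z)) 0 (prod.swap y) = lpp w 0 y"
  using lpp_swap[of 0 "prod.swap y" w] assms by (auto simp: le_prod_iff pos_quadrant_def zero_prod_def)

lemma stationary_vertical_upper:
  assumes ns: "\<not> small_exit (\<lambda>z. w (prod.swap z)) b\<^sub>0 s" and w: "w 0 = 0"
    and b: "b\<^sub>0 \<in> pos_quadrant" "fst b\<^sub>0 \<le> snd b" "fst b \<le> snd b\<^sub>0" "1 \<le> fst b"
    and s: "1 \<le> s" "s \<le> fst b\<^sub>0" and P: "snd P \<le> s" "1 \<le> fst P" "P \<le> b"
  shows "lpp w P (b + e2) - lpp w P b \<le> lpp w 0 (b + e2) - lpp w 0 b"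
proof -
  have sw: "prod.swap (b + e2) = prod.swap b + e1" by (simp add: prod_eq_iff e1_def e2_def)
  have bq: "b \<in> pos_quadrant" "b + e2 \<in> pos_quadrant" using b by (auto simp: pos_quadrant_def e2_def)
  have l: "lpp (\<lambda>z. w (prod.swap z)) (prod.swap P) (prod.swap y) = lpp w P y" if "P \<le> y" for y
    using lpp_swap[of "prod.swap P" "prod.swap y" w] that by (auto simp: le_prod_iff)
  have "P \<le> b + e2" using P by (auto simp: le_prod_iff e2_def)
  then show ?thesis
    using stationary_horizontal_upper[OF ns, of "prod.swap b" "prod.swap P"] w b s P
    unfolding sw[symmetric] lpp_swap_zero[OF bq(1)] lpp_swap_zero[OF bq(2)]
    by (auto simp: l zero_prod_def le_prod_iff)
qed

lemma stationary_horizontal_lower: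
  assumes ns: "\<not> small_exit (\<lambda>z. w (prod.swap z)) b\<^sub>0 s" and w: "w 0 = 0"
    and b: "b\<^sub>0 \<in> pos_quadrant" "fst b\<^sub>0 \<le> snd b" "fst b + 1 \<le> snd b\<^sub>0" "1 \<le> fst b"
    and s: "1 \<le> s" "s \<le> fst b\<^sub>0" and P: "snd P \<le> s" "1 \<le> fst P" "P \<le> b"
  shows "lpp w 0 (b + e1) - lpp w 0 b \<le> lpp w P (b + e1) - lpp w P b"
proof -
  have sw: "prod.swap (b + e1) = prod.swap b + e2" by (simp add: prod_eq_iff e1_def e2_def)
  have bq: "b \<in> pos_quadrant" "b + e1 \<in> pos_quadrant" using b by (auto simp: pos_quadrant_def e1_def)
  have l: "lpp (\<lambda>z. w (prod.swap z)) (prod.swap P) (prod.swap y) = lpp w P y" if "P \<le> y" for y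
    using lpp_swap[of "prod.swap P" "prod.swap y" w] that by (auto simp: le_prod_iff)
  have "P \<le> b + e1" using P by (auto simp: le_prod_iff e1_def)
  then show ?thesis
    using stationary_vertical_lower[OF ns, of "prod.swap b" "prod.swap P"] w b s P
    unfolding sw[symmetric] lpp_swap_zero[OF bq(1)] lpp_swap_zero[OF bq(2)]
    by (auto simp: l zero_prod_def le_prod_iff)
qed

text \<open>
  Seen from a boundary point \<open>p\<close> to the left of the fixed point \<open>b\<close>, a horizontal exit beats all vertical
  ones. Crossing preserves this when the endpoint moves right. So at \<open>b\<close> some horizontal exit is at least
  as good as every vertical one, which is unlikely if \<open>b\<close> is far to the left of the corner.
\<close>

lemma opt_exit_far_left:
  assumes o: "opt_exit w p e" and p: "snd p = snd b" "fst p \<le> fst b" "p \<in> pos_quadrant" "b \<in> pos_quadrant"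
    and e: "1 \<le> e" and s: "0 \<le> s"
  shows "small_exit (\<lambda>z. w (prod.swap z)) (prod.swap b) s"
proof -
  have eb: "e \<in> exit_points b" using o p e by (auto simp: opt_exit_def exit_points_def)
  have "exit_value (\<lambda>z. w (prod.swap z)) (prod.swap b) k \<le> exit_value (\<lambda>z. w (prod.swap z)) (prod.swap b) (- e)"
    if k: "k \<in> exit_points (prod.swap b)" "s < k" for k
  proof -
    have kb: "- k \<in> exit_points b" using k by (simp add: exit_points_swap)
    then have kp: "- k \<in> exit_points p" using p k s by (auto simp: exit_points_def)
    have "exit_value w b (- k) + exit_value w p e \<le> exit_value w p (- k) + exit_value w b e"
      by (rule exit_value_crossing) (use k s e p kb o in \<open>auto simp: opt_exit_def\<close>)
    moreover have "exit_value w p (- k) \<le> exit_value w p e" using o kp by (simp add: opt_exit_def)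
    ultimately have "exit_value w b (- k) \<le> exit_value w b e" by simp
    then show ?thesis using exit_value_swap[OF p(4) kb, of w] exit_value_swap[OF p(4) eb, of w] by simp
  qed
  then show ?thesis unfolding small_exit_def
    using eb e s by (intro bexI[of _ "- e"]) (auto simp: exit_points_swap)
qed

text \<open>
  The counterpart for points \<open>p\<close> below \<open>b\<close>: at \<open>b\<close> an exit of at most \<open>s\<close> beats all larger ones.
\<close>

lemma opt_exit_far_right:
  assumes o: "opt_exit w p e" and p: "fst p = fst b" "snd p \<le> snd b" "p \<in> pos_quadrant" "b \<in> pos_quadrant"
    and e: "1 \<le> e" "e \<le> s"
  shows "small_exit w b s"
proof -
  have "small_exit w p s" unfolding small_exit_def
    using o e by (intro bexI[of _ e]) (auto simp: opt_exit_def)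
  have eb: "e \<in> exit_points b" using o p e by (auto simp: opt_exit_def exit_points_def)
  have "exit_value w b k \<le> exit_value w b e" if k: "k \<in> exit_points b" "s < k" for k
  proof -
    have kp: "k \<in> exit_points p" using p k e by (auto simp: exit_points_def)
    have "exit_value w p e + exit_value w b k \<le> exit_value w b e + exit_value w p k"
      by (rule exit_value_crossing) (use k e p kp o in \<open>auto simp: opt_exit_def\<close>)
    moreover have "exit_value w p k \<le> exit_value w p e" using o kp by (simp add: opt_exit_def)
    ultimately show ?thesis by simp
  qed
  then show ?thesis unfolding small_exit_def
    using eb e by (intro bexI[of _ e]) auto
qed

section \<open>Two coupled stationary models\<close>

text \<open>
  Column cells are indexed upwards from 1, whereas the coupling of the two horizontal boundaries runs
  from \<open>m\<close> down to 1. Outside \<open>{1..m}\<close> the identity keeps the map injective on all naturals.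
\<close>

definition reverse_index :: "nat \<Rightarrow> nat \<Rightarrow> nat" where
  "reverse_index m j = (if 1 \<le> j \<and> j \<le> m then m + 1 - j else j)"

text \<open>
  The boundary of the \<open>\<mu>\<close>-model is produced from that of the \<open>\<lambda>\<close>-model by a chain of cells. It starts at
  the far end \<open>m\<close> of the horizontal boundary with the auxiliary increment \<open>WW\<close>, passes
  down to the origin, and up the vertical boundary. \<open>bridge x m (m - i)\<close> is the
  increment that links the two models in front of column \<open>i + 1\<close>; \<open>mu_h\<close> and \<open>mu_v\<close> are the resulting
  horizontal and vertical boundary weights.
\<close>

definition bridge :: "(slot \<Rightarrow> real) \<Rightarrow> nat \<Rightarrow> nat \<Rightarrow> real" where
  "bridge x m = column_h (x WW) (\<lambda>j. x (HI (reverse_index m j))) (\<lambda>j. x (VI (reverse_index m j)))"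

definition mu_h :: "(slot \<Rightarrow> real) \<Rightarrow> nat \<Rightarrow> nat \<Rightarrow> real" where
  "mu_h x m i = min (bridge x m (m - i)) (x (HI i))"

definition mu_v :: "(slot \<Rightarrow> real) \<Rightarrow> nat \<Rightarrow> nat \<Rightarrow> real" where
  "mu_v x m = column_v (bridge x m m) (\<lambda>j. x (AJ j)) (\<lambda>j. x (SJ j))"

definition all_slots :: "nat \<Rightarrow> nat \<Rightarrow> slot set" where
  "all_slots m n = HI ` {1..m} \<union> VI ` {1..m} \<union> {WW} \<union> SJ ` {1..n} \<union> AJ ` {1..n} \<union>
     case_prod OM ` ({1..m} \<times> {1..n}) \<union> BI ` {1..m} \<union> BJ ` {1..n}"

text \<open>
  The rates satisfy the additive relation required at every cell:
  \<open>1 - \<mu> = (\<lambda> - \<mu>) + (1 - \<lambda>)\<close>, \<open>\<lambda> = (\<lambda> - \<mu>) + \<mu>\<close> and \<open>1 = (1 - \<lambda>) + \<lambda> = (1 - \<mu>) + \<mu>\<close>.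
\<close>

definition slot_rate :: "real \<Rightarrow> real \<Rightarrow> real \<Rightarrow> slot \<Rightarrow> real" where
  "slot_rate \<rho> la mu k = (case k of HI _ \<Rightarrow> 1 - la | VI _ \<Rightarrow> 1 - mu | WW \<Rightarrow> la - mu | SJ _ \<Rightarrow> la | AJ _ \<Rightarrow> mu
     | OM _ _ \<Rightarrow> 1 | BI _ \<Rightarrow> 1 - \<rho> | BJ _ \<Rightarrow> \<rho>)"

lemma slot_rate_simps [simp]:
  "slot_rate \<rho> la mu (HI i) = 1 - la" "slot_rate \<rho> la mu (VI i) = 1 - mu" "slot_rate \<rho> la mu WW = la - mu"
  "slot_rate \<rho> la mu (SJ j) = la" "slot_rate \<rho> la mu (AJ j) = mu" "slot_rate \<rho> la mu (OM i j) = 1"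
  "slot_rate \<rho> la mu (BI i) = 1 - \<rho>" "slot_rate \<rho> la mu (BJ j) = \<rho>"
  by (simp_all add: slot_rate_def)

lemma mem_all_slots [simp]:
  "HI i \<in> all_slots m n \<longleftrightarrow> 1 \<le> i \<and> i \<le> m" "VI i \<in> all_slots m n \<longleftrightarrow> 1 \<le> i \<and> i \<le> m"
  "WW \<in> all_slots m n" "SJ j \<in> all_slots m n \<longleftrightarrow> 1 \<le> j \<and> j \<le> n" "AJ j \<in> all_slots m n \<longleftrightarrow> 1 \<le> j \<and> j \<le> n"
  "OM i j \<in> all_slots m n \<longleftrightarrow> 1 \<le> i \<and> i \<le> m \<and> 1 \<le> j \<and> j \<le> n"
  "BI i \<in> all_slots m n \<longleftrightarrow> 1 \<le> i \<and> i \<le> m" "BJ j \<in> all_slots m n \<longleftrightarrow> 1 \<le> j \<and> j \<le> n"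
  by (auto simp: all_slots_def)

lemma reverse_index_simps: "1 \<le> j \<Longrightarrow> j \<le> m \<Longrightarrow> reverse_index m j = m + 1 - j" by (simp add: reverse_index_def)

lemma inj_reverse_index: "inj (reverse_index m)" unfolding inj_def reverse_index_def by auto

lemma inj_slot_reverse_index: "inj (\<lambda>j. HI (reverse_index m j))" "inj (\<lambda>j. VI (reverse_index m j))"
proof -
  have "j = j'" if "reverse_index m j = reverse_index m j'" for j j' using inj_reverse_index that by (rule injD)
  then show "inj (\<lambda>j. HI (reverse_index m j))" "inj (\<lambda>j. VI (reverse_index m j))" by (intro injI; simp)+
qed

lemma bridge_rec:
  assumes "i < m"
  shows "bridge x m (m - i) = x (VI (Suc i)) + max 0 (bridge x m (m - Suc i) - x (HI (Suc i)))"
proof -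
  have e: "m - i = Suc (m - Suc i)" using assms by simp
  have r: "reverse_index m (Suc (m - Suc i)) = Suc i" using assms by (simp add: reverse_index_def)
  show ?thesis unfolding e bridge_def column_h.simps r ..
qed

lemma grid_v_coupled:
  assumes "i \<le> m"
  shows "grid_v (mu_h x m) (mu_v x m) Om i =
    column_v (bridge x m (m - i)) (grid_v (\<lambda>i. x (VI i)) (\<lambda>j. x (AJ j)) (grid_dual (\<lambda>i. x (HI i)) (\<lambda>j. x (SJ j)) Om) i)
      (grid_v (\<lambda>i. x (HI i)) (\<lambda>j. x (SJ j)) Om i)"
  using grid_v_braid[of m "\<lambda>i. bridge x m (m - i)" "\<lambda>i. x (VI i)" "\<lambda>i. x (HI i)" "mu_h x m" i, OF bridge_rec _ assms]
  by (simp add: mu_h_def mu_v_def)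

lemma grid_v_add:
  "grid_v (\<lambda>i. H (q + i)) (grid_v H V Om q) (\<lambda>i. Om (q + i)) i = grid_v H V Om (q + i)"
  by (induction i) auto

lemma grid_h_add:
  assumes "1 \<le> i"
  shows "grid_h (\<lambda>i. H (q + i)) (grid_v H V Om q) (\<lambda>i. Om (q + i)) i j = grid_h H V Om (q + i) j"
proof -
  have "q + i - 1 = q + (i - 1)" using assms by simp
  then show ?thesis unfolding grid_h_def grid_v_add by simp
qed

lemma coupled_input_law:
  assumes X: "exp_family M (all_slots m n) (slot_rate \<rho> la mu) X"
  shows "exp_family M (grid_slots m n) (grid_rate (1 - mu) mu)
    (\<lambda>k \<omega>. case k of HI i \<Rightarrow> mu_h (\<lambda>k. X k \<omega>) m i | SJ j \<Rightarrow> mu_v (\<lambda>k. X k \<omega>) m j | _ \<Rightarrow> X k \<omega>)"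
proof -
  let ?K = "all_slots m n" and ?r = "slot_rate \<rho> la mu"
  define Y where "Y = (\<lambda>k \<omega>. case k of WW \<Rightarrow> bridge (\<lambda>k. X k \<omega>) m m
    | HI i \<Rightarrow> (if 1 \<le> i \<and> i \<le> m then column_v (X WW \<omega>) (\<lambda>j. X (HI (reverse_index m j)) \<omega>) (\<lambda>j. X (VI (reverse_index m j)) \<omega>) (m + 1 - i) else X k \<omega>)
    | VI i \<Rightarrow> (if 1 \<le> i \<and> i \<le> m then mu_h (\<lambda>k. X k \<omega>) m i else X k \<omega>) | _ \<Rightarrow> X k \<omega>)"
  have Y: "exp_family M ?K ?r Y"
  proof (rule exp_family_column[OF X, where h=WW and n=m and v="\<lambda>j. HI (reverse_index m j)" and c="\<lambda>j. VI (reverse_index m j)"])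
    fix k \<omega> assume k: "k \<in> ?K" "k \<noteq> WW" "k \<notin> (\<lambda>j. HI (reverse_index m j)) ` {1..m}" "k \<notin> (\<lambda>j. VI (reverse_index m j)) ` {1..m}"
    have "HI i \<in> (\<lambda>j. HI (reverse_index m j)) ` {1..m}" "VI i \<in> (\<lambda>j. VI (reverse_index m j)) ` {1..m}" if "1 \<le> i" "i \<le> m" for i
      using that by (auto intro!: image_eqI[of _ _ "m + 1 - i"] simp: reverse_index_def)
    then show "Y k \<omega> = X k \<omega>" using k by (auto simp: Y_def split: slot.splits)
  qed (use inj_slot_reverse_index in \<open>simp_all add: reverse_index_simps Y_def bridge_def mu_h_def column_dual_def, (fastforce+)?\<close>)
  define Z where "Z = (\<lambda>k \<omega>. case k of WW \<Rightarrow> column_h (Y WW \<omega>) (\<lambda>j. Y (AJ j) \<omega>) (\<lambda>j. Y (SJ j) \<omega>) n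
    | AJ j \<Rightarrow> (if 1 \<le> j \<and> j \<le> n then mu_v (\<lambda>k. X k \<omega>) m j else Y k \<omega>)
    | SJ j \<Rightarrow> (if 1 \<le> j \<and> j \<le> n then column_dual (Y WW \<omega>) (\<lambda>j. Y (AJ j) \<omega>) (\<lambda>j. Y (SJ j) \<omega>) j else Y k \<omega>)
    | _ \<Rightarrow> Y k \<omega>)"
  have Z: "exp_family M ?K ?r Z"
  proof (rule exp_family_column[OF Y, where h=WW and n=n and v=AJ and c=SJ])
    fix k \<omega> assume "k \<in> ?K" "k \<noteq> WW" "k \<notin> AJ ` {1..n}" "k \<notin> SJ ` {1..n}"
    then show "Z k \<omega> = Y k \<omega>" by (auto simp: Z_def split: slot.splits)
  qed (auto simp: Z_def Y_def mu_v_def inj_def)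
  define g where "g = (\<lambda>k. case k of HI i \<Rightarrow> VI i | SJ j \<Rightarrow> AJ j | _ \<Rightarrow> k)"
  have "exp_family M (grid_slots m n) (\<lambda>k. ?r (g k)) (\<lambda>k. Z (g k))"
    by (rule exp_family_reindex[OF Z]) (auto simp: g_def grid_slots_def inj_on_def)
  then show ?thesis
    by (rule exp_family_cong) (auto simp: g_def grid_slots_def Z_def Y_def)
qed

text \<open>
  The increments at the top of the \<open>\<lambda>\<close>-model in the first \<open>m\<^sub>0\<close> columns, those of the \<open>\<mu>\<close>-model in the
  remaining columns and the \<open>\<mu>\<close>-increments on the right side are all produced by one sequence of
  cell maps in place, hence independent. The order of the cells makes this work: by
  \<open>grid_v_braid\<close>, the \<open>\<mu>\<close>-increments entering column \<open>m\<^sub>0 + 1\<close> can be computed after the \<open>\<lambda>\<close>-grid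
  over the first \<open>m\<^sub>0\<close> columns has been evaluated and its weights replaced by the dual ones.
\<close>

lemma coupled_output_law:
  assumes X: "exp_family M (all_slots m n) (slot_rate \<rho> la mu) X" and m\<^sub>0: "m\<^sub>0 \<le> m"
  shows "exp_family M (HI ` {1..m\<^sub>0} \<union> VI ` {m\<^sub>0<..m} \<union> AJ ` {1..n} \<union> BI ` {1..m} \<union> BJ ` {1..n}) (slot_rate \<rho> la mu)
    (\<lambda>k \<omega>. case k of
       HI i \<Rightarrow> grid_h (\<lambda>i. X (HI i) \<omega>) (\<lambda>j. X (SJ j) \<omega>) (\<lambda>i j. X (OM i j) \<omega>) i n
     | VI i \<Rightarrow> grid_h (mu_h (\<lambda>k. X k \<omega>) m) (mu_v (\<lambda>k. X k \<omega>) m) (\<lambda>i j. X (OM i j) \<omega>) i n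
     | AJ j \<Rightarrow> grid_v (mu_h (\<lambda>k. X k \<omega>) m) (mu_v (\<lambda>k. X k \<omega>) m) (\<lambda>i j. X (OM i j) \<omega>) m j
     | _ \<Rightarrow> X k \<omega>)" (is "exp_family M ?J _ ?F")
proof -
  let ?K = "all_slots m n" and ?r = "slot_rate \<rho> la mu"
  let ?H = "\<lambda>\<omega> i. X (HI i) \<omega>" and ?S = "\<lambda>\<omega> j. X (SJ j) \<omega>" and ?O = "\<lambda>\<omega> i j. X (OM i j) \<omega>"
  let ?U = "\<lambda>\<omega>. mu_h (\<lambda>k. X k \<omega>) m" and ?D = "\<lambda>\<omega>. mu_v (\<lambda>k. X k \<omega>) m"
  let ?G = "\<lambda>\<omega>. grid_v (?U \<omega>) (?D \<omega>) (?O \<omega>)"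
  \<comment> \<open>The horizontal boundaries are coupled in the columns beyond \<open>m\<^sub>0\<close> only.\<close>
  define Y\<^sub>0 where "Y\<^sub>0 = (\<lambda>k \<omega>. case k of WW \<Rightarrow> bridge (\<lambda>k. X k \<omega>) m (m - m\<^sub>0)
    | HI i \<Rightarrow> (if m\<^sub>0 < i \<and> i \<le> m then column_v (X WW \<omega>) (\<lambda>j. X (HI (reverse_index m j)) \<omega>) (\<lambda>j. X (VI (reverse_index m j)) \<omega>) (m + 1 - i) else X k \<omega>)
    | VI i \<Rightarrow> (if m\<^sub>0 < i \<and> i \<le> m then ?U \<omega> i else X k \<omega>) | _ \<Rightarrow> X k \<omega>)"
  have Y0: "exp_family M ?K ?r Y\<^sub>0"
  proof (rule exp_family_column[OF X, where h=WW and n="m - m\<^sub>0" and v="\<lambda>j. HI (reverse_index m j)" and c="\<lambda>j. VI (reverse_index m j)"])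
    fix k \<omega> assume k: "k \<in> ?K" "k \<noteq> WW" "k \<notin> (\<lambda>j. HI (reverse_index m j)) ` {1..m - m\<^sub>0}" "k \<notin> (\<lambda>j. VI (reverse_index m j)) ` {1..m - m\<^sub>0}"
    have "HI i \<in> (\<lambda>j. HI (reverse_index m j)) ` {1..m - m\<^sub>0}" "VI i \<in> (\<lambda>j. VI (reverse_index m j)) ` {1..m - m\<^sub>0}" if "m\<^sub>0 < i" "i \<le> m" for i
      using that by (auto intro!: image_eqI[of _ _ "m + 1 - i"] simp: reverse_index_def)
    then show "Y\<^sub>0 k \<omega> = X k \<omega>" using k by (auto simp: Y\<^sub>0_def split: slot.splits)
  qed (use inj_slot_reverse_index in \<open>simp_all add: reverse_index_simps Y\<^sub>0_def bridge_def mu_h_def column_dual_def, (fastforce+)?\<close>)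
  \<comment> \<open>The \<open>\<lambda>\<close>-grid over the first \<open>m\<^sub>0\<close> columns leaves its dual weights in the bulk.\<close>
  define Y\<^sub>1 where "Y\<^sub>1 = (\<lambda>k \<omega>. case k of
      HI i \<Rightarrow> (if 1 \<le> i \<and> i \<le> m\<^sub>0 then grid_h (?H \<omega>) (?S \<omega>) (?O \<omega>) i n else Y\<^sub>0 k \<omega>)
    | SJ j \<Rightarrow> (if 1 \<le> j \<and> j \<le> n then grid_v (?H \<omega>) (?S \<omega>) (?O \<omega>) m\<^sub>0 j else Y\<^sub>0 k \<omega>)
    | OM i j \<Rightarrow> (if 1 \<le> i \<and> i \<le> m\<^sub>0 \<and> 1 \<le> j \<and> j \<le> n then grid_dual (?H \<omega>) (?S \<omega>) (?O \<omega>) i j else Y\<^sub>0 k \<omega>)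
    | _ \<Rightarrow> Y\<^sub>0 k \<omega>)"
  have Y0s: "Y\<^sub>0 (SJ j) \<omega> = X (SJ j) \<omega>" "Y\<^sub>0 (OM i j) \<omega> = X (OM i j) \<omega>" "Y\<^sub>0 (AJ j) \<omega> = X (AJ j) \<omega>"
    "i \<le> m\<^sub>0 \<Longrightarrow> Y\<^sub>0 (HI i) \<omega> = X (HI i) \<omega>" "i \<le> m\<^sub>0 \<Longrightarrow> Y\<^sub>0 (VI i) \<omega> = X (VI i) \<omega>" for i j \<omega>
    by (auto simp: Y\<^sub>0_def)
  have Y1: "exp_family M ?K ?r Y\<^sub>1"
  proof (rule exp_family_grid[OF Y0, where m=m\<^sub>0 and n=n and hs=HI and vs=SJ and cs=OM])
    fix i j :: nat and \<omega>
    show "1 \<le> i \<Longrightarrow> i \<le> m\<^sub>0 \<Longrightarrow> Y\<^sub>1 (HI i) \<omega> = grid_h (\<lambda>i. Y\<^sub>0 (HI i) \<omega>) (\<lambda>j. Y\<^sub>0 (SJ j) \<omega>) (\<lambda>i j. Y\<^sub>0 (OM i j) \<omega>) i n"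
      unfolding Y\<^sub>1_def by (simp add: Y0s) (rule grid_h_cong[where m=m\<^sub>0 and n=n]; simp add: Y0s)
    show "1 \<le> j \<Longrightarrow> j \<le> n \<Longrightarrow> Y\<^sub>1 (SJ j) \<omega> = grid_v (\<lambda>i. Y\<^sub>0 (HI i) \<omega>) (\<lambda>j. Y\<^sub>0 (SJ j) \<omega>) (\<lambda>i j. Y\<^sub>0 (OM i j) \<omega>) m\<^sub>0 j"
      unfolding Y\<^sub>1_def by (simp add: Y0s) (rule grid_v_cong[where m=m\<^sub>0 and n=n]; simp add: Y0s)
    assume ij: "1 \<le> i" "i \<le> m\<^sub>0" "1 \<le> j" "j \<le> n"
    have "grid_dual (?H \<omega>) (?S \<omega>) (?O \<omega>) i j = grid_dual (\<lambda>i. Y\<^sub>0 (HI i) \<omega>) (?S \<omega>) (?O \<omega>) i j"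
      unfolding grid_dual_def Y0s(4)[OF ij(2)] by (rule column_v_cong(2)) (use ij in \<open>auto intro!: grid_v_cong[where n=n] simp: Y0s\<close>)
    then show "Y\<^sub>1 (OM i j) \<omega> = grid_dual (\<lambda>i. Y\<^sub>0 (HI i) \<omega>) (\<lambda>j. Y\<^sub>0 (SJ j) \<omega>) (\<lambda>i j. Y\<^sub>0 (OM i j) \<omega>) i j"
      using ij by (simp add: Y\<^sub>1_def Y0s)
  next
    fix k \<omega> assume "k \<in> ?K" "k \<notin> HI ` {1..m\<^sub>0}" "k \<notin> SJ ` {1..n}" "k \<notin> case_prod OM ` ({1..m\<^sub>0} \<times> {1..n})"
    then show "Y\<^sub>1 k \<omega> = Y\<^sub>0 k \<omega>" by (auto simp: Y\<^sub>1_def split: slot.splits)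
  qed (use m\<^sub>0 in \<open>auto simp: inj_def\<close>)
  let ?a = "\<lambda>\<omega>. grid_v (\<lambda>i. X (VI i) \<omega>) (\<lambda>j. X (AJ j) \<omega>) (grid_dual (?H \<omega>) (?S \<omega>) (?O \<omega>)) m\<^sub>0"
  \<comment> \<open>The auxiliary increments of the second class run through these dual weights.\<close>
  define Y\<^sub>2 where "Y\<^sub>2 = (\<lambda>k \<omega>. case k of
      VI i \<Rightarrow> (if 1 \<le> i \<and> i \<le> m\<^sub>0 then grid_h (\<lambda>i. Y\<^sub>1 (VI i) \<omega>) (\<lambda>j. Y\<^sub>1 (AJ j) \<omega>) (\<lambda>i j. Y\<^sub>1 (OM i j) \<omega>) i n else Y\<^sub>1 k \<omega>)
    | AJ j \<Rightarrow> (if 1 \<le> j \<and> j \<le> n then ?a \<omega> j else Y\<^sub>1 k \<omega>)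
    | OM i j \<Rightarrow> (if 1 \<le> i \<and> i \<le> m\<^sub>0 \<and> 1 \<le> j \<and> j \<le> n then grid_dual (\<lambda>i. Y\<^sub>1 (VI i) \<omega>) (\<lambda>j. Y\<^sub>1 (AJ j) \<omega>) (\<lambda>i j. Y\<^sub>1 (OM i j) \<omega>) i j else Y\<^sub>1 k \<omega>)
    | _ \<Rightarrow> Y\<^sub>1 k \<omega>)"
  have Y2: "exp_family M ?K ?r Y\<^sub>2"
  proof (rule exp_family_grid[OF Y1, where m=m\<^sub>0 and n=n and hs=VI and vs=AJ and cs=OM])
    fix j :: nat and \<omega>
    assume j: "1 \<le> j" "j \<le> n"
    have "?a \<omega> j = grid_v (\<lambda>i. Y\<^sub>1 (VI i) \<omega>) (\<lambda>j. Y\<^sub>1 (AJ j) \<omega>) (\<lambda>i j. Y\<^sub>1 (OM i j) \<omega>) m\<^sub>0 j"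
      by (rule grid_v_cong[where n=n]) (use j in \<open>auto simp: Y\<^sub>1_def Y0s\<close>)
    then show "Y\<^sub>2 (AJ j) \<omega> = \<dots>" using j by (simp add: Y\<^sub>2_def)
  next
    fix k \<omega> assume "k \<in> ?K" "k \<notin> VI ` {1..m\<^sub>0}" "k \<notin> AJ ` {1..n}" "k \<notin> case_prod OM ` ({1..m\<^sub>0} \<times> {1..n})"
    then show "Y\<^sub>2 k \<omega> = Y\<^sub>1 k \<omega>" by (auto simp: Y\<^sub>2_def split: slot.splits)
  qed (use m\<^sub>0 in \<open>auto simp: inj_def Y\<^sub>2_def\<close>)
  \<comment> \<open>Coupling the two vertical boundaries at column \<open>m\<^sub>0\<close> yields the vertical \<open>\<mu>\<close>-increments there.\<close>
  define Y\<^sub>3 where "Y\<^sub>3 = (\<lambda>k \<omega>. case k of WW \<Rightarrow> column_h (Y\<^sub>2 WW \<omega>) (\<lambda>j. Y\<^sub>2 (AJ j) \<omega>) (\<lambda>j. Y\<^sub>2 (SJ j) \<omega>) n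
    | AJ j \<Rightarrow> (if 1 \<le> j \<and> j \<le> n then ?G \<omega> m\<^sub>0 j else Y\<^sub>2 k \<omega>)
    | SJ j \<Rightarrow> (if 1 \<le> j \<and> j \<le> n then column_dual (Y\<^sub>2 WW \<omega>) (\<lambda>j. Y\<^sub>2 (AJ j) \<omega>) (\<lambda>j. Y\<^sub>2 (SJ j) \<omega>) j else Y\<^sub>2 k \<omega>)
    | _ \<Rightarrow> Y\<^sub>2 k \<omega>)"
  have Y3: "exp_family M ?K ?r Y\<^sub>3"
  proof (rule exp_family_column[OF Y2, where h=WW and n=n and v=AJ and c=SJ])
    fix j :: nat and \<omega>
    assume j: "1 \<le> j" "j \<le> n"
    have w: "Y\<^sub>2 WW \<omega> = bridge (\<lambda>k. X k \<omega>) m (m - m\<^sub>0)" by (simp add: Y\<^sub>2_def Y\<^sub>1_def Y\<^sub>0_def)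
    have "?G \<omega> m\<^sub>0 j = column_v (Y\<^sub>2 WW \<omega>) (\<lambda>j. Y\<^sub>2 (AJ j) \<omega>) (\<lambda>j. Y\<^sub>2 (SJ j) \<omega>) j"
      unfolding grid_v_coupled[OF m\<^sub>0] w by (rule column_v_cong(1)) (use j in \<open>auto simp: Y\<^sub>2_def Y\<^sub>1_def\<close>)
    then show "Y\<^sub>3 (AJ j) \<omega> = \<dots>" using j by (simp add: Y\<^sub>3_def)
  next
    fix k \<omega> assume "k \<in> ?K" "k \<noteq> WW" "k \<notin> AJ ` {1..n}" "k \<notin> SJ ` {1..n}"
    then show "Y\<^sub>3 k \<omega> = Y\<^sub>2 k \<omega>" by (auto simp: Y\<^sub>3_def split: slot.splits)
  qed (auto simp: Y\<^sub>3_def inj_def)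
  define q where "q = m - m\<^sub>0"
  have q: "m\<^sub>0 + q = m" using m\<^sub>0 by (simp add: q_def)
  \<comment> \<open>These and the coupled horizontal weights feed the \<open>\<mu>\<close>-grid over the remaining columns.\<close>
  define Y\<^sub>4 where "Y\<^sub>4 = (\<lambda>k \<omega>. case k of
      VI i \<Rightarrow> (if m\<^sub>0 < i \<and> i \<le> m then grid_h (?U \<omega>) (?D \<omega>) (?O \<omega>) i n else Y\<^sub>3 k \<omega>)
    | AJ j \<Rightarrow> (if 1 \<le> j \<and> j \<le> n then ?G \<omega> m j else Y\<^sub>3 k \<omega>)
    | OM i j \<Rightarrow> (if m\<^sub>0 < i \<and> i \<le> m \<and> 1 \<le> j \<and> j \<le> n then
        grid_dual (\<lambda>i. Y\<^sub>3 (VI (m\<^sub>0 + i)) \<omega>) (\<lambda>j. Y\<^sub>3 (AJ j) \<omega>) (\<lambda>i j. Y\<^sub>3 (OM (m\<^sub>0 + i) j) \<omega>) (i - m\<^sub>0) j else Y\<^sub>3 k \<omega>)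
    | _ \<Rightarrow> Y\<^sub>3 k \<omega>)"
  have Y3s: "1 \<le> i \<Longrightarrow> i \<le> q \<Longrightarrow> Y\<^sub>3 (VI (m\<^sub>0 + i)) \<omega> = ?U \<omega> (m\<^sub>0 + i)"
    "1 \<le> j \<Longrightarrow> j \<le> n \<Longrightarrow> Y\<^sub>3 (AJ j) \<omega> = ?G \<omega> m\<^sub>0 j"
    "1 \<le> i \<Longrightarrow> Y\<^sub>3 (OM (m\<^sub>0 + i) j) \<omega> = X (OM (m\<^sub>0 + i) j) \<omega>" for i j \<omega>
    using q by (auto simp: Y\<^sub>3_def Y\<^sub>2_def Y\<^sub>1_def Y\<^sub>0_def)
  have Y4: "exp_family M ?K ?r Y\<^sub>4"
  proof (rule exp_family_grid[OF Y3, where m=q and n=n and hs="\<lambda>i. VI (m\<^sub>0 + i)" and vs=AJ and cs="\<lambda>i j. OM (m\<^sub>0 + i) j"])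
    fix i :: nat and \<omega>
    assume i: "1 \<le> i" "i \<le> q"
    have "grid_h (?U \<omega>) (?D \<omega>) (?O \<omega>) (m\<^sub>0 + i) n = grid_h (\<lambda>i. ?U \<omega> (m\<^sub>0 + i)) (?G \<omega> m\<^sub>0) (\<lambda>i j. X (OM (m\<^sub>0 + i) j) \<omega>) i n"
      using grid_h_add[OF i(1), of "?U \<omega>" m\<^sub>0 "?D \<omega>" "?O \<omega>" n] by simp
    also have "\<dots> = grid_h (\<lambda>i. Y\<^sub>3 (VI (m\<^sub>0 + i)) \<omega>) (\<lambda>j. Y\<^sub>3 (AJ j) \<omega>) (\<lambda>i j. Y\<^sub>3 (OM (m\<^sub>0 + i) j) \<omega>) i n"
      by (rule grid_h_cong[where m=q and n=n]) (use i in \<open>auto simp: Y3s\<close>)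
    finally show "Y\<^sub>4 (VI (m\<^sub>0 + i)) \<omega> = \<dots>" using i q by (simp add: Y\<^sub>4_def)
  next
    fix j :: nat and \<omega>
    assume j: "1 \<le> j" "j \<le> n"
    have "?G \<omega> m j = grid_v (\<lambda>i. ?U \<omega> (m\<^sub>0 + i)) (?G \<omega> m\<^sub>0) (\<lambda>i j. X (OM (m\<^sub>0 + i) j) \<omega>) q j"
      using grid_v_add[of "?U \<omega>" m\<^sub>0 "?D \<omega>" "?O \<omega>" q] q by simp
    also have "\<dots> = grid_v (\<lambda>i. Y\<^sub>3 (VI (m\<^sub>0 + i)) \<omega>) (\<lambda>j. Y\<^sub>3 (AJ j) \<omega>) (\<lambda>i j. Y\<^sub>3 (OM (m\<^sub>0 + i) j) \<omega>) q j"
      by (rule grid_v_cong[where n=n]) (use j in \<open>auto simp: Y3s\<close>)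
    finally show "Y\<^sub>4 (AJ j) \<omega> = \<dots>" using j by (simp add: Y\<^sub>4_def)
  next
    fix k \<omega> assume k: "k \<in> ?K" "k \<notin> (\<lambda>i. VI (m\<^sub>0 + i)) ` {1..q}" "k \<notin> AJ ` {1..n}"
      "k \<notin> case_prod (\<lambda>i j. OM (m\<^sub>0 + i) j) ` ({1..q} \<times> {1..n})"
    have "VI i \<in> (\<lambda>i. VI (m\<^sub>0 + i)) ` {1..q}" if "m\<^sub>0 < i" "i \<le> m" for i
      using that q by (auto intro!: image_eqI[of _ _ "i - m\<^sub>0"])
    moreover have "OM i j \<in> case_prod (\<lambda>i j. OM (m\<^sub>0 + i) j) ` ({1..q} \<times> {1..n})" if "m\<^sub>0 < i" "i \<le> m" "1 \<le> j" "j \<le> n" for i j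
      using that q by (auto intro!: image_eqI[of _ _ "(i - m\<^sub>0, j)"])
    ultimately show "Y\<^sub>4 k \<omega> = Y\<^sub>3 k \<omega>" using k by (auto simp: Y\<^sub>4_def split: slot.splits)
  qed (use q in \<open>auto simp: inj_def Y\<^sub>4_def\<close>)
  have "exp_family M ?J ?r Y\<^sub>4"
    by (rule exp_family_subset[OF Y4]) (use m\<^sub>0 in auto)
  then show ?thesis
    by (rule exp_family_cong) (use m\<^sub>0 in \<open>auto simp: Y\<^sub>4_def Y\<^sub>3_def Y\<^sub>2_def Y\<^sub>1_def Y\<^sub>0_def\<close>)
qed

section \<open>Exits near the corner force two walks to stay low\<close>

text \<open>
  Steps of the two walks around the exit \<open>e\<close>. The stationary models run backwards from the corner, so
  column \<open>i\<close> of the rectangle is their column \<open>m + 1 - i\<close>. The right walk compares weights on the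
  axis with \<open>\<lambda>\<close>-increments. The left walk compares \<open>\<mu>\<close>-increments with the weights at \<open>e - 1, \<dots>, 1\<close>
  and then continues for \<open>T\<close> steps on the vertical axis.
\<close>

definition right_walk :: "nat \<Rightarrow> nat \<Rightarrow> nat \<Rightarrow> (slot \<times> slot) list" where
  "right_walk m T e = map (\<lambda>i. (BI (e + i + 1), HI (m + 1 - (e + i)))) [0..<T]"

definition left_walk :: "nat \<Rightarrow> nat \<Rightarrow> nat \<Rightarrow> nat \<Rightarrow> (slot \<times> slot) list" where
  "left_walk m n T e = map (\<lambda>i. (VI (m + 1 - (e - 1 - i)), BI (e - 1 - i))) [0..<e - 1] @
     map (\<lambda>j. (BJ (Suc j), AJ (n - j))) [0..<T]"

abbreviation lambda_weights :: "(slot \<Rightarrow> real) \<Rightarrow> int \<times> int \<Rightarrow> real" where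
  "lambda_weights \<equiv> slot_weights"

abbreviation mu_weights :: "(slot \<Rightarrow> real) \<Rightarrow> nat \<Rightarrow> int \<times> int \<Rightarrow> real" where
  "mu_weights x m \<equiv> grid_weights (mu_h x m) (mu_v x m) (\<lambda>i j. x (OM i j))"

definition outgoing :: "(slot \<Rightarrow> real) \<Rightarrow> nat \<Rightarrow> nat \<Rightarrow> slot \<Rightarrow> real" where
  "outgoing x m n k = (case k of
       HI i \<Rightarrow> grid_h (\<lambda>i. x (HI i)) (\<lambda>j. x (SJ j)) (\<lambda>i j. x (OM i j)) i n
     | VI i \<Rightarrow> grid_h (mu_h x m) (mu_v x m) (\<lambda>i j. x (OM i j)) i n
     | AJ j \<Rightarrow> grid_v (mu_h x m) (mu_v x m) (\<lambda>i j. x (OM i j)) m j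
     | _ \<Rightarrow> x k)"

lemma stays_below_append:
  "stays_below (l @ l') x y \<longleftrightarrow> stays_below l x y \<and> stays_below l' x (y - (\<Sum>(\<alpha>, \<beta>)\<leftarrow>l. x \<alpha> - x \<beta>))"
  by (induction l x y rule: stays_below.induct) (auto simp: algebra_simps)

lemma stays_below_map:
  "stays_below (map (\<lambda>i. (f i, g i)) [0..<N]) x y \<longleftrightarrow> (\<forall>r\<in>{1..N}. (\<Sum>i<r. x (f i) - x (g i)) \<le> y)"
proof -
  have "(\<Sum>(\<alpha>, \<beta>)\<leftarrow>take r (map (\<lambda>i. (f i, g i)) [0..<N]). x \<alpha> - x \<beta>) = (\<Sum>i<r. x (f i) - x (g i))" if "r \<le> N" for r
  proof -
    have "take r (map (\<lambda>i. (f i, g i)) [0..<N]) = map (\<lambda>i. (f i, g i)) [0..<r]"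
      using that by (simp add: take_map take_upt)
    then show ?thesis
      by (simp add: o_def sum_list_sum_nth atLeast0LessThan interv_sum_list_conv_sum_set_nat)
  qed
  then show ?thesis unfolding stays_below_iff by (auto simp: Ball_def)
qed

text \<open>
  The value of exit \<open>e\<close> minus that of another exit telescopes into increments of the
  passage time to \<open>p\<close>. These are replaced by stationary increments, larger ones on
  the right of \<open>e\<close> and smaller ones on the left, so optimality of \<open>e\<close> bounds all partial sums. The switch
  from the horizontal to the vertical axis costs the weight at \<open>e\<close>, which is therefore
  the starting level of the left walk.
\<close>

lemma window_walks:
  fixes w :: "int \<times> int \<Rightarrow> real" and x :: "slot \<Rightarrow> real"
  assumes OM: "\<And>i j. 1 \<le> i \<Longrightarrow> i \<le> m \<Longrightarrow> 1 \<le> j \<Longrightarrow> j \<le> n \<Longrightarrow> x (OM i j) = w (int m + 1 - int i, int n + 1 - int j)"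
    and BI: "\<And>i. 1 \<le> i \<Longrightarrow> i \<le> m \<Longrightarrow> x (BI i) = w (int i, 0)" "\<And>i. 1 \<le> i \<Longrightarrow> i \<le> m \<Longrightarrow> 0 \<le> x (BI i)"
    and BJ: "\<And>j. 1 \<le> j \<Longrightarrow> j \<le> n \<Longrightarrow> x (BJ j) = w (0, int j)"
    and AJ: "\<And>j. 1 \<le> j \<Longrightarrow> j \<le> n \<Longrightarrow> 0 \<le> outgoing x m n (AJ j)"
    and E3: "\<not> small_exit (lambda_weights x) (int m - int k - int T, int n) (int s\<^sub>1)"
    and E4: "\<not> small_exit (\<lambda>z. mu_weights x m (prod.swap z)) (int n - int T, int m) (int s\<^sub>2)"
    and size: "1 \<le> s\<^sub>1" "1 \<le> s\<^sub>2" "k + T + s\<^sub>1 < m" "T + s\<^sub>2 < n" "1 \<le> T"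
    and p: "snd p = int n \<and> int m - int s\<^sub>1 < fst p \<and> fst p \<le> int m \<or>
            fst p = int m \<and> int n - int s\<^sub>2 < snd p \<and> snd p \<le> int n"
    and e: "1 \<le> e" "e \<le> k" "opt_exit w p (int e)"
  shows "stays_below (right_walk m T e) (outgoing x m n) 0 \<and> stays_below (left_walk m n T e) (outgoing x m n) (outgoing x m n (BI e))"
proof -
  let ?y = "outgoing x m n"
  define c where "c = (int m + 1, int n + 1)"
  define P where "P = c - p"
  have pq: "p \<in> pos_quadrant" and pm: "p \<le> (int m, int n)" "int m - int s\<^sub>1 < fst p" "int n - int s\<^sub>2 < snd p"
    using p size by (auto simp: pos_quadrant_def le_prod_iff)
  have P: "1 \<le> fst P" "fst P \<le> int s\<^sub>1" "1 \<le> snd P" "snd P \<le> int s\<^sub>2"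
    using p size by (auto simp: P_def c_def)
  have hat: "lpp W P q = lpp w (c - q) p" if W: "\<And>i j. 1 \<le> i \<Longrightarrow> i \<le> m \<Longrightarrow> 1 \<le> j \<Longrightarrow> j \<le> n \<Longrightarrow> W (int i, int j) = x (OM i j)"
    and q: "P \<le> q" "q \<le> (int m, int n)" for W q
  proof -
    have "lpp W P q = lpp (\<lambda>z. w (c - z)) P q"
    proof (rule lpp_cong)
      fix z assume z: "z \<in> {P..q}"
      obtain i j where ij: "z = (int i, int j)" "1 \<le> i" "1 \<le> j" "i \<le> m" "j \<le> n"
        using z P q by (intro that[of "nat (fst z)" "nat (snd z)"]) (auto simp: le_prod_iff prod_eq_iff)
      then show "W z = w (c - z)" by (simp add: W OM c_def)
    qed
    also have "\<dots> = lpp w (c - q) (c - P)" by (rule lpp_reflect[OF q(1)])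
    finally show ?thesis by (simp add: P_def)
  qed
  have Wl: "lambda_weights x (int i, int j) = x (OM i j)" "mu_weights x m (int i, int j) = x (OM i j)"
    if "1 \<le> i" "1 \<le> j" for i j using that by (auto simp: grid_weights_def)
  have W0: "lambda_weights x 0 = 0" "mu_weights x m 0 = 0" by (simp_all add: grid_weights_def)
  have gl: "lpp (lambda_weights x) 0 (int i, int j) = corner_passage (\<lambda>i. x (HI i)) (\<lambda>j. x (SJ j)) (\<lambda>i j. x (OM i j)) i j"
    "lpp (mu_weights x m) 0 (int i, int j) = corner_passage (mu_h x m) (mu_v x m) (\<lambda>i j. x (OM i j)) i j" for i j
    by (simp_all add: corner_passage_def)
  define Ip where "Ip = (\<lambda>i. lpp w (int i, 1) p - lpp w (int i + 1, 1) p)"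
  define Jp where "Jp = (\<lambda>j. lpp w (1, int j) p - lpp w (1, int j + 1) p)"
  have IpW: "Ip i = lpp W P ((int m - int i, int n) + e1) - lpp W P (int m - int i, int n)"
    if W: "\<And>i j. 1 \<le> i \<Longrightarrow> i \<le> m \<Longrightarrow> 1 \<le> j \<Longrightarrow> j \<le> n \<Longrightarrow> W (int i, int j) = x (OM i j)" and i: "1 \<le> i" "i \<le> k + T" for W i
  proof -
    have "lpp W P ((int m - int i, int n) + e1) = lpp w (c - ((int m - int i, int n) + e1)) p"
      by (rule hat[OF W]) (use P size i in \<open>auto simp: le_prod_iff e1_def\<close>)
    moreover have "lpp W P (int m - int i, int n) = lpp w (c - (int m - int i, int n)) p"
      by (rule hat[OF W]) (use P size i in \<open>auto simp: le_prod_iff\<close>)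
    ultimately show ?thesis by (simp add: Ip_def c_def e1_def add_ac)
  qed
  have JpW: "Jp j = lpp W P ((int m, int n - int j) + e2) - lpp W P (int m, int n - int j)"
    if W: "\<And>i j. 1 \<le> i \<Longrightarrow> i \<le> m \<Longrightarrow> 1 \<le> j \<Longrightarrow> j \<le> n \<Longrightarrow> W (int i, int j) = x (OM i j)" and j: "1 \<le> j" "j \<le> T" for W j
  proof -
    have "lpp W P ((int m, int n - int j) + e2) = lpp w (c - ((int m, int n - int j) + e2)) p"
      by (rule hat[OF W]) (use P size j in \<open>auto simp: le_prod_iff e2_def\<close>)
    moreover have "lpp W P (int m, int n - int j) = lpp w (c - (int m, int n - int j)) p"
      by (rule hat[OF W]) (use P size j in \<open>auto simp: le_prod_iff\<close>)
    ultimately show ?thesis by (simp add: Jp_def c_def e2_def add_ac)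
  qed
  have up: "Ip i \<le> ?y (HI (m + 1 - i))" if i: "1 \<le> i" "i \<le> k + T" for i
  proof -
    have "Ip i = lpp (lambda_weights x) P ((int m - int i, int n) + e1) - lpp (lambda_weights x) P (int m - int i, int n)"
      by (rule IpW) (use i Wl in auto)
    also have "\<dots> \<le> lpp (lambda_weights x) 0 ((int m - int i, int n) + e1) - lpp (lambda_weights x) 0 (int m - int i, int n)"
      by (rule stationary_horizontal_upper[OF E3 W0(1)]) (use P size i in \<open>auto simp: le_prod_iff pos_quadrant_def\<close>)
    also have "(int m - int i, int n) + e1 = (int (m + 1 - i), int n)" using i size by (auto simp: e1_def of_nat_diff)
    also have "(int m - int i, int n) = (int (m + 1 - i - 1), int n)" using i size by (auto simp: of_nat_diff)
    also have "lpp (lambda_weights x) 0 (int (m + 1 - i), int n) - lpp (lambda_weights x) 0 (int (m + 1 - i - 1), int n) = ?y (HI (m + 1 - i))"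
      unfolding gl outgoing_def slot.case by (rule grid_h_eq[symmetric]) (use i size in simp)
    finally show ?thesis .
  qed
  have low: "?y (VI (m + 1 - i)) \<le> Ip i" if i: "1 \<le> i" "i \<le> k" for i
  proof -
    have "Ip i = lpp (mu_weights x m) P ((int m - int i, int n) + e1) - lpp (mu_weights x m) P (int m - int i, int n)"
      by (rule IpW) (use i Wl in auto)
    also have "\<dots> \<ge> lpp (mu_weights x m) 0 ((int m - int i, int n) + e1) - lpp (mu_weights x m) 0 (int m - int i, int n)"
      by (rule stationary_horizontal_lower[OF E4 W0(2)]) (use P size i in \<open>auto simp: le_prod_iff pos_quadrant_def\<close>)
    also have "(int m - int i, int n) + e1 = (int (m + 1 - i), int n)" using i size by (auto simp: e1_def of_nat_diff)
    also have "(int m - int i, int n) = (int (m + 1 - i - 1), int n)" using i size by (auto simp: of_nat_diff)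
    also have "lpp (mu_weights x m) 0 (int (m + 1 - i), int n) - lpp (mu_weights x m) 0 (int (m + 1 - i - 1), int n) = ?y (VI (m + 1 - i))"
      unfolding gl outgoing_def slot.case by (rule grid_h_eq[symmetric]) (use i size in simp)
    finally show ?thesis .
  qed
  have upJ: "Jp j \<le> ?y (AJ (n + 1 - j))" if j: "1 \<le> j" "j \<le> T" for j
  proof -
    have "Jp j = lpp (mu_weights x m) P ((int m, int n - int j) + e2) - lpp (mu_weights x m) P (int m, int n - int j)"
      by (rule JpW) (use j Wl in auto)
    also have "\<dots> \<le> lpp (mu_weights x m) 0 ((int m, int n - int j) + e2) - lpp (mu_weights x m) 0 (int m, int n - int j)"
      by (rule stationary_vertical_upper[OF E4 W0(2)]) (use P size j in \<open>auto simp: le_prod_iff pos_quadrant_def\<close>)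
    also have "(int m, int n - int j) + e2 = (int m, int (n + 1 - j))" using j size by (auto simp: e2_def of_nat_diff)
    also have "(int m, int n - int j) = (int m, int (n + 1 - j - 1))" using j size by (auto simp: of_nat_diff)
    also have "lpp (mu_weights x m) 0 (int m, int (n + 1 - j)) - lpp (mu_weights x m) 0 (int m, int (n + 1 - j - 1)) = ?y (AJ (n + 1 - j))"
      unfolding gl outgoing_def slot.case by (rule grid_v_eq[symmetric]) (use j size in simp)
    finally show ?thesis .
  qed
  have yB: "?y (BI i) = w (int i, 0)" if "1 \<le> i" "i \<le> m" for i using that by (simp add: outgoing_def BI)
  have yJ: "?y (BJ j) = w (0, int j)" if "1 \<le> j" "j \<le> n" for j using that by (simp add: outgoing_def BJ)
  \<comment> \<open>Exit values in terms of increments.\<close>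
  have vh: "exit_value w p (int r) = (\<Sum>i=1..r. w (int i, 0)) + lpp w (1, 1) p - (\<Sum>i=1..r - 1. Ip i)"
    if "1 \<le> r" for r
    using that
  proof (induction r rule: dec_induct)
    case base
    show ?case by (simp add: exit_value_def)
  next
    case (step r)
    have "{1..int (Suc r)} = insert (int (Suc r)) {1..int r}" by auto
    then have "(\<Sum>i=1..int (Suc r). w (i, 0)) = (\<Sum>i=1..int r. w (i, 0)) + w (int (Suc r), 0)" by simp
    moreover have "(\<Sum>i=1..Suc r - 1. Ip i) = (\<Sum>i=1..r - 1. Ip i) + Ip r"
      using step.hyps by (cases r) auto
    ultimately show ?case using step by (simp add: exit_value_def Ip_def add_ac)
  qed
  have vv: "exit_value w p (- int r) = (\<Sum>j=1..r. w (0, int j)) + lpp w (1, 1) p - (\<Sum>j=1..r - 1. Jp j)"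
    if "1 \<le> r" for r
    using that
  proof (induction r rule: dec_induct)
    case base
    show ?case by (simp add: exit_value_def)
  next
    case (step r)
    have "{1..int (Suc r)} = insert (int (Suc r)) {1..int r}" by auto
    then have "(\<Sum>i=1..int (Suc r). w (0, i)) = (\<Sum>i=1..int r. w (0, i)) + w (0, int (Suc r))" by simp
    moreover have "(\<Sum>i=1..Suc r - 1. Jp i) = (\<Sum>i=1..r - 1. Jp i) + Jp r"
      using step.hyps by (cases r) auto
    ultimately show ?case using step by (simp add: exit_value_def Jp_def add_ac)
  qed
  have vstep: "exit_value w p (int (Suc d)) - exit_value w p (int d) = w (int (Suc d), 0) - Ip d" if d: "1 \<le> d" for d
  proof -
    have "(\<Sum>i=1..Suc d - 1. Ip i) = (\<Sum>i=1..d - 1. Ip i) + Ip d" using d by (cases d) auto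
    moreover have "(\<Sum>i=1..Suc d. w (int i, 0)) = (\<Sum>i=1..d. w (int i, 0)) + w (int (Suc d), 0)" by simp
    ultimately show ?thesis using vh[of "Suc d"] vh[OF d] by simp
  qed
  have opt: "exit_value w p j \<le> exit_value w p (int e)" if "j \<in> exit_points p" for j
    using e(3) that by (simp add: opt_exit_def)
  have "stays_below (right_walk m T e) ?y 0"
    unfolding right_walk_def stays_below_map
  proof
    fix r assume r: "r \<in> {1..T}"
    have "int (e + r) \<in> exit_points p" using pm size e r by (auto simp: exit_points_def)
    then have o: "exit_value w p (int (e + r)) \<le> exit_value w p (int e)" by (rule opt)
    have H: "exit_value w p (int (e + r)) - exit_value w p (int e) = (\<Sum>i<r. w (int (e + i + 1), 0) - Ip (e + i))" for r
    proof (induction r)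
      case (Suc r)
      have "exit_value w p (int (e + Suc r)) - exit_value w p (int (e + r)) = w (int (e + r + 1), 0) - Ip (e + r)"
        using vstep[of "e + r"] e by simp
      then show ?case using Suc by simp
    qed simp
    have "(\<Sum>i<r. ?y (BI (e + i + 1)) - ?y (HI (m + 1 - (e + i)))) \<le> (\<Sum>i<r. w (int (e + i + 1), 0) - Ip (e + i))"
    proof (intro sum_mono)
      fix i assume i: "i \<in> {..<r}"
      have "Ip (e + i) \<le> ?y (HI (m + 1 - (e + i)))" by (rule up) (use i r e in auto)
      moreover have "?y (BI (e + i + 1)) = w (int (e + i + 1), 0)" by (rule yB) (use i r e size in auto)
      ultimately show "?y (BI (e + i + 1)) - ?y (HI (m + 1 - (e + i))) \<le> w (int (e + i + 1), 0) - Ip (e + i)" by simp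
    qed
    then show "(\<Sum>i<r. ?y (BI (e + i + 1)) - ?y (HI (m + 1 - (e + i)))) \<le> 0"
      using o H[of r] by linarith
  qed
  moreover have "stays_below (left_walk m n T e) ?y (?y (BI e))"
    unfolding left_walk_def stays_below_append stays_below_map
  proof (intro conjI ballI)
    fix r assume r: "r \<in> {1..e - 1}"
    have "int (e - r) \<in> exit_points p" using pm size e r by (auto simp: exit_points_def)
    then have o: "exit_value w p (int (e - r)) \<le> exit_value w p (int e)" by (rule opt)
    have H: "r < e \<Longrightarrow> exit_value w p (int e) - exit_value w p (int (e - r)) = (\<Sum>i<r. w (int (e - i), 0) - Ip (e - 1 - i))" for r
    proof (induction r)
      case (Suc r)
      define d where "d = e - Suc r"
      have d: "e - r = Suc d" "1 \<le> d" "e - 1 - r = d" using Suc by (auto simp: d_def)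
      have "exit_value w p (int (Suc d)) - exit_value w p (int d) = w (int (Suc d), 0) - Ip d"
        by (rule vstep[OF d(2)])
      moreover have "int e - int r = 1 + int d" using Suc.prems by (simp add: d_def of_nat_diff)
      ultimately show ?case using Suc d unfolding d_def[symmetric] by simp
    qed simp
    have shift: "(\<Sum>i<r. w (int (e - i), 0)) + w (int (e - r), 0) = w (int e, 0) + (\<Sum>i<r. w (int (e - 1 - i), 0))" for r
      by (induction r) auto
    have "0 \<le> w (int (e - r), 0)"
    proof -
      have er: "1 \<le> e - r" "e - r \<le> m" using r e size by auto
      show ?thesis using BI(2)[OF er] unfolding BI(1)[OF er] .
    qed
    moreover have "(\<Sum>i<r. ?y (VI (m + 1 - (e - 1 - i))) - ?y (BI (e - 1 - i))) \<le> (\<Sum>i<r. Ip (e - 1 - i) - w (int (e - 1 - i), 0))"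
    proof (intro sum_mono)
      fix i assume i: "i \<in> {..<r}"
      have "?y (VI (m + 1 - (e - 1 - i))) \<le> Ip (e - 1 - i)" by (rule low) (use i r e in auto)
      moreover have "?y (BI (e - 1 - i)) = w (int (e - 1 - i), 0)" by (rule yB) (use i r e size in auto)
      ultimately show "?y (VI (m + 1 - (e - 1 - i))) - ?y (BI (e - 1 - i)) \<le> Ip (e - 1 - i) - w (int (e - 1 - i), 0)" by simp
    qed
    moreover have "?y (BI e) = w (int e, 0)" by (rule yB) (use e size in auto)
    ultimately have calc: "0 \<le> w (int (e - r), 0)"
      "(\<Sum>i<r. ?y (VI (m + 1 - (e - 1 - i))) - ?y (BI (e - 1 - i))) \<le> (\<Sum>i<r. Ip (e - 1 - i) - w (int (e - 1 - i), 0))"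
      "?y (BI e) = w (int e, 0)" by auto
    show "(\<Sum>i<r. ?y (VI (m + 1 - (e - 1 - i))) - ?y (BI (e - 1 - i))) \<le> ?y (BI e)"
    proof -
      have "r < e" using r by auto
      from H[OF this] show ?thesis using o shift[of r] calc unfolding sum_subtractf by linarith
    qed
  next
    fix r assume r: "r \<in> {1..T}"
    have "- int r \<in> exit_points p" using pm size r by (auto simp: exit_points_def)
    then have o: "exit_value w p (- int r) \<le> exit_value w p (int e)" by (rule opt)
    have L: "(\<Sum>(\<alpha>, \<beta>)\<leftarrow>map (\<lambda>i. (VI (m + 1 - (e - 1 - i)), BI (e - 1 - i))) [0..<e - 1]. ?y \<alpha> - ?y \<beta>) =
      (\<Sum>i=1..e - 1. ?y (VI (m + 1 - i)) - ?y (BI i))"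
    proof -
      have "(\<Sum>(\<alpha>, \<beta>)\<leftarrow>map (\<lambda>i. (VI (m + 1 - (e - 1 - i)), BI (e - 1 - i))) [0..<e - 1]. ?y \<alpha> - ?y \<beta>) =
        (\<Sum>i<e - 1. ?y (VI (m + 1 - (e - 1 - i))) - ?y (BI (e - 1 - i)))"
        by (simp add: o_def sum_list_sum_nth atLeast0LessThan interv_sum_list_conv_sum_set_nat)
      also have "\<dots> = (\<Sum>i=1..e - 1. ?y (VI (m + 1 - i)) - ?y (BI i))"
        by (rule sum.reindex_bij_witness[of _ "\<lambda>i. e - 1 - i" "\<lambda>i. e - 1 - i"]) auto
      finally show ?thesis .
    qed
    have "(\<Sum>i=1..e - 1. ?y (VI (m + 1 - i)) - ?y (BI i)) \<le> (\<Sum>i=1..e - 1. Ip i - w (int i, 0))"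
    proof (intro sum_mono)
      fix i assume i: "i \<in> {1..e - 1}"
      have "?y (VI (m + 1 - i)) \<le> Ip i" by (rule low) (use i e in auto)
      moreover have "?y (BI i) = w (int i, 0)" by (rule yB) (use i e size in auto)
      ultimately show "?y (VI (m + 1 - i)) - ?y (BI i) \<le> Ip i - w (int i, 0)" by simp
    qed
    moreover have "(\<Sum>i<r. ?y (BJ (Suc i)) - ?y (AJ (n - i))) \<le> (\<Sum>j=1..r. w (0, int j)) - (\<Sum>j=1..r - 1. Jp j)"
    proof -
      have "(\<Sum>i<r. ?y (BJ (Suc i)) - ?y (AJ (n - i))) = (\<Sum>j=1..r. ?y (BJ j) - ?y (AJ (n + 1 - j)))"
        by (rule sum.reindex_bij_witness[of _ "\<lambda>i. i - 1" Suc]) auto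
      also have "\<dots> = (\<Sum>j=1..r. w (0, int j)) - (\<Sum>j=1..r. ?y (AJ (n + 1 - j)))"
        unfolding sum_subtractf using r size by (intro arg_cong2[where f=minus] sum.cong refl yJ) auto
      also have "(\<Sum>j=1..r. ?y (AJ (n + 1 - j))) = (\<Sum>j=1..r - 1. ?y (AJ (n + 1 - j))) + ?y (AJ (n + 1 - r))"
        using r by (cases r) auto
      also have "(\<Sum>j=1..r. w (0, int j)) - \<dots> \<le> (\<Sum>j=1..r. w (0, int j)) - (\<Sum>j=1..r - 1. Jp j)"
      proof -
        have "(\<Sum>j=1..r - 1. Jp j) \<le> (\<Sum>j=1..r - 1. ?y (AJ (n + 1 - j)))"
          by (intro sum_mono upJ) (use r in auto)
        moreover have "0 \<le> ?y (AJ (n + 1 - r))" by (rule AJ) (use r size in auto)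
        ultimately show ?thesis by simp
      qed
      finally show ?thesis .
    qed
    moreover have "(\<Sum>i=1..e. w (int i, 0)) = (\<Sum>i=1..e - 1. w (int i, 0)) + w (int e, 0)"
      using e by (cases e) auto
    moreover have "?y (BI e) = w (int e, 0)" by (rule yB) (use e size in auto)
    ultimately show "(\<Sum>i<r. ?y (BJ (Suc i)) - ?y (AJ (n - i))) \<le> ?y (BI e) -
      (\<Sum>(\<alpha>, \<beta>)\<leftarrow>map (\<lambda>i. (VI (m + 1 - (e - 1 - i)), BI (e - 1 - i))) [0..<e - 1]. ?y \<alpha> - ?y \<beta>)"
      using o r e unfolding L by (simp add: vh vv sum_subtractf)
  qed
  ultimately show ?thesis by blast
qed

section \<open>The bound for exits through the horizontal axis\<close>

text \<open>
  The right-hand side of \<open>exit_bound\<close> for parameter \<open>p\<close>, perturbation \<open>t\<close>, an \<open>m\<close> by \<open>n\<close> rectangle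
  and exits up to \<open>s\<close>.
\<close>

definition exit_expr :: "real \<Rightarrow> real \<Rightarrow> nat \<Rightarrow> nat \<Rightarrow> nat \<Rightarrow> real" where
  "exit_expr p t m n s = exp (- real s) + 2 * exp (4 * real s * t\<^sup>2 / (1 - p)\<^sup>2 - m * t\<^sup>2 / (2 * (1 - (p - t))\<^sup>2) +
        n * t\<^sup>2 / (2 * (p - t)\<^sup>2) + n * t ^ 4 / (p - t) ^ 4)"

lemma not_mem_grid_slots [simp]:
  "VI i \<notin> grid_slots m n" "WW \<notin> grid_slots m n" "AJ j \<notin> grid_slots m n" "BI i \<notin> grid_slots m n" "BJ j \<notin> grid_slots m n"
  by (auto simp: grid_slots_def)

lemma exit_value_cong:
  assumes "\<And>z. z \<in> {0..y} \<Longrightarrow> z \<noteq> 0 \<Longrightarrow> w z = w' z" "y \<in> pos_quadrant" "k \<in> exit_points y"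
  shows "exit_value w y k = exit_value w' y k"
proof -
  have l: "lpp w (i, j) y = lpp w' (i, j) y" if "0 < i" "0 < j" for i j
    by (rule lpp_cong) (use that in \<open>auto simp: le_prod_iff zero_prod_def intro!: assms(1)\<close>)
  have "w (i, 0) = w' (i, 0)" if "0 < i" "i \<le> fst y" for i
    using that assms(2) by (intro assms(1)) (auto simp: le_prod_iff zero_prod_def pos_quadrant_def)
  moreover have "w (0, i) = w' (0, i)" if "0 < i" "i \<le> snd y" for i
    using that assms(2) by (intro assms(1)) (auto simp: le_prod_iff zero_prod_def pos_quadrant_def)
  ultimately show ?thesis
    using assms(3) l by (auto simp: exit_value_def exit_points_def intro!: sum.cong)
qed

lemma small_exit_cong:
  assumes "\<And>z. z \<in> {0..y} \<Longrightarrow> z \<noteq> 0 \<Longrightarrow> w z = w' z" "y \<in> pos_quadrant"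
  shows "small_exit w y s \<longleftrightarrow> small_exit w' y s"
  unfolding small_exit_def using exit_value_cong[OF assms] by auto

lemma grid_weights_swap: "grid_weights H V Om (prod.swap z) = grid_weights V H (\<lambda>i j. Om j i) z"
  unfolding grid_weights_def fst_swap snd_swap by (cases "1 \<le> fst z"; cases "1 \<le> snd z") simp_all

lemma grid_weights_restrict:
  assumes "0 \<le> z" "z \<noteq> 0"
  shows "grid_weights (\<lambda>i. f (int i, 0)) (\<lambda>j. f (0, int j)) (\<lambda>i j. f (int i, int j)) z = f z"
proof -
  obtain a b where z: "z = (a, b)" by fastforce
  consider "1 \<le> a" "1 \<le> b" | "1 \<le> a" "b = 0" | "a = 0" "1 \<le> b"
    using assms unfolding z le_prod_iff zero_prod_def by fastforce
  then show ?thesis by cases (simp_all add: z grid_weights_def)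
qed

text \<open>
  The reversed models need boundary weights that are independent of the rectangle and of the axes.
  They are taken from the bulk weights in the two rows above and the two columns to the right
  of the rectangle, which have to be rescaled to the required rates.
\<close>

definition site :: "nat \<Rightarrow> nat \<Rightarrow> slot \<Rightarrow> int \<times> int" where
  "site m n k = (case k of HI i \<Rightarrow> (int m + 1 - int i, int n + 1) | VI i \<Rightarrow> (int m + 1 - int i, int n + 2)
     | WW \<Rightarrow> (int m + 1, int n + 1) | SJ j \<Rightarrow> (int m + 1, int n + 1 - int j) | AJ j \<Rightarrow> (int m + 2, int n + 1 - int j)
     | OM i j \<Rightarrow> (int m + 1 - int i, int n + 1 - int j) | BI i \<Rightarrow> (int i, 0) | BJ j \<Rightarrow> (0, int j))"

lemma inj_site: "inj_on (site m n) (all_slots m n)"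
proof (rule inj_onI)
  fix a b assume "a \<in> all_slots m n" "b \<in> all_slots m n" "site m n a = site m n b"
  then show "a = b" by (cases a; cases b) (auto simp: site_def)
qed

lemma coupled_family:
  fixes m n :: nat
  assumes base: "\<And>K. finite K \<Longrightarrow> K \<subseteq> weight_sites \<Longrightarrow> exp_family M K (weight_rate \<rho>) X\<^sub>0"
    and r: "0 < mu" "mu < \<rho>" "\<rho> < la" "la < 1"
  defines "X \<equiv> \<lambda>k \<omega>. weight_rate \<rho> (site m n k) / slot_rate \<rho> la mu k * X\<^sub>0 (site m n k) \<omega>"
  shows "exp_family M (all_slots m n) (slot_rate \<rho> la mu) X"
proof -
  have fin: "finite (all_slots m n)" by (simp add: all_slots_def)
  have sub: "site m n ` all_slots m n \<subseteq> weight_sites"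
    by (auto simp: all_slots_def site_def weight_sites_def zero_prod_def)
  have pos: "0 < weight_rate \<rho> z" "0 < slot_rate \<rho> la mu k" for z k
    using r by (auto simp: weight_rate_def slot_rate_def split: slot.splits)
  have "exp_family M (all_slots m n) (\<lambda>k. weight_rate \<rho> (site m n k)) (\<lambda>k. X\<^sub>0 (site m n k))"
    by (rule exp_family_reindex[OF base[of "site m n ` all_slots m n"] inj_site]) (use fin sub in auto)
  from exp_family_scale[OF this, of "\<lambda>k. weight_rate \<rho> (site m n k) / slot_rate \<rho> la mu k"] pos
  have "exp_family M (all_slots m n) (\<lambda>k. weight_rate \<rho> (site m n k) / (weight_rate \<rho> (site m n k) / slot_rate \<rho> la mu k)) X"
    unfolding X_def by simp
  then show ?thesis by (rule exp_family_cong) (use pos in \<open>auto simp: less_imp_neq[THEN not_sym]\<close>)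
qed

text \<open>
  A union bound over four unlikely exits and the \<open>k\<close> pairs of walks. The first two exit events concern
  the original model and place \<open>p\<close> near the corner; the other two concern the reversed
  models and justify the sandwich. The event itself is only covered by the measurable set \<open>B\<close> almost
  surely, since the comparison of the walks uses that the weights are nonnegative.
\<close>

lemma horizontal_exit_bound:
  fixes \<rho> t h a\<^sub>0 \<kappa> :: real and m n k T s s\<^sub>1 s\<^sub>2 :: nat
  assumes base: "\<And>K. finite K \<Longrightarrow> K \<subseteq> weight_sites \<Longrightarrow> exp_family M K (weight_rate \<rho>) X\<^sub>0"
    and \<rho>: "0 < \<kappa>" "\<kappa> < \<rho>" "\<kappa> < 1 - \<rho>"
    and t: "0 < t" "3 * t \<le> \<rho>" "3 * t \<le> 1 - \<rho>"
    and size: "1 \<le> s" "1 \<le> s\<^sub>1" "1 \<le> s\<^sub>2" "1 \<le> T" "1 \<le> k" "k \<le> s" "s \<le> m" "s \<le> n" "k + T + s\<^sub>1 < m" "T + s\<^sub>2 < n"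
      "s\<^sub>1 + (k + T) \<le> m" "s\<^sub>2 + T \<le> n"
    and a\<^sub>0: "a\<^sub>0 \<le> \<rho>" "a\<^sub>0 \<le> 1 - \<rho>" and h: "0 < h" "h < a\<^sub>0" "\<kappa> * h + 1 / (2 * real T) \<le> h\<^sup>2" "a\<^sub>0 \<le> 2 * real T * h"
  shows "\<exists>B\<in>sets M. (AE \<omega> in M. (\<exists>z\<in>pos_quadrant. \<not> (fst z \<le> int m \<and> snd z \<le> int n) \<and>
       (\<exists>e. 1 \<le> e \<and> e \<le> int k \<and> opt_exit (\<lambda>z. X\<^sub>0 z \<omega>) z e)) \<longrightarrow> \<omega> \<in> B) \<and>
     emeasure M B \<le> ennreal (k * (32 * h\<^sup>2 / a\<^sub>0\<^sup>2) + exit_expr (1 - \<rho>) t n (m - s\<^sub>1) s + exit_expr \<rho> t m (n - s\<^sub>2) s +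
       exit_expr (\<rho> + \<kappa>) t (m - k - T) n s\<^sub>1 + exit_expr (1 - (\<rho> - \<kappa>)) t (n - T) m s\<^sub>2)"
proof -
  define la where "la = \<rho> + \<kappa>"
  define mu where "mu = \<rho> - \<kappa>"
  have r: "0 < mu" "mu < \<rho>" "\<rho> < la" "la < 1" using \<rho> by (auto simp: la_def mu_def)
  define X where "X = (\<lambda>k \<omega>. weight_rate \<rho> (site m n k) / slot_rate \<rho> la mu k * X\<^sub>0 (site m n k) \<omega>)"
  have XA: "exp_family M (all_slots m n) (slot_rate \<rho> la mu) X"
    unfolding X_def by (rule coupled_family[OF base r])
  define w where "w = (\<lambda>\<omega> z. X\<^sub>0 z \<omega>)"
  let ?x = "\<lambda>\<omega> k. X k \<omega>"
  interpret M: prob_space M by (rule exp_familyD(1)[OF XA])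
  \<comment> \<open>The four exit events.\<close>
  define g\<^sub>1 where "g\<^sub>1 = (\<lambda>k. case k of HI i \<Rightarrow> (0, int i) | SJ j \<Rightarrow> (int j, 0) | OM i j \<Rightarrow> (int j, int i) | _ \<Rightarrow> 0)"
  define g\<^sub>2 where "g\<^sub>2 = (\<lambda>k. case k of HI i \<Rightarrow> (int i, 0) | SJ j \<Rightarrow> (0, int j) | OM i j \<Rightarrow> (int i, int j) | _ \<Rightarrow> 0)"
  define g\<^sub>4 where "g\<^sub>4 = (\<lambda>k. case k of HI i \<Rightarrow> SJ i | SJ j \<Rightarrow> HI j | OM i j \<Rightarrow> OM j i | _ \<Rightarrow> k)"
  define V where "V = (\<lambda>k \<omega>. case k of HI i \<Rightarrow> mu_h (?x \<omega>) m i | SJ j \<Rightarrow> mu_v (?x \<omega>) m j | _ \<Rightarrow> X k \<omega>)"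
  have sub: "g\<^sub>1 ` grid_slots a b \<subseteq> weight_sites" "g\<^sub>2 ` grid_slots a b \<subseteq> weight_sites" for a b
    by (auto simp: g\<^sub>1_def g\<^sub>2_def grid_slots_def weight_sites_def zero_prod_def)
  have injg: "inj_on g\<^sub>1 (grid_slots a b)" "inj_on g\<^sub>2 (grid_slots a b)" for a b
  proof -
    have "x = y" if "x \<in> grid_slots a b" "y \<in> grid_slots a b" "g\<^sub>1 x = g\<^sub>1 y \<or> g\<^sub>2 x = g\<^sub>2 y" for x y
      using that unfolding g\<^sub>1_def g\<^sub>2_def by (cases x; cases y; force simp: zero_prod_def)
    then show "inj_on g\<^sub>1 (grid_slots a b)" "inj_on g\<^sub>2 (grid_slots a b)" by (auto intro!: inj_onI)
  qed
  have F1: "exp_family M (grid_slots n (m - s\<^sub>1)) (grid_rate (1 - (1 - \<rho>)) (1 - \<rho>)) (\<lambda>k. X\<^sub>0 (g\<^sub>1 k))"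
    by (rule exp_family_cong[OF exp_family_reindex[OF base[OF _ sub(1)] injg(1)]])
      (use sub in \<open>auto simp: finite_grid_slots\<close>, auto simp: g\<^sub>1_def grid_slots_def weight_rate_def)
  have F2: "exp_family M (grid_slots m (n - s\<^sub>2)) (grid_rate (1 - \<rho>) \<rho>) (\<lambda>k. X\<^sub>0 (g\<^sub>2 k))"
    by (rule exp_family_cong[OF exp_family_reindex[OF base[OF _ sub(2)] injg(2)]])
      (use sub in \<open>auto simp: finite_grid_slots\<close>, auto simp: g\<^sub>2_def grid_slots_def weight_rate_def)
  have F3: "exp_family M (grid_slots (m - k - T) n) (grid_rate (1 - la) la) X"
    by (rule exp_family_cong[OF exp_family_subset[OF XA]]) (auto simp: grid_slots_def)
  have F4: "exp_family M (grid_slots (n - T) m) (grid_rate (1 - (1 - mu)) (1 - mu)) (\<lambda>k. V (g\<^sub>4 k))"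
  proof (rule exp_family_cong[OF exp_family_reindex])
    show "exp_family M (grid_slots m n) (grid_rate (1 - mu) mu) V"
      unfolding V_def by (rule coupled_input_law[OF XA])
    have "x = y" if "g\<^sub>4 x = g\<^sub>4 y" for x y
      using that unfolding g\<^sub>4_def by (cases x; cases y; simp)
    then show "inj_on g\<^sub>4 (grid_slots (n - T) m)" by (auto intro!: inj_onI)
    show "g\<^sub>4 ` grid_slots (n - T) m \<subseteq> grid_slots m n"
    proof (rule image_subsetI)
      fix x assume "x \<in> grid_slots (n - T) m"
      then show "g\<^sub>4 x \<in> grid_slots m n" by (cases x) (auto simp: g\<^sub>4_def)
    qed
  qed (auto simp: g\<^sub>4_def grid_slots_def)
  let ?E1 = "\<lambda>\<omega>. small_exit (slot_weights (\<lambda>k. X\<^sub>0 (g\<^sub>1 k) \<omega>)) (int n, int (m - s\<^sub>1)) (int s)"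
  let ?E2 = "\<lambda>\<omega>. small_exit (slot_weights (\<lambda>k. X\<^sub>0 (g\<^sub>2 k) \<omega>)) (int m, int (n - s\<^sub>2)) (int s)"
  let ?E3 = "\<lambda>\<omega>. small_exit (slot_weights (?x \<omega>)) (int (m - k - T), int n) (int s\<^sub>1)"
  let ?E4 = "\<lambda>\<omega>. small_exit (slot_weights (\<lambda>k. V (g\<^sub>4 k) \<omega>)) (int (n - T), int m) (int s\<^sub>2)"
  have meas: "{\<omega> \<in> space M. small_exit (slot_weights (\<lambda>k. Y k \<omega>)) (int a, int b) c} \<in> sets M"
    if Y: "exp_family M (grid_slots a b) R Y" and ab: "1 \<le> a" "1 \<le> b" for a b c R Y
    by (rule sets_small_exit, rule measurable_grid_weights[where m=a and n=b])
      (use exp_familyD(4)[OF Y] ab in \<open>auto simp: pos_quadrant_def\<close>)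
  have b1: "emeasure M {\<omega> \<in> space M. ?E1 \<omega>} \<le> ennreal (exit_expr (1 - \<rho>) t n (m - s\<^sub>1) s)"
    unfolding exit_expr_def by (rule exit_bound[OF F1]) (use t \<rho> size in auto)
  have b2: "emeasure M {\<omega> \<in> space M. ?E2 \<omega>} \<le> ennreal (exit_expr \<rho> t m (n - s\<^sub>2) s)"
    unfolding exit_expr_def by (rule exit_bound[OF F2]) (use t \<rho> size in auto)
  have b3: "emeasure M {\<omega> \<in> space M. ?E3 \<omega>} \<le> ennreal (exit_expr la t (m - k - T) n s\<^sub>1)"
    unfolding exit_expr_def by (rule exit_bound[OF F3]) (use t \<rho> size in \<open>auto simp: la_def\<close>)
  have b4: "emeasure M {\<omega> \<in> space M. ?E4 \<omega>} \<le> ennreal (exit_expr (1 - mu) t (n - T) m s\<^sub>2)"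
    unfolding exit_expr_def by (rule exit_bound[OF F4]) (use t \<rho> r size in \<open>auto simp: mu_def\<close>)
  \<comment> \<open>The walk event of each exit point.\<close>
  let ?y = "\<lambda>\<omega>. outgoing (?x \<omega>) m n"
  let ?Z = "\<lambda>k \<omega>. ?y \<omega> k"
  define W where "W = (\<lambda>e. {\<omega> \<in> space M. stays_below (right_walk m T e) (\<lambda>k. ?Z k \<omega>) 0 \<and>
     stays_below (left_walk m n T e) (\<lambda>k. ?Z k \<omega>) (?Z (BI e) \<omega>)})"
  define J where "J = (\<lambda>m\<^sub>0. HI ` {1..m\<^sub>0} \<union> VI ` {m\<^sub>0<..m} \<union> AJ ` {1..n} \<union> BI ` {1..m} \<union> BJ ` {1..n})"
  have memJ: "HI i \<in> J m\<^sub>0 \<longleftrightarrow> 1 \<le> i \<and> i \<le> m\<^sub>0" "VI i \<in> J m\<^sub>0 \<longleftrightarrow> m\<^sub>0 < i \<and> i \<le> m" "AJ j \<in> J m\<^sub>0 \<longleftrightarrow> 1 \<le> j \<and> j \<le> n"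
    "BI i \<in> J m\<^sub>0 \<longleftrightarrow> 1 \<le> i \<and> i \<le> m" "BJ j \<in> J m\<^sub>0 \<longleftrightarrow> 1 \<le> j \<and> j \<le> n" for i j m\<^sub>0
    unfolding J_def by auto
  have FZ: "exp_family M (J m\<^sub>0) (slot_rate \<rho> la mu) ?Z" if "m\<^sub>0 \<le> m" for m\<^sub>0
    unfolding J_def by (rule exp_family_cong[OF coupled_output_law[OF XA that]]) (auto simp: outgoing_def)
  have walks: "W e \<in> sets M \<and> emeasure M (W e) \<le> ennreal (32 * h\<^sup>2 / a\<^sub>0\<^sup>2)" if e: "e \<in> {1..k}" for e
  proof
    \<comment> \<open>The exit splits the reversed columns: \<open>\<lambda>\<close>-increments are used up to column \<open>m\<^sub>0\<close>, \<open>\<mu>\<close>-increments beyond.\<close>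
    define m\<^sub>0 where "m\<^sub>0 = m + 1 - e"
    have m0: "m\<^sub>0 \<le> m" "m\<^sub>0 + e = m + 1" using e size by (auto simp: m\<^sub>0_def)
    let ?l1 = "right_walk m T e" and ?l2 = "left_walk m n T e"
    have s1: "slots ?l1 = map (\<lambda>i. BI (e + i + 1)) [0..<T] @ map (\<lambda>i. HI (m + 1 - (e + i))) [0..<T]"
      by (simp add: slots_def right_walk_def)
    have s2: "slots ?l2 = map (\<lambda>i. VI (m + 1 - (e - 1 - i))) [0..<e - 1] @ map (\<lambda>j. BJ (Suc j)) [0..<T] @
        map (\<lambda>i. BI (e - 1 - i)) [0..<e - 1] @ map (\<lambda>j. AJ (n - j)) [0..<T]"
      by (simp add: slots_def left_walk_def)
    have d: "distinct (slots ?l1 @ BI e # slots ?l2)"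
      unfolding s1 s2 using e size by (auto simp: distinct_map inj_on_def)
    have K: "set (slots ?l1 @ BI e # slots ?l2) \<subseteq> J m\<^sub>0"
    proof
      fix q assume "q \<in> set (slots ?l1 @ BI e # slots ?l2)"
      then consider i where "i < T" "q = BI (e + i + 1)" | i where "i < T" "q = HI (m + 1 - (e + i))" | "q = BI e"
        | i where "i < e - 1" "q = VI (m + 1 - (e - 1 - i))" | j where "j < T" "q = BJ (Suc j)"
        | i where "i < e - 1" "q = BI (e - 1 - i)" | j where "j < T" "q = AJ (n - j)"
        unfolding s1 s2 by fastforce
      then show "q \<in> J m\<^sub>0" by cases (use e size m0 in \<open>simp_all add: memJ, arith+\<close>)
    qed
    have len: "length ?l1 = T" "length ?l2 = e - 1 + T" by (simp_all add: right_walk_def left_walk_def)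
    note D = exp_familyD[OF FZ[OF m0(1)]]
    have "W e = {\<omega> \<in> space M. stays_below ?l1 (\<lambda>k. ?Z k \<omega>) 0} \<inter> {\<omega> \<in> space M. stays_below ?l2 (\<lambda>k. ?Z k \<omega>) (?Z (BI e) \<omega>)}"
      by (auto simp: W_def)
    moreover have "\<dots> \<in> sets M"
      using K by (intro sets.Int sets_stays_below D(4)) auto
    ultimately show "W e \<in> sets M" by simp
    have T0: "0 < real T" using size by simp
    have rate: "a * b / (2 * real N) \<le> 1 / (2 * real T)" if "0 \<le> a" "a \<le> 1" "0 \<le> b" "b \<le> 1" "T \<le> N" for a b :: real and N
      using that T0 by (intro frac_le mult_le_one) auto
    have kh: "\<kappa> * h + z \<le> h\<^sup>2" if "z \<le> 1 / (2 * real T)" for z using that h(3) by simp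
    have "emeasure M (W e) \<le> ennreal (16 * h\<^sup>2 / a\<^sub>0 * (1 / a\<^sub>0 + 1 / slot_rate \<rho> la mu (BI e)))"
      unfolding W_def
    proof (rule two_walks_bound[OF FZ[OF m0(1)] d K])
      show "?l1 \<noteq> []" "?l2 \<noteq> []" using size by (auto simp: right_walk_def left_walk_def)
      show "0 < h" "h < a\<^sub>0" by (rule h)+
      fix \<alpha> \<beta> assume "(\<alpha>, \<beta>) \<in> set ?l1"
      then have ab: "slot_rate \<rho> la mu \<alpha> = 1 - \<rho>" "slot_rate \<rho> la mu \<beta> = 1 - la"
        by (auto simp: right_walk_def)
      show "a\<^sub>0 \<le> slot_rate \<rho> la mu \<alpha> \<and> (slot_rate \<rho> la mu \<alpha> - slot_rate \<rho> la mu \<beta>) * h +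
          slot_rate \<rho> la mu \<alpha> * slot_rate \<rho> la mu \<beta> / real (2 * length ?l1) \<le> h\<^sup>2"
        unfolding ab len using a\<^sub>0 kh[OF rate[of "1 - \<rho>" "1 - la" T]] r by (simp add: la_def)
    next
      fix \<alpha> \<beta> assume "(\<alpha>, \<beta>) \<in> set ?l2"
      then consider "slot_rate \<rho> la mu \<alpha> = 1 - mu" "slot_rate \<rho> la mu \<beta> = 1 - \<rho>"
        | "slot_rate \<rho> la mu \<alpha> = \<rho>" "slot_rate \<rho> la mu \<beta> = mu"
        by (auto simp: left_walk_def)
      then show "a\<^sub>0 \<le> slot_rate \<rho> la mu \<alpha> \<and> (slot_rate \<rho> la mu \<alpha> - slot_rate \<rho> la mu \<beta>) * h +
          slot_rate \<rho> la mu \<alpha> * slot_rate \<rho> la mu \<beta> / real (2 * length ?l2) \<le> h\<^sup>2"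
      proof cases
        case 1
        show ?thesis unfolding 1 len using a\<^sub>0 kh[OF rate[of "1 - mu" "1 - \<rho>" "e - 1 + T"]] r by (simp add: mu_def)
      next
        case 2
        show ?thesis unfolding 2 len using a\<^sub>0 kh[OF rate[of \<rho> mu "e - 1 + T"]] r by (simp add: mu_def)
      qed
    next
      show "a\<^sub>0 \<le> real (2 * length ?l1) * h" using h unfolding len by simp
      have "2 * real T * h \<le> real (2 * (e - 1 + T)) * h" using h by (intro mult_right_mono) auto
      then show "a\<^sub>0 \<le> real (2 * length ?l2) * h" using h unfolding len by linarith
    qed
    also have "\<dots> \<le> ennreal (16 * h\<^sup>2 / a\<^sub>0 * (1 / a\<^sub>0 + 1 / a\<^sub>0))"
      using h a\<^sub>0 r by (intro ennreal_leI mult_left_mono add_left_mono) (auto intro!: divide_left_mono)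
    also have "16 * h\<^sup>2 / a\<^sub>0 * (1 / a\<^sub>0 + 1 / a\<^sub>0) = 32 * h\<^sup>2 / a\<^sub>0\<^sup>2" by (simp add: power2_eq_square)
    finally show "emeasure M (W e) \<le> ennreal (32 * h\<^sup>2 / a\<^sub>0\<^sup>2)" .
  qed
  define B\<^sub>0 where "B\<^sub>0 = {\<omega> \<in> space M. ?E1 \<omega>} \<union> {\<omega> \<in> space M. ?E2 \<omega>} \<union> {\<omega> \<in> space M. ?E3 \<omega>} \<union> {\<omega> \<in> space M. ?E4 \<omega>}"
  define B where "B = B\<^sub>0 \<union> (\<Union>e\<in>{1..k}. W e)"
  have mE: "{\<omega> \<in> space M. ?E1 \<omega>} \<in> sets M" "{\<omega> \<in> space M. ?E2 \<omega>} \<in> sets M" "{\<omega> \<in> space M. ?E3 \<omega>} \<in> sets M"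
    "{\<omega> \<in> space M. ?E4 \<omega>} \<in> sets M"
    by (rule meas[OF F1] meas[OF F2] meas[OF F3] meas[OF F4], (use size in linarith)+)+
  have mW: "(\<Union>e\<in>{1..k}. W e) \<in> sets M" using walks by auto
  have BM: "B \<in> sets M" unfolding B_def B\<^sub>0_def using mE mW by auto
  have nn: "AE \<omega> in M. \<forall>k\<in>J m. 0 \<le> ?Z k \<omega>" by (rule exp_family_AE_nonneg[OF FZ]) simp
  have "AE \<omega> in M. (\<exists>z\<in>pos_quadrant. \<not> (fst z \<le> int m \<and> snd z \<le> int n) \<and>
       (\<exists>e. 1 \<le> e \<and> e \<le> int k \<and> opt_exit (\<lambda>z. X\<^sub>0 z \<omega>) z e)) \<longrightarrow> \<omega> \<in> B"
    using nn AE_space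
  proof eventually_elim
    case (elim \<omega>)
    show ?case
    proof
      assume "\<exists>z\<in>pos_quadrant. \<not> (fst z \<le> int m \<and> snd z \<le> int n) \<and>
       (\<exists>e. 1 \<le> e \<and> e \<le> int k \<and> opt_exit (\<lambda>z. X\<^sub>0 z \<omega>) z e)"
      then obtain z e' where z: "z \<in> pos_quadrant" "\<not> (fst z \<le> int m \<and> snd z \<le> int n)"
        "1 \<le> e'" "e' \<le> int k" "opt_exit (w \<omega>) z e'" by (auto simp: w_def)
      define e where "e = nat e'"
      have e: "e' = int e" "1 \<le> e" "e \<le> k" using z by (auto simp: e_def)
      have "\<exists>p. (fst p = int m \<and> 1 \<le> snd p \<and> snd p \<le> int n \<or> snd p = int n \<and> e' \<le> fst p \<and> fst p \<le> int m) \<and> opt_exit (w \<omega>) p e'"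
        by (rule opt_exit_boundary[OF z(5,1,2)]) (use z size e in auto)
      then obtain p where p: "fst p = int m \<and> 1 \<le> snd p \<and> snd p \<le> int n \<or> snd p = int n \<and> e' \<le> fst p \<and> fst p \<le> int m"
        "opt_exit (w \<omega>) p (int e)" using e(1) by blast
      have pq: "p \<in> pos_quadrant" using p(1) z size by (auto simp: pos_quadrant_def)
      consider "snd p = int n" "fst p \<le> int (m - s\<^sub>1)" | "fst p = int m" "snd p \<le> int (n - s\<^sub>2)"
        | "snd p = int n \<and> int m - int s\<^sub>1 < fst p \<and> fst p \<le> int m \<or> fst p = int m \<and> int n - int s\<^sub>2 < snd p \<and> snd p \<le> int n"
        using p(1) size by fastforce
      then show "\<omega> \<in> B"
      proof cases
        case 1
        have "small_exit (\<lambda>z. w \<omega> (prod.swap z)) (prod.swap (int (m - s\<^sub>1), int n)) (int s)"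
          by (rule opt_exit_far_left[OF p(2)]) (use 1 pq e size in \<open>auto simp: pos_quadrant_def\<close>)
        moreover have "small_exit (\<lambda>z. w \<omega> (prod.swap z)) (int n, int (m - s\<^sub>1)) (int s) \<longleftrightarrow> ?E1 \<omega>"
          using size grid_weights_restrict[of _ "\<lambda>z. w \<omega> (prod.swap z)"]
          by (intro small_exit_cong) (auto simp: w_def g\<^sub>1_def pos_quadrant_def)
        ultimately show ?thesis using elim(2) by (simp add: B_def B\<^sub>0_def)
      next
        case 2
        have "small_exit (w \<omega>) (int m, int (n - s\<^sub>2)) (int s)"
          by (rule opt_exit_far_right[OF p(2)]) (use 2 pq e size in \<open>auto simp: pos_quadrant_def\<close>)
        moreover have "small_exit (w \<omega>) (int m, int (n - s\<^sub>2)) (int s) \<longleftrightarrow> ?E2 \<omega>"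
          using size grid_weights_restrict[of _ "w \<omega>"]
          by (intro small_exit_cong) (auto simp: w_def g\<^sub>2_def pos_quadrant_def)
        ultimately show ?thesis using elim(2) by (simp add: B_def B\<^sub>0_def)
      next
        case 3
        show ?thesis
        proof (cases "?E3 \<omega> \<or> ?E4 \<omega>")
          case True
          then show ?thesis using elim(2) by (auto simp: B_def B\<^sub>0_def)
        next
          case False
          have E4: "small_exit (\<lambda>z. mu_weights (?x \<omega>) m (prod.swap z)) (int n - int T, int m) (int s\<^sub>2) \<longleftrightarrow> ?E4 \<omega>"
          proof -
            have "(\<lambda>z. mu_weights (?x \<omega>) m (prod.swap z)) = slot_weights (\<lambda>k. V (g\<^sub>4 k) \<omega>)"
              unfolding grid_weights_swap by (simp add: V_def g\<^sub>4_def)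
            moreover have "int n - int T = int (n - T)" using size(12) by linarith
            ultimately show ?thesis by (simp only:)
          qed
          have E3: "int m - int k - int T = int (m - k - T)" using size(11) by linarith
          have "stays_below (right_walk m T e) (?y \<omega>) 0 \<and> stays_below (left_walk m n T e) (?y \<omega>) (?y \<omega> (BI e))"
          proof (rule window_walks[where w="w \<omega>" and k=k and s\<^sub>1=s\<^sub>1 and s\<^sub>2=s\<^sub>2 and p=p])
            show "?x \<omega> (OM i j) = w \<omega> (int m + 1 - int i, int n + 1 - int j)" if "1 \<le> i" "i \<le> m" "1 \<le> j" "j \<le> n" for i j
              using that unfolding X_def w_def site_def weight_rate_def by simp
            show "?x \<omega> (BI i) = w \<omega> (int i, 0)" if "1 \<le> i" "i \<le> m" for i
              using that r unfolding X_def w_def site_def weight_rate_def by simp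
            show "?x \<omega> (BJ j) = w \<omega> (0, int j)" if "1 \<le> j" "j \<le> n" for j
              using that r unfolding X_def w_def site_def weight_rate_def by simp
            show "0 \<le> ?x \<omega> (BI i)" if "1 \<le> i" "i \<le> m" for i
            proof -
              have "BI i \<in> J m" using that memJ by simp
              with elim(1) have "0 \<le> ?y \<omega> (BI i)" by blast
              then show ?thesis by (simp add: outgoing_def)
            qed
            show "0 \<le> ?y \<omega> (AJ j)" if "1 \<le> j" "j \<le> n" for j
            proof -
              have "AJ j \<in> J m" using that memJ by simp
              with elim(1) show ?thesis by blast
            qed
            show "\<not> small_exit (slot_weights (?x \<omega>)) (int m - int k - int T, int n) (int s\<^sub>1)"
              using False unfolding E3 by simp
            show "\<not> small_exit (\<lambda>z. mu_weights (?x \<omega>) m (prod.swap z)) (int n - int T, int m) (int s\<^sub>2)"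
              using False E4 by simp
            show "1 \<le> s\<^sub>1" "1 \<le> s\<^sub>2" "k + T + s\<^sub>1 < m" "T + s\<^sub>2 < n" "1 \<le> T" by (rule size)+
            show "1 \<le> e" "e \<le> k" by (rule e)+
            show "opt_exit (w \<omega>) p (int e)" by (rule p)
            show "snd p = int n \<and> int m - int s\<^sub>1 < fst p \<and> fst p \<le> int m \<or>
              fst p = int m \<and> int n - int s\<^sub>2 < snd p \<and> snd p \<le> int n" by (rule 3)
          qed
          then have "\<omega> \<in> W e" using elim(2) by (simp add: W_def)
          then show ?thesis using e by (auto simp: B_def)
        qed
      qed
    qed
  qed
  moreover have "emeasure M B \<le> ennreal (k * (32 * h\<^sup>2 / a\<^sub>0\<^sup>2) + exit_expr (1 - \<rho>) t n (m - s\<^sub>1) s + exit_expr \<rho> t m (n - s\<^sub>2) s +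
       exit_expr la t (m - k - T) n s\<^sub>1 + exit_expr (1 - mu) t (n - T) m s\<^sub>2)"
  proof -
    have "emeasure M (\<Union>e\<in>{1..k}. W e) \<le> (\<Sum>e\<in>{1..k}. emeasure M (W e))"
      using walks by (intro emeasure_subadditive_finite) auto
    also have "\<dots> \<le> (\<Sum>e\<in>{1..k}. ennreal (32 * h\<^sup>2 / a\<^sub>0\<^sup>2))" using walks by (intro sum_mono) auto
    also have "\<dots> = ennreal (\<Sum>e\<in>{1..k}. 32 * h\<^sup>2 / a\<^sub>0\<^sup>2)" by (rule sum_ennreal) simp
    also have "(\<Sum>e\<in>{1..k}. 32 * h\<^sup>2 / a\<^sub>0\<^sup>2) = k * (32 * h\<^sup>2 / a\<^sub>0\<^sup>2)" by simp
    finally have bW: "emeasure M (\<Union>e\<in>{1..k}. W e) \<le> ennreal (k * (32 * h\<^sup>2 / a\<^sub>0\<^sup>2))" .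
    have pos: "0 \<le> exit_expr p t a b c" for p a b c by (simp add: exit_expr_def add_nonneg_nonneg)
    have un: "emeasure M (A \<union> A') \<le> ennreal (u + v)"
      if "A \<in> sets M" "A' \<in> sets M" "emeasure M A \<le> ennreal u" "emeasure M A' \<le> ennreal v" "0 \<le> u" "0 \<le> v" for A A' u v
    proof -
      have "emeasure M (A \<union> A') \<le> emeasure M A + emeasure M A'" by (rule emeasure_subadditive[OF that(1,2)])
      also have "\<dots> \<le> ennreal u + ennreal v" by (intro add_mono that)
      also have "\<dots> = ennreal (u + v)" using that by simp
      finally show ?thesis .
    qed
    have "emeasure M B \<le> ennreal ((((exit_expr (1 - \<rho>) t n (m - s\<^sub>1) s + exit_expr \<rho> t m (n - s\<^sub>2) s) +
       exit_expr la t (m - k - T) n s\<^sub>1) + exit_expr (1 - mu) t (n - T) m s\<^sub>2) + k * (32 * h\<^sup>2 / a\<^sub>0\<^sup>2))"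
      unfolding B_def B\<^sub>0_def
      by (intro un sets.Un mE mW b1 b2 b3 b4 bW pos add_nonneg_nonneg) auto
    then show ?thesis by (simp add: add_ac)
  qed
  ultimately show ?thesis using BM unfolding la_def mu_def by blast
qed

section \<open>Choice of the scales\<close>

lemma mult_power2_divide_diff: "x * (y / z)\<^sup>2 - w / z\<^sup>2 = (x * y\<^sup>2 - w) / (z\<^sup>2 :: real)"
  by (simp add: power_divide diff_divide_distrib)

text \<open>
  Under \<open>diff\<close> the endpoint misses the characteristic direction of \<open>p - \<epsilon>\<close> by a large enough
  multiple of \<open>\<epsilon> N\<close> to make the exponent in \<open>exit_expr\<close> at most \<open>- \<epsilon>\<^sup>2 (\<epsilon> N)\<close>.
\<close>

lemma exit_expr_le:
  fixes b p \<epsilon> N c :: real and m n s :: nat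
  assumes b: "0 < b" "b \<le> 1" and p: "b / 2 \<le> 1 - p" "b / 2 \<le> p - \<epsilon>" and \<epsilon>: "0 < \<epsilon>" "\<epsilon> \<le> 1" "16 * \<epsilon> \<le> b ^ 4"
    and N: "0 < N" and n: "real n \<le> N" and s: "real s \<le> c * (\<epsilon> * N)" "\<epsilon> * N \<le> real s"
    and diff: "real n / (p - \<epsilon>)\<^sup>2 - real m / (1 - (p - \<epsilon>))\<^sup>2 \<le> - 2 * (16 * c / b\<^sup>2 + 2) * (\<epsilon> * N)"
  shows "exit_expr p \<epsilon> m n s \<le> 3 * exp (- (N * \<epsilon> ^ 3))"
proof -
  define u where "u = p - \<epsilon>"
  have u: "b / 2 \<le> u" using p by (simp add: u_def)
  have eN: "0 < \<epsilon> * N" using \<epsilon> N by simp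
  have s0: "0 \<le> c" using s eN by (metis dual_order.trans less_eq_real_def linorder_not_less mult_neg_pos of_nat_0_le_iff)
  have p4: "(b / 2)\<^sup>2 \<le> (1 - p)\<^sup>2" using p b by (intro power_mono) auto
  have "4 * real s / (1 - p)\<^sup>2 \<le> 4 * (c * (\<epsilon> * N)) / (b / 2)\<^sup>2"
    using p4 s b by (intro frac_le) auto
  also have "\<dots> = 16 * c / b\<^sup>2 * (\<epsilon> * N)" by (simp add: power_divide)
  finally have 1: "4 * real s / (1 - p)\<^sup>2 \<le> 16 * c / b\<^sup>2 * (\<epsilon> * N)" .
  have u4: "(b / 2) ^ 4 \<le> u ^ 4" using u b by (intro power_mono) auto
  have "real n * \<epsilon>\<^sup>2 / u ^ 4 \<le> N * \<epsilon>\<^sup>2 / (b / 2) ^ 4"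
    using u4 n b by (intro frac_le mult_right_mono) auto
  also have "\<dots> = (16 * \<epsilon> / b ^ 4) * (\<epsilon> * N)" by (simp add: power_divide power2_eq_square)
  also have "\<dots> \<le> 1 * (\<epsilon> * N)" using \<epsilon> b eN by (intro mult_right_mono) auto
  finally have 2: "real n * \<epsilon>\<^sup>2 / u ^ 4 \<le> \<epsilon> * N" by simp
  have "4 * real s / (1 - p)\<^sup>2 + (real n / u\<^sup>2 - real m / (1 - u)\<^sup>2) / 2 + real n * \<epsilon>\<^sup>2 / u ^ 4 \<le>
    16 * c / b\<^sup>2 * (\<epsilon> * N) + (- 2 * (16 * c / b\<^sup>2 + 2) * (\<epsilon> * N)) / 2 + \<epsilon> * N"
    using 1 2 diff unfolding u_def[symmetric] by (intro add_mono divide_right_mono) auto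
  also have "\<dots> = - (\<epsilon> * N)"
  proof -
    have "(- 2 * (16 * c / b\<^sup>2 + 2) * (\<epsilon> * N)) / 2 = - (16 * c / b\<^sup>2 + 2) * (\<epsilon> * N)" by simp
    then show ?thesis by (simp only:) (simp add: algebra_simps)
  qed
  finally have "\<epsilon>\<^sup>2 * (4 * real s / (1 - p)\<^sup>2 + (real n / u\<^sup>2 - real m / (1 - u)\<^sup>2) / 2 + real n * \<epsilon>\<^sup>2 / u ^ 4) \<le> \<epsilon>\<^sup>2 * (- (\<epsilon> * N))"
    by (intro mult_left_mono) auto
  also have "\<epsilon>\<^sup>2 * (4 * real s / (1 - p)\<^sup>2 + (real n / u\<^sup>2 - real m / (1 - u)\<^sup>2) / 2 + real n * \<epsilon>\<^sup>2 / u ^ 4) =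
     4 * real s * \<epsilon>\<^sup>2 / (1 - p)\<^sup>2 - real m * \<epsilon>\<^sup>2 / (2 * (1 - u)\<^sup>2) + real n * \<epsilon>\<^sup>2 / (2 * u\<^sup>2) + real n * \<epsilon> ^ 4 / u ^ 4"
    by (simp add: algebra_simps diff_divide_distrib power2_eq_square power4_eq_xxxx)
  also have "\<epsilon>\<^sup>2 * (- (\<epsilon> * N)) = - (N * \<epsilon> ^ 3)" by (simp add: power2_eq_square power3_eq_cube)
  finally have F1: "exp (4 * real s * \<epsilon>\<^sup>2 / (1 - p)\<^sup>2 - real m * \<epsilon>\<^sup>2 / (2 * (1 - u)\<^sup>2) + real n * \<epsilon>\<^sup>2 / (2 * u\<^sup>2) + real n * \<epsilon> ^ 4 / u ^ 4)
    \<le> exp (- (N * \<epsilon> ^ 3))" by simp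
  have F2: "exp (- real s) \<le> exp (- (N * \<epsilon> ^ 3))"
  proof -
    have "\<epsilon> ^ 3 \<le> \<epsilon> ^ 1" using \<epsilon> by (intro power_decreasing) auto
    then have "N * \<epsilon> ^ 3 \<le> N * \<epsilon>" using N by (intro mult_left_mono) auto
    then show ?thesis using s(2) by (simp add: mult.commute)
  qed
  show ?thesis unfolding exit_expr_def using F1 F2 unfolding u_def by linarith
qed

text \<open>
  Here the miss comes from the endpoint, which lies \<open>C \<epsilon> N\<close> below the corner.
\<close>

lemma exit_expr_forward:
  fixes b \<rho> \<epsilon> N C :: real and m n s :: nat
  assumes b: "0 < b" "b \<le> \<rho>" "b \<le> 1 - \<rho>" and \<epsilon>: "0 < \<epsilon>" "16 * \<epsilon> \<le> b ^ 4" "2 * \<epsilon> \<le> b"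
    and N: "0 < N" "1 \<le> \<epsilon> * N" and C: "4 + 75 / b\<^sup>2 \<le> C"
    and m: "N * (1 - \<rho>)\<^sup>2 - 1 \<le> real m" and n: "real n \<le> N * \<rho>\<^sup>2 - C * (\<epsilon> * N)"
    and s: "real s \<le> 2 * (\<epsilon> * N)" "\<epsilon> * N \<le> real s"
  shows "exit_expr \<rho> \<epsilon> m n s \<le> 3 * exp (- (N * \<epsilon> ^ 3))"
proof (rule exit_expr_le[OF b(1), where c=2])
  define u where "u = \<rho> - \<epsilon>"
  have b1: "b \<le> 1 / 2" using b by simp
  have u: "b / 2 \<le> u" "u \<le> 1" "b \<le> 1 - u" "1 - u \<le> 1" using b \<epsilon> by (auto simp: u_def)
  have eN: "0 < \<epsilon> * N" using N by simp
  have bb: "1 / b \<le> 1 / b\<^sup>2" using b b1 by (simp add: field_simps power2_eq_square)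
  have b2: "b\<^sup>2 \<le> 1" using b b1 by (simp add: power_le_one)
  have C0: "0 \<le> C" using C by (smt (verit) divide_nonneg_nonneg zero_le_power2)
  have "real n / u\<^sup>2 \<le> (N * \<rho>\<^sup>2 - C * (\<epsilon> * N)) / u\<^sup>2" using n by (intro divide_right_mono) auto
  also have "\<dots> = N * (\<rho> / u)\<^sup>2 - C * (\<epsilon> * N) / u\<^sup>2" by (simp only: power_divide diff_divide_distrib times_divide_eq_right)
  also have "\<dots> \<le> N * (1 + 8 * \<epsilon> / b) - C * (\<epsilon> * N)"
  proof (rule diff_mono)
    have "\<rho> / u = 1 + \<epsilon> / u" using u b by (simp add: u_def field_simps)
    also have "\<epsilon> / u \<le> \<epsilon> / (b / 2)" using u b \<epsilon> by (intro divide_left_mono) auto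
    finally have "\<rho> / u \<le> 1 + 2 * \<epsilon> / b" by (simp add: mult.commute)
    then have "(\<rho> / u)\<^sup>2 \<le> (1 + 2 * \<epsilon> / b)\<^sup>2" using b u by (intro power_mono) auto
    also have "\<dots> = 1 + 4 * (\<epsilon> / b) + 4 * (\<epsilon> / b) * (\<epsilon> / b)" by (simp add: power2_eq_square algebra_simps)
    also have "\<dots> \<le> 1 + 4 * (\<epsilon> / b) + 4 * (\<epsilon> / b) * 1"
      using b \<epsilon> by (intro add_left_mono mult_left_mono) (auto simp: field_simps)
    finally have "(\<rho> / u)\<^sup>2 \<le> 1 + 8 * \<epsilon> / b" by simp
    then show "N * (\<rho> / u)\<^sup>2 \<le> N * (1 + 8 * \<epsilon> / b)" using N by (intro mult_left_mono) auto
    have "u\<^sup>2 \<le> 1" using u b by (intro power_le_one) auto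
    then have "C * (\<epsilon> * N) / 1 \<le> C * (\<epsilon> * N) / u\<^sup>2"
      using C0 eN u b by (intro divide_left_mono) auto
    then show "C * (\<epsilon> * N) \<le> C * (\<epsilon> * N) / u\<^sup>2" by simp
  qed
  finally have 1: "real n / u\<^sup>2 \<le> N + 8 * (1 / b) * (\<epsilon> * N) - C * (\<epsilon> * N)" by (simp add: algebra_simps)
  have "N * (1 - 2 * (\<epsilon> / b)) - (\<epsilon> * N) / b\<^sup>2 \<le> N * ((1 - \<rho>) / (1 - u))\<^sup>2 - 1 / (1 - u)\<^sup>2"
  proof (rule diff_mono)
    have "(1 - \<rho>) / (1 - u) = 1 - \<epsilon> / (1 - u)" using u b by (simp add: u_def field_simps)
    moreover have "\<epsilon> / (1 - u) \<le> \<epsilon> / b" using u b \<epsilon> by (intro divide_left_mono) auto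
    ultimately have q: "1 - \<epsilon> / b \<le> (1 - \<rho>) / (1 - u)" by simp
    have "1 - 2 * (\<epsilon> / b) \<le> (1 - \<epsilon> / b)\<^sup>2" by (simp add: power2_eq_square algebra_simps)
    also have "\<dots> \<le> ((1 - \<rho>) / (1 - u))\<^sup>2" using q b \<epsilon> by (intro power_mono) (auto simp: field_simps)
    finally show "N * (1 - 2 * (\<epsilon> / b)) \<le> N * ((1 - \<rho>) / (1 - u))\<^sup>2" using N by (intro mult_left_mono) auto
    have "b\<^sup>2 \<le> (1 - u)\<^sup>2" using u b by (intro power_mono) auto
    then show "1 / (1 - u)\<^sup>2 \<le> \<epsilon> * N / b\<^sup>2" using N b by (intro frac_le) auto
  qed
  also have "\<dots> = (N * (1 - \<rho>)\<^sup>2 - 1) / (1 - u)\<^sup>2" by (rule mult_power2_divide_diff)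
  also have "\<dots> \<le> real m / (1 - u)\<^sup>2" using m by (intro divide_right_mono) auto
  finally have 2: "N - 2 * (1 / b) * (\<epsilon> * N) - (1 / b\<^sup>2) * (\<epsilon> * N) \<le> real m / (1 - u)\<^sup>2" by (simp add: algebra_simps)
  \<comment> \<open>The constant 75 consists of 64 for the exit window and 11 for rounding and for the linearized squares.\<close>
  have "10 * (1 / b) + 1 / b\<^sup>2 - C \<le> - 2 * (16 * 2 / b\<^sup>2 + 2)" using C bb by simp
  then have "(10 * (1 / b) + 1 / b\<^sup>2 - C) * (\<epsilon> * N) \<le> - 2 * (16 * 2 / b\<^sup>2 + 2) * (\<epsilon> * N)"
    using eN by (intro mult_right_mono) auto
  moreover have "(10 * (1 / b) + 1 / b\<^sup>2 - C) * (\<epsilon> * N) =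
    (N + 8 * (1 / b) * (\<epsilon> * N) - C * (\<epsilon> * N)) - (N - 2 * (1 / b) * (\<epsilon> * N) - (1 / b\<^sup>2) * (\<epsilon> * N))"
    by (simp add: algebra_simps)
  ultimately show "real n / (\<rho> - \<epsilon>)\<^sup>2 - real m / (1 - (\<rho> - \<epsilon>))\<^sup>2 \<le> - 2 * (16 * 2 / b\<^sup>2 + 2) * (\<epsilon> * N)"
    using 1 2 unfolding u_def[symmetric] by linarith
  have "N * \<rho>\<^sup>2 \<le> N * 1" using N b by (intro mult_left_mono power_le_one) auto
  moreover have "0 \<le> C * (\<epsilon> * N)" using C0 eN by simp
  ultimately show "real n \<le> N" using n by linarith
qed (use b \<epsilon> N s in auto)

text \<open>
  Here the miss comes from the parameter, which is tilted by \<open>\<eta> \<epsilon>\<close>.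
\<close>

lemma exit_expr_reverse:
  fixes b \<rho> \<epsilon> N C \<eta> :: real and m n s :: nat
  assumes b: "0 < b" "b \<le> \<rho>" "b \<le> 1 - \<rho>" and \<epsilon>: "0 < \<epsilon>" "16 * \<epsilon> \<le> b ^ 4" "2 * (\<eta> * \<epsilon>) \<le> b"
    and N: "0 < N" "1 \<le> \<epsilon> * N" and C: "0 \<le> C" and \<eta>: "3 + (16 * C + 24) / b\<^sup>2 \<le> \<eta>"
    and m: "N * (1 - \<rho>)\<^sup>2 - 4 * (\<epsilon> * N) \<le> real m" and n: "real n \<le> N * \<rho>\<^sup>2"
    and s: "real s \<le> (C + 1) * (\<epsilon> * N)" "\<epsilon> * N \<le> real s"
  shows "exit_expr (\<rho> + \<eta> * \<epsilon>) \<epsilon> m n s \<le> 3 * exp (- (N * \<epsilon> ^ 3))"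
proof (rule exit_expr_le[OF b(1), where c="C + 1"])
  define u where "u = \<rho> + \<eta> * \<epsilon> - \<epsilon>"
  have eN: "0 < \<epsilon> * N" using N by simp
  have "0 \<le> (16 * C + 24) / b\<^sup>2" using C by simp
  then have \<eta>1: "3 \<le> \<eta>" using \<eta> by simp
  then have "1 * \<epsilon> \<le> \<eta> * \<epsilon>" using \<epsilon> by (intro mult_right_mono) auto
  then have e\<eta>: "\<epsilon> \<le> \<eta> * \<epsilon>" by (simp only: mult_1)
  then have u: "\<rho> \<le> u" "b / 2 \<le> 1 - u" "1 - u \<le> 1" "0 < u" using b \<epsilon> unfolding u_def by linarith+
  have u1: "0 < 1 - u" using u b by linarith
  have "real n / u\<^sup>2 \<le> N * \<rho>\<^sup>2 / \<rho>\<^sup>2" using n u b N by (intro frac_le power_mono) auto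
  then have 1: "real n / u\<^sup>2 \<le> N" using b by simp
  have "N * (1 + 2 * ((\<eta> - 1) * \<epsilon>)) - 4 * (\<epsilon> * N) / (b / 2)\<^sup>2 \<le> N * ((1 - \<rho>) / (1 - u))\<^sup>2 - 4 * (\<epsilon> * N) / (1 - u)\<^sup>2"
  proof (rule diff_mono)
    have e0: "0 \<le> (\<eta> - 1) * \<epsilon>" using \<eta>1 \<epsilon> by simp
    have "(1 - \<rho>) / (1 - u) = 1 + (\<eta> - 1) * \<epsilon> / (1 - u)" using u1 by (simp add: u_def field_simps)
    moreover have "(\<eta> - 1) * \<epsilon> / 1 \<le> (\<eta> - 1) * \<epsilon> / (1 - u)" using u u1 e0 by (intro divide_left_mono) auto
    ultimately have q: "1 + (\<eta> - 1) * \<epsilon> \<le> (1 - \<rho>) / (1 - u)" by simp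
    have "1 + 2 * ((\<eta> - 1) * \<epsilon>) \<le> (1 + (\<eta> - 1) * \<epsilon>)\<^sup>2" by (simp add: power2_sum)
    also have "\<dots> \<le> ((1 - \<rho>) / (1 - u))\<^sup>2" using q e0 by (intro power_mono) auto
    finally show "N * (1 + 2 * ((\<eta> - 1) * \<epsilon>)) \<le> N * ((1 - \<rho>) / (1 - u))\<^sup>2" using N by (intro mult_left_mono) auto
    have "(b / 2)\<^sup>2 \<le> (1 - u)\<^sup>2" using u b by (intro power_mono) auto
    then show "4 * (\<epsilon> * N) / (1 - u)\<^sup>2 \<le> 4 * (\<epsilon> * N) / (b / 2)\<^sup>2" using eN b u1 by (intro divide_left_mono) auto
  qed
  also have "\<dots> = (N * (1 - \<rho>)\<^sup>2 - 4 * (\<epsilon> * N)) / (1 - u)\<^sup>2" by (rule mult_power2_divide_diff)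
  also have "\<dots> \<le> real m / (1 - u)\<^sup>2" using m by (intro divide_right_mono) auto
  finally have 2: "N * (1 + 2 * ((\<eta> - 1) * \<epsilon>)) - 4 * (\<epsilon> * N) / (b / 2)\<^sup>2 \<le> real m / (1 - u)\<^sup>2" .
  have "N - (N * (1 + 2 * ((\<eta> - 1) * \<epsilon>)) - 4 * (\<epsilon> * N) / (b / 2)\<^sup>2) = (16 * (1 / b\<^sup>2) - 2 * (\<eta> - 1)) * (\<epsilon> * N)"
    by (simp add: power_divide algebra_simps)
  also have "\<dots> \<le> - 2 * (16 * (C + 1) / b\<^sup>2 + 2) * (\<epsilon> * N)"
  proof (rule mult_right_mono)
    show "16 * (1 / b\<^sup>2) - 2 * (\<eta> - 1) \<le> - 2 * (16 * (C + 1) / b\<^sup>2 + 2)" using \<eta> by (simp add: add_divide_distrib distrib_left)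
  qed (use eN in simp)
  finally show "real n / (\<rho> + \<eta> * \<epsilon> - \<epsilon>)\<^sup>2 - real m / (1 - (\<rho> + \<eta> * \<epsilon> - \<epsilon>))\<^sup>2 \<le> - 2 * (16 * (C + 1) / b\<^sup>2 + 2) * (\<epsilon> * N)"
    using 1 2 unfolding u_def[symmetric] by linarith
  have "N * \<rho>\<^sup>2 \<le> N * 1" using N b by (intro mult_left_mono power_le_one) auto
  then show "real n \<le> N" using n by linarith
  show "b / 2 \<le> 1 - (\<rho> + \<eta> * \<epsilon>)" "b / 2 \<le> \<rho> + \<eta> * \<epsilon> - \<epsilon>" using u b \<epsilon> e\<eta> unfolding u_def by linarith+
  have "b ^ 4 \<le> 1" using b by (intro power_le_one) auto
  then show "\<epsilon> \<le> 1" using \<epsilon> by simp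
qed (use b \<epsilon> N s in auto)

text \<open>
  With \<open>N = L\<^sup>3\<close> and \<open>\<epsilon> = r / L\<close> one has \<open>N \<epsilon>\<^sup>3 = r\<^sup>3\<close> and \<open>\<epsilon> N = r L\<^sup>2\<close>. The exit windows are of order
  \<open>\<epsilon> N\<close>, the tilt is \<open>\<kappa> = \<eta> \<epsilon>\<close> and the walks have about \<open>L\<^sup>2\<close> steps. The constants are chosen in
  the order \<open>C\<close>, \<open>\<eta>\<close>: the distance from the corner has to beat the exit window, and the tilt has
  to beat that distance.
\<close>

lemma horizontal_exit_scaled:
  fixes \<rho> b C \<eta> L r \<delta> :: real and m n :: nat
  assumes base: "\<And>K. finite K \<Longrightarrow> K \<subseteq> weight_sites \<Longrightarrow> exp_family M K (weight_rate \<rho>) X\<^sub>0"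
    and b: "0 < b" "b \<le> \<rho>" "b \<le> 1 - \<rho>" and C: "4 + 75 / b\<^sup>2 \<le> C" and \<eta>: "3 + (16 * C + 24) / b\<^sup>2 \<le> \<eta>"
    and L: "1 \<le> L" and r: "1 \<le> r" and \<delta>: "\<delta> = exp (- (r ^ 3))" "1 \<le> \<delta> * L\<^sup>2"
    and small: "16 * (\<eta> + C + 10) * (r / L) \<le> b ^ 4"
  defines "m \<equiv> nat \<lfloor>L ^ 3 * (1 - \<rho>)\<^sup>2\<rfloor>" and "n \<equiv> nat \<lfloor>L ^ 3 * \<rho>\<^sup>2\<rfloor>"
  shows "\<exists>B\<in>sets M. (AE \<omega> in M. (\<exists>z\<in>pos_quadrant. \<not> (fst z \<le> int m \<and> snd z \<le> int n) \<and>
       (\<exists>e. 1 \<le> e \<and> real_of_int e \<le> \<delta> * L\<^sup>2 \<and> opt_exit (\<lambda>z. X\<^sub>0 z \<omega>) z e)) \<longrightarrow> \<omega> \<in> B) \<and>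
     emeasure M B \<le> ennreal ((32 * (\<eta> + 1)\<^sup>2 / b\<^sup>2 + 12) * r\<^sup>2 * \<delta>)"
proof -
  define N where "N = L ^ 3"
  define \<epsilon> where "\<epsilon> = r / L"
  define k where "k = nat \<lfloor>\<delta> * L\<^sup>2\<rfloor>"
  define s where "s = nat \<lceil>\<epsilon> * N\<rceil>"
  define s1 where "s1 = nat \<lceil>C * (\<epsilon> * N)\<rceil>"
  define T where "T = nat \<lceil>L\<^sup>2\<rceil>"
  have b1: "b \<le> 1" using b by simp
  have N: "1 \<le> N" using L by (simp add: N_def)
  have \<epsilon>0: "0 < \<epsilon>" using L r by (simp add: \<epsilon>_def)
  have eN: "\<epsilon> * N = r * L\<^sup>2" using L by (simp add: \<epsilon>_def N_def power3_eq_cube power2_eq_square)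
  have eL: "1 / L \<le> \<epsilon>" using L r unfolding \<epsilon>_def by (intro divide_right_mono) auto
  have L2: "1 \<le> L\<^sup>2" using L by simp
  have "1 * L\<^sup>2 \<le> r * L\<^sup>2" using r by (intro mult_right_mono) auto
  then have LeN: "L\<^sup>2 \<le> \<epsilon> * N" unfolding eN by simp
  then have eN1: "1 \<le> \<epsilon> * N" using L2 by linarith
  have r3: "N * \<epsilon> ^ 3 = r ^ 3" using L by (simp add: N_def \<epsilon>_def power_divide)
  have \<delta>0: "0 < \<delta>" "\<delta> \<le> 1" using \<delta>(1) r by auto
  have C4: "4 \<le> C" using C by (smt (verit) divide_nonneg_nonneg zero_le_power2)
  have "0 \<le> (16 * C + 24) / b\<^sup>2" using C4 by simp
  then have \<eta>3: "3 \<le> \<eta>" using \<eta> by simp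
  have C4e: "0 \<le> C * \<epsilon>" "0 \<le> \<eta> * \<epsilon>" using C4 \<eta>3 \<epsilon>0 by auto
  have small': "16 * (\<eta> * \<epsilon>) + 16 * (C * \<epsilon>) + 160 * \<epsilon> \<le> b ^ 4"
    using small by (simp add: \<epsilon>_def[symmetric] algebra_simps)
  have b42: "b ^ 4 \<le> b\<^sup>2" "b\<^sup>2 \<le> b" "b ^ 4 \<le> 1"
    using b b1 power_decreasing[of 2 4 b] power_decreasing[of 1 2 b] by (auto simp: power_le_one)
  \<comment> \<open>The rounded scales, all measured against \<open>\<epsilon> N\<close>.\<close>
  have pm: "N * b\<^sup>2 \<le> N * (1 - \<rho>)\<^sup>2" "N * b\<^sup>2 \<le> N * \<rho>\<^sup>2" using b N by (auto intro!: mult_left_mono power_mono)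
  have m0: "0 \<le> N * (1 - \<rho>)\<^sup>2" "0 \<le> N * \<rho>\<^sup>2" using N by auto
  have m: "real m \<le> N * (1 - \<rho>)\<^sup>2" "N * (1 - \<rho>)\<^sup>2 - 1 \<le> real m"
    unfolding m_def N_def[symmetric] using m0(1) by linarith+
  have n: "real n \<le> N * \<rho>\<^sup>2" "N * \<rho>\<^sup>2 - 1 \<le> real n"
    unfolding n_def N_def[symmetric] using m0(2) by linarith+
  have "\<delta> * L\<^sup>2 \<le> 1 * L\<^sup>2" using \<delta>0 by (intro mult_right_mono) auto
  then have \<delta>L: "\<delta> * L\<^sup>2 \<le> \<epsilon> * N" using LeN by linarith
  have k: "real k \<le> \<delta> * L\<^sup>2" "1 \<le> k" unfolding k_def using \<delta>(2) by linarith+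
  have kN: "real k \<le> \<epsilon> * N" using k \<delta>L by linarith
  have s: "\<epsilon> * N \<le> real s" "real s \<le> 2 * (\<epsilon> * N)" unfolding s_def using eN1 by linarith+
  have CeN: "1 * (\<epsilon> * N) \<le> C * (\<epsilon> * N)" using C4 eN1 by (intro mult_right_mono) auto
  have s1: "C * (\<epsilon> * N) \<le> real s1" "real s1 \<le> (C + 1) * (\<epsilon> * N)"
    unfolding s1_def distrib_right using eN1 CeN by linarith+
  have T: "L\<^sup>2 \<le> real T" "real T \<le> 2 * (\<epsilon> * N)" unfolding T_def using L2 LeN eN1 by linarith+
  have "(16 * (C * \<epsilon>) + 160 * \<epsilon>) * N \<le> b\<^sup>2 * N" using small' b42 C4e N by (intro mult_right_mono) auto
  then have big: "16 * (C * (\<epsilon> * N)) + 160 * (\<epsilon> * N) \<le> N * b\<^sup>2" by (simp add: algebra_simps)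
  have total: "real k + real T + real s1 < real m" "real k + real T + real s1 < real n" "real s < real m" "real s < real n"
    using big pm m(2) n(2) kN T(2) s1(2) s(2) CeN eN1 unfolding distrib_right by linarith+
  have sz: "k + T + s1 < m" "T + s1 < n" "s \<le> m" "s \<le> n" "s1 \<le> m" "s1 \<le> n" "k + T \<le> m" "T \<le> n"
    using total by linarith+
  have ks: "k \<le> s" using kN s(1) by linarith
  have pos: "1 \<le> s" "1 \<le> s1" "1 \<le> T" using s(1) s1(1) T(1) L2 eN1 CeN by linarith+
  have hT: "\<eta> * \<epsilon> * ((\<eta> + 1) * \<epsilon>) + 1 / (2 * real T) \<le> ((\<eta> + 1) * \<epsilon>)\<^sup>2"
  proof -
    have "1 / (2 * real T) \<le> 1 / L\<^sup>2" using T(1) L2 by (intro frac_le) auto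
    also have "\<dots> = (1 / L)\<^sup>2" by (simp add: power_divide)
    also have "\<dots> \<le> \<epsilon>\<^sup>2" using eL L by (intro power_mono) auto
    also have "\<dots> = 1 * \<epsilon>\<^sup>2" by simp
    also have "\<dots> \<le> (\<eta> + 1) * \<epsilon>\<^sup>2" using \<eta>3 by (intro mult_right_mono) auto
    finally show ?thesis by (simp add: power2_eq_square algebra_simps)
  qed
  have aT: "b \<le> 2 * real T * ((\<eta> + 1) * \<epsilon>)"
  proof -
    have "1 * (1 / L) \<le> (\<eta> + 1) * \<epsilon>" using \<eta>3 eL L by (intro mult_mono) auto
    then have "L\<^sup>2 * (1 / L) \<le> real T * ((\<eta> + 1) * \<epsilon>)" using T(1) L by (intro mult_mono) auto
    moreover have "L\<^sup>2 * (1 / L) = L" using L by (simp add: power2_eq_square)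
    ultimately show ?thesis using b1 L by linarith
  qed
  have dn: "real (m - s1) = real m - real s1" "real (n - s1) = real n - real s1"
    "real (m - k - T) = real m - real k - real T" "real (n - T) = real n - real T"
    using sz by linarith+
  have E\<delta>: "exp (- (N * \<epsilon> ^ 3)) = \<delta>" using r3 \<delta>(1) by simp
  have N0: "0 < N" using N by simp
  have e16: "16 * \<epsilon> \<le> b ^ 4" "2 * \<epsilon> \<le> b" "2 * (\<eta> * \<epsilon>) \<le> b" using small' C4e \<epsilon>0 b42 by linarith+
  have C0: "0 \<le> C" using C4 by simp
  have E1: "exit_expr (1 - \<rho>) \<epsilon> n (m - s1) s \<le> 3 * \<delta>"
    unfolding E\<delta>[symmetric]
    by (rule exit_expr_forward[OF b(1) b(3) _ \<epsilon>0 e16(1,2) N0 eN1 C _ _ s(2,1)]) (use b n m dn s1 in auto)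
  have E2: "exit_expr \<rho> \<epsilon> m (n - s1) s \<le> 3 * \<delta>"
    unfolding E\<delta>[symmetric]
    by (rule exit_expr_forward[OF b \<epsilon>0 e16(1,2) N0 eN1 C m(2) _ s(2,1)]) (use n dn s1 in auto)
  have E3: "exit_expr (\<rho> + \<eta> * \<epsilon>) \<epsilon> (m - k - T) n s1 \<le> 3 * \<delta>"
    unfolding E\<delta>[symmetric]
    by (rule exit_expr_reverse[OF b \<epsilon>0 e16(1,3) N0 eN1 C0 \<eta> _ n(1) s1(2)])
      (use m dn s1 CeN kN T eN1 in auto)
  have "exit_expr (1 - \<rho> + \<eta> * \<epsilon>) \<epsilon> (n - T) m s1 \<le> 3 * \<delta>"
    unfolding E\<delta>[symmetric]
    by (rule exit_expr_reverse[OF b(1) b(3) _ \<epsilon>0 e16(1,3) N0 eN1 C0 \<eta> _ m(1) s1(2)])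
      (use b n dn s1 CeN kN T eN1 in auto)
  then have E4: "exit_expr (1 - (\<rho> - \<eta> * \<epsilon>)) \<epsilon> (n - T) m s1 \<le> 3 * \<delta>"
    by (simp add: algebra_simps)
  have "\<exists>B\<in>sets M. (AE \<omega> in M. (\<exists>z\<in>pos_quadrant. \<not> (fst z \<le> int m \<and> snd z \<le> int n) \<and>
       (\<exists>e. 1 \<le> e \<and> e \<le> int k \<and> opt_exit (\<lambda>z. X\<^sub>0 z \<omega>) z e)) \<longrightarrow> \<omega> \<in> B) \<and>
     emeasure M B \<le> ennreal (k * (32 * ((\<eta> + 1) * \<epsilon>)\<^sup>2 / b\<^sup>2) + exit_expr (1 - \<rho>) \<epsilon> n (m - s1) s + exit_expr \<rho> \<epsilon> m (n - s1) s +
       exit_expr (\<rho> + \<eta> * \<epsilon>) \<epsilon> (m - k - T) n s1 + exit_expr (1 - (\<rho> - \<eta> * \<epsilon>)) \<epsilon> (n - T) m s1)"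
  proof (rule horizontal_exit_bound)
    show "exp_family M K (weight_rate \<rho>) X\<^sub>0" if "finite K" "K \<subseteq> weight_sites" for K by (rule base[OF that])
    show "0 < \<eta> * \<epsilon>" using \<eta>3 \<epsilon>0 by simp
    show "\<eta> * \<epsilon> < \<rho>" "\<eta> * \<epsilon> < 1 - \<rho>" using e16(3) b by linarith+
    show "3 * \<epsilon> \<le> \<rho>" "3 * \<epsilon> \<le> 1 - \<rho>" using small' C4e \<epsilon>0 b42 b by linarith+
    show "0 < (\<eta> + 1) * \<epsilon>" using \<eta>3 \<epsilon>0 by simp
    show "(\<eta> + 1) * \<epsilon> < b" unfolding distrib_right using small' C4e \<epsilon>0 b42 b by linarith
    show "s1 + (k + T) \<le> m" "s1 + T \<le> n" using sz by linarith+
  qed (fact b \<epsilon>0 k(2) pos ks sz hT aT)+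
  then obtain B where B: "B \<in> sets M" "AE \<omega> in M. (\<exists>z\<in>pos_quadrant. \<not> (fst z \<le> int m \<and> snd z \<le> int n) \<and>
       (\<exists>e. 1 \<le> e \<and> e \<le> int k \<and> opt_exit (\<lambda>z. X\<^sub>0 z \<omega>) z e)) \<longrightarrow> \<omega> \<in> B"
     "emeasure M B \<le> ennreal (k * (32 * ((\<eta> + 1) * \<epsilon>)\<^sup>2 / b\<^sup>2) + exit_expr (1 - \<rho>) \<epsilon> n (m - s1) s + exit_expr \<rho> \<epsilon> m (n - s1) s +
       exit_expr (\<rho> + \<eta> * \<epsilon>) \<epsilon> (m - k - T) n s1 + exit_expr (1 - (\<rho> - \<eta> * \<epsilon>)) \<epsilon> (n - T) m s1)"
    by blast
  have ek: "e \<le> int k" if "1 \<le> e" "real_of_int e \<le> \<delta> * L\<^sup>2" for e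
    using that unfolding k_def by linarith
  have "k * (32 * ((\<eta> + 1) * \<epsilon>)\<^sup>2 / b\<^sup>2) \<le> \<delta> * L\<^sup>2 * (32 * ((\<eta> + 1) * \<epsilon>)\<^sup>2 / b\<^sup>2)"
    using k(1) by (intro mult_right_mono) auto
  also have "\<dots> = 32 * (\<eta> + 1)\<^sup>2 / b\<^sup>2 * r\<^sup>2 * \<delta>"
    using L by (simp add: \<epsilon>_def power_mult_distrib power_divide)
  finally have w: "k * (32 * ((\<eta> + 1) * \<epsilon>)\<^sup>2 / b\<^sup>2) \<le> 32 * (\<eta> + 1)\<^sup>2 / b\<^sup>2 * r\<^sup>2 * \<delta>" .
  have "1 * \<delta> \<le> r\<^sup>2 * \<delta>" using r \<delta>0 by (intro mult_right_mono) auto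
  then have "k * (32 * ((\<eta> + 1) * \<epsilon>)\<^sup>2 / b\<^sup>2) + exit_expr (1 - \<rho>) \<epsilon> n (m - s1) s + exit_expr \<rho> \<epsilon> m (n - s1) s +
       exit_expr (\<rho> + \<eta> * \<epsilon>) \<epsilon> (m - k - T) n s1 + exit_expr (1 - (\<rho> - \<eta> * \<epsilon>)) \<epsilon> (n - T) m s1
     \<le> (32 * (\<eta> + 1)\<^sup>2 / b\<^sup>2 + 12) * r\<^sup>2 * \<delta>"
    using w E1 E2 E3 E4 unfolding distrib_right by linarith
  then have "emeasure M B \<le> ennreal ((32 * (\<eta> + 1)\<^sup>2 / b\<^sup>2 + 12) * r\<^sup>2 * \<delta>)"
    using B(3) by (meson ennreal_leI order_trans)
  moreover have "AE \<omega> in M. (\<exists>z\<in>pos_quadrant. \<not> (fst z \<le> int m \<and> snd z \<le> int n) \<and>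
       (\<exists>e. 1 \<le> e \<and> real_of_int e \<le> \<delta> * L\<^sup>2 \<and> opt_exit (\<lambda>z. X\<^sub>0 z \<omega>) z e)) \<longrightarrow> \<omega> \<in> B"
    using B(2) by eventually_elim (use ek in blast)
  ultimately show ?thesis using B(1) by blast
qed

text \<open>
  If \<open>\<delta> N\<^sup>2\<^sup>/\<^sup>3 \<ge> 1\<close> then \<open>- ln \<delta>\<close> is at most \<open>ln N\<close>, so \<open>\<epsilon>\<^sup>3 \<le> ln N / N\<close> is small for large \<open>N\<close>,
  uniformly in \<open>\<delta>\<close>.
\<close>

lemma horizontal_exit_asymptotics:
  fixes \<rho> :: real
  assumes \<rho>: "0 < \<rho>" "\<rho> < 1"
  shows "\<exists>C>0. \<exists>N\<^sub>0>0. \<forall>\<delta> N (M :: 'a measure) X\<^sub>0. 0 < \<delta> \<longrightarrow> \<delta> \<le> exp (- 1) \<longrightarrow> N\<^sub>0 \<le> N \<longrightarrow> 1 \<le> \<delta> * N powr (2/3) \<longrightarrow>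
     (\<forall>K. finite K \<longrightarrow> K \<subseteq> weight_sites \<longrightarrow> exp_family M K (weight_rate \<rho>) X\<^sub>0) \<longrightarrow>
     (\<exists>B\<in>sets M. (AE \<omega> in M. (\<exists>z\<in>pos_quadrant. \<not> z \<le> v_corner \<rho> N \<and>
       (\<exists>e. 1 \<le> e \<and> real_of_int e \<le> \<delta> * N powr (2/3) \<and> opt_exit (\<lambda>z. X\<^sub>0 z \<omega>) z e)) \<longrightarrow> \<omega> \<in> B) \<and>
      emeasure M B \<le> ennreal (C * \<bar>ln \<delta>\<bar> powr (2/3) * \<delta>))"
proof -
  define b where "b = min \<rho> (1 - \<rho>)"
  define C where "C = 4 + 75 / b\<^sup>2"
  define \<eta> where "\<eta> = 3 + (16 * C + 24) / b\<^sup>2"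
  define D where "D = 16 * (\<eta> + C + 10)"
  have b: "0 < b" "b \<le> \<rho>" "b \<le> 1 - \<rho>" using \<rho> by (auto simp: b_def)
  have "0 \<le> C" by (simp add: C_def)
  moreover have "0 \<le> (16 * C + 24) / b\<^sup>2" using calculation by simp
  then have "3 \<le> \<eta>" by (simp add: \<eta>_def)
  ultimately have D0: "0 < D" unfolding D_def by (intro mult_pos_pos add_nonneg_pos add_nonneg_nonneg) simp_all
  have "((\<lambda>N :: real. ln N / N) \<longlongrightarrow> 0) at_top" by (rule ln_x_over_x_tendsto_0)
  moreover have "0 < (b ^ 4) ^ 3 / D ^ 3" using b D0 by simp
  ultimately have "eventually (\<lambda>N. ln N / N < (b ^ 4) ^ 3 / D ^ 3) at_top" by (rule order_tendstoD)
  then obtain N1 where N1: "\<And>N. N1 \<le> N \<Longrightarrow> ln N / N < (b ^ 4) ^ 3 / D ^ 3"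
    unfolding eventually_at_top_linorder by blast
  show ?thesis
  proof (rule exI[of _ "32 * (\<eta> + 1)\<^sup>2 / b\<^sup>2 + 12"], rule conjI, simp add: add_nonneg_pos, rule exI[of _ "max 1 N1"], rule conjI, simp, intro allI impI)
    fix \<delta> N :: real and M :: "'a measure" and X\<^sub>0
    assume \<delta>: "0 < \<delta>" "\<delta> \<le> exp (- 1)" and "max 1 N1 \<le> N" and big: "1 \<le> \<delta> * N powr (2/3)"
      and base: "\<forall>K. finite K \<longrightarrow> K \<subseteq> weight_sites \<longrightarrow> exp_family M K (weight_rate \<rho>) X\<^sub>0"
    then have N: "1 \<le> N" "N1 \<le> N" by auto
    define L where "L = N powr (1/3)"
    define r where "r = (- ln \<delta>) powr (1/3)"
    have "ln \<delta> \<le> ln (exp (- 1))" using \<delta> by (subst ln_le_cancel_iff) auto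
    then have l: "1 \<le> - ln \<delta>" by simp
    have L1: "1 \<le> L" unfolding L_def using N by (intro ge_one_powr_ge_zero) auto
    have r1: "1 \<le> r" unfolding r_def using l by (intro ge_one_powr_ge_zero) auto
    have L3: "L ^ 3 = N" "L\<^sup>2 = N powr (2/3)" using N by (simp_all add: L_def powr_power)
    have r3: "r ^ 3 = - ln \<delta>" "r\<^sup>2 = \<bar>ln \<delta>\<bar> powr (2/3)" using l by (simp_all add: r_def powr_power)
    have "0 \<le> ln (\<delta> * N powr (2/3))" using big by (rule ln_ge_zero)
    also have "\<dots> = ln \<delta> + 2 / 3 * ln N" using \<delta> N by (simp add: ln_mult ln_powr)
    finally have "r ^ 3 \<le> 2 / 3 * ln N" unfolding r3 by simp
    moreover have "0 \<le> ln N" using N by simp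
    ultimately have "r ^ 3 \<le> ln N" by linarith
    then have "r ^ 3 / L ^ 3 \<le> ln N / N" unfolding L3 using N by (intro divide_right_mono) auto
    also have "\<dots> < (b ^ 4) ^ 3 / D ^ 3" by (rule N1[OF N(2)])
    finally have "D ^ 3 * (r ^ 3 / L ^ 3) \<le> D ^ 3 * ((b ^ 4) ^ 3 / D ^ 3)" using D0 by (intro mult_left_mono) auto
    then have "(D * (r / L)) ^ 3 \<le> (b ^ 4) ^ 3" using D0 by (simp add: power_mult_distrib power_divide)
    then have small: "D * (r / L) \<le> b ^ 4" by (rule power_le_imp_le_base[of _ 2, unfolded Suc_numeral, simplified]) (use b in auto)
    have d: "\<delta> = exp (- (r ^ 3))" "1 \<le> \<delta> * L\<^sup>2" unfolding r3(1) L3 using \<delta> big by simp_all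
    have c: "4 + 75 / b\<^sup>2 \<le> C" "3 + (16 * C + 24) / b\<^sup>2 \<le> \<eta>" by (simp_all add: C_def \<eta>_def)
    have base': "exp_family M K (weight_rate \<rho>) X\<^sub>0" if "finite K" "K \<subseteq> weight_sites" for K using base that by blast
    have *: "\<exists>B\<in>sets M. (AE \<omega> in M. (\<exists>z\<in>pos_quadrant. \<not> (fst z \<le> int (nat \<lfloor>N * (1 - \<rho>)\<^sup>2\<rfloor>) \<and> snd z \<le> int (nat \<lfloor>N * \<rho>\<^sup>2\<rfloor>)) \<and>
       (\<exists>e. 1 \<le> e \<and> real_of_int e \<le> \<delta> * N powr (2/3) \<and> opt_exit (\<lambda>z. X\<^sub>0 z \<omega>) z e)) \<longrightarrow> \<omega> \<in> B) \<and>
     emeasure M B \<le> ennreal ((32 * (\<eta> + 1)\<^sup>2 / b\<^sup>2 + 12) * \<bar>ln \<delta>\<bar> powr (2/3) * \<delta>)"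
      using horizontal_exit_scaled[OF base' b c L1 r1 d small[unfolded D_def]] unfolding L3 r3(2) .
    have corner: "z \<le> v_corner \<rho> N \<longleftrightarrow> fst z \<le> int (nat \<lfloor>N * (1 - \<rho>)\<^sup>2\<rfloor>) \<and> snd z \<le> int (nat \<lfloor>N * \<rho>\<^sup>2\<rfloor>)" for z
      using N by (simp add: v_corner_def less_eq_prod_def)
    show "\<exists>B\<in>sets M. (AE \<omega> in M. (\<exists>z\<in>pos_quadrant. \<not> z \<le> v_corner \<rho> N \<and>
       (\<exists>e. 1 \<le> e \<and> real_of_int e \<le> \<delta> * N powr (2/3) \<and> opt_exit (\<lambda>z. X\<^sub>0 z \<omega>) z e)) \<longrightarrow> \<omega> \<in> B) \<and>
      emeasure M B \<le> ennreal ((32 * (\<eta> + 1)\<^sup>2 / b\<^sup>2 + 12) * \<bar>ln \<delta>\<bar> powr (2/3) * \<delta>)"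
      unfolding corner by (rule *)
  qed
qed

section \<open>Both axes\<close>

lemma exit_time_opt_exit:
  assumes "z \<in> pos_quadrant"
  shows "opt_exit \<omega> z (exit_time \<omega> z)"
  unfolding opt_exit_def exit_time_attains(2)[OF assms]
proof (intro conjI ballI exit_time_attains(1) assms)
  fix j assume "j \<in> exit_points z"
  then consider "j \<in> {1..fst z}" | l where "l \<in> {1..snd z}" "j = - l" unfolding exit_points_def by blast
  then show "exit_value \<omega> z j \<le> stationary_lpp \<omega> z"
  proof cases
    case 1
    then show ?thesis unfolding stationary_lpp_def by (intro max.coboundedI1 Max_ge) auto
  next
    case 2
    then show ?thesis unfolding stationary_lpp_def by (intro max.coboundedI2 Max_ge) auto
  qed
qed

lemma opt_exit_swap:
  assumes "z \<in> pos_quadrant" "opt_exit w z e"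
  shows "opt_exit (\<lambda>z. w (prod.swap z)) (prod.swap z) (- e)"
  unfolding opt_exit_def
proof (intro conjI ballI)
  have e: "e \<in> exit_points z" using assms(2) by (simp add: opt_exit_def)
  then show "- e \<in> exit_points (prod.swap z)" by (simp add: exit_points_swap)
  fix j assume "j \<in> exit_points (prod.swap z)"
  then have j: "- j \<in> exit_points z" by (simp add: exit_points_swap)
  have "exit_value w z (- j) \<le> exit_value w z e" using assms(2) j by (simp add: opt_exit_def)
  then show "exit_value (\<lambda>z. w (prod.swap z)) (prod.swap z) j \<le> exit_value (\<lambda>z. w (prod.swap z)) (prod.swap z) (- e)"
    using exit_value_swap[OF assms(1) e, of w] exit_value_swap[OF assms(1) j, of w] by simp
qed

lemma exp_family_stationary_swap:
  assumes "0 < \<rho>" "\<rho> < 1" "finite K" "K \<subseteq> weight_sites"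
  shows "exp_family (stationary_measure \<rho>) K (weight_rate (1 - \<rho>)) (\<lambda>z \<omega>. \<omega> (prod.swap z))"
proof (rule exp_family_cong[OF exp_family_reindex[OF exp_family_stationary]])
  show "prod.swap ` K \<subseteq> weight_sites" using assms(4) by (auto simp: weight_sites_def zero_prod_def)
  show "weight_rate \<rho> (prod.swap k) = weight_rate (1 - \<rho>) k" if "k \<in> K" for k
  proof -
    have "\<not> (fst k = 0 \<and> snd k = 0)" using that assms(4) by (auto simp: weight_sites_def prod_eq_iff)
    then show ?thesis by (auto simp: weight_rate_def)
  qed
qed (use assms in auto)

text \<open>
  For \<open>\<delta> N\<^sup>2\<^sup>/\<^sup>3 < 1\<close> the event is empty, as exit times are nonzero integers. This is what permits
  \<open>N\<^sub>0\<close> to be independent of \<open>\<delta>\<close>.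
\<close>

theorem theorem4p5:
  fixes \<rho> :: real
  assumes "0 < \<rho>" and "\<rho> < 1"
  shows "\<exists>\<delta>\<^sub>0>0. \<exists>C>0. \<exists>N\<^sub>0>0. \<forall>\<delta> N :: real.
           0 < \<delta> \<and> \<delta> \<le> \<delta>\<^sub>0 \<and> N\<^sub>0 \<le> N \<longrightarrow>
           measure (stationary_measure \<rho>)
             {\<omega> \<in> space (stationary_measure \<rho>).
                \<exists>z \<in> pos_quadrant - {0..v_corner \<rho> N}.
                  real_of_int \<bar>exit_time \<omega> z\<bar> \<le> \<delta> * N powr (2/3)}
           \<le> C * \<bar>ln \<delta>\<bar> powr (2/3) * \<delta>"
proof -
  let ?M = "stationary_measure \<rho>"
  have \<rho>': "0 < 1 - \<rho>" "1 - \<rho> < 1" using assms by auto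
  interpret prob_space ?M by (rule prob_space_stationary_measure[OF assms])
  obtain C\<^sub>h N\<^sub>h where h: "0 < C\<^sub>h" "0 < N\<^sub>h" and H: "\<forall>\<delta> N (M :: (int \<times> int \<Rightarrow> real) measure) X\<^sub>0. 0 < \<delta> \<longrightarrow> \<delta> \<le> exp (- 1) \<longrightarrow> N\<^sub>h \<le> N \<longrightarrow> 1 \<le> \<delta> * N powr (2/3) \<longrightarrow>
     (\<forall>K. finite K \<longrightarrow> K \<subseteq> weight_sites \<longrightarrow> exp_family M K (weight_rate \<rho>) X\<^sub>0) \<longrightarrow>
     (\<exists>B\<in>sets M. (AE \<omega> in M. (\<exists>z\<in>pos_quadrant. \<not> z \<le> v_corner \<rho> N \<and>
       (\<exists>e. 1 \<le> e \<and> real_of_int e \<le> \<delta> * N powr (2/3) \<and> opt_exit (\<lambda>z. X\<^sub>0 z \<omega>) z e)) \<longrightarrow> \<omega> \<in> B) \<and>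
      emeasure M B \<le> ennreal (C\<^sub>h * \<bar>ln \<delta>\<bar> powr (2/3) * \<delta>))"
    using horizontal_exit_asymptotics[OF assms, where 'a = "int \<times> int \<Rightarrow> real"] by (elim exE conjE) (rule that; assumption)
  obtain C\<^sub>v N\<^sub>v where v: "0 < C\<^sub>v" "0 < N\<^sub>v" and V: "\<forall>\<delta> N (M :: (int \<times> int \<Rightarrow> real) measure) X\<^sub>0. 0 < \<delta> \<longrightarrow> \<delta> \<le> exp (- 1) \<longrightarrow> N\<^sub>v \<le> N \<longrightarrow> 1 \<le> \<delta> * N powr (2/3) \<longrightarrow>
     (\<forall>K. finite K \<longrightarrow> K \<subseteq> weight_sites \<longrightarrow> exp_family M K (weight_rate (1 - \<rho>)) X\<^sub>0) \<longrightarrow>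
     (\<exists>B\<in>sets M. (AE \<omega> in M. (\<exists>z\<in>pos_quadrant. \<not> z \<le> v_corner (1 - \<rho>) N \<and>
       (\<exists>e. 1 \<le> e \<and> real_of_int e \<le> \<delta> * N powr (2/3) \<and> opt_exit (\<lambda>z. X\<^sub>0 z \<omega>) z e)) \<longrightarrow> \<omega> \<in> B) \<and>
      emeasure M B \<le> ennreal (C\<^sub>v * \<bar>ln \<delta>\<bar> powr (2/3) * \<delta>))"
    using horizontal_exit_asymptotics[OF \<rho>', where 'a = "int \<times> int \<Rightarrow> real"] by (elim exE conjE) (rule that; assumption)
  have "measure ?M {\<omega> \<in> space ?M. \<exists>z \<in> pos_quadrant - {0..v_corner \<rho> N}. real_of_int \<bar>exit_time \<omega> z\<bar> \<le> \<delta> * N powr (2/3)}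
     \<le> (C\<^sub>h + C\<^sub>v) * \<bar>ln \<delta>\<bar> powr (2/3) * \<delta>" (is "measure ?M ?E \<le> _")
    if \<delta>: "0 < \<delta>" "\<delta> \<le> exp (- 1)" and N: "max N\<^sub>h N\<^sub>v \<le> N" for \<delta> N
  proof (cases "1 \<le> \<delta> * N powr (2/3)")
    case False
    have "1 \<le> \<bar>exit_time \<omega> z\<bar>" if "z \<in> pos_quadrant" for \<omega> z
      using exit_time_attains(1)[OF that, of \<omega>] by (auto simp: exit_points_def)
    then have "1 \<le> real_of_int \<bar>exit_time \<omega> z\<bar>" if "z \<in> pos_quadrant" for \<omega> z
      using that by (metis of_int_1_le_iff)
    then have "\<not> real_of_int \<bar>exit_time \<omega> z\<bar> \<le> \<delta> * N powr (2/3)" if "z \<in> pos_quadrant" for \<omega> z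
      using that False by (meson order_trans)
    then have "?E = {}" by blast
    moreover have "0 \<le> (C\<^sub>h + C\<^sub>v) * \<bar>ln \<delta>\<bar> powr (2/3) * \<delta>" using h v \<delta> by simp
    ultimately show ?thesis by (simp only: measure_empty)
  next
    case True
    define R where "R = \<bar>ln \<delta>\<bar> powr (2/3) * \<delta>"
    have R0: "0 \<le> R" using \<delta> by (simp add: R_def)
    have base: "\<forall>K. finite K \<longrightarrow> K \<subseteq> weight_sites \<longrightarrow> exp_family ?M K (weight_rate \<rho>) (\<lambda>z \<omega>. \<omega> z)"
      "\<forall>K. finite K \<longrightarrow> K \<subseteq> weight_sites \<longrightarrow> exp_family ?M K (weight_rate (1 - \<rho>)) (\<lambda>z \<omega>. \<omega> (prod.swap z))"
      using exp_family_stationary[OF assms] exp_family_stationary_swap[OF assms] by auto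
    have Nhv: "N\<^sub>h \<le> N" "N\<^sub>v \<le> N" using N by auto
    obtain B where B: "B \<in> sets ?M" "AE \<omega> in ?M. (\<exists>z\<in>pos_quadrant. \<not> z \<le> v_corner \<rho> N \<and>
       (\<exists>e. 1 \<le> e \<and> real_of_int e \<le> \<delta> * N powr (2/3) \<and> opt_exit (\<lambda>z. \<omega> z) z e)) \<longrightarrow> \<omega> \<in> B"
      "emeasure ?M B \<le> ennreal (C\<^sub>h * R)"
      using H[rule_format, OF \<delta> Nhv(1) True] base(1) unfolding R_def mult.assoc by blast
    obtain B' where B': "B' \<in> sets ?M" "AE \<omega> in ?M. (\<exists>z\<in>pos_quadrant. \<not> z \<le> v_corner (1 - \<rho>) N \<and>
       (\<exists>e. 1 \<le> e \<and> real_of_int e \<le> \<delta> * N powr (2/3) \<and> opt_exit (\<lambda>z. \<omega> (prod.swap z)) z e)) \<longrightarrow> \<omega> \<in> B'"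
      "emeasure ?M B' \<le> ennreal (C\<^sub>v * R)"
      using V[rule_format, OF \<delta> Nhv(2) True] base(2) unfolding R_def mult.assoc by blast
    have "AE \<omega> in ?M. \<omega> \<in> ?E \<longrightarrow> \<omega> \<in> B \<union> B'"
      using B(2) B'(2)
    proof eventually_elim
      case (elim \<omega>)
      show ?case
      proof
        assume "\<omega> \<in> ?E"
        then obtain z where z: "z \<in> pos_quadrant" "z \<notin> {0..v_corner \<rho> N}" "real_of_int \<bar>exit_time \<omega> z\<bar> \<le> \<delta> * N powr (2/3)" by blast
        have nz: "\<not> z \<le> v_corner \<rho> N" using z(1,2) by (auto simp: pos_quadrant_def less_eq_prod_def)
        define e where "e = exit_time \<omega> z"
        have o: "opt_exit \<omega> z e" unfolding e_def by (rule exit_time_opt_exit[OF z(1)])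
        then have "e \<noteq> 0" by (auto simp: opt_exit_def exit_points_def)
        then consider "1 \<le> e" | "e \<le> - 1" by linarith
        then show "\<omega> \<in> B \<union> B'"
        proof cases
          case 1
          then have "real_of_int e \<le> \<delta> * N powr (2/3)" using z(3) by (simp add: e_def)
          then show ?thesis using elim(1) z(1) nz o 1 by blast
        next
          case 2
          then have e: "1 \<le> - e" "\<bar>e\<bar> = - e" by linarith+
          then have "real_of_int (- e) \<le> \<delta> * N powr (2/3)" using z(3) unfolding e_def[symmetric] by simp
          note e(1) this
          moreover have "prod.swap z \<in> pos_quadrant" using z(1) by (auto simp: pos_quadrant_def)
          moreover have "\<not> prod.swap z \<le> v_corner (1 - \<rho>) N"
            using nz by (auto simp: v_corner_def less_eq_prod_def)
          ultimately show ?thesis using elim(2) opt_exit_swap[OF z(1) o] by blast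
        qed
      qed
    qed
    then have "emeasure ?M ?E \<le> emeasure ?M (B \<union> B')" using B(1) B'(1) by (intro emeasure_mono_AE) auto
    also have "\<dots> \<le> emeasure ?M B + emeasure ?M B'" by (rule emeasure_subadditive[OF B(1) B'(1)])
    also have "\<dots> \<le> ennreal (C\<^sub>h * R) + ennreal (C\<^sub>v * R)" by (intro add_mono B B')
    also have "\<dots> = ennreal (C\<^sub>h * R + C\<^sub>v * R)" using h v R0 by (intro ennreal_plus[symmetric]) auto
    finally have "measure ?M ?E \<le> C\<^sub>h * R + C\<^sub>v * R"
      using h v R0 by (subst (asm) emeasure_eq_measure, subst (asm) ennreal_le_iff) auto
    also have "\<dots> = (C\<^sub>h + C\<^sub>v) * \<bar>ln \<delta>\<bar> powr (2/3) * \<delta>" by (simp add: R_def algebra_simps)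
    finally show ?thesis .
  qed
  then show ?thesis
    using h v by (intro exI[of _ "exp (- 1)"] conjI exI[of _ "C\<^sub>h + C\<^sub>v"] exI[of _ "max N\<^sub>h N\<^sub>v"]) auto
qed

end
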